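(* Let $\Omega\subset\mathbb{R}^n$ be a bounded John domain, with $n\geq 3$. Then there is a constant $C$ such that $$\|\mathbf{v}\|_{W^{1,2}(\Omega)}\leq C\left\{\|\mathbf{v}\|_{L^2(\Omega)}+\|l(\mathbf{v})\|_{L^2(\Omega)}\right\}$$ for all $\mathbf{v}\in W^{1,2}(\Omega,\mathbb{R}^n)$.
   Context: John domain: a bounded domain $\Omega\subset\mathbb{R}^n$, $n\ge 2$, is a John domain with parameter $C>1$ if there is a point $x_0\in\Omega$ such that every $y\in\Omega$ has a rectifiable curve parameterized by arc length $\gamma:[0,\ell]\to\Omega$ ($\ell$ the length of $\gamma$) with $\gamma(0)=y$, $\gamma(\ell)=x_0$ and $\mathrm{dist}(\gamma(t),\partial\Omega)\geq t/C$ for all $t\in[0,\ell]$. For a vector field $\mathbf{v}$ with differential matrix $D\mathbf{v}$, set $\varepsilon(\mathbf{v})=\frac12(D\mathbf{v}+D\mathbf{v}^T)$ and $l(\mathbf{v})=\varepsilon(\mathbf{v})-\frac{\mathrm{div}\,\mathbf{v}}{n}I$, where $I$ is the $n\times n$ identity matrix. The spaces $W^{1,2}(\Omega,\mathbb{R}^n)$ and $L^2$ are the usual unweighted ones. *)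

theory Defs
  imports "HOL-Analysis.Analysis"
begin

subsection \<open>John domains\<close>

text \<open>Length of the curve \<open>g\<close> on \<open>{a..b}\<close>: the supremum of the lengths of inscribed polygons,
  whose vertices are given by increasing lists of parameters.\<close>

definition curve_length :: "(real \<Rightarrow> 'a::metric_space) \<Rightarrow> real \<Rightarrow> real \<Rightarrow> ennreal" where
  "curve_length g a b =
     (SUP ts \<in> {ts. sorted ts \<and> set ts \<subseteq> {a..b}}.
        \<Sum>i<length ts - 1. ennreal (dist (g (ts ! i)) (g (ts ! Suc i))))"

definition rectifiable :: "(real \<Rightarrow> 'a::metric_space) \<Rightarrow> real \<Rightarrow> real \<Rightarrow> bool" where
  "rectifiable g a b \<longleftrightarrow> continuous_on {a..b} g \<and> curve_length g a b < \<infinity>"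

definition arc_length_parametrized :: "(real \<Rightarrow> 'a::metric_space) \<Rightarrow> real \<Rightarrow> bool" where
  "arc_length_parametrized g len \<longleftrightarrow>
     0 \<le> len \<and> rectifiable g 0 len \<and> (\<forall>t\<in>{0..len}. curve_length g 0 t = ennreal t)"

definition john_domain_with :: "real \<Rightarrow> (real ^ 'n) set \<Rightarrow> bool" where
  "john_domain_with C \<Omega> \<longleftrightarrow>
     C > 1 \<and> open \<Omega> \<and> connected \<Omega> \<and> bounded \<Omega> \<and>
     (\<exists>x0\<in>\<Omega>. \<forall>y\<in>\<Omega>. \<exists>g len.
        arc_length_parametrized g len \<and> g ` {0..len} \<subseteq> \<Omega> \<and> g 0 = y \<and> g len = x0 \<and>
        (\<forall>t\<in>{0..len}. infdist (g t) (frontier \<Omega>) \<ge> t / C))"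

definition john_domain :: "(real ^ 'n) set \<Rightarrow> bool" where
  "john_domain \<Omega> \<longleftrightarrow> (\<exists>C. john_domain_with C \<Omega>)"

subsection \<open>Weak derivatives\<close>

definition partial :: "'n \<Rightarrow> (real ^ 'n \<Rightarrow> real) \<Rightarrow> real ^ 'n \<Rightarrow> real" where
  "partial j \<phi> x = frechet_derivative \<phi> (at x) (axis j 1)"

text \<open>\<open>C\<^sup>\<infinity>\<close> on the whole space.  Differentiability of all iterated partial derivatives implies
  their continuity.\<close>

definition smooth :: "(real ^ 'n \<Rightarrow> real) \<Rightarrow> bool" where
  "smooth \<phi> \<longleftrightarrow> (\<forall>js x. foldr partial js \<phi> differentiable (at x))"

definition test_functions :: "(real ^ 'n) set \<Rightarrow> (real ^ 'n \<Rightarrow> real) set" where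
  "test_functions \<Omega> =
     {\<phi>. smooth \<phi> \<and> compact (closure {x. \<phi> x \<noteq> 0}) \<and> closure {x. \<phi> x \<noteq> 0} \<subseteq> \<Omega>}"

definition locally_integrable :: "(real ^ 'n) set \<Rightarrow> (real ^ 'n \<Rightarrow> 'b::euclidean_space) \<Rightarrow> bool" where
  "locally_integrable \<Omega> f \<longleftrightarrow> (\<forall>K. compact K \<and> K \<subseteq> \<Omega> \<longrightarrow> set_integrable lebesgue K f)"

text \<open>\<open>D\<close> is a weak differential matrix of \<open>v\<close> on \<open>\<Omega>\<close>, where \<open>D x $ i $ j\<close> is the \<open>j\<close>-th partial
  derivative of the \<open>i\<close>-th component.\<close>

definition has_weak_differential ::
    "(real ^ 'n) set \<Rightarrow> (real ^ 'n \<Rightarrow> real ^ 'n) \<Rightarrow> (real ^ 'n \<Rightarrow> real ^ 'n ^ 'n) \<Rightarrow> bool" where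
  "has_weak_differential \<Omega> v D \<longleftrightarrow>
     locally_integrable \<Omega> v \<and> locally_integrable \<Omega> D \<and>
     (\<forall>\<phi>\<in>test_functions \<Omega>. \<forall>i j.
        set_lebesgue_integral lebesgue \<Omega> (\<lambda>x. v x $ i * partial j \<phi> x) =
        - set_lebesgue_integral lebesgue \<Omega> (\<lambda>x. D x $ i $ j * \<phi> x))"

definition weakly_differentiable :: "(real ^ 'n) set \<Rightarrow> (real ^ 'n \<Rightarrow> real ^ 'n) \<Rightarrow> bool" where
  "weakly_differentiable \<Omega> v \<longleftrightarrow> (\<exists>D. has_weak_differential \<Omega> v D)"

text \<open>A representative of the weak differential, which on an open set is unique up to equality
  almost everywhere; the integrals below do not depend on the choice.\<close>

definition weak_differential ::
    "(real ^ 'n) set \<Rightarrow> (real ^ 'n \<Rightarrow> real ^ 'n) \<Rightarrow> real ^ 'n \<Rightarrow> real ^ 'n ^ 'n" where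
  "weak_differential \<Omega> v = (SOME D. has_weak_differential \<Omega> v D)"

subsection \<open>Function spaces\<close>

text \<open>For matrix-valued \<open>f\<close>, the library norm on \<open>real ^ 'n ^ 'n\<close> is the Frobenius norm.\<close>

definition L2_space :: "(real ^ 'n) set \<Rightarrow> (real ^ 'n \<Rightarrow> 'b::euclidean_space) set" where
  "L2_space \<Omega> =
     {f. set_borel_measurable lebesgue \<Omega> f \<and> set_integrable lebesgue \<Omega> (\<lambda>x. (norm (f x))\<^sup>2)}"

definition L2_norm :: "(real ^ 'n) set \<Rightarrow> (real ^ 'n \<Rightarrow> 'b::euclidean_space) \<Rightarrow> real" where
  "L2_norm \<Omega> f = sqrt (set_lebesgue_integral lebesgue \<Omega> (\<lambda>x. (norm (f x))\<^sup>2))"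

definition W12_space :: "(real ^ 'n) set \<Rightarrow> (real ^ 'n \<Rightarrow> real ^ 'n) set" where
  "W12_space \<Omega> =
     {v. v \<in> L2_space \<Omega> \<and> weakly_differentiable \<Omega> v \<and> weak_differential \<Omega> v \<in> L2_space \<Omega>}"

definition W12_norm :: "(real ^ 'n) set \<Rightarrow> (real ^ 'n \<Rightarrow> real ^ 'n) \<Rightarrow> real" where
  "W12_norm \<Omega> v = sqrt ((L2_norm \<Omega> v)\<^sup>2 + (L2_norm \<Omega> (weak_differential \<Omega> v))\<^sup>2)"

subsection \<open>The trace-free symmetric gradient\<close>

definition sym_gradient ::
    "(real ^ 'n) set \<Rightarrow> (real ^ 'n \<Rightarrow> real ^ 'n) \<Rightarrow> real ^ 'n \<Rightarrow> real ^ 'n ^ 'n" where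
  "sym_gradient \<Omega> v x =
     (1/2) *\<^sub>R (weak_differential \<Omega> v x + transpose (weak_differential \<Omega> v x))"

definition divergence :: "(real ^ 'n) set \<Rightarrow> (real ^ 'n \<Rightarrow> real ^ 'n) \<Rightarrow> real ^ 'n \<Rightarrow> real" where
  "divergence \<Omega> v x = trace (weak_differential \<Omega> v x)"

definition trace_free_sym_gradient ::
    "(real ^ 'n) set \<Rightarrow> (real ^ 'n \<Rightarrow> real ^ 'n) \<Rightarrow> real ^ 'n \<Rightarrow> real ^ 'n ^ 'n" where
  "trace_free_sym_gradient \<Omega> v x =
     sym_gradient \<Omega> v x - (divergence \<Omega> v x / real CARD('n)) *\<^sub>R mat 1"

end

theory Submission
  imports Defs
begin

text \<open>
  Write \<open>D\<close> for the differential of \<open>v\<close> and \<open>L\<close> for its symmetric trace-free part.  For \<open>n \<ge> 3\<close> the third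
  derivatives of \<open>v\<close> are linear combinations of second derivatives of \<open>L\<close>.  Hence the mean over a ball of the
  second-order Taylor polynomials of \<open>D\<close>, evaluated at a point \<open>x\<close>, changes by at most the mean of \<open>|L|\<close> when the
  ball is moved to a comparable one whose distance to \<open>x\<close> is at most a multiple of its radius.

  On a ball of radius \<open>R\<close> comparable to the distance to the boundary, the mean at scale \<open>R\<close> is a mollification of
  \<open>D\<close>; summing over dyadic scales bounds the \<open>L\<^sup>2\<close> norm of \<open>v\<close> minus its mollification by \<open>R\<close> times that of \<open>L\<close>,
  and a Caccioppoli inequality turns this into a bound for \<open>D\<close> minus its mollification.  The mollification itself
  is estimated by moving the ball along a John curve to the center, where integration by parts leaves the norm of
  \<open>v\<close>.  The means of \<open>|L|\<close> met on the way are collected in the operator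
  \<open>h \<mapsto> \<integral> 1(|x - y| \<le> C d(y)) d(y)\<^sup>-\<^sup>n h(y) dy\<close>, which is bounded on \<open>L\<^sup>2\<close>.
\<close>

subsection \<open>Smooth functions\<close>

text \<open>For n \<ge> 3 the fields with L = 0 are polynomials of degree at most two; in the plane
  they are the holomorphic functions, which no Taylor polynomial of fixed degree describes. Their
  differential is affine but not constant: a plain mean of D would change when the ball travels, the
  Taylor polynomial evaluated at a fixed point does not. As D has no derivatives, those of the
  Taylor polynomial are put on the kernel, and moving the ball becomes an identity between kernels,
  whose difference is a sum of third derivatives of bumps. One kernel serves for v and for D. The
  passage through v in the local bound has a reason. Comparing D at consecutive scales costs a mean
  of |L| without any power of the radius, and the sum over small scales need not converge; for v the
  same comparison gains a factor r, and the sum is geometric. Along a John curve the radii grow, so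
  that for fixed y the weights r^(-n) of the balls that see y add up to a multiple of d(y)^(-n). Up
  to a constant, the resulting operator is the adjoint of averaging over balls of radius C d(y)
  around y.\<close>

lemma partial_eqI:
  "(f has_derivative f') (at x) \<Longrightarrow> partial j f x = f' (axis j 1)"
  unfolding partial_def using frechet_derivative_at by metis

lemma smooth_imp_differentiable: "smooth f \<Longrightarrow> f differentiable (at x)"
  unfolding smooth_def by (drule spec[of _ "[]"]) simp

lemma smooth_partial: "smooth f \<Longrightarrow> smooth (partial j f)"
  unfolding smooth_def
proof (intro allI)
  fix js x assume "\<forall>js x. foldr partial js f differentiable at x"
  then have "foldr partial (js @ [j]) f differentiable at x" by blast
  then show "foldr partial js (partial j f) differentiable at x" by simp
qed

lemma smooth_foldr_partial: "smooth f \<Longrightarrow> smooth (foldr partial js f)"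
  by (induction js) (auto intro: smooth_partial)

text \<open>\<open>smooth\<close> is the largest set of differentiable functions that is closed
  under \<open>partial\<close>, so any such set containing the function will do as a witness.
  Explicit formulas for iterated derivatives are avoided in this way.\<close>

lemma smooth_coinduct:
  assumes "f \<in> S" "\<And>f x. f \<in> S \<Longrightarrow> f differentiable (at x)" "\<And>f j. f \<in> S \<Longrightarrow> partial j f \<in> S"
  shows "smooth f"
proof -
  have "foldr partial js f \<in> S" for js
    using assms by (induction js) auto
  then show ?thesis using assms(2) unfolding smooth_def by blast
qed

text \<open>The derivative of a product is a sum of products, so closure under multiplication has to
  come together with closure under addition. The generated algebra is closed under
  \<open>partial\<close> as soon as the derivatives of the generators lie in it, and then
  \<open>smooth_coinduct\<close> applies.\<close>

inductive_set fun_algebra :: "(real ^ 'n \<Rightarrow> real) set \<Rightarrow> (real ^ 'n \<Rightarrow> real) set" for S where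
  base: "f \<in> S \<Longrightarrow> f \<in> fun_algebra S"
| const: "(\<lambda>x. c) \<in> fun_algebra S"
| add: "f \<in> fun_algebra S \<Longrightarrow> g \<in> fun_algebra S \<Longrightarrow> (\<lambda>x. f x + g x) \<in> fun_algebra S"
| mult: "f \<in> fun_algebra S \<Longrightarrow> g \<in> fun_algebra S \<Longrightarrow> (\<lambda>x. f x * g x) \<in> fun_algebra S"

lemma frechet_derivative_works': "f differentiable (at x) \<Longrightarrow> (f has_derivative frechet_derivative f (at x)) (at x)"
  using frechet_derivative_works by blast

lemma partial_const [simp]: "partial j (\<lambda>x. c) = (\<lambda>x. 0)"
  by (rule ext, subst partial_eqI[where f'="\<lambda>x. 0"]) auto

lemma partial_add_at:
  assumes "f differentiable (at x)" "g differentiable (at x)"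
  shows "partial j (\<lambda>x. f x + g x) x = partial j f x + partial j g x"
  unfolding partial_def[of j f] partial_def[of j g]
  by (rule partial_eqI) (intro has_derivative_add assms[THEN frechet_derivative_works'])

lemma partial_mult_at:
  assumes "f differentiable (at x)" "g differentiable (at x)"
  shows "partial j (\<lambda>x. f x * g x) x = partial j f x * g x + f x * partial j g x"
  unfolding partial_def[of j f] partial_def[of j g]
  by (subst partial_eqI[OF has_derivative_mult[OF assms[THEN frechet_derivative_works']]]) simp

lemma fun_algebra_smooth:
  assumes diff: "\<And>f x. f \<in> S \<Longrightarrow> f differentiable (at x)"
    and part: "\<And>f j. f \<in> S \<Longrightarrow> partial j f \<in> fun_algebra S"
    and f: "f \<in> fun_algebra S"
  shows "smooth f"
proof (rule smooth_coinduct[OF f])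
  fix f x assume "f \<in> fun_algebra S"
  then have "\<forall>x. f differentiable (at x)"
    by induction (auto intro!: diff derivative_intros)
  then show "f differentiable (at x)" by blast
next
  fix f j assume "f \<in> fun_algebra S"
  then have "(\<forall>x. f differentiable (at x)) \<and> partial j f \<in> fun_algebra S"
  proof induction
    case (base f) then show ?case using diff part by blast
  next
    case (const c) show ?case using fun_algebra.const[of 0] by simp
  next
    case (add f g)
    then have "partial j (\<lambda>x. f x + g x) = (\<lambda>x. partial j f x + partial j g x)"
      using partial_add_at by blast
    with add show ?case by (auto intro!: derivative_intros fun_algebra.add)
  next
    case (mult f g)
    then have "partial j (\<lambda>x. f x * g x) = (\<lambda>x. partial j f x * g x + f x * partial j g x)"
      using partial_mult_at by blast
    with mult show ?case by (auto intro!: derivative_intros fun_algebra.add fun_algebra.mult)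
  qed
  then show "partial j f \<in> fun_algebra S" by blast
qed

lemma fun_algebra_smooth_gens: "f \<in> fun_algebra {f. smooth f} \<Longrightarrow> smooth f"
  by (rule fun_algebra_smooth) (auto intro: smooth_imp_differentiable smooth_partial fun_algebra.base)

lemma smooth_const: "smooth (\<lambda>x. c)"
  by (intro fun_algebra_smooth_gens fun_algebra.const)

lemma smooth_add: "smooth f \<Longrightarrow> smooth g \<Longrightarrow> smooth (\<lambda>x. f x + g x)"
  by (intro fun_algebra_smooth_gens fun_algebra.add fun_algebra.base) auto

lemma smooth_mult: "smooth f \<Longrightarrow> smooth g \<Longrightarrow> smooth (\<lambda>x. f x * g x)"
  by (intro fun_algebra_smooth_gens fun_algebra.mult fun_algebra.base) auto

lemma smooth_uminus: "smooth f \<Longrightarrow> smooth (\<lambda>x. - f x)"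
  using smooth_mult[OF smooth_const[of "-1"]] by auto

lemma smooth_diff: "smooth f \<Longrightarrow> smooth g \<Longrightarrow> smooth (\<lambda>x. f x - g x)"
  using smooth_add[OF _ smooth_uminus] by auto

lemma smooth_sum: "(\<And>i. i \<in> I \<Longrightarrow> smooth (f i)) \<Longrightarrow> smooth (\<lambda>x. \<Sum>i\<in>I. f i x)"
proof (induction I rule: infinite_finite_induct)
  case (insert i I)
  then show ?case by (simp add: smooth_add)
qed (auto intro: smooth_const)

lemma partial_add: "smooth f \<Longrightarrow> smooth g \<Longrightarrow> partial j (\<lambda>x. f x + g x) = (\<lambda>x. partial j f x + partial j g x)"
  using partial_add_at smooth_imp_differentiable by blast

lemma partial_mult: "smooth f \<Longrightarrow> smooth g \<Longrightarrow>
    partial j (\<lambda>x. f x * g x) = (\<lambda>x. partial j f x * g x + f x * partial j g x)"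
  using partial_mult_at smooth_imp_differentiable by blast

lemma partial_cmult: "smooth f \<Longrightarrow> partial j (\<lambda>x. c * f x) = (\<lambda>x. c * partial j f x)"
  by (subst partial_mult) (auto intro: smooth_const)

lemma partial_uminus: "smooth f \<Longrightarrow> partial j (\<lambda>x. - f x) = (\<lambda>x. - partial j f x)"
  using partial_cmult[of f j "-1"] by simp

lemma partial_diff: "smooth f \<Longrightarrow> smooth g \<Longrightarrow> partial j (\<lambda>x. f x - g x) = (\<lambda>x. partial j f x - partial j g x)"
  using partial_add[OF _ smooth_uminus, of f g j] by (simp add: partial_uminus)

lemma partial_sum: "(\<And>i. i \<in> I \<Longrightarrow> smooth (f i)) \<Longrightarrow>
    partial j (\<lambda>x. \<Sum>i\<in>I. f i x) = (\<lambda>x. \<Sum>i\<in>I. partial j (f i) x)"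
proof (induction I rule: infinite_finite_induct)
  case (insert i I)
  then show ?case by (simp add: smooth_sum partial_add)
qed auto

lemma partial_coord: "partial j (\<lambda>x. x $ i) = (\<lambda>x. if i = j then 1 else 0)"
  by (rule ext, subst partial_eqI[where f'="\<lambda>x. x $ i"])
    (auto simp: axis_def intro!: bounded_linear_imp_has_derivative bounded_linear_vec_nth)

lemma smooth_coord: "smooth (\<lambda>x. x $ i)"
proof (rule fun_algebra_smooth[of "{\<lambda>x. x $ i}"])
  show "(\<lambda>x. x $ i) \<in> fun_algebra {\<lambda>x. x $ i}" by (auto intro: fun_algebra.base)
qed (auto simp: partial_coord fun_algebra.const intro!: bounded_linear_imp_differentiable bounded_linear_vec_nth)

lemma has_derivative_affine_comp:
  assumes "f differentiable (at (c *\<^sub>R (x - a)))"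
  shows "((\<lambda>x. f (c *\<^sub>R (x - a))) has_derivative
     (\<lambda>h. frechet_derivative f (at (c *\<^sub>R (x - a))) (c *\<^sub>R h))) (at x)"
proof -
  have 1: "((\<lambda>x. c *\<^sub>R (x - a)) has_derivative (\<lambda>h. c *\<^sub>R h)) (at x)"
    by (auto intro!: derivative_eq_intros)
  show ?thesis
    using diff_chain_at[OF 1 frechet_derivative_works'[OF assms]] by (simp add: o_def)
qed

lemma partial_affine:
  assumes "smooth f"
  shows "partial j (\<lambda>x. f (c *\<^sub>R (x - a))) = (\<lambda>x. c * partial j f (c *\<^sub>R (x - a)))"
proof
  fix x
  have d: "f differentiable (at (c *\<^sub>R (x - a)))" by (rule smooth_imp_differentiable[OF assms])
  show "partial j (\<lambda>x. f (c *\<^sub>R (x - a))) x = c * partial j f (c *\<^sub>R (x - a))"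
    by (subst partial_eqI[OF has_derivative_affine_comp[OF d]])
      (simp add: partial_def linear_cmul[OF linear_frechet_derivative[OF d]])
qed

text \<open>Each derivative pulls out a factor \<open>c\<close>. The invariant set therefore
  consists of the scalar multiples \<open>k * f (c *\<^sub>R (x - a))\<close> for all
  \<open>k\<close> and all smooth \<open>f\<close>.\<close>

lemma smooth_affine:
  assumes "smooth f"
  shows "smooth (\<lambda>x. f (c *\<^sub>R (x - a)))"
proof (rule smooth_coinduct[of _ "{\<lambda>x. k * f (c *\<^sub>R (x - a)) | k f. smooth f}"])
  show "(\<lambda>x. f (c *\<^sub>R (x - a))) \<in> {\<lambda>x. k * f (c *\<^sub>R (x - a)) | k f. smooth f}"
    using assms by (auto intro!: exI[of _ 1])
next
  fix g :: "real^'a \<Rightarrow> real" and x assume "g \<in> {\<lambda>x. k * f (c *\<^sub>R (x - a)) | k f. smooth f}"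
  then obtain k f where g: "g = (\<lambda>x. k * f (c *\<^sub>R (x - a)))" "smooth f" by blast
  have "(\<lambda>x. f (c *\<^sub>R (x - a))) differentiable (at x)"
    using has_derivative_affine_comp[OF smooth_imp_differentiable[OF g(2)]] unfolding differentiable_def by blast
  then show "g differentiable (at x)" unfolding g by (auto intro!: derivative_intros)
next
  fix g :: "real^'a \<Rightarrow> real" and j assume "g \<in> {\<lambda>x. k * f (c *\<^sub>R (x - a)) | k f. smooth f}"
  then obtain k f where g: "g = (\<lambda>x. k * f (c *\<^sub>R (x - a)))" "smooth f" by blast
  have "partial j g x = (k * c) * partial j f (c *\<^sub>R (x - a))" for x
  proof -
    have "(\<lambda>x. f (c *\<^sub>R (x - a))) differentiable (at x)"
      using has_derivative_affine_comp[OF smooth_imp_differentiable[OF g(2)]] unfolding differentiable_def by blast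
    then show ?thesis unfolding g using partial_mult_at[of "\<lambda>x. k" x "\<lambda>x. f (c *\<^sub>R (x - a))" j]
      by (simp add: partial_affine[OF g(2)])
  qed
  then have "partial j g = (\<lambda>x. (k * c) * partial j f (c *\<^sub>R (x - a)))" by blast
  then show "partial j g \<in> {\<lambda>x. k * f (c *\<^sub>R (x - a)) | k f. smooth f}"
    using smooth_partial[OF g(2)] by blast
qed

lemma smooth_continuous_on: "smooth f \<Longrightarrow> continuous_on S f"
  by (meson continuous_at_imp_continuous_on differentiable_imp_continuous_within smooth_imp_differentiable)

lemma smooth_borel [measurable_dest]: "smooth f \<Longrightarrow> f \<in> borel_measurable borel"
  by (intro borel_measurable_continuous_onI smooth_continuous_on)

section \<open>Symmetry of second derivatives\<close>

lemma DERIV_partial_line: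
  assumes "smooth f"
  shows "((\<lambda>t. f (x + t *\<^sub>R axis i 1)) has_real_derivative partial i f (x + t *\<^sub>R axis i 1)) (at t)"
proof -
  have d: "f differentiable (at (x + t *\<^sub>R axis i 1))" using smooth_imp_differentiable[OF assms] .
  have 1: "((\<lambda>t. x + t *\<^sub>R axis i 1) has_derivative (\<lambda>h. h *\<^sub>R axis i 1)) (at t)"
    by (auto intro!: derivative_eq_intros)
  have eq: "(\<lambda>h. frechet_derivative f (at (x + t *\<^sub>R axis i 1)) (h *\<^sub>R axis i 1)) = (*) (partial i f (x + t *\<^sub>R axis i 1))"
    using linear_frechet_derivative[OF d] by (auto simp: linear_cmul partial_def)
  show ?thesis
    using diff_chain_at[OF 1 frechet_derivative_works'[OF d]] unfolding has_field_derivative_def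
    by (simp add: o_def eq)
qed

text \<open>The mean value theorem is used twice: for the increment in direction \<open>j\<close>,
  seen as a function of the step in direction \<open>i\<close>, and then for
  \<open>partial i f\<close> along direction \<open>j\<close>.\<close>

lemma second_difference_mvt:
  assumes f: "smooth f" and s: "s > 0"
  shows "\<exists>\<sigma> \<tau>. 0 < \<sigma> \<and> \<sigma> < s \<and> 0 < \<tau> \<and> \<tau> < s \<and>
    f (x + s *\<^sub>R axis i 1 + s *\<^sub>R axis j 1) - f (x + s *\<^sub>R axis i 1) - f (x + s *\<^sub>R axis j 1) + f x =
    s\<^sup>2 * partial j (partial i f) (x + \<sigma> *\<^sub>R axis i 1 + \<tau> *\<^sub>R axis j 1)"
proof -
  define u where "u = (\<lambda>t. f (x + s *\<^sub>R axis j 1 + t *\<^sub>R axis i 1) - f (x + t *\<^sub>R axis i 1))"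
  have du: "(u has_real_derivative (partial i f (x + s *\<^sub>R axis j 1 + t *\<^sub>R axis i 1) - partial i f (x + t *\<^sub>R axis i 1))) (at t)" for t
    unfolding u_def by (intro DERIV_diff DERIV_partial_line f)
  obtain \<sigma> where \<sigma>: "0 < \<sigma>" "\<sigma> < s"
    "u s - u 0 = (s - 0) * (partial i f (x + s *\<^sub>R axis j 1 + \<sigma> *\<^sub>R axis i 1) - partial i f (x + \<sigma> *\<^sub>R axis i 1))"
    using MVT2[OF s, of u "\<lambda>t. partial i f (x + s *\<^sub>R axis j 1 + t *\<^sub>R axis i 1) - partial i f (x + t *\<^sub>R axis i 1)"] du by blast
  define w where "w = (\<lambda>t. partial i f ((x + \<sigma> *\<^sub>R axis i 1) + t *\<^sub>R axis j 1))"
  have dw: "(w has_real_derivative (partial j (partial i f) ((x + \<sigma> *\<^sub>R axis i 1) + t *\<^sub>R axis j 1))) (at t)" for t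
    unfolding w_def by (intro DERIV_partial_line smooth_partial f)
  obtain \<tau> where \<tau>: "0 < \<tau>" "\<tau> < s"
    "w s - w 0 = (s - 0) * partial j (partial i f) ((x + \<sigma> *\<^sub>R axis i 1) + \<tau> *\<^sub>R axis j 1)"
    using MVT2[OF s, of w "\<lambda>t. partial j (partial i f) ((x + \<sigma> *\<^sub>R axis i 1) + t *\<^sub>R axis j 1)"] dw by blast
  have "u s - u 0 = s * (w s - w 0)"
    using \<sigma>(3) by (simp add: w_def ac_simps)
  then have "f (x + s *\<^sub>R axis i 1 + s *\<^sub>R axis j 1) - f (x + s *\<^sub>R axis i 1) - f (x + s *\<^sub>R axis j 1) + f x =
    s\<^sup>2 * partial j (partial i f) (x + \<sigma> *\<^sub>R axis i 1 + \<tau> *\<^sub>R axis j 1)"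
    using \<tau>(3) by (simp add: u_def power2_eq_square ac_simps)
  with \<sigma> \<tau> show ?thesis by blast
qed

text \<open>The second difference is symmetric in \<open>i\<close> and \<open>j\<close>. Hence one
  mixed derivative at some point near \<open>x\<close> equals the other one at another point near
  \<open>x\<close>, and both are continuous.\<close>

lemma partial_commute:
  assumes f: "smooth f"
  shows "partial i (partial j f) = partial j (partial i f)"
proof
  fix x
  let ?a = "partial i (partial j f)" and ?b = "partial j (partial i f)"
  show "?a x = ?b x"
  proof (rule ccontr)
    assume ne: "?a x \<noteq> ?b x"
    define e where "e = \<bar>?a x - ?b x\<bar> / 2"
    have e: "e > 0" using ne by (simp add: e_def)
    have cont: "isCont g x" if "smooth g" for g
      using smooth_continuous_on[OF that, of UNIV] by (simp add: continuous_on_eq_continuous_at)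
    have ca: "isCont ?a x" and cb: "isCont ?b x"
      by (intro cont smooth_partial f)+
    obtain d1 where d1: "d1 > 0" "\<And>y. dist y x < d1 \<Longrightarrow> \<bar>?a y - ?a x\<bar> < e"
      using ca e unfolding continuous_at_eps_delta by (metis dist_real_def)
    obtain d2 where d2: "d2 > 0" "\<And>y. dist y x < d2 \<Longrightarrow> \<bar>?b y - ?b x\<bar> < e"
      using cb e unfolding continuous_at_eps_delta by (metis dist_real_def)
    \<comment> \<open>The intermediate points are displaced by less than 2 s, which keeps them
      within both radii of continuity.\<close>
    define s where "s = min d1 d2 / 2"
    have s: "s > 0" using d1 d2 by (simp add: s_def)
    have near: "dist (x + \<sigma> *\<^sub>R axis k 1 + \<tau> *\<^sub>R axis l 1) x < min d1 d2"
      if "0 < \<sigma>" "\<sigma> < s" "0 < \<tau>" "\<tau> < s" for \<sigma> \<tau> and k l :: 'a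
    proof -
      have "dist (x + \<sigma> *\<^sub>R axis k 1 + \<tau> *\<^sub>R axis l 1) x = norm (\<sigma> *\<^sub>R axis k (1::real) + \<tau> *\<^sub>R axis l 1)"
        by (simp add: dist_norm add.assoc)
      also have "\<dots> \<le> \<sigma> + \<tau>"
        using that by (intro order_trans[OF norm_triangle_ineq]) simp
      finally show ?thesis using that by (simp add: s_def)
    qed
    obtain \<sigma> \<tau> where 1: "0 < \<sigma>" "\<sigma> < s" "0 < \<tau>" "\<tau> < s"
      "f (x + s *\<^sub>R axis i 1 + s *\<^sub>R axis j 1) - f (x + s *\<^sub>R axis i 1) - f (x + s *\<^sub>R axis j 1) + f x =
       s\<^sup>2 * ?b (x + \<sigma> *\<^sub>R axis i 1 + \<tau> *\<^sub>R axis j 1)"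
      using second_difference_mvt[OF f s] by blast
    obtain \<sigma>' \<tau>' where 2: "0 < \<sigma>'" "\<sigma>' < s" "0 < \<tau>'" "\<tau>' < s"
      "f (x + s *\<^sub>R axis j 1 + s *\<^sub>R axis i 1) - f (x + s *\<^sub>R axis j 1) - f (x + s *\<^sub>R axis i 1) + f x =
       s\<^sup>2 * ?a (x + \<sigma>' *\<^sub>R axis j 1 + \<tau>' *\<^sub>R axis i 1)"
      using second_difference_mvt[OF f s] by blast
    have "s\<^sup>2 * ?b (x + \<sigma> *\<^sub>R axis i 1 + \<tau> *\<^sub>R axis j 1) = s\<^sup>2 * ?a (x + \<sigma>' *\<^sub>R axis j 1 + \<tau>' *\<^sub>R axis i 1)"
      using 1(5) 2(5) by (simp add: algebra_simps)
    then have "?b (x + \<sigma> *\<^sub>R axis i 1 + \<tau> *\<^sub>R axis j 1) = ?a (x + \<sigma>' *\<^sub>R axis j 1 + \<tau>' *\<^sub>R axis i 1)"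
      using s by simp
    moreover have "\<bar>?b (x + \<sigma> *\<^sub>R axis i 1 + \<tau> *\<^sub>R axis j 1) - ?b x\<bar> < e"
      using d2(2) near[OF 1(1-4), of i j] by simp
    moreover have "\<bar>?a (x + \<sigma>' *\<^sub>R axis j 1 + \<tau>' *\<^sub>R axis i 1) - ?a x\<bar> < e"
      using d1(2) near[OF 2(1-4), of j i] by simp
    ultimately have "\<bar>?a x - ?b x\<bar> < 2 * e" by linarith
    then show False unfolding e_def by simp
  qed
qed

text \<open>Leibniz rule with at most 2^m terms. All bounds refer to the single point
  \<open>x\<close>, because one factor will be an affine function, which is bounded only on the
  support of the other factor.\<close>

lemma foldr_partial_mult_bound:
  assumes "smooth f" "smooth g"
    and "\<And>js. length js \<le> m \<Longrightarrow> \<bar>foldr partial js f x\<bar> \<le> A"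
    and "\<And>js. length js \<le> m \<Longrightarrow> \<bar>foldr partial js g x\<bar> \<le> B"
    and "length js \<le> m"
  shows "\<bar>foldr partial js (\<lambda>x. f x * g x) x\<bar> \<le> 2 ^ m * A * B"
  using assms
proof (induction m arbitrary: f g js)
  case 0
  have "\<bar>f x * g x\<bar> \<le> A * B" using 0(3)[of "[]"] 0(4)[of "[]"] by (auto simp: abs_mult intro!: mult_mono)
  then show ?case using 0 by simp
next
  case (Suc m)
  have 0: "0 \<le> A" "0 \<le> B" using Suc.prems(3)[of "[]"] Suc.prems(4)[of "[]"] by auto
  show ?case
  proof (cases js rule: rev_cases)
    case Nil
    have "\<bar>f x * g x\<bar> \<le> A * B" using Suc.prems(3)[of "[]"] Suc.prems(4)[of "[]"] by (auto simp: abs_mult intro!: mult_mono)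
    also have "\<dots> \<le> 2 ^ Suc m * (A * B)" using 0 mult_right_mono[of 1 "2 ^ Suc m" "A * B"] two_realpow_ge_one[of "Suc m"] by auto
    finally show ?thesis using Nil by (simp add: mult.assoc)
  next
    \<comment> \<open>\<open>foldr\<close> applies the last index of the list first, so it is the
      last derivative that is distributed over the product before the induction hypothesis is used
      for the rest.\<close>
    case (snoc ks j)
    have len: "length ks \<le> m" using Suc.prems snoc by simp
    have split: "foldr partial ks (\<lambda>x. p x + q x) = (\<lambda>x. foldr partial ks p x + foldr partial ks q x)"
      if "smooth p" "smooth q" for p q
      using that by (induction ks) (auto simp: partial_add smooth_foldr_partial)
    have f': "\<bar>foldr partial ls (partial j f) x\<bar> \<le> A" "\<bar>foldr partial ls f x\<bar> \<le> A" if "length ls \<le> m" for ls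
      using Suc.prems(3)[of "ls @ [j]"] Suc.prems(3)[of "ls"] that by auto
    have g': "\<bar>foldr partial ls (partial j g) x\<bar> \<le> B" "\<bar>foldr partial ls g x\<bar> \<le> B" if "length ls \<le> m" for ls
      using Suc.prems(4)[of "ls @ [j]"] Suc.prems(4)[of "ls"] that by auto
    have "foldr partial js (\<lambda>x. f x * g x) x =
      foldr partial ks (\<lambda>x. partial j f x * g x) x + foldr partial ks (\<lambda>x. f x * partial j g x) x"
      using Suc.prems(1,2) by (simp add: snoc partial_mult split smooth_mult smooth_partial)
    moreover have "\<bar>foldr partial ks (\<lambda>x. partial j f x * g x) x\<bar> \<le> 2 ^ m * A * B"
      using Suc.prems(1,2) f' g' len by (intro Suc.IH) (auto intro: smooth_partial)
    moreover have "\<bar>foldr partial ks (\<lambda>x. f x * partial j g x) x\<bar> \<le> 2 ^ m * A * B"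
      using Suc.prems(1,2) f' g' len by (intro Suc.IH) (auto intro: smooth_partial)
    ultimately show ?thesis by simp
  qed
qed

section \<open>Smooth functions with prescribed support\<close>

definition bumps :: "(real ^ 'n) set \<Rightarrow> (real ^ 'n \<Rightarrow> real) set" where
  "bumps K = {\<phi>. smooth \<phi> \<and> (\<forall>x. x \<notin> K \<longrightarrow> \<phi> x = 0)}"

lemma bumpsI: "smooth \<phi> \<Longrightarrow> (\<And>x. x \<notin> K \<Longrightarrow> \<phi> x = 0) \<Longrightarrow> \<phi> \<in> bumps K"
  by (simp add: bumps_def)

lemma bumps_smooth: "\<phi> \<in> bumps K \<Longrightarrow> smooth \<phi>"
  and bumps_zero: "\<phi> \<in> bumps K \<Longrightarrow> x \<notin> K \<Longrightarrow> \<phi> x = 0"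
  by (auto simp: bumps_def)

lemma bumps_partial:
  assumes "\<phi> \<in> bumps K" "closed K"
  shows "partial j \<phi> \<in> bumps K"
proof (rule bumpsI)
  show "smooth (partial j \<phi>)" by (intro smooth_partial bumps_smooth[OF assms(1)])
  fix x assume "x \<notin> K"
  have "(\<phi> has_derivative (\<lambda>h. 0)) (at x)"
    by (rule has_derivative_transform_within_open[of "\<lambda>x. 0" _ _ _ "- K"])
      (use assms \<open>x \<notin> K\<close> bumps_zero[OF assms(1)] in auto)
  then show "partial j \<phi> x = 0" by (rule partial_eqI)
qed

lemma bumps_mult_right: "\<phi> \<in> bumps K \<Longrightarrow> smooth f \<Longrightarrow> (\<lambda>x. f x * \<phi> x) \<in> bumps K"
  and bumps_mult_left: "\<phi> \<in> bumps K \<Longrightarrow> smooth f \<Longrightarrow> (\<lambda>x. \<phi> x * f x) \<in> bumps K"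
  by (auto simp: bumps_def smooth_mult)

lemma bumps_add: "\<phi> \<in> bumps K \<Longrightarrow> \<psi> \<in> bumps K \<Longrightarrow> (\<lambda>x. \<phi> x + \<psi> x) \<in> bumps K"
  and bumps_diff: "\<phi> \<in> bumps K \<Longrightarrow> \<psi> \<in> bumps K \<Longrightarrow> (\<lambda>x. \<phi> x - \<psi> x) \<in> bumps K"
  and bumps_cmult: "\<phi> \<in> bumps K \<Longrightarrow> (\<lambda>x. c * \<phi> x) \<in> bumps K"
  by (auto simp: bumps_def smooth_add smooth_diff smooth_mult smooth_const)

lemma bumps_sum: "(\<And>i. i \<in> I \<Longrightarrow> f i \<in> bumps K) \<Longrightarrow> (\<lambda>x. \<Sum>i\<in>I. f i x) \<in> bumps K"
  by (auto simp: bumps_def smooth_sum)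

lemma bumps_test_functions:
  assumes "\<phi> \<in> bumps K" "compact K" "K \<subseteq> \<Omega>"
  shows "\<phi> \<in> test_functions \<Omega>"
proof -
  have "closure {x. \<phi> x \<noteq> 0} \<subseteq> K"
    using assms by (intro closure_minimal) (auto simp: compact_imp_closed dest: bumps_zero)
  moreover from this have "compact (closure {x. \<phi> x \<noteq> 0})"
    using assms(2) by (meson bounded_subset closed_closure compact_eq_bounded_closed)
  ultimately show ?thesis using assms bumps_smooth by (auto simp: test_functions_def)
qed

lemma bumps_bounded:
  assumes "\<phi> \<in> bumps K" "compact K"
  obtains M where "M \<ge> 0" "\<And>x. \<bar>\<phi> x\<bar> \<le> M"
proof -
  have "compact (\<phi> ` K)"
    by (intro compact_continuous_image smooth_continuous_on bumps_smooth[OF assms(1)] assms)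
  then have "bounded (\<phi> ` K)" by (rule compact_imp_bounded)
  then obtain B where B: "\<forall>x\<in>K. \<bar>\<phi> x\<bar> \<le> B"
    unfolding bounded_iff by auto
  show ?thesis
  proof (rule that[of "max B 0"])
    fix x show "\<bar>\<phi> x\<bar> \<le> max B 0"
      using B bumps_zero[OF assms(1), of x] by (cases "x \<in> K") auto
  qed auto
qed

lemma bumps_foldr_partial: "\<phi> \<in> bumps K \<Longrightarrow> closed K \<Longrightarrow> foldr partial js \<phi> \<in> bumps K"
  by (induction js) (auto intro: bumps_partial)

lemma bumps_derivatives_bounded:
  assumes "\<phi> \<in> bumps K" "compact K"
  obtains M where "M \<ge> 0" "\<And>js x. length js \<le> m \<Longrightarrow> \<bar>foldr partial js \<phi> x\<bar> \<le> M"
proof -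
  let ?J = "{js :: 'a list. length js \<le> m}"
  have fin: "finite ?J" using finite_lists_length_le[of "UNIV :: 'a set" m] by simp
  have "\<exists>M\<ge>0. \<forall>x. \<bar>foldr partial js \<phi> x\<bar> \<le> M" for js
    using bumps_bounded[OF bumps_foldr_partial[OF assms(1) compact_imp_closed[OF assms(2)]] assms(2)] by metis
  then obtain M where M: "\<And>js. M js \<ge> 0" "\<And>js x. \<bar>foldr partial js \<phi> x\<bar> \<le> M js" by metis
  show ?thesis
  proof (rule that[of "\<Sum>js\<in>?J. M js"])
    fix js :: "'a list" and x assume "length js \<le> m"
    then have "M js \<le> (\<Sum>js\<in>?J. M js)" using fin M by (intro member_le_sum) auto
    with M(2) show "\<bar>foldr partial js \<phi> x\<bar> \<le> (\<Sum>js\<in>?J. M js)" by (meson order_trans)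
  qed (auto intro: sum_nonneg M)
qed

section \<open>A smooth bump built from exp(-1/s)\<close>

definition poly_exp_inv :: "real poly \<Rightarrow> real \<Rightarrow> real" where
  "poly_exp_inv p s = (if s > 0 then poly p (1 / s) * exp (- 1 / s) else 0)"

lemma poly_exp_minus_tendsto_0: "((\<lambda>t. poly p t * exp (- t :: real)) \<longlongrightarrow> 0) at_top"
proof -
  have "((\<lambda>t. \<Sum>i\<le>degree p. coeff p i * (t ^ i / exp t)) \<longlongrightarrow> (\<Sum>i\<le>degree p. coeff p i * 0)) at_top"
    by (intro tendsto_sum tendsto_mult tendsto_const tendsto_power_div_exp_0)
  then show ?thesis
    by (simp add: poly_altdef exp_minus sum_distrib_right divide_inverse mult.assoc)
qed

text \<open>With t = 1/s one has d/ds = -t^2 d/dt, and -t^2 (p(t) e^(-t))' = t^2 (p(t) - p'(t))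
  e^(-t). The family over all polynomials is thus closed under differentiation, including the point
  0, where the exponential beats every polynomial.\<close>

lemma DERIV_poly_exp_inv:
  "(poly_exp_inv p has_real_derivative poly_exp_inv (monom 1 2 * (p - pderiv p)) s) (at s)"
proof -
  consider "s > 0" | "s < 0" | "s = 0" by linarith
  then show ?thesis
  proof cases
    case 1
    have "((\<lambda>s. poly p (1 / s) * exp (- 1 / s)) has_real_derivative
      poly (monom 1 2 * (p - pderiv p)) (1 / s) * exp (- 1 / s)) (at s)"
      using 1 by (auto intro!: derivative_eq_intros DERIV_chain'[of _ _ _ _ "poly p"] poly_DERIV
          simp: poly_monom field_simps power2_eq_square)
    moreover have "eventually (\<lambda>x. poly p (1 / x) * exp (- 1 / x) = poly_exp_inv p x) (nhds s)"
      using 1 unfolding eventually_nhds poly_exp_inv_def by (intro exI[of _ "{0<..}"]) auto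
    ultimately show ?thesis
      using DERIV_cong_ev[of s s "\<lambda>s. poly p (1 / s) * exp (- 1 / s)" "poly_exp_inv p"] 1
      by (auto simp: poly_exp_inv_def[of _ s])
  next
    case 2
    have "eventually (\<lambda>x. 0 = poly_exp_inv p x) (nhds s)"
      using 2 unfolding eventually_nhds poly_exp_inv_def by (intro exI[of _ "{..<0}"]) auto
    then show ?thesis
      using DERIV_cong_ev[of s s "\<lambda>s. 0" "poly_exp_inv p" 0 0] 2 by (auto simp: poly_exp_inv_def[of _ s])
  next
    case 3
    have "((\<lambda>h. poly_exp_inv p h / h) \<longlongrightarrow> 0) (at_right 0)"
    proof -
      \<comment> \<open>The difference quotient at 0 is again of the form p(1/h) e^(-1/h), with p
        multiplied by the variable.\<close>
      have "((\<lambda>t. poly (pCons 0 p) t * exp (- t)) \<longlongrightarrow> 0) at_top" by (rule poly_exp_minus_tendsto_0)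
      then have "((\<lambda>h. poly (pCons 0 p) (inverse h) * exp (- inverse h)) \<longlongrightarrow> 0) (at_right 0)"
        by (rule filterlim_compose[OF _ filterlim_inverse_at_top_right])
      then show ?thesis
        by (rule Lim_transform_eventually)
          (auto simp: eventually_at_filter poly_exp_inv_def field_simps)
    qed
    moreover have "((\<lambda>h. poly_exp_inv p h / h) \<longlongrightarrow> 0) (at_left 0)"
    proof (rule Lim_transform_eventually[OF tendsto_const])
      show "eventually (\<lambda>x. 0 = poly_exp_inv p x / x) (at_left 0)"
        by (auto simp: eventually_at_filter poly_exp_inv_def)
    qed
    ultimately have "((\<lambda>h. poly_exp_inv p h / h) \<longlongrightarrow> 0) (at 0)"
      by (simp add: filterlim_split_at)
    then show ?thesis using 3 by (simp add: has_field_derivative_iff poly_exp_inv_def)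
  qed
qed

text \<open>The chain rule produces the inner derivative -2 x_j, so the coordinates are taken as
  generators along with the functions \<open>poly_exp_inv p (1 - x \<bullet> x)\<close> for all
  polynomials.\<close>

lemma smooth_poly_exp_inv: "smooth (\<lambda>x :: real ^ 'n. poly_exp_inv p (1 - x \<bullet> x))"
proof -
  let ?S = "range (\<lambda>p (x :: real^'n). poly_exp_inv p (1 - x \<bullet> x)) \<union> range (\<lambda>i x. x $ i)"
  have der: "((\<lambda>x :: real^'n. poly_exp_inv p (1 - x \<bullet> x)) has_derivative
    (\<lambda>h. poly_exp_inv (monom 1 2 * (p - pderiv p)) (1 - x \<bullet> x) * (- 2 * (x \<bullet> h)))) (at x)" for p x
  proof -
    have "((\<lambda>x :: real^'n. 1 - x \<bullet> x) has_derivative (\<lambda>h. - 2 * (x \<bullet> h))) (at x)"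
      by (auto intro!: derivative_eq_intros simp: inner_commute)
    from diff_chain_at[OF this DERIV_poly_exp_inv[of p, THEN has_field_derivative_imp_has_derivative]]
    show ?thesis by (simp add: o_def)
  qed
  show ?thesis
  proof (rule fun_algebra_smooth[of ?S])
    fix f :: "real^'n \<Rightarrow> real" and x assume "f \<in> ?S"
    then consider p where "f = (\<lambda>x. poly_exp_inv p (1 - x \<bullet> x))" | i where "f = (\<lambda>x. x $ i)" by blast
    then show "f differentiable at x"
    proof cases
      case 1
      show ?thesis unfolding 1 differentiable_def using der by blast
    next
      case 2
      show ?thesis unfolding 2 by (rule smooth_imp_differentiable[OF smooth_coord])
    qed
  next
    fix f :: "real^'n \<Rightarrow> real" and j assume "f \<in> ?S"
    then consider p where "f = (\<lambda>x. poly_exp_inv p (1 - x \<bullet> x))" | i where "f = (\<lambda>x. x $ i)" by blast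
    then show "partial j f \<in> fun_algebra ?S"
    proof cases
      case 1
      have "partial j f = (\<lambda>x. poly_exp_inv (monom 1 2 * (p - pderiv p)) (1 - x \<bullet> x) * ((-2) * x $ j))"
        unfolding 1 by (rule ext, subst partial_eqI[OF der]) (simp add: inner_axis)
      also have "\<dots> \<in> fun_algebra ?S"
        by (intro fun_algebra.mult[of _ ?S] fun_algebra.const fun_algebra.base) auto
      finally show ?thesis .
    next
      case 2
      then show ?thesis by (auto simp: partial_coord intro: fun_algebra.const)
    qed
  qed (auto intro!: fun_algebra.base)
qed

definition std_bump :: "real ^ 'n \<Rightarrow> real" where
  "std_bump x = poly_exp_inv 1 (1 - x \<bullet> x)"

lemma std_bump_bumps: "std_bump \<in> bumps (cball 0 1)"
proof (rule bumpsI)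
  show "smooth std_bump" using smooth_poly_exp_inv[of 1] by (simp add: std_bump_def[abs_def])
  fix x :: "real^'a" assume "x \<notin> cball 0 1"
  then have "1 < norm x" by simp
  then have "1 < x \<bullet> x" by (simp add: dot_square_norm one_less_power)
  then show "std_bump x = 0" by (simp add: std_bump_def poly_exp_inv_def)
qed

lemma std_bump_nonneg: "std_bump x \<ge> 0"
  by (simp add: std_bump_def poly_exp_inv_def)

subsection \<open>Differentiation under the integral sign\<close>

lemma nn_integral_lborel_affine:
  fixes t :: "'a::euclidean_space"
  assumes [measurable]: "f \<in> borel_measurable borel" and c: "c \<noteq> 0"
  shows "(\<integral>\<^sup>+x. f x \<partial>lborel) = ennreal (\<bar>c\<bar> ^ DIM('a)) * (\<integral>\<^sup>+x. f (t + c *\<^sub>R x) \<partial>lborel)"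
  by (subst lborel_affine[OF c, of t])
     (simp add: nn_integral_density nn_integral_distr nn_integral_cmult)

lemma integrable_lborel_affine:
  fixes t :: "'a::euclidean_space" and f :: "'a \<Rightarrow> 'b :: {banach, second_countable_topology}"
  assumes f: "integrable lborel f" and c: "c \<noteq> 0"
  shows "integrable lborel (\<lambda>x. f (t + c *\<^sub>R x))"
  using f f[THEN borel_measurable_integrable] c unfolding integrable_iff_bounded
  by (subst (asm) nn_integral_lborel_affine[where c=c and t=t]) (auto simp: ennreal_mult_less_top)

lemma integrable_lborel_affine_iff:
  fixes t :: "'a::euclidean_space" and f :: "'a \<Rightarrow> 'b :: {banach, second_countable_topology}"
  assumes c: "c \<noteq> 0"
  shows "integrable lborel (\<lambda>x. f (t + c *\<^sub>R x)) \<longleftrightarrow> integrable lborel f"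
  using integrable_lborel_affine[of f c t] c
    integrable_lborel_affine[of "\<lambda>x. f (t + c *\<^sub>R x)" "1/c" "-(1/c) *\<^sub>R t"]
  by (auto simp: algebra_simps)

lemma integral_lborel_affine:
  fixes t :: "'a::euclidean_space" and f :: "'a \<Rightarrow> 'b :: {banach, second_countable_topology}"
  assumes c: "c \<noteq> 0"
  shows "(\<integral>x. f x \<partial>lborel) = (\<bar>c\<bar> ^ DIM('a)) *\<^sub>R (\<integral>x. f (t + c *\<^sub>R x) \<partial>lborel)"
proof cases
  assume f[measurable]: "integrable lborel f" then show ?thesis
    using c f[THEN borel_measurable_integrable] integrable_lborel_affine[OF f c, of t]
    by (subst lborel_affine[OF c, of t]) (simp add: integral_density integral_distr)
next
  assume "\<not> integrable lborel f" with c show ?thesis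
    by (simp add: integrable_lborel_affine_iff not_integrable_integral_eq)
qed

text \<open>The mean value inequality turns the bound on \<open>f'\<close> into a Lipschitz bound,
  so the normalised remainder is dominated by \<open>2 * w y\<close>. Dominated convergence works
  along sequences, hence the limit is tested on every sequence tending to 0.\<close>

lemma has_derivative_integral_dominated:
  fixes f :: "'a::euclidean_space \<Rightarrow> 'b::euclidean_space \<Rightarrow> real"
  assumes int: "\<And>x. integrable M (f x)"
    and der: "\<And>x y. ((\<lambda>x. f x y) has_derivative f' x y) (at x)"
    and meas[measurable]: "\<And>x h. (\<lambda>y. f' x y h) \<in> borel_measurable M"
    and bound: "\<And>x y h. \<bar>f' x y h\<bar> \<le> w y * norm h"
    and w: "integrable M w"
  shows "((\<lambda>x. \<integral>y. f x y \<partial>M) has_derivative (\<lambda>h. \<integral>y. f' x y h \<partial>M)) (at x)"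
proof -
  obtain b :: 'a where b: "b \<in> Basis" using nonempty_Basis by blast
  have w0: "0 \<le> w y" for y
    using order_trans[OF abs_ge_zero bound[of x y b]] b by simp
  have int': "integrable M (\<lambda>y. f' x y h)" for x h
    by (rule Bochner_Integration.integrable_bound[of _ "\<lambda>y. w y * norm h"])
      (use w bound w0 in auto)
  have lin: "linear (f' x y)" for x y using has_derivative_linear[OF der] .
  have lip: "\<bar>f (x + h) y - f x y\<bar> \<le> w y * norm h" for h y
  proof -
    have "onorm (f' x y) \<le> w y" for x using bound by (intro onorm_bound w0) auto
    then show ?thesis
      using differentiable_bound[of UNIV "\<lambda>x. f x y" "\<lambda>x. f' x y" "w y" "x + h" x] der by auto
  qed
  have bl: "bounded_linear (\<lambda>h. \<integral>y. f' x y h \<partial>M)"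
  proof (rule bounded_linear_intro[where K = "\<integral>y. w y \<partial>M"])
    show "(\<integral>y. f' x y (h + k) \<partial>M) = (\<integral>y. f' x y h \<partial>M) + (\<integral>y. f' x y k \<partial>M)" for h k
      by (simp add: linear_add[OF lin] int')
    show "(\<integral>y. f' x y (c *\<^sub>R h) \<partial>M) = c *\<^sub>R (\<integral>y. f' x y h \<partial>M)" for c h
      by (simp add: linear_cmul[OF lin])
    show "norm (\<integral>y. f' x y h \<partial>M) \<le> norm h * (\<integral>y. w y \<partial>M)" for h
    proof -
      have "norm (\<integral>y. f' x y h \<partial>M) \<le> (\<integral>y. w y * norm h \<partial>M)"
        by (rule Bochner_Integration.integral_norm_bound_integral) (use w int' bound in auto)
      then show ?thesis by (simp add: mult.commute)
    qed
  qed
  have "((\<lambda>h. norm ((\<integral>y. f (x + h) y \<partial>M) - (\<integral>y. f x y \<partial>M) - (\<integral>y. f' x y h \<partial>M)) / norm h) \<longlongrightarrow> 0) (at 0)"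
    unfolding tendsto_at_iff_sequentially
  proof (intro allI impI)
    fix X :: "nat \<Rightarrow> 'a" assume X0: "\<forall>i. X i \<in> UNIV - {0}" and X: "X \<longlonglongrightarrow> 0"
    define q where "q i y = (f (x + X i) y - f x y - f' x y (X i)) / norm (X i)" for i y
    have fm [measurable]: "f x \<in> borel_measurable M" for x using int by auto
    have "(\<lambda>i. \<integral>y. q i y \<partial>M) \<longlonglongrightarrow> (\<integral>y. 0 \<partial>M)"
    proof (rule integral_dominated_convergence[where w = "\<lambda>y. 2 * w y"])
      show "integrable M (\<lambda>y. 2 * w y)" using w by simp
      show "AE y in M. (\<lambda>i. q i y) \<longlonglongrightarrow> 0"
      proof (rule AE_I2)
        fix y
        have "((\<lambda>h. norm (f (x + h) y - f x y - f' x y h) / norm h) \<longlongrightarrow> 0) (at 0)"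
          using der[of y x] unfolding has_derivative_at by blast
        then have "(\<lambda>i. norm (f (x + X i) y - f x y - f' x y (X i)) / norm (X i)) \<longlonglongrightarrow> 0"
          using X0 X unfolding tendsto_at_iff_sequentially by (auto simp: o_def)
        then show "(\<lambda>i. q i y) \<longlonglongrightarrow> 0"
          unfolding q_def by (subst tendsto_rabs_zero_iff[symmetric]) (simp add: abs_divide)
      qed
      show "AE y in M. norm (q i y) \<le> 2 * w y" for i
      proof (rule AE_I2)
        fix y
        have "\<bar>f (x + X i) y - f x y - f' x y (X i)\<bar> \<le> 2 * w y * norm (X i)"
          using lip[of "X i" y] bound[of x y "X i"] by linarith
        then show "norm (q i y) \<le> 2 * w y"
          using X0 by (simp add: q_def abs_divide divide_le_eq)
      qed
    qed (auto simp: q_def)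
    moreover have "(\<integral>y. q i y \<partial>M) = ((\<integral>y. f (x + X i) y \<partial>M) - (\<integral>y. f x y \<partial>M) - (\<integral>y. f' x y (X i) \<partial>M)) / norm (X i)" for i
      unfolding q_def by (simp add: int int')
    ultimately have "(\<lambda>i. \<bar>((\<integral>y. f (x + X i) y \<partial>M) - (\<integral>y. f x y \<partial>M) - (\<integral>y. f' x y (X i) \<partial>M)) / norm (X i)\<bar>) \<longlonglongrightarrow> 0"
      by (intro tendsto_rabs_zero) simp
    then show "((\<lambda>h. norm ((\<integral>y. f (x + h) y \<partial>M) - (\<integral>y. f x y \<partial>M) - (\<integral>y. f' x y h \<partial>M)) / norm h) \<circ> X) \<longlonglongrightarrow> 0"
      by (simp add: o_def abs_divide)
  qed
  with bl show ?thesis unfolding has_derivative_at by blast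
qed

lemma smooth_has_derivative:
  assumes "smooth f"
  shows "(f has_derivative (\<lambda>h. \<Sum>j\<in>UNIV. partial j f x * h $ j)) (at x)"
proof -
  have d: "(f has_derivative frechet_derivative f (at x)) (at x)"
    by (rule frechet_derivative_works'[OF smooth_imp_differentiable[OF assms]])
  have "frechet_derivative f (at x) h = (\<Sum>j\<in>UNIV. partial j f x * h $ j)" for h
  proof -
    have l: "linear (frechet_derivative f (at x))" using has_derivative_linear[OF d] .
    have "frechet_derivative f (at x) h = frechet_derivative f (at x) (\<Sum>j\<in>UNIV. h $ j *\<^sub>R axis j 1)"
      by (subst basis_expansion[of h, symmetric]) (simp add: scalar_mult_eq_scaleR)
    also have "\<dots> = (\<Sum>j\<in>UNIV. h $ j *\<^sub>R frechet_derivative f (at x) (axis j 1))"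
      by (simp add: linear_sum[OF l] linear_cmul[OF l])
    finally show ?thesis by (simp add: partial_def mult.commute)
  qed
  then show ?thesis using d by (metis (no_types, lifting) ext)
qed

lemma smooth_has_derivative_chain:
  assumes "smooth f" and g: "(g has_derivative g') (at x)"
  shows "((\<lambda>x. f (g x)) has_derivative (\<lambda>h. \<Sum>j\<in>UNIV. partial j f (g x) * g' h $ j)) (at x)"
  using diff_chain_at[OF g smooth_has_derivative[OF assms(1)]] by (simp add: o_def)

lemma sum_mult_component_bound:
  fixes h :: "real ^ 'n"
  assumes "\<And>j. \<bar>p j\<bar> \<le> M"
  shows "\<bar>\<Sum>j\<in>UNIV. p j * h $ j\<bar> \<le> real CARD('n) * M * norm h"
proof -
  have "\<bar>\<Sum>j\<in>UNIV. p j * h $ j\<bar> \<le> (\<Sum>j\<in>(UNIV::'n set). M * norm h)"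
  proof (rule order_trans[OF sum_abs sum_mono])
    fix j show "\<bar>p j * h $ j\<bar> \<le> M * norm h"
      unfolding abs_mult using assms[of j] component_le_norm_cart[of h j] 
      by (intro mult_mono) auto
  qed
  then show ?thesis by simp
qed

lemma integrable_mult_bumps:
  assumes V: "integrable lborel V" and \<phi>: "\<phi> \<in> bumps K" "compact K"
  shows "integrable lborel (\<lambda>y. V y * \<phi> (c *\<^sub>R (y - x)))"
proof -
  obtain M where M: "M \<ge> 0" "\<And>x. \<bar>\<phi> x\<bar> \<le> M" using bumps_bounded[OF \<phi>] by blast
  have [measurable]: "\<phi> \<in> borel_measurable borel" by (rule smooth_borel[OF bumps_smooth[OF \<phi>(1)]])
  have [measurable]: "V \<in> borel_measurable borel" using V by auto
  show ?thesis
  proof (rule Bochner_Integration.integrable_bound[of _ "\<lambda>y. M * norm (V y)"])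
    show "AE y in lborel. norm (V y * \<phi> (c *\<^sub>R (y - x))) \<le> norm (M * norm (V y))"
      using M by (auto simp: abs_mult mult.commute[of M] intro!: mult_left_mono AE_I2)
  qed (use V in auto)
qed

lemma integrable_bumps:
  fixes \<phi> :: "real ^ 'n \<Rightarrow> real"
  assumes \<phi>: "\<phi> \<in> bumps K" "compact K"
  shows "integrable lborel \<phi>"
proof -
  have "integrable lborel (\<lambda>y. indicator K y * \<phi> (1 *\<^sub>R (y - 0)))"
    by (rule integrable_mult_bumps[OF _ \<phi>])
      (use \<phi>(2) emeasure_compact_finite[OF \<phi>(2)] in \<open>auto simp: borel_compact\<close>)
  also have "(\<lambda>y. indicator K y * \<phi> (1 *\<^sub>R (y - 0))) = \<phi>"
    using bumps_zero[OF \<phi>(1)] by (auto simp: indicator_def fun_eq_iff)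
  finally show ?thesis .
qed

lemma convolution_bumps_has_derivative:
  assumes V: "integrable lborel V" and \<phi>: "\<phi> \<in> bumps K" "compact K"
  shows "((\<lambda>x. \<integral>y. V y * \<phi> (c *\<^sub>R (y - x)) \<partial>lborel) has_derivative
    (\<lambda>h. \<integral>y. V y * (\<Sum>j\<in>UNIV. partial j \<phi> (c *\<^sub>R (y - x)) * ((- c) *\<^sub>R h) $ j) \<partial>lborel)) (at x)"
proof -
  obtain M where M: "M \<ge> 0" "\<And>js x. length js \<le> 1 \<Longrightarrow> \<bar>foldr partial js \<phi> x\<bar> \<le> M"
    using bumps_derivatives_bounded[OF \<phi>] by blast
  have M1: "\<bar>partial j \<phi> x\<bar> \<le> M" for j x using M(2)[of "[j]"] by simp
  note sm = bumps_smooth[OF \<phi>(1)]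
  have [measurable]: "partial j \<phi> \<in> borel_measurable borel" for j
    by (rule smooth_borel[OF smooth_partial[OF sm]])
  have [measurable]: "V \<in> borel_measurable borel" using V by auto
  show ?thesis
  proof (rule has_derivative_integral_dominated[where w = "\<lambda>y. \<bar>V y\<bar> * (real CARD('a) * M * \<bar>c\<bar>)"])
    show "integrable lborel (\<lambda>y. V y * \<phi> (c *\<^sub>R (y - x)))" for x
      by (rule integrable_mult_bumps[OF V \<phi>])
    show "((\<lambda>x. V y * \<phi> (c *\<^sub>R (y - x))) has_derivative
      (\<lambda>h. V y * (\<Sum>j\<in>UNIV. partial j \<phi> (c *\<^sub>R (y - x)) * ((- c) *\<^sub>R h) $ j))) (at x)" for x y
      by (intro has_derivative_mult_right smooth_has_derivative_chain sm) (auto intro!: derivative_eq_intros)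
    show "\<bar>V y * (\<Sum>j\<in>UNIV. partial j \<phi> (c *\<^sub>R (y - x)) * ((- c) *\<^sub>R h) $ j)\<bar>
      \<le> \<bar>V y\<bar> * (real CARD('a) * M * \<bar>c\<bar>) * norm h" for x y h
    proof -
      have "\<bar>\<Sum>j\<in>UNIV. partial j \<phi> (c *\<^sub>R (y - x)) * ((- c) *\<^sub>R h) $ j\<bar> \<le> real CARD('a) * M * norm ((- c) *\<^sub>R h)"
        by (rule sum_mult_component_bound[OF M1])
      then show ?thesis unfolding abs_mult by (auto simp: mult.assoc intro!: mult_left_mono)
    qed
  qed (use V in auto)
qed

lemma partial_convolution:
  assumes V: "integrable lborel V" and \<phi>: "\<phi> \<in> bumps K" "compact K"
  shows "partial j (\<lambda>x. \<integral>y. V y * \<phi> (c *\<^sub>R (y - x)) \<partial>lborel) =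
    (\<lambda>x. - c * (\<integral>y. V y * partial j \<phi> (c *\<^sub>R (y - x)) \<partial>lborel))"
proof
  fix x
  have "partial j (\<lambda>x. \<integral>y. V y * \<phi> (c *\<^sub>R (y - x)) \<partial>lborel) x =
    (\<integral>y. V y * (\<Sum>k\<in>UNIV. partial k \<phi> (c *\<^sub>R (y - x)) * ((- c) *\<^sub>R axis j 1) $ k) \<partial>lborel)"
    by (rule partial_eqI[OF convolution_bumps_has_derivative[OF assms]])
  also have "\<dots> = (\<integral>y. - c * (V y * partial j \<phi> (c *\<^sub>R (y - x))) \<partial>lborel)"
    by (intro Bochner_Integration.integral_cong refl)
      (simp add: axis_def if_distrib sum.delta mult.commute cong: if_cong)
  finally show "partial j (\<lambda>x. \<integral>y. V y * \<phi> (c *\<^sub>R (y - x)) \<partial>lborel) x =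
    - c * (\<integral>y. V y * partial j \<phi> (c *\<^sub>R (y - x)) \<partial>lborel)" by simp
qed

lemma smooth_convolution:
  assumes V: "integrable lborel V" and \<phi>: "\<phi> \<in> bumps K" "compact K"
  shows "smooth (\<lambda>x. \<integral>y. V y * \<phi> (c *\<^sub>R (y - x)) \<partial>lborel)"
proof -
  let ?I = "\<lambda>\<phi> x. \<integral>y. V y * \<phi> (c *\<^sub>R (y - x)) \<partial>lborel"
  let ?S = "{\<lambda>x. k * ?I \<phi> x | k \<phi>. \<phi> \<in> bumps K}"
  have d: "?I \<phi> differentiable (at x)" if "\<phi> \<in> bumps K" for \<phi> x
    using convolution_bumps_has_derivative[OF V that \<phi>(2)] unfolding differentiable_def by blast
  show ?thesis
  proof (rule smooth_coinduct[of _ ?S])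
    show "?I \<phi> \<in> ?S" using \<phi> by (auto intro!: exI[of _ 1])
  next
    fix f :: "real^'a \<Rightarrow> real" and x assume "f \<in> ?S"
    then obtain k \<phi> where "f = (\<lambda>x. k * ?I \<phi> x)" "\<phi> \<in> bumps K" by blast
    then show "f differentiable (at x)" using d by (auto intro!: derivative_intros)
  next
    fix f :: "real^'a \<Rightarrow> real" and j assume "f \<in> ?S"
    then obtain k \<phi> where f: "f = (\<lambda>x. k * ?I \<phi> x)" "\<phi> \<in> bumps K" by blast
    have "partial j f x = (k * (- c)) * ?I (partial j \<phi>) x" for x
      unfolding f(1) using partial_mult_at[of "\<lambda>x. k" x "?I \<phi>" j] d[OF f(2)]
      by (simp add: partial_convolution[OF V f(2) \<phi>(2)])
    then have "partial j f = (\<lambda>x. (k * (- c)) * ?I (partial j \<phi>) x)" by blast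
    then show "partial j f \<in> ?S" using bumps_partial[OF f(2) compact_imp_closed[OF \<phi>(2)]] by blast
  qed
qed

text \<open>By translation invariance the integral of \<phi>(y - x) over y does not depend on x;
  differentiating under the integral sign at x = 0 gives the claim. The indicator \<open>V\<close>
  is 1 on all supports that occur for |x| < 1 and supplies the integrable factor that
  \<open>partial_convolution\<close> expects.\<close>

lemma integral_partial_bumps_0:
  fixes \<phi> :: "real ^ 'n \<Rightarrow> real"
  assumes \<phi>: "\<phi> \<in> bumps K" "compact K"
  shows "(\<integral>y. partial j \<phi> y \<partial>lborel) = 0"
proof -
  obtain \<rho> where "\<And>y. y \<in> K \<Longrightarrow> norm y \<le> \<rho>" using compact_imp_bounded[OF \<phi>(2)] unfolding bounded_iff by blast
  then have \<rho>: "K \<subseteq> cball 0 \<rho>" by auto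
  define V :: "real^'n \<Rightarrow> real" where "V = indicator (cball 0 (\<rho> + 1))"
  have V: "integrable lborel V" unfolding V_def using emeasure_compact_finite[OF compact_cball[of "0::real^'n" "\<rho>+1"]] by auto
  define F where "F x = (\<integral>y. V y * \<phi> (1 *\<^sub>R (y - x)) \<partial>lborel)" for x
  have F: "F x = (\<integral>y. \<phi> y \<partial>lborel)" if "norm x < 1" for x
  proof -
    have "V y * \<phi> (y - x) = \<phi> (y - x)" for y
    proof (cases "y - x \<in> K")
      case True
      then have "norm (y - x) \<le> \<rho>" using \<rho> by auto
      then have "norm y \<le> \<rho> + 1" using that norm_triangle_ineq[of "y - x" x] by simp
      then show ?thesis by (simp add: V_def)
    qed (simp add: bumps_zero[OF \<phi>(1)])
    then have "F x = (\<integral>y. \<phi> (y - x) \<partial>lborel)" unfolding F_def by (intro Bochner_Integration.integral_cong) auto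
    also have "\<dots> = (\<integral>y. \<phi> y \<partial>lborel)"
      using integral_lborel_affine[of 1 \<phi> "-x"] by simp
    finally show ?thesis .
  qed
  have "(F has_derivative (\<lambda>h. 0)) (at 0)"
    by (rule has_derivative_transform_within_open[of "\<lambda>x. \<integral>y. \<phi> y \<partial>lborel" _ _ _ "ball 0 1"])
      (use F in auto)
  then have "partial j F 0 = 0" using partial_eqI by fastforce
  moreover have "partial j F 0 = - (\<integral>y. V y * partial j \<phi> y \<partial>lborel)"
    unfolding F_def[abs_def] partial_convolution[OF V \<phi>] by simp
  moreover have "V y * partial j \<phi> y = partial j \<phi> y" for y
    using bumps_zero[OF bumps_partial[OF \<phi>(1) compact_imp_closed[OF \<phi>(2)]], of y j] \<rho>
    by (cases "y \<in> K") (auto simp: V_def)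
  ultimately show ?thesis by simp
qed

text \<open>The ball with centre t b and radius 1 + t c moves from the unit ball to the ball around
  b of radius 1 + c. The bump is carried along and integrated over the time t. For m = n the weight
  preserves the integral of the bump; the exponent is a parameter because each derivative raises it
  by one.\<close>

definition path_average :: "real ^ 'n \<Rightarrow> real \<Rightarrow> nat \<Rightarrow> (real ^ 'n \<Rightarrow> real) \<Rightarrow> real ^ 'n \<Rightarrow> real" where
  "path_average b c m \<phi> y =
    (\<integral>t. indicator {0..1} t * ((1 / (1 + t * c)) ^ m * \<phi> ((1 / (1 + t * c)) *\<^sub>R (y - t *\<^sub>R b))) \<partial>lborel)"

context
  fixes b :: "real ^ 'n" and c :: real
  assumes c: "0 \<le> c"
begin

lemma path_average_bounds:
  assumes "t \<in> {0..1}"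
  shows "0 \<le> 1 / (1 + t * c)" "1 / (1 + t * c) \<le> 1"
  using assms c by (auto simp: divide_le_eq)

lemma path_average_integrable:
  assumes [measurable]: "\<phi> \<in> borel_measurable borel" and M0: "\<And>x. \<bar>\<phi> x\<bar> \<le> M"
  shows "integrable lborel (\<lambda>t. indicator {0..1} t * ((1 / (1 + t * c)) ^ m * \<phi> ((1 / (1 + t * c)) *\<^sub>R (y - t *\<^sub>R b))))"
proof -
  have ind: "integrable lborel (indicator {0..1::real} :: real \<Rightarrow> real)"
    using emeasure_compact_finite[OF compact_Icc[of "0::real" 1]] by auto
  have M: "M \<ge> 0" using M0[of 0] by linarith
  have pw: "(1 / (1 + t * c)) ^ m \<le> 1" "0 \<le> (1 / (1 + t * c)) ^ m" if "t \<in> {0..1}" for t m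
    using path_average_bounds[OF that] power_le_one zero_le_power by blast+
  show ?thesis
  proof (rule Bochner_Integration.integrable_bound[of _ "\<lambda>t. indicator {0..1} t * M"])
    show "AE t in lborel. norm (indicator {0..1} t * ((1 / (1 + t * c)) ^ m * \<phi> ((1 / (1 + t * c)) *\<^sub>R (y - t *\<^sub>R b))))
       \<le> norm (indicator {0..1} t * M)"
    proof (rule AE_I2)
      fix t :: real
      have "t \<in> {0..1} \<Longrightarrow> (1 / (1 + t * c)) ^ m * \<bar>\<phi> ((1 / (1 + t * c)) *\<^sub>R (y - t *\<^sub>R b))\<bar> \<le> 1 * M"
        using pw[of t m] M0 by (intro mult_mono) auto
      then show "norm (indicator {0..1} t * ((1 / (1 + t * c)) ^ m * \<phi> ((1 / (1 + t * c)) *\<^sub>R (y - t *\<^sub>R b))))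
       \<le> norm (indicator {0..1} t * M)"
        using pw[of t m] M by (cases "t \<in> {0..1}") (auto simp: abs_mult)
    qed
  qed (use ind in auto)
qed

lemma path_average_has_derivative:
  assumes \<phi>: "\<phi> \<in> bumps K" "compact K"
  shows "(path_average b c m \<phi> has_derivative (\<lambda>h. \<integral>t. indicator {0..1} t * ((1 / (1 + t * c)) ^ m *
     (\<Sum>j\<in>UNIV. partial j \<phi> ((1 / (1 + t * c)) *\<^sub>R (y - t *\<^sub>R b)) * ((1 / (1 + t * c)) *\<^sub>R h) $ j)) \<partial>lborel)) (at y)"
proof -
  obtain M where M: "M \<ge> 0" "\<And>js x. length js \<le> 1 \<Longrightarrow> \<bar>foldr partial js \<phi> x\<bar> \<le> M"
    using bumps_derivatives_bounded[OF \<phi>] by blast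
  have M1: "\<bar>partial j \<phi> x\<bar> \<le> M" for j x using M(2)[of "[j]"] by simp
  have M0: "\<bar>\<phi> x\<bar> \<le> M" for x using M(2)[of "[]"] by simp
  note sm = bumps_smooth[OF \<phi>(1)]
  have [measurable]: "partial j \<phi> \<in> borel_measurable borel" for j
    by (rule smooth_borel[OF smooth_partial[OF sm]])
  have [measurable]: "\<phi> \<in> borel_measurable borel" by (rule smooth_borel[OF sm])
  have ind: "integrable lborel (indicator {0..1::real} :: real \<Rightarrow> real)"
    using emeasure_compact_finite[OF compact_Icc[of "0::real" 1]] by auto
  have pw: "(1 / (1 + t * c)) ^ m \<le> 1" "0 \<le> (1 / (1 + t * c)) ^ m" if "t \<in> {0..1}" for t m
    using path_average_bounds[OF that] power_le_one zero_le_power by blast+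
  show ?thesis unfolding path_average_def[abs_def]
  proof (rule has_derivative_integral_dominated[where w = "\<lambda>t. indicator {0..1} t * (real CARD('n) * M)"])
    show "integrable lborel (\<lambda>t. indicator {0..1} t * ((1 / (1 + t * c)) ^ m * \<phi> ((1 / (1 + t * c)) *\<^sub>R (y - t *\<^sub>R b))))" for y
      by (rule path_average_integrable[OF _ M0]) measurable
    show "((\<lambda>y. indicator {0..1} t * ((1 / (1 + t * c)) ^ m * \<phi> ((1 / (1 + t * c)) *\<^sub>R (y - t *\<^sub>R b)))) has_derivative
      (\<lambda>h. indicator {0..1} t * ((1 / (1 + t * c)) ^ m *
     (\<Sum>j\<in>UNIV. partial j \<phi> ((1 / (1 + t * c)) *\<^sub>R (y - t *\<^sub>R b)) * ((1 / (1 + t * c)) *\<^sub>R h) $ j)))) (at y)" for y t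
      by (intro has_derivative_mult_right smooth_has_derivative_chain sm) (auto intro!: derivative_eq_intros)
    show "\<bar>indicator {0..1} t * ((1 / (1 + t * c)) ^ m *
     (\<Sum>j\<in>UNIV. partial j \<phi> ((1 / (1 + t * c)) *\<^sub>R (y - t *\<^sub>R b)) * ((1 / (1 + t * c)) *\<^sub>R h) $ j))\<bar>
      \<le> indicator {0..1} t * (real CARD('n) * M) * norm h" for y t h
    proof (cases "t \<in> {0..1}")
      case True
      let ?s = "1 / (1 + t * c)"
      have "\<bar>\<Sum>j\<in>UNIV. partial j \<phi> (?s *\<^sub>R (y - t *\<^sub>R b)) * (?s *\<^sub>R h) $ j\<bar>
        \<le> real CARD('n) * M * norm (?s *\<^sub>R h)"
        by (rule sum_mult_component_bound[OF M1])
      also have "\<dots> \<le> real CARD('n) * M * norm h"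
        unfolding norm_scaleR using path_average_bounds[OF True] M(1)
        by (intro mult_left_mono mult_left_le_one_le) auto
      finally have "?s ^ m * \<bar>\<Sum>j\<in>UNIV. partial j \<phi> (?s *\<^sub>R (y - t *\<^sub>R b)) * (?s *\<^sub>R h) $ j\<bar>
        \<le> 1 * (real CARD('n) * M * norm h)"
        by (intro mult_mono pw[OF True]) auto
      then show ?thesis using True pw(2)[OF True, of m] by (simp add: abs_mult)
    qed simp
  qed (use ind in auto)
qed

lemma partial_path_average:
  assumes \<phi>: "\<phi> \<in> bumps K" "compact K"
  shows "partial j (path_average b c m \<phi>) = path_average b c (Suc m) (partial j \<phi>)"
proof
  fix y
  show "partial j (path_average b c m \<phi>) y = path_average b c (Suc m) (partial j \<phi>) y"
    unfolding partial_eqI[OF path_average_has_derivative[OF assms]] path_average_def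
    by (intro Bochner_Integration.integral_cong refl)
      (simp add: axis_def if_distrib sum.delta mult.commute cong: if_cong)
qed

lemma smooth_path_average:
  assumes \<phi>: "\<phi> \<in> bumps K" "compact K"
  shows "smooth (path_average b c m \<phi>)"
proof (rule smooth_coinduct[of _ "{path_average b c m \<phi> | m \<phi>. \<phi> \<in> bumps K}"])
  show "path_average b c m \<phi> \<in> {path_average b c m \<phi> | m \<phi>. \<phi> \<in> bumps K}" using \<phi> by blast
  show "f differentiable (at x)" if "f \<in> {path_average b c m \<phi> | m \<phi>. \<phi> \<in> bumps K}" for f x
    using that path_average_has_derivative[OF _ \<phi>(2)] unfolding differentiable_def by blast
  show "partial j f \<in> {path_average b c m \<phi> | m \<phi>. \<phi> \<in> bumps K}"
    if "f \<in> {path_average b c m \<phi> | m \<phi>. \<phi> \<in> bumps K}" for f j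
    using that partial_path_average[OF _ \<phi>(2)] bumps_partial[OF _ compact_imp_closed[OF \<phi>(2)]] by fastforce
qed

lemma foldr_partial_path_average:
  assumes \<phi>: "\<phi> \<in> bumps K" "compact K"
  shows "foldr partial js (path_average b c m \<phi>) = path_average b c (length js + m) (foldr partial js \<phi>)"
  by (induction js)
    (auto simp: partial_path_average[OF bumps_foldr_partial[OF \<phi>(1) compact_imp_closed[OF \<phi>(2)]] \<phi>(2)])

text \<open>Since c \<ge> 0, the weights are at most 1 and the time interval has length 1. The bound
  is therefore uniform in \<open>b\<close>, \<open>c\<close> and \<open>m\<close>, which later
  yields one constant for all pairs of comparable balls.\<close>

lemma path_average_le:
  assumes meas: "\<phi> \<in> borel_measurable borel" and bd: "\<And>x. \<bar>\<phi> x\<bar> \<le> M"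
  shows "\<bar>path_average b c m \<phi> y\<bar> \<le> M"
proof -
  have ind: "integrable lborel (indicator {0..1::real} :: real \<Rightarrow> real)"
    using emeasure_compact_finite[OF compact_Icc[of "0::real" 1]] by auto
  have "M \<ge> 0" using bd[of 0] by linarith
  have pw: "(1 / (1 + t * c)) ^ m \<le> 1" "0 \<le> (1 / (1 + t * c)) ^ m" if "t \<in> {0..1}" for t
    using path_average_bounds[OF that] power_le_one zero_le_power by blast+
  have "norm (path_average b c m \<phi> y) \<le> (\<integral>t. indicator {0..1::real} t * M \<partial>lborel)"
    unfolding path_average_def
  proof (rule Bochner_Integration.integral_norm_bound_integral)
    show "integrable lborel (\<lambda>t. indicator {0..1::real} t * M)" using ind by simp
    fix t :: real
    have "t \<in> {0..1} \<Longrightarrow> (1 / (1 + t * c)) ^ m * \<bar>\<phi> ((1 / (1 + t * c)) *\<^sub>R (y - t *\<^sub>R b))\<bar> \<le> 1 * M"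
      using pw[of t] bd by (intro mult_mono) auto
    then show "norm (indicator {0..1} t * ((1 / (1 + t * c)) ^ m * \<phi> ((1 / (1 + t * c)) *\<^sub>R (y - t *\<^sub>R b))))
         \<le> indicator {0..1} t * M"
      using pw[of t] by (cases "t \<in> {0..1}") (auto simp: abs_mult)
    show "integrable lborel (\<lambda>t. indicator {0..1} t * ((1 / (1 + t * c)) ^ m * \<phi> ((1 / (1 + t * c)) *\<^sub>R (y - t *\<^sub>R b))))"
      by (rule path_average_integrable[OF meas bd])
  qed
  then show ?thesis by simp
qed

end

subsection \<open>Third derivatives and the trace-free symmetric part\<close>

definition trace_free_sym :: "real ^ 'n ^ 'n \<Rightarrow> real ^ 'n ^ 'n" where
  "trace_free_sym A = (1/2) *\<^sub>R (A + transpose A) - (trace A / real CARD('n)) *\<^sub>R mat 1"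

lemma trace_free_sym_component:
  "trace_free_sym (A :: real ^ 'n ^ 'n) $ i $ j =
    (A $ i $ j + A $ j $ i) / 2 - (if i = j then (\<Sum>m\<in>UNIV. A $ m $ m) / real CARD('n) else 0)"
  by (simp add: trace_free_sym_def transpose_def mat_def trace_def field_simps)

lemma linear_trace_free_sym: "linear trace_free_sym"
  by (rule linearI)
    (auto simp: vec_eq_iff trace_free_sym_component sum.distrib sum_distrib_left[symmetric] field_simps)

lemma bounded_linear_trace_free_sym: "bounded_linear trace_free_sym"
  using linear_trace_free_sym linear_conv_bounded_linear by blast

lemma trace_free_sym_scaleR: "trace_free_sym (c *\<^sub>R A) = c *\<^sub>R trace_free_sym A"
  by (rule linear_cmul[OF linear_trace_free_sym])

lemma trace_free_sym_borel [measurable]: "trace_free_sym \<in> borel_measurable borel"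
  by (intro borel_measurable_continuous_onI linear_continuous_on bounded_linear_trace_free_sym)

lemma matrix_component_le_norm: "\<bar>(A :: real ^ 'n ^ 'm) $ i $ j\<bar> \<le> norm A"
  using component_le_norm_cart[of "A $ i" j] Finite_Cartesian_Product.norm_nth_le[of A i] by linarith

text \<open>The tensor \<open>A\<close> plays the role of the third derivatives of \<open>v\<close>.  The Saint-Venant identities
  eliminate the trace \<open>\<sigma>\<close>; this is the only place where \<open>n \<ge> 3\<close> is used.\<close>

lemma third_derivative_tensor_bound:
  fixes A :: "'n::finite \<Rightarrow> 'n \<Rightarrow> 'n \<Rightarrow> 'n \<Rightarrow> real"
  assumes n: "CARD('n) \<ge> 3"
    and s1: "\<And>i j k l. A i j k l = A i k j l"
    and s2: "\<And>i j k l. A i j k l = A i j l k"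
    and B: "\<And>a b c d. \<bar>(A a b c d + A b a c d) / 2 - (if a = b then \<sigma> c d else 0)\<bar> \<le> M"
  shows "\<bar>A i j k l\<bar> \<le> 21 * M"
proof -
  \<comment> \<open>If A i j k l is the derivative of v_i in the directions j, k, l, then E a b c d
    is the second derivative in the directions c, d of the strain component (a, b), and in the
    application \<sigma> is the Hessian of div v / n.\<close>
  define E where "E = (\<lambda>a b c d. (A a b c d + A b a c d) / 2)"
  have B1: "\<bar>E a b c d\<bar> \<le> M" if "a \<noteq> b" for a b c d
    using B[of a b c d] that by (simp add: E_def)
  have B2: "\<bar>E a a c d - \<sigma> c d\<bar> \<le> M" for a c d
    using B[of a a c d] by (simp add: E_def)
  have M: "M \<ge> 0" using B2[of undefined undefined undefined] by linarith
  have SV: "E i i c d + E c d i i - E i c i d - E i d i c = 0" for i c d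
  proof -
    have "A i c i d = A i i c d" "A i d i c = A i i c d" "A c i i d = A c d i i" "A d i i c = A d c i i"
      using s1[of i c i d] s1[of i d i c] s2[of i i d c] s2[of c i i d] s1[of c i d i] s2[of d i i c] s1[of d i c i]
      by metis+
    then show ?thesis unfolding E_def by (simp add: field_simps)
  qed
  have pick: "\<exists>m. m \<notin> {p, q}" for p q :: 'n
  proof (rule ccontr)
    assume "\<nexists>m. m \<notin> {p, q}"
    then have "(UNIV :: 'n set) = {p, q}" by auto
    then have "CARD('n) \<le> card {p, q}" by simp
    also have "\<dots> \<le> 2" by (simp add: card_insert_if)
    finally show False using n by simp
  qed
  \<comment> \<open>With i different from both c and d, three of the four terms of the compatibility
    identity are off-diagonal and bounded by M; the fourth differs from \<sigma> c d by at most
    M.\<close>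
  have off: "\<bar>\<sigma> c d\<bar> \<le> 4 * M" if "c \<noteq> d" for c d
  proof -
    obtain i where "i \<noteq> c" "i \<noteq> d" using pick[of c d] by auto
    then show ?thesis using SV[of i c d] B2[of i c d] B1[of c d i i] B1[of i c i d] B1[of i d i c] that
      by (simp add: abs_le_iff)
  qed
  have pair: "\<bar>\<sigma> c c + \<sigma> d d\<bar> \<le> 4 * M" if "c \<noteq> d" for c d
    using SV[of c d d] B2[of c d d] B2[of d c c] B1[of c d c d] that by (simp add: abs_le_iff)
  \<comment> \<open>For three distinct indices, 2 \<sigma>_cc = (\<sigma>_cc + \<sigma>_ii) +
    (\<sigma>_cc + \<sigma>_mm) - (\<sigma>_ii + \<sigma>_mm).\<close>
  have diag: "\<bar>\<sigma> c c\<bar> \<le> 6 * M" for c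
  proof -
    obtain i where i: "i \<noteq> c" using pick[of c c] by auto
    obtain m where "m \<noteq> c" "m \<noteq> i" using pick[of c i] by auto
    then show ?thesis using pair[of c i] pair[of c m] pair[of i m] i by (simp add: abs_le_iff)
  qed
  have \<sigma>: "\<bar>\<sigma> c d\<bar> \<le> 6 * M" for c d using off[of c d] diag[of c] M by (cases "c = d") auto
  have E: "\<bar>E a b c d\<bar> \<le> 7 * M" for a b c d
    using B1[of a b c d] B2[of a c d] \<sigma>[of c d] M by (cases "a = b") (auto simp: abs_le_iff)
  \<comment> \<open>The formula for second derivatives of v in terms of first derivatives of the
    strain, differentiated once more. Three terms of size 7 M give the constant 21.\<close>
  have "A i j k l = E i j k l + E i k j l - E j k i l"
    unfolding E_def using s1[of i k j l] s1[of j i k l] s1[of k i j l] by (simp add: field_simps)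
  then show ?thesis using E[of i j k l] E[of i k j l] E[of j k i l] by (simp add: abs_le_iff)
qed

text \<open>Only the identity of integration by parts is local to \<open>U\<close>; both fields are
  integrable on the whole space, in the application as extensions by zero. Integrals then carry no
  restriction to \<open>U\<close>, and passing to another ball is an affine change of
  variables.\<close>

definition weak_pair :: "(real ^ 'n) set \<Rightarrow> (real ^ 'n \<Rightarrow> real ^ 'n) \<Rightarrow> (real ^ 'n \<Rightarrow> real ^ 'n ^ 'n) \<Rightarrow> bool" where
  "weak_pair U V G \<longleftrightarrow> open U \<and> integrable lborel V \<and> integrable lborel G \<and>
    (\<forall>K \<phi> i j. compact K \<longrightarrow> K \<subseteq> U \<longrightarrow> \<phi> \<in> bumps K \<longrightarrow>
      (\<integral>x. V x $ i * partial j \<phi> x \<partial>lborel) = - (\<integral>x. G x $ i $ j * \<phi> x \<partial>lborel))"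

lemma weak_pairD:
  assumes "weak_pair U V G"
  shows "open U" "integrable lborel V" "integrable lborel G"
    "integrable lborel (\<lambda>x. V x $ i)" "integrable lborel (\<lambda>x. G x $ i $ j)"
    and "compact K \<Longrightarrow> K \<subseteq> U \<Longrightarrow> \<phi> \<in> bumps K \<Longrightarrow>
      (\<integral>x. V x $ i * partial j \<phi> x \<partial>lborel) = - (\<integral>x. G x $ i $ j * \<phi> x \<partial>lborel)"
proof -
  show V: "integrable lborel V" and G: "integrable lborel G" and "open U"
    using assms by (auto simp: weak_pair_def)
  show "integrable lborel (\<lambda>x. V x $ i)"
    by (rule integrable_bounded_linear[OF bounded_linear_vec_nth V])
  show "integrable lborel (\<lambda>x. G x $ i $ j)"
    by (intro integrable_bounded_linear[OF bounded_linear_vec_nth] G)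
  show "compact K \<Longrightarrow> K \<subseteq> U \<Longrightarrow> \<phi> \<in> bumps K \<Longrightarrow>
      (\<integral>x. V x $ i * partial j \<phi> x \<partial>lborel) = - (\<integral>x. G x $ i $ j * \<phi> x \<partial>lborel)"
    using assms by (auto simp: weak_pair_def)
qed

lemma integrable_mult_bumps':
  "integrable lborel V \<Longrightarrow> \<phi> \<in> bumps K \<Longrightarrow> compact K \<Longrightarrow> integrable lborel (\<lambda>y. V y * \<phi> y)"
  using integrable_mult_bumps[of V \<phi> K 1 0] by simp

abbreviation L1_trace_free_sym :: "(real ^ 'n) set \<Rightarrow> (real ^ 'n \<Rightarrow> real ^ 'n ^ 'n) \<Rightarrow> real" where
  "L1_trace_free_sym U G \<equiv> (\<integral>x. indicator U x * norm (trace_free_sym (G x)) \<partial>lborel)"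

lemma integrable_indicator_trace_free_sym:
  assumes "integrable lborel G" "open U"
  shows "integrable lborel (\<lambda>x. indicator U x * norm (trace_free_sym (G x)))"
proof -
  have "integrable lborel (\<lambda>x. norm (trace_free_sym (G x)))"
    by (intro integrable_norm integrable_bounded_linear[OF bounded_linear_trace_free_sym] assms)
  from integrable_mult_indicator[OF _ this, of U] show ?thesis using assms(2) by simp
qed

text \<open>The integrals of G_ij against the second derivatives of \<psi> have the symmetries of
  the third derivatives of v, although only G exists: to exchange j and k, one derivative is moved
  to V and another one back. \<open>third_derivative_tensor_bound\<close> then reduces all of them
  to pairings with the trace-free symmetric part of G.\<close>

lemma weak_pair_second_derivatives:
  fixes V :: "real ^ 'n \<Rightarrow> real ^ 'n"
  assumes n: "CARD('n) \<ge> 3" and wp: "weak_pair U V G"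
    and K: "compact K" "K \<subseteq> U" and \<psi>: "\<psi> \<in> bumps K"
    and M: "\<And>c d x. \<bar>partial c (partial d \<psi>) x\<bar> \<le> M"
  shows "\<bar>\<integral>x. G x $ i $ j * partial k (partial l \<psi>) x \<partial>lborel\<bar> \<le> 21 * (M * L1_trace_free_sym U G)"
proof -
  note D = weak_pairD[OF wp]
  have Kc: "closed K" using K compact_imp_closed by blast
  note bp = bumps_partial[OF _ Kc]
  have int: "integrable lborel (\<lambda>x. G x $ i $ j * partial k (partial l \<psi>) x)" for i j k l
    by (intro integrable_mult_bumps'[OF D(5) _ K(1)] bp \<psi>)
  have int': "integrable lborel (\<lambda>x. partial k (partial l \<psi>) x * G x $ i $ j)" for i j k l
    using int[of i j k l] by (simp only: mult.commute)
  define A where "A = (\<lambda>i j k l. \<integral>x. G x $ i $ j * partial k (partial l \<psi>) x \<partial>lborel)"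
  define \<sigma> where "\<sigma> = (\<lambda>k l. (\<Sum>m\<in>UNIV. A m m k l) / real CARD('n))"
  have swap: "(\<integral>x. G x $ i $ j * partial k \<phi> x \<partial>lborel) = (\<integral>x. G x $ i $ k * partial j \<phi> x \<partial>lborel)"
    if "\<phi> \<in> bumps K" for \<phi> i j k
    using D(6)[OF K bp[OF that, of k], of i j] D(6)[OF K bp[OF that, of j], of i k]
      partial_commute[OF bumps_smooth[OF that], of j k] by simp
  have "\<bar>A i j k l\<bar> \<le> 21 * (M * L1_trace_free_sym U G)"
  proof (rule third_derivative_tensor_bound[OF n, of A \<sigma>])
    show "A i j k l = A i k j l" for i j k l
      unfolding A_def using swap[OF bp[OF \<psi>]] by simp
    show "A i j k l = A i j l k" for i j k l
      unfolding A_def by (simp add: partial_commute[OF bumps_smooth[OF \<psi>], of k l])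
    fix a b c d
    have "(A a b c d + A b a c d) / 2 - (if a = b then \<sigma> c d else 0) =
      (\<integral>x. trace_free_sym (G x) $ a $ b * partial c (partial d \<psi>) x \<partial>lborel)"
    proof -
      have "(\<integral>x. trace_free_sym (G x) $ a $ b * partial c (partial d \<psi>) x \<partial>lborel) =
        (\<integral>x. (G x $ a $ b * partial c (partial d \<psi>) x) / 2 + (G x $ b $ a * partial c (partial d \<psi>) x) / 2
          - (if a = b then (\<Sum>m\<in>UNIV. G x $ m $ m * partial c (partial d \<psi>) x) / real CARD('n) else 0) \<partial>lborel)"
        by (intro Bochner_Integration.integral_cong refl)
          (simp add: trace_free_sym_component algebra_simps sum_distrib_left add_divide_distrib)
      also have "\<dots> = A a b c d / 2 + A b a c d / 2 - (if a = b then \<sigma> c d else 0)"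
        unfolding A_def \<sigma>_def by (cases "a = b") (simp_all add: int int' mult.commute[of _ "partial c (partial d \<psi>) _"])
      finally show ?thesis by simp
    qed
    also have "\<bar>\<dots>\<bar> \<le> (\<integral>x. M * (indicator U x * norm (trace_free_sym (G x))) \<partial>lborel)"
    proof (rule order_trans[OF integral_abs_bound], rule integral_mono')
      show "integrable lborel (\<lambda>x. M * (indicator U x * norm (trace_free_sym (G x))))"
        using integrable_indicator_trace_free_sym[OF D(3,1)] by simp
      have M0: "M \<ge> 0" using order_trans[OF abs_ge_zero M] .
      fix x
      show "\<bar>trace_free_sym (G x) $ a $ b * partial c (partial d \<psi>) x\<bar> \<le> M * (indicator U x * norm (trace_free_sym (G x)))"
      proof (cases "x \<in> K")
        case True
        then show ?thesis using K(2) M[of c d x] matrix_component_le_norm[of "trace_free_sym (G x)" a b] M0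
          by (auto simp: abs_mult mult.commute[of M] intro!: mult_mono)
      next
        case False
        then have "partial c (partial d \<psi>) x = 0" using bumps_zero[OF bp[OF bp[OF \<psi>]]] by blast
        then show ?thesis using M0 by simp
      qed
    qed (use order_trans[OF abs_ge_zero M] in simp)
    finally show "\<bar>(A a b c d + A b a c d) / 2 - (if a = b then \<sigma> c d else 0)\<bar> \<le> M * L1_trace_free_sym U G"
      by simp
  qed
  then show ?thesis unfolding A_def .
qed

text \<open>The factor \<open>r\<close> in front of G is the chain rule. Constants found on balls
  around 0 of fixed radius are transported to all balls by this lemma.\<close>

lemma weak_pair_rescale:
  fixes V :: "real ^ 'n \<Rightarrow> real ^ 'n"
  assumes wp: "weak_pair U V G" and r: "r > 0" and U': "open U'" "\<And>y. y \<in> U' \<Longrightarrow> z + r *\<^sub>R y \<in> U"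
  shows "weak_pair U' (\<lambda>y. V (z + r *\<^sub>R y)) (\<lambda>y. r *\<^sub>R G (z + r *\<^sub>R y))"
  unfolding weak_pair_def
proof (intro conjI allI impI)
  show "open U'" by fact
  show "integrable lborel (\<lambda>y. V (z + r *\<^sub>R y))"
    using integrable_lborel_affine[OF weak_pairD(2)[OF wp]] r by simp
  show "integrable lborel (\<lambda>y. r *\<^sub>R G (z + r *\<^sub>R y))"
    using integrable_lborel_affine[OF weak_pairD(3)[OF wp]] r by simp
  fix K \<phi> i j assume K: "compact K" "K \<subseteq> U'" and \<phi>: "\<phi> \<in> bumps K"
  define \<phi>' where "\<phi>' = (\<lambda>x. \<phi> ((1 / r) *\<^sub>R (x - z)))"
  let ?K = "(\<lambda>y. z + r *\<^sub>R y) ` K"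
  have K': "compact ?K" by (intro compact_continuous_image K continuous_intros)
  have KU: "?K \<subseteq> U" using K U' by auto
  have \<phi>': "\<phi>' \<in> bumps ?K"
  proof (rule bumpsI)
    show "smooth \<phi>'" unfolding \<phi>'_def by (intro smooth_affine bumps_smooth[OF \<phi>])
    fix x assume "x \<notin> ?K"
    moreover have "x = z + r *\<^sub>R ((1 / r) *\<^sub>R (x - z))" using r by simp
    ultimately have "(1 / r) *\<^sub>R (x - z) \<notin> K" by blast
    then show "\<phi>' x = 0" unfolding \<phi>'_def using bumps_zero[OF \<phi>] by blast
  qed
  have p: "partial j \<phi>' = (\<lambda>x. (1 / r) * partial j \<phi> ((1 / r) *\<^sub>R (x - z)))"
    unfolding \<phi>'_def by (rule partial_affine[OF bumps_smooth[OF \<phi>]])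
  have "(\<integral>x. V x $ i * partial j \<phi>' x \<partial>lborel) = - (\<integral>x. G x $ i $ j * \<phi>' x \<partial>lborel)"
    by (rule weak_pairD(6)[OF wp K' KU \<phi>'])
  also have "(\<integral>x. V x $ i * partial j \<phi>' x \<partial>lborel) =
      r ^ CARD('n) * (\<integral>y. V (z + r *\<^sub>R y) $ i * ((1 / r) * partial j \<phi> y) \<partial>lborel)"
    using r by (subst integral_lborel_affine[of r _ z]) (auto simp: p)
  also have "(\<integral>x. G x $ i $ j * \<phi>' x \<partial>lborel) = r ^ CARD('n) * (\<integral>y. G (z + r *\<^sub>R y) $ i $ j * \<phi> y \<partial>lborel)"
    using r by (subst integral_lborel_affine[of r _ z]) (auto simp: \<phi>'_def)
  finally have "r ^ CARD('n) * (\<integral>y. V (z + r *\<^sub>R y) $ i * ((1 / r) * partial j \<phi> y) \<partial>lborel) =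
    r ^ CARD('n) * (- (\<integral>y. G (z + r *\<^sub>R y) $ i $ j * \<phi> y \<partial>lborel))" by simp
  then have "(\<integral>y. V (z + r *\<^sub>R y) $ i * ((1 / r) * partial j \<phi> y) \<partial>lborel) =
    - (\<integral>y. G (z + r *\<^sub>R y) $ i $ j * \<phi> y \<partial>lborel)"
    using r by (simp only: mult_cancel_left) auto
  then have "(\<integral>y. (1 / r) * (V (z + r *\<^sub>R y) $ i * partial j \<phi> y) \<partial>lborel) = - (\<integral>y. G (z + r *\<^sub>R y) $ i $ j * \<phi> y \<partial>lborel)"
    by (simp only: mult.left_commute)
  then have "(\<integral>y. (V (z + r *\<^sub>R y) $ i * partial j \<phi> y) \<partial>lborel) = - (r * (\<integral>y. G (z + r *\<^sub>R y) $ i $ j * \<phi> y \<partial>lborel))"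
    using r by (simp add: field_simps)
  then show "(\<integral>x. V (z + r *\<^sub>R x) $ i * partial j \<phi> x \<partial>lborel) = - (\<integral>x. (r *\<^sub>R G (z + r *\<^sub>R x)) $ i $ j * \<phi> x \<partial>lborel)"
    by (simp add: mult.assoc)
qed

text \<open>The formal adjoint of the map that takes the second-order Taylor polynomial at y and
  evaluates it at \<open>a\<close>: for smooth f, integrating f against
  \<open>kernel_op a \<psi>\<close> gives the \<psi>-weighted mean over y of f(y) + \<Sum> (a_i -
  y_i) D_i f(y) + 1/2 \<Sum> (a_i - y_i) (a_j - y_j) D_i D_j f(y). In the adjoint form f need only
  be integrable.\<close>

definition kernel_op :: "real ^ 'n \<Rightarrow> (real ^ 'n \<Rightarrow> real) \<Rightarrow> real ^ 'n \<Rightarrow> real" where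
  "kernel_op a \<psi> y = \<psi> y - (\<Sum>i\<in>UNIV. partial i (\<lambda>y. (a $ i - y $ i) * \<psi> y) y)
     + (\<Sum>i\<in>UNIV. \<Sum>j\<in>UNIV. partial i (partial j (\<lambda>y. (a $ i - y $ i) * ((a $ j - y $ j) * \<psi> y))) y) / 2"

lemma smooth_dist_coord: "smooth (\<lambda>y. a - y $ i)"
  by (intro smooth_diff smooth_const smooth_coord)

lemma partial_dist_coord: "partial j (\<lambda>y. a - y $ i) = (\<lambda>y. if i = j then -1 else 0)"
  by (subst partial_diff) (auto simp: smooth_const smooth_coord partial_coord)

lemma kernel_op_bumps:
  assumes "\<psi> \<in> bumps K" "closed K" shows "kernel_op a \<psi> \<in> bumps K"
proof -
  have "(\<lambda>y. \<psi> y - (\<Sum>i\<in>UNIV. partial i (\<lambda>y. (a $ i - y $ i) * \<psi> y) y)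
     + (1/2) * (\<Sum>i\<in>UNIV. \<Sum>j\<in>UNIV. partial i (partial j (\<lambda>y. (a $ i - y $ i) * ((a $ j - y $ j) * \<psi> y))) y)) \<in> bumps K"
    by (intro bumps_add bumps_diff bumps_cmult bumps_sum bumps_partial bumps_mult_right smooth_dist_coord assms)
  then show ?thesis by (simp add: kernel_op_def[abs_def])
qed

lemma kernel_op_diff:
  assumes f: "smooth f" and g: "smooth g"
  shows "kernel_op a (\<lambda>y. f y - g y) y = kernel_op a f y - kernel_op a g y"
proof -
  have 1: "(\<lambda>y. (a $ i - y $ i) * (f y - g y)) = (\<lambda>y. (a $ i - y $ i) * f y - (a $ i - y $ i) * g y)" for i
    by (simp add: algebra_simps)
  have 2: "(\<lambda>y. (a $ i - y $ i) * ((a $ j - y $ j) * (f y - g y))) =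
     (\<lambda>y. (a $ i - y $ i) * ((a $ j - y $ j) * f y) - (a $ i - y $ i) * ((a $ j - y $ j) * g y))" for i j
    by (simp add: algebra_simps)
  note sm = smooth_mult[OF smooth_dist_coord]
  show ?thesis unfolding kernel_op_def 1 2
    by (simp add: partial_diff sm f g smooth_partial sum_subtractf diff_divide_distrib)
qed

text \<open>In each term there are as many derivatives as coordinate differences; every derivative
  brings a factor c and every difference a factor 1/c. Averaged Taylor polynomials are thus
  covariant under translations and dilations.\<close>

lemma kernel_op_affine:
  assumes f: "smooth f" and c: "c \<noteq> 0"
  shows "kernel_op a (\<lambda>y. f (c *\<^sub>R (y - b))) y = kernel_op (c *\<^sub>R (a - b)) f (c *\<^sub>R (y - b))"
proof -
  let ?X = "\<lambda>i y. (c *\<^sub>R (a - b)) $ i - y $ i"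
  note sm = smooth_mult[OF smooth_dist_coord]
  have e: "a $ i - y $ i = (1 / c) * ?X i (c *\<^sub>R (y - b))" for i y using c by (simp add: field_simps)
  have 1: "partial i (\<lambda>y. (a $ i - y $ i) * f (c *\<^sub>R (y - b))) y =
      partial i (\<lambda>u. ?X i u * f u) (c *\<^sub>R (y - b))" for i y
  proof -
    have "(\<lambda>y. (a $ i - y $ i) * f (c *\<^sub>R (y - b))) =
      (\<lambda>y. (1 / c) * (\<lambda>u. ?X i u * f u) (c *\<^sub>R (y - b)))" unfolding e by (simp add: mult.assoc)
    then show ?thesis
      using c partial_cmult[OF smooth_affine[OF sm[OF f]], of i "1/c"]
        partial_affine[OF sm[OF f], of i] by simp
  qed
  have 2: "partial i (partial j (\<lambda>y. (a $ i - y $ i) * ((a $ j - y $ j) * f (c *\<^sub>R (y - b))))) y =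
      partial i (partial j (\<lambda>u. ?X i u * (?X j u * f u))) (c *\<^sub>R (y - b))" for i j y
  proof -
    let ?F = "\<lambda>u. ?X i u * (?X j u * f u)"
    have s: "smooth ?F" by (intro sm f)
    have "(\<lambda>y. (a $ i - y $ i) * ((a $ j - y $ j) * f (c *\<^sub>R (y - b)))) =
      (\<lambda>y. (1 / c\<^sup>2) * ?F (c *\<^sub>R (y - b)))" unfolding e by (simp add: power2_eq_square field_simps)
    moreover have "partial i (partial j (\<lambda>y. (1 / c\<^sup>2) * ?F (c *\<^sub>R (y - b)))) =
      (\<lambda>y. partial i (partial j ?F) (c *\<^sub>R (y - b)))"
    proof -
      have "partial j (\<lambda>y. (1 / c\<^sup>2) * ?F (c *\<^sub>R (y - b))) = (\<lambda>y. (1 / c\<^sup>2) * (c * partial j ?F (c *\<^sub>R (y - b))))"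
        by (subst partial_cmult[OF smooth_affine[OF s]], subst partial_affine[OF s]) (rule refl)
      also have "\<dots> = (\<lambda>y. (1 / c) * partial j ?F (c *\<^sub>R (y - b)))" using c by (simp add: power2_eq_square)
      finally have "partial i (partial j (\<lambda>y. (1 / c\<^sup>2) * ?F (c *\<^sub>R (y - b)))) =
        partial i (\<lambda>y. (1 / c) * partial j ?F (c *\<^sub>R (y - b)))" by simp
      also have "\<dots> = (\<lambda>y. (1 / c) * (c * partial i (partial j ?F) (c *\<^sub>R (y - b))))"
        by (subst partial_cmult[OF smooth_affine[OF smooth_partial[OF s]]], subst partial_affine[OF smooth_partial[OF s]]) (rule refl)
      finally show ?thesis using c by simp
    qed
    ultimately show ?thesis by simp
  qed
  show ?thesis unfolding kernel_op_def 1 2 ..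
qed

text \<open>The terms of lower order telescope, so that only third derivatives are left.\<close>

lemma kernel_op_divergence:
  assumes F: "\<And>k. smooth (F k)"
  shows "kernel_op a (\<lambda>y. \<Sum>k\<in>UNIV. partial k (F k) y) y =
    (\<Sum>i\<in>UNIV. \<Sum>j\<in>UNIV. \<Sum>k\<in>UNIV.
      partial i (partial j (partial k (\<lambda>y. (a $ i - y $ i) * ((a $ j - y $ j) * F k y)))) y) / 2"
proof -
  let ?X = "\<lambda>i y. a $ i - y $ i"
  let ?S = "\<lambda>y. \<Sum>k\<in>UNIV. partial k (F k) y"
  note smX = smooth_mult[OF smooth_dist_coord]
  note sm = smooth_mult smooth_dist_coord smooth_partial smooth_sum smooth_add F
  \<comment> \<open>Pulling the coordinate difference under the derivative costs its own derivative,
    which is -1 for k = i; this is the origin of the extra \<open>F i y\<close>.\<close>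
  have 1: "(\<lambda>y. ?X i y * ?S y) = (\<lambda>y. (\<Sum>k\<in>UNIV. partial k (\<lambda>y. ?X i y * F k y) y) + F i y)" for i
  proof
    fix y
    have "partial k (\<lambda>y. ?X i y * F k y) y = (if i = k then - F k y else 0) + ?X i y * partial k (F k) y" for k
      by (subst partial_mult) (auto simp: smooth_dist_coord F partial_dist_coord)
    then show "?X i y * ?S y = (\<Sum>k\<in>UNIV. partial k (\<lambda>y. ?X i y * F k y) y) + F i y"
      by (simp add: sum.distrib sum_distrib_left)
  qed
  have 2: "(\<lambda>y. ?X i y * (?X j y * ?S y)) =
    (\<lambda>y. (\<Sum>k\<in>UNIV. partial k (\<lambda>y. ?X i y * (?X j y * F k y)) y) + (?X j y * F i y + ?X i y * F j y))" for i j
  proof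
    fix y
    have "partial k (\<lambda>y. ?X i y * (?X j y * F k y)) y =
        (if i = k then - (?X j y * F k y) else 0) + ?X i y * partial k (\<lambda>y. ?X j y * F k y) y" for k
      by (subst partial_mult) (auto simp: sm partial_dist_coord)
    then have "(\<Sum>k\<in>UNIV. partial k (\<lambda>y. ?X i y * (?X j y * F k y)) y) + ?X j y * F i y =
      ?X i y * (\<Sum>k\<in>UNIV. partial k (\<lambda>y. ?X j y * F k y) y)"
      by (simp add: sum.distrib sum_distrib_left)
    moreover have "?X i y * (?X j y * ?S y) = ?X i y * (\<Sum>k\<in>UNIV. partial k (\<lambda>y. ?X j y * F k y) y) + ?X i y * F j y"
      by (simp only: fun_cong[OF 1[of j], of y] distrib_left)
    ultimately show "?X i y * (?X j y * ?S y) =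
      (\<Sum>k\<in>UNIV. partial k (\<lambda>y. ?X i y * (?X j y * F k y)) y) + (?X j y * F i y + ?X i y * F j y)"
      by linarith
  qed
  have d1: "partial i (\<lambda>y. ?X i y * ?S y) y =
      (\<Sum>k\<in>UNIV. partial i (partial k (\<lambda>y. ?X i y * F k y)) y) + partial i (F i) y" for i y
    unfolding 1 by (simp add: partial_add partial_sum sm)
  have d2: "partial i (partial j (\<lambda>y. ?X i y * (?X j y * ?S y))) y =
      (\<Sum>k\<in>UNIV. partial i (partial j (partial k (\<lambda>y. ?X i y * (?X j y * F k y)))) y)
       + (partial i (partial j (\<lambda>y. ?X j y * F i y)) y + partial i (partial j (\<lambda>y. ?X i y * F j y)) y)" for i j y
    unfolding 2 by (simp add: partial_add partial_sum sm)
  \<comment> \<open>The two correction terms agree after exchanging i and j; together, with the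
    factor 1/2, they cancel the sum of second derivatives that comes from the linear Taylor
    term.\<close>
  have "(\<Sum>i\<in>UNIV. \<Sum>j\<in>UNIV. partial i (partial j (\<lambda>y. ?X j y * F i y)) y) =
    (\<Sum>i\<in>UNIV. \<Sum>j\<in>UNIV. partial i (partial j (\<lambda>y. ?X i y * F j y)) y)"
    by (subst sum.swap) (simp add: partial_commute[OF smX[OF F]])
  then show ?thesis
    unfolding kernel_op_def d1 d2 by (simp add: sum.distrib add_divide_distrib)
qed

section \<open>The normalised bump and its Taylor kernel\<close>

lemma std_bump_lower: "norm x \<le> 1/2 \<Longrightarrow> exp (-2) \<le> std_bump x"
proof -
  assume "norm x \<le> 1/2"
  then have "(norm x)\<^sup>2 \<le> (1/2)\<^sup>2" by (intro power_mono) auto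
  then have s: "1 - x \<bullet> x \<ge> 1/2" by (simp add: dot_square_norm power2_eq_square)
  then have "1 / (1 - x \<bullet> x) \<le> 2" by (simp add: divide_le_eq)
  with s show ?thesis by (simp add: std_bump_def poly_exp_inv_def)
qed

lemma integral_std_bump_pos: "(\<integral>x. std_bump (x :: real ^ 'n) \<partial>lborel) > 0"
proof -
  let ?B = "ball 0 (1/2) :: (real^'n) set"
  have fin: "emeasure lborel ?B < \<infinity>" using emeasure_bounded_finite[of ?B] by (simp add: less_top)
  have "0 < exp (-2) * measure lborel ?B"
    using content_ball_pos[of "1/2" "0::real^'n"] by (simp add: measure_completion)
  also have "\<dots> = (\<integral>x. exp (-2) * indicator ?B x \<partial>lborel)" using fin by simp
  also have "\<dots> \<le> (\<integral>x. std_bump (x :: real ^ 'n) \<partial>lborel)"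
    by (rule integral_mono')
      (auto simp: integrable_bumps[OF std_bump_bumps] std_bump_nonneg std_bump_lower indicator_def)
  finally show ?thesis .
qed

definition mollifier :: "real ^ 'n \<Rightarrow> real" where
  "mollifier x = (1 / (\<integral>x. std_bump (x :: real ^ 'n) \<partial>lborel)) * std_bump x"

lemma mollifier_bumps: "mollifier \<in> bumps (cball 0 1)"
  unfolding mollifier_def[abs_def] by (intro bumps_cmult std_bump_bumps)

lemma integral_mollifier: "(\<integral>x. mollifier (x :: real ^ 'n) \<partial>lborel) = 1"
  using integral_std_bump_pos[where 'n = 'n] unfolding mollifier_def by simp

lemma kernel_op_mollifier_bumps: "kernel_op a mollifier \<in> bumps (cball 0 1)"
  by (intro kernel_op_bumps mollifier_bumps closed_cball)

text \<open>All terms except the first are derivatives of bumps and integrate to zero. For a = 0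
  this says that the Taylor mean at the centre of a ball is a mollification with a kernel of mass
  one.\<close>

lemma integral_kernel_op_mollifier: "(\<integral>y. kernel_op a mollifier y \<partial>lborel) = 1"
proof -
  note bm = bumps_mult_right[OF _ smooth_dist_coord]
  have b1: "(\<lambda>y. (a $ i - y $ i) * mollifier y) \<in> bumps (cball 0 1)" for i
    by (intro bm mollifier_bumps)
  have b2: "(\<lambda>y. (a $ i - y $ i) * ((a $ j - y $ j) * mollifier y)) \<in> bumps (cball 0 1)" for i j
    by (intro bm mollifier_bumps)
  note [simp] = integral_partial_bumps_0[OF b1 compact_cball]
    integral_partial_bumps_0[OF bumps_partial[OF b2 closed_cball] compact_cball]
    integrable_bumps[OF bumps_partial[OF b1 closed_cball] compact_cball]
    integrable_bumps[OF bumps_partial[OF bumps_partial[OF b2 closed_cball] closed_cball] compact_cball]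
    integrable_bumps[OF mollifier_bumps compact_cball]
  show ?thesis unfolding kernel_op_def by (simp add: integral_mollifier)
qed

text \<open>The rescaled bumps \<open>r\<^sup>-\<^sup>n \<eta>((y - t b) / r)\<close>, \<open>r = 1 + t c\<close>, satisfy a continuity equation; its
  integral over \<open>t\<close> is the identity below.\<close>

lemma path_average_divergence:
  fixes \<eta> :: "real ^ 'n \<Rightarrow> real"
  assumes c: "0 \<le> c" and \<eta>: "\<eta> \<in> bumps K" "compact K"
  shows "\<eta> y - (1 / (1 + c)) ^ CARD('n) * \<eta> ((1 / (1 + c)) *\<^sub>R (y - b)) =
    (\<Sum>k\<in>UNIV. partial k (path_average b c CARD('n) (\<lambda>u. (b $ k + c * u $ k) * \<eta> u)) y)"
proof -
  let ?n = "CARD('n)"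
  define s where "s t = 1 / (1 + t * c)" for t
  define u where "u t = s t *\<^sub>R (y - t *\<^sub>R b)" for t
  define \<phi> where "\<phi> k u = (b $ k + c * u $ k) * \<eta> u" for k u
  note sm = bumps_smooth[OF \<eta>(1)]
  have sl: "smooth (\<lambda>u. b $ k + c * u $ k)" for k
    by (intro smooth_add smooth_mult smooth_const smooth_coord)
  have \<phi>: "\<phi> k \<in> bumps K" for k
    unfolding \<phi>_def[abs_def] by (intro bumps_mult_right \<eta> sl)
  have p\<phi>: "partial k (\<phi> k) u = c * \<eta> u + (b $ k + c * u $ k) * partial k \<eta> u" for k u
  proof -
    have "partial k (\<lambda>u. b $ k + c * u $ k) = (\<lambda>u. c)"
      by (simp add: partial_add partial_cmult smooth_const smooth_coord smooth_mult partial_coord)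
    then show ?thesis unfolding \<phi>_def[abs_def] by (simp add: partial_mult sl sm)
  qed
  define h where "h t = s t ^ ?n * \<eta> (u t)" for t
  \<comment> \<open>Minus the divergence in y of the flux s^n (b + c u) \<eta>(u). The additional
    power of \<open>s\<close> comes from differentiating u = s (y - t b) in y.\<close>
  define h' where "h' t = - (s t ^ Suc ?n * (\<Sum>k\<in>UNIV. partial k (\<phi> k) (u t)))" for t
  have pos: "1 + t * c > 0" if "t \<ge> 0" for t using c that by (simp add: add_pos_nonneg)
  have dh: "(h has_real_derivative h' t) (at t)" if t: "t \<ge> 0" for t
  proof -
    have ds: "(s has_real_derivative (- c * (s t)\<^sup>2)) (at t)"
      unfolding s_def using pos[OF t] by (auto intro!: derivative_eq_intros simp: power2_eq_square field_simps)
    have du: "(u has_derivative (\<lambda>h. h *\<^sub>R ((- s t) *\<^sub>R (b + c *\<^sub>R u t)))) (at t)"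
    proof -
      have "(u has_derivative (\<lambda>h. s t *\<^sub>R (- (h *\<^sub>R b)) + (h * (- c * (s t)\<^sup>2)) *\<^sub>R (y - t *\<^sub>R b))) (at t)"
        unfolding u_def
        by (rule has_derivative_eq_rhs[OF has_derivative_scaleR[OF ds[THEN has_field_derivative_imp_has_derivative]]])
          (auto intro!: derivative_eq_intros simp: mult.commute)
      then show ?thesis
        by (rule has_derivative_eq_rhs)
          (auto simp: u_def power2_eq_square algebra_simps)
    qed
    have "((\<lambda>t. \<eta> (u t)) has_derivative (\<lambda>h. \<Sum>k\<in>UNIV. partial k \<eta> (u t) * (h *\<^sub>R ((- s t) *\<^sub>R (b + c *\<^sub>R u t))) $ k)) (at t)"
      by (rule smooth_has_derivative_chain[OF sm du])
    then have "((\<lambda>t. \<eta> (u t)) has_real_derivative (- s t * (\<Sum>k\<in>UNIV. partial k \<eta> (u t) * (b $ k + c * u t $ k)))) (at t)"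
      unfolding has_field_derivative_def
      by (rule has_derivative_eq_rhs) (auto simp: fun_eq_iff sum_distrib_left sum_negf[symmetric] mult_ac intro!: sum.cong)
    then have "(h has_real_derivative (real ?n * s t ^ (?n - 1) * (- c * (s t)\<^sup>2) * \<eta> (u t)
        + s t ^ ?n * (- s t * (\<Sum>k\<in>UNIV. partial k \<eta> (u t) * (b $ k + c * u t $ k))))) (at t)"
      unfolding h_def using ds by (auto intro!: derivative_eq_intros)
    moreover have "(\<Sum>k\<in>UNIV. partial k (\<phi> k) (u t)) =
       real ?n * (c * \<eta> (u t)) + (\<Sum>k\<in>UNIV. partial k \<eta> (u t) * (b $ k + c * u t $ k))"
      unfolding p\<phi> by (simp add: sum.distrib mult.commute)
    moreover have "s t ^ (?n - 1) * (s t)\<^sup>2 = s t ^ Suc ?n"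
      by (simp add: power_add[symmetric])
    ultimately show ?thesis unfolding h'_def
      by (elim DERIV_cong) (simp add: algebra_simps)
  qed
  have cu: "continuous_on {0..1} s" "continuous_on {0..1} u"
    unfolding u_def s_def using pos by (auto intro!: continuous_intros simp: less_imp_neq[symmetric])
  have "(\<integral>t. indicator {0..1} t *\<^sub>R h' t \<partial>lborel) = h 1 - h 0"
  proof (rule integral_FTC_atLeastAtMost)
    show "(h has_vector_derivative h' t) (at t within {0..1})" if "0 \<le> t" "t \<le> 1" for t
      using dh[OF that(1)] has_real_derivative_iff_has_vector_derivative has_vector_derivative_at_within by blast
    show "continuous_on {0..1} h'" unfolding h'_def
      by (intro continuous_intros cu continuous_on_compose2[OF smooth_continuous_on[OF smooth_partial[OF bumps_smooth[OF \<phi>]], of UNIV]]) auto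
  qed simp
  moreover have "(\<integral>t. indicator {0..1} t *\<^sub>R h' t \<partial>lborel) =
    - (\<integral>t. (\<Sum>k\<in>UNIV. indicator {0..1} t * ((1 / (1 + t * c)) ^ Suc ?n *
          partial k (\<phi> k) ((1 / (1 + t * c)) *\<^sub>R (y - t *\<^sub>R b)))) \<partial>lborel)"
    by (subst Bochner_Integration.integral_minus[symmetric], intro Bochner_Integration.integral_cong refl)
      (simp add: h'_def sum_distrib_left s_def u_def)
  moreover have "\<dots> = - (\<Sum>k\<in>UNIV. path_average b c (Suc ?n) (partial k (\<phi> k)) y)"
  proof -
    have "integrable lborel (\<lambda>t. indicator {0..1} t * ((1 / (1 + t * c)) ^ Suc ?n *
          partial k (\<phi> k) ((1 / (1 + t * c)) *\<^sub>R (y - t *\<^sub>R b))))" for k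
    proof -
      have bp: "partial k (\<phi> k) \<in> bumps K" by (intro bumps_partial \<phi> compact_imp_closed \<eta>)
      obtain M where "\<And>x. \<bar>partial k (\<phi> k) x\<bar> \<le> M" using bumps_bounded[OF bp \<eta>(2)] by blast
      then show ?thesis by (intro path_average_integrable[OF c] smooth_borel bumps_smooth[OF bp])
    qed
    then show ?thesis unfolding path_average_def by simp
  qed
  moreover have "h 1 - h 0 = (1 / (1 + c)) ^ ?n * \<eta> ((1 / (1 + c)) *\<^sub>R (y - b)) - \<eta> y"
    by (simp add: h_def s_def u_def)
  moreover have "partial k (path_average b c ?n (\<phi> k)) y = path_average b c (Suc ?n) (partial k (\<phi> k)) y" for k
    using partial_path_average[OF c \<phi> \<eta>(2)] by simp
  ultimately show ?thesis unfolding \<phi>_def[abs_def] by simp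
qed

section \<open>Comparison of the kernels of two nearby balls\<close>

lemma kernel_op_cmult:
  assumes f: "smooth f"
  shows "kernel_op a (\<lambda>y. c * f y) y = c * kernel_op a f y"
proof -
  note sm = smooth_mult[OF smooth_dist_coord]
  have 1: "(\<lambda>y. (a $ i - y $ i) * (c * f y)) = (\<lambda>y. c * ((a $ i - y $ i) * f y))" for i
    by (simp add: mult_ac)
  have 2: "(\<lambda>y. (a $ i - y $ i) * ((a $ j - y $ j) * (c * f y))) =
     (\<lambda>y. c * ((a $ i - y $ i) * ((a $ j - y $ j) * f y)))" for i j
    by (simp add: mult_ac)
  have "kernel_op a (\<lambda>y. c * f y) y = c * f y - (\<Sum>i\<in>UNIV. c * partial i (\<lambda>y. (a $ i - y $ i) * f y) y)
     + (\<Sum>i\<in>UNIV. \<Sum>j\<in>UNIV. c * partial i (partial j (\<lambda>y. (a $ i - y $ i) * ((a $ j - y $ j) * f y))) y) / 2"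
    unfolding kernel_op_def 1 2 by (simp add: partial_cmult sm f smooth_partial)
  then show ?thesis unfolding kernel_op_def by (simp add: sum_distrib_left[symmetric] algebra_simps)
qed

lemma foldr_partial_affine_bound:
  assumes g: "smooth g" and p: "\<And>j. partial j g = (\<lambda>y. d j)"
    and "\<bar>g x\<bar> \<le> B" "\<And>j. \<bar>d j\<bar> \<le> B"
  shows "\<bar>foldr partial js g x\<bar> \<le> B"
proof (cases js rule: rev_cases)
  case (snoc ks j)
  have "foldr partial ks (\<lambda>y. e) = (\<lambda>y. if ks = [] then e else 0)" for e :: real
    by (induction ks) auto
  moreover have "0 \<le> B" using assms(3) by linarith
  ultimately show ?thesis using snoc p assms(4) by simp
qed (use assms in simp)

text \<open>Passing from the unit ball to the ball around b of radius \<theta> changes the bump by a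
  divergence, hence the Taylor kernel by third derivatives of bumps with uniform bounds. For v one
  derivative is moved onto v; for D it stays on the bump. In both cases two derivatives against G
  are left for \<open>weak_pair_second_derivatives\<close>. The point \<open>a\<close> is the
  evaluation point in the coordinates of the ball and may lie outside of it.\<close>

lemma kernel_step:
  assumes n: "CARD('n) \<ge> 3" and A: "A \<ge> 0"
  obtains M where "M \<ge> 0"
    and "\<And>V G (a :: real ^ 'n) b \<theta> i. weak_pair (ball 0 4) V G \<Longrightarrow> norm a \<le> A \<Longrightarrow> norm b \<le> 1 \<Longrightarrow> 1 \<le> \<theta> \<Longrightarrow> \<theta> \<le> 2 \<Longrightarrow>
      \<bar>\<integral>y. V y $ i * ((1 / \<theta>) ^ CARD('n) * kernel_op ((1 / \<theta>) *\<^sub>R (a - b)) mollifier ((1 / \<theta>) *\<^sub>R (y - b))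
        - kernel_op a mollifier y) \<partial>lborel\<bar> \<le> M * L1_trace_free_sym (ball 0 4) G"
    and "\<And>V G (a :: real ^ 'n) b \<theta> i j. weak_pair (ball 0 4) V G \<Longrightarrow> norm a \<le> A \<Longrightarrow> norm b \<le> 1 \<Longrightarrow> 1 \<le> \<theta> \<Longrightarrow> \<theta> \<le> 2 \<Longrightarrow>
      \<bar>\<integral>y. G y $ i $ j * ((1 / \<theta>) ^ CARD('n) * kernel_op ((1 / \<theta>) *\<^sub>R (a - b)) mollifier ((1 / \<theta>) *\<^sub>R (y - b))
        - kernel_op a mollifier y) \<partial>lborel\<bar> \<le> M * L1_trace_free_sym (ball 0 4) G"
proof -
  let ?\<eta> = "mollifier :: real^'n \<Rightarrow> real" and ?n = "CARD('n)"
  obtain M0 where M0: "M0 \<ge> 0" "\<And>js x. length js \<le> 3 \<Longrightarrow> \<bar>foldr partial js ?\<eta> x\<bar> \<le> M0"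
    using bumps_derivatives_bounded[OF mollifier_bumps compact_cball] by blast
  note sm\<eta> = bumps_smooth[OF mollifier_bumps]
  \<comment> \<open>The factors 2^3 are Leibniz constants for order three, A + 3 bounds the
    coordinate differences on the ball of radius 3, and 2 bounds the components of b + c u on the
    unit ball.\<close>
  define B where "B = 2 ^ 3 * (A + 3) * (2 ^ 3 * (A + 3) * (2 ^ 3 * 2 * M0))"
  have B0: "B \<ge> 0" unfolding B_def using A M0 by simp
  define M where "M = real ?n ^ 3 * (21 * B)"
  have M: "M \<ge> 0" unfolding M_def using B0 by simp
  have key: "\<exists>P. \<forall>i j k. P i j k \<in> bumps (cball 0 3) \<and> (\<forall>js x. length js \<le> 3 \<longrightarrow> \<bar>foldr partial js (P i j k) x\<bar> \<le> B) \<and>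
      (\<forall>y. (1 / \<theta>) ^ ?n * kernel_op ((1 / \<theta>) *\<^sub>R (a - b)) mollifier ((1 / \<theta>) *\<^sub>R (y - b)) - kernel_op a mollifier y =
      - (\<Sum>i\<in>UNIV. \<Sum>j\<in>UNIV. \<Sum>k\<in>UNIV. partial i (partial j (partial k (P i j k))) y) / 2)"
    if a: "norm a \<le> A" and b: "norm b \<le> 1" and \<theta>: "1 \<le> \<theta>" "\<theta> \<le> 2" for a b :: "real^'n" and \<theta>
  proof -
    define c where "c = \<theta> - 1"
    have c: "0 \<le> c" "c \<le> 1" "1 + c = \<theta>" using \<theta> by (auto simp: c_def)
    define \<phi> where "\<phi> k u = (b $ k + c * u $ k) * ?\<eta> u" for k u
    have sl: "smooth (\<lambda>u. b $ k + c * u $ k)" for k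
      by (intro smooth_add smooth_mult smooth_const smooth_coord)
    have \<phi>: "\<phi> k \<in> bumps (cball 0 1)" for k
      unfolding \<phi>_def[abs_def] by (intro bumps_mult_right mollifier_bumps sl)
    have \<phi>b: "\<bar>foldr partial js (\<phi> k) u\<bar> \<le> 2 ^ 3 * 2 * M0" if "length js \<le> 3" for js k u
    proof (cases "u \<in> cball 0 1")
      case True
      have pl: "partial j (\<lambda>u. b $ k + c * u $ k) = (\<lambda>u. if k = j then c else 0)" for j
        by (simp add: partial_add partial_cmult smooth_const smooth_coord smooth_mult partial_coord)
      have "\<bar>b $ k + c * u $ k\<bar> \<le> 2"
      proof -
        have "\<bar>c * u $ k\<bar> \<le> 1 * 1" unfolding abs_mult
          using c component_le_norm_cart[of u k] True by (intro mult_mono) auto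
        then show ?thesis using component_le_norm_cart[of b k] b by linarith
      qed
      then have "\<bar>foldr partial ks (\<lambda>u. b $ k + c * u $ k) u\<bar> \<le> 2" for ks
        using c by (intro foldr_partial_affine_bound[OF sl pl]) auto
      then show ?thesis unfolding \<phi>_def[abs_def]
        by (intro foldr_partial_mult_bound[OF sl sm\<eta> _ M0(2) that]) auto
    next
      case False
      then have "foldr partial js (\<phi> k) u = 0" using bumps_zero[OF bumps_foldr_partial[OF \<phi> closed_cball]] by blast
      then show ?thesis using M0 by simp
    qed
    define F where "F k = path_average b c ?n (\<phi> k)" for k
    have smF: "smooth (F k)" for k unfolding F_def by (rule smooth_path_average[OF c(1) \<phi> compact_cball])
    \<comment> \<open>The moving balls have centres of norm at most 1 and radii at most 2, so they
      stay in the closed ball of radius 3, which is a compact subset of the open ball of radius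
      4.\<close>
    have Fz: "F k y = 0" if "y \<notin> cball 0 3" for k y
    proof -
      have "\<phi> k ((1 / (1 + t * c)) *\<^sub>R (y - t *\<^sub>R b)) = 0" if t: "t \<in> {0..1}" for t
      proof (rule bumps_zero[OF \<phi>])
        have "t * c \<le> 1 * 1" "0 \<le> t * c" using t c mult_mono[of t 1 c 1] by auto
        then have "1 + t * c \<le> 2" "0 < 1 + t * c" by auto
        moreover have "norm (t *\<^sub>R b) \<le> 1 * 1" unfolding norm_scaleR using t b by (intro mult_mono) auto
        then have "norm (y - t *\<^sub>R b) > 2"
          using norm_triangle_ineq2[of y "t *\<^sub>R b"] \<open>y \<notin> cball 0 3\<close> by simp
        ultimately show "(1 / (1 + t * c)) *\<^sub>R (y - t *\<^sub>R b) \<notin> cball 0 1" by (simp add: divide_le_eq)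
      qed
      then have "(\<lambda>t. indicator {0..1} t * ((1 / (1 + t * c)) ^ ?n * \<phi> k ((1 / (1 + t * c)) *\<^sub>R (y - t *\<^sub>R b)))) = (\<lambda>t. 0)"
        by (auto simp: indicator_def)
      then show ?thesis unfolding F_def path_average_def by simp
    qed
    have Fb: "\<bar>foldr partial js (F k) y\<bar> \<le> 2 ^ 3 * 2 * M0" if "length js \<le> 3" for js k y
      unfolding F_def foldr_partial_path_average[OF c(1) \<phi> compact_cball]
      by (intro path_average_le[OF c(1)] \<phi>b that smooth_borel bumps_smooth[OF bumps_foldr_partial[OF \<phi> closed_cball]])
    define P where "P i j k = (\<lambda>y. (a $ i - y $ i) * ((a $ j - y $ j) * F k y))" for i j k
    have FB: "F k \<in> bumps (cball 0 3)" for k by (intro bumpsI smF Fz)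
    have P: "P i j k \<in> bumps (cball 0 3)" for i j k
      unfolding P_def by (intro bumps_mult_right smooth_dist_coord FB)
    have Pb: "\<bar>foldr partial js (P i j k) y\<bar> \<le> B" if len: "length js \<le> 3" for i j k js y
    proof (cases "y \<in> cball 0 3")
      case True
      have X: "\<bar>foldr partial ks (\<lambda>y. a $ l - y $ l) y\<bar> \<le> A + 3" for ks l
      proof (rule foldr_partial_affine_bound[OF smooth_dist_coord partial_dist_coord])
        show "\<bar>a $ l - y $ l\<bar> \<le> A + 3"
          using component_le_norm_cart[of a l] component_le_norm_cart[of y l] a True by auto
      qed (use A in auto)
      show ?thesis unfolding P_def B_def
        by (intro foldr_partial_mult_bound[OF smooth_dist_coord smooth_mult[OF smooth_dist_coord smF] X _ len]
          foldr_partial_mult_bound[OF smooth_dist_coord smF X Fb])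
    next
      case False
      then show ?thesis using bumps_zero[OF bumps_foldr_partial[OF P closed_cball] False] B0 by simp
    qed
    have "(1 / \<theta>) ^ ?n * kernel_op ((1 / \<theta>) *\<^sub>R (a - b)) mollifier ((1 / \<theta>) *\<^sub>R (y - b)) - kernel_op a mollifier y =
      - (\<Sum>i\<in>UNIV. \<Sum>j\<in>UNIV. \<Sum>k\<in>UNIV. partial i (partial j (partial k (P i j k))) y) / 2" for y
    proof -
      let ?S = "\<lambda>y. \<Sum>k\<in>UNIV. partial k (F k) y"
      have eq: "(\<lambda>y. (1 / \<theta>) ^ ?n * ?\<eta> ((1 / \<theta>) *\<^sub>R (y - b))) = (\<lambda>y. ?\<eta> y - ?S y)"
      proof
        fix y
        show "(1 / \<theta>) ^ ?n * ?\<eta> ((1 / \<theta>) *\<^sub>R (y - b)) = ?\<eta> y - ?S y"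
          using path_average_divergence[OF c(1) mollifier_bumps compact_cball, of y b]
          unfolding F_def \<phi>_def[abs_def] c(3) by simp
      qed
      have "(1 / \<theta>) ^ ?n * kernel_op ((1 / \<theta>) *\<^sub>R (a - b)) mollifier ((1 / \<theta>) *\<^sub>R (y - b)) =
        kernel_op a (\<lambda>y. (1 / \<theta>) ^ ?n * ?\<eta> ((1 / \<theta>) *\<^sub>R (y - b))) y"
        using \<theta> by (subst kernel_op_cmult[OF smooth_affine[OF sm\<eta>]], subst kernel_op_affine[OF sm\<eta>]) auto
      also have "\<dots> = kernel_op a ?\<eta> y - kernel_op a ?S y"
        unfolding eq by (intro kernel_op_diff sm\<eta> smooth_sum smooth_partial smF)
      also have "kernel_op a ?S y = (\<Sum>i\<in>UNIV. \<Sum>j\<in>UNIV. \<Sum>k\<in>UNIV. partial i (partial j (partial k (P i j k))) y) / 2"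
        unfolding P_def by (rule kernel_op_divergence[OF smF])
      finally show ?thesis by simp
    qed
    with P Pb show ?thesis by blast
  qed
  have sub: "cball 0 3 \<subseteq> ball (0::real^'n) 4" by auto
  have bound: "\<bar>\<integral>y. f y * D y \<partial>lborel\<bar> \<le> M * L"
    if f: "integrable lborel f" and P: "\<And>i j k. P i j k \<in> bumps (cball 0 3)"
    and D: "\<And>y. D y = - (\<Sum>i\<in>UNIV. \<Sum>j\<in>UNIV. \<Sum>k\<in>UNIV. partial i (partial j (partial k (P i j k))) y) / 2"
    and le: "\<And>i j k. \<bar>\<integral>y. f y * partial i (partial j (partial k (P i j k))) y \<partial>lborel\<bar> \<le> 21 * (B * L)"
    for f D :: "real^'n \<Rightarrow> real" and P and L :: real
  proof -
    have int: "integrable lborel (\<lambda>y. f y * partial i (partial j (partial k (P i j k))) y)" for i j k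
      by (rule integrable_mult_bumps'[OF f bumps_partial[OF bumps_partial[OF bumps_partial[OF P closed_cball] closed_cball] closed_cball] compact_cball])
    have L0: "0 \<le> 21 * (B * L)" using order_trans[OF abs_ge_zero le] .
    have "(\<integral>y. f y * D y \<partial>lborel) = (\<integral>y. - (\<Sum>i\<in>UNIV. \<Sum>j\<in>UNIV. \<Sum>k\<in>UNIV. f y * partial i (partial j (partial k (P i j k))) y) / 2 \<partial>lborel)"
      unfolding D by (simp add: sum_distrib_left)
    also have "\<dots> = - (\<Sum>i\<in>UNIV. \<Sum>j\<in>UNIV. \<Sum>k\<in>UNIV. \<integral>y. f y * partial i (partial j (partial k (P i j k))) y \<partial>lborel) / 2"
      by (simp add: int)
    finally have "\<bar>\<integral>y. f y * D y \<partial>lborel\<bar> \<le> \<bar>\<Sum>i\<in>UNIV. \<Sum>j\<in>UNIV. \<Sum>k\<in>UNIV. \<integral>y. f y * partial i (partial j (partial k (P i j k))) y \<partial>lborel\<bar>"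
      by simp
    also have "\<dots> \<le> (\<Sum>i\<in>(UNIV::'n set). \<Sum>j\<in>(UNIV::'n set). \<Sum>k\<in>(UNIV::'n set). 21 * (B * L))"
      by (intro order_trans[OF sum_abs] sum_mono le)
    also have "\<dots> = M * L" by (simp add: M_def power3_eq_cube)
    finally show ?thesis .
  qed
  show thesis
  proof (rule that[OF M])
    fix V :: "real^'n \<Rightarrow> real^'n" and G and a b :: "real^'n" and \<theta> :: real and i j
    assume wp: "weak_pair (ball 0 4) V G" and ab: "norm a \<le> A" "norm b \<le> 1" "1 \<le> \<theta>" "\<theta> \<le> 2"
    obtain P where P': "\<forall>i j k. P i j k \<in> bumps (cball 0 3) \<and> (\<forall>js x. length js \<le> 3 \<longrightarrow> \<bar>foldr partial js (P i j k) x\<bar> \<le> B) \<and>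
      (\<forall>y. (1 / \<theta>) ^ ?n * kernel_op ((1 / \<theta>) *\<^sub>R (a - b)) mollifier ((1 / \<theta>) *\<^sub>R (y - b)) - kernel_op a mollifier y =
      - (\<Sum>i\<in>UNIV. \<Sum>j\<in>UNIV. \<Sum>k\<in>UNIV. partial i (partial j (partial k (P i j k))) y) / 2)"
      using key[OF ab] by (elim exE)
    note P'' = P'[THEN spec, THEN spec, THEN spec]
    note P = P''[THEN conjunct1] P''[THEN conjunct2, THEN conjunct1, rule_format]
      P''[THEN conjunct2, THEN conjunct2, THEN spec]
    note bp = bumps_partial[OF _ closed_cball]
    show "\<bar>\<integral>y. V y $ i * ((1 / \<theta>) ^ CARD('n) * kernel_op ((1 / \<theta>) *\<^sub>R (a - b)) mollifier ((1 / \<theta>) *\<^sub>R (y - b))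
        - kernel_op a mollifier y) \<partial>lborel\<bar> \<le> M * L1_trace_free_sym (ball 0 4) G"
    proof (rule bound[OF weak_pairD(4)[OF wp] P(1) P(3)])
      fix l j k
      have "\<bar>\<integral>y. G y $ i $ l * partial j (partial k (P l j k)) y \<partial>lborel\<bar> \<le> 21 * (B * L1_trace_free_sym (ball 0 4) G)"
        by (rule weak_pair_second_derivatives[OF n wp compact_cball sub P(1)]) (use P(2)[of "[_, _]"] in simp)
      then show "\<bar>\<integral>y. V y $ i * partial l (partial j (partial k (P l j k))) y \<partial>lborel\<bar> \<le> 21 * (B * L1_trace_free_sym (ball 0 4) G)"
        using weak_pairD(6)[OF wp compact_cball sub bp[OF bp[OF P(1)]]] by simp
    qed
    show "\<bar>\<integral>y. G y $ i $ j * ((1 / \<theta>) ^ CARD('n) * kernel_op ((1 / \<theta>) *\<^sub>R (a - b)) mollifier ((1 / \<theta>) *\<^sub>R (y - b))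
        - kernel_op a mollifier y) \<partial>lborel\<bar> \<le> M * L1_trace_free_sym (ball 0 4) G"
      by (rule bound[OF weak_pairD(5)[OF wp] P(1) P(3)],
          rule weak_pair_second_derivatives[OF n wp compact_cball sub bp[OF P(1)]])
        (use P(2)[of "[_, _, _]"] in simp)
  qed
qed

subsection \<open>Averaged Taylor polynomials\<close>

text \<open>The mean of the second-order Taylor polynomials at \<open>x\<close> of \<open>f\<close>, expanded around the points of the
  ball of radius \<open>r\<close> around \<open>z\<close>; the derivatives have been moved to the kernel.\<close>

definition taylor_mean :: "(real ^ 'n \<Rightarrow> real) \<Rightarrow> real ^ 'n \<Rightarrow> real \<Rightarrow> real ^ 'n \<Rightarrow> real" where
  "taylor_mean f z r x = (\<integral>y. f (z + r *\<^sub>R y) * kernel_op ((1 / r) *\<^sub>R (x - z)) mollifier y \<partial>lborel)"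

text \<open>Both means have to be integrals of the same function y \<mapsto> f(z + r y) against two
  kernels. In the coordinates of the ball (z, r), the ball (z', r') has centre b = (z' - z) / r and
  radius \<theta> = r' / r, which are the parameters of \<open>kernel_step\<close>.\<close>

lemma taylor_mean_rescale:
  fixes f :: "real ^ 'n \<Rightarrow> real"
  assumes r: "r > 0" and r': "r' > 0"
  shows "taylor_mean f z' r' x = (\<integral>y. f (z + r *\<^sub>R y) * ((1 / (r' / r)) ^ CARD('n) *
    kernel_op ((1 / (r' / r)) *\<^sub>R ((1 / r) *\<^sub>R (x - z) - (1 / r) *\<^sub>R (z' - z))) mollifier
      ((1 / (r' / r)) *\<^sub>R (y - (1 / r) *\<^sub>R (z' - z)))) \<partial>lborel)" (is "_ = integral\<^sup>L _ ?h")
proof -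
  let ?\<theta> = "r' / r" and ?b = "(1 / r) *\<^sub>R (z' - z)"
  have \<theta>: "?\<theta> > 0" using r r' by simp
  have "integral\<^sup>L lborel ?h = ?\<theta> ^ CARD('n) * (\<integral>y. ?h (?b + ?\<theta> *\<^sub>R y) \<partial>lborel)"
    using integral_lborel_affine[of ?\<theta> ?h ?b] \<theta>
    by (simp only: abs_of_pos[OF \<theta>] DIM_cart DIM_real mult_1_right real_scaleR_def less_imp_neq[symmetric] not_False_eq_True)
  also have "\<dots> = (\<integral>y. ?\<theta> ^ CARD('n) * ?h (?b + ?\<theta> *\<^sub>R y) \<partial>lborel)" by simp
  also have "\<dots> = taylor_mean f z' r' x"
    unfolding taylor_mean_def
  proof (intro Bochner_Integration.integral_cong refl)
    fix y
    have cancel: "q * (F * (q' * k)) = F * k" if "q * q' = 1" for q q' F k :: real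
    proof -
      have "q * (F * (q' * k)) = (q * q') * (F * k)" by (simp only: mult_ac)
      then show ?thesis using that by simp
    qed
    have 1: "z + r *\<^sub>R (?b + ?\<theta> *\<^sub>R y) = z' + r' *\<^sub>R y" using r by (simp add: algebra_simps)
    have 2: "(1 / ?\<theta>) *\<^sub>R ((1 / r) *\<^sub>R (x - z) - ?b) = (1 / r') *\<^sub>R (x - z')"
      using r by (simp add: scaleR_diff_right[symmetric])
    have 3: "(1 / ?\<theta>) *\<^sub>R ((?b + ?\<theta> *\<^sub>R y) - ?b) = y" using r r' by simp
    have 4: "?\<theta> ^ CARD('n) * (1 / ?\<theta>) ^ CARD('n) = 1" using r r' by (simp add: power_mult_distrib[symmetric])
    show "?\<theta> ^ CARD('n) * ?h (?b + ?\<theta> *\<^sub>R y) = f (z' + r' *\<^sub>R y) * kernel_op ((1 / r') *\<^sub>R (x - z')) mollifier y"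
      unfolding 1 2 3 by (rule cancel[OF 4])
  qed
  finally show ?thesis by simp
qed

lemma L1_trace_free_sym_rescale:
  fixes G :: "real ^ 'n \<Rightarrow> real ^ 'n ^ 'n"
  assumes r: "r > 0"
  shows "L1_trace_free_sym (ball 0 \<rho>) (\<lambda>y. r *\<^sub>R G (z + r *\<^sub>R y)) = r * ((1 / r) ^ CARD('n) * L1_trace_free_sym (ball z (\<rho> * r)) G)"
proof -
  have ind: "indicator (ball z (\<rho> * r)) (z + r *\<^sub>R y) = (indicator (ball 0 \<rho>) y :: real)" for y
    using r by (auto simp: indicator_def dist_norm mult.commute)
  have 4: "(1 / r) ^ CARD('n) * (r ^ CARD('n) * q) = q" for q
    using r by (simp add: power_divide)
  have "L1_trace_free_sym (ball z (\<rho> * r)) G = r ^ CARD('n) * (\<integral>y. indicator (ball 0 \<rho>) y * norm (trace_free_sym (G (z + r *\<^sub>R y))) \<partial>lborel)"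
    using r by (subst integral_lborel_affine[of r _ z]) (auto simp: ind)
  moreover have "L1_trace_free_sym (ball 0 \<rho>) (\<lambda>y. r *\<^sub>R G (z + r *\<^sub>R y)) =
    r * (\<integral>y. indicator (ball 0 \<rho>) y * norm (trace_free_sym (G (z + r *\<^sub>R y))) \<partial>lborel)"
    using r by (simp add: trace_free_sym_scaleR mult.left_commute)
  ultimately show ?thesis by (simp only: 4)
qed

text \<open>\<open>kernel_step\<close> transported to radius \<open>r\<close>. The rescaled
  differential is r D: for the means of v this leaves a factor r on the right, for the means of D it
  cancels. The hypothesis \<open>dist x z \<le> A * r\<close> lets the evaluation point lie far
  outside of the ball, as it does along a John curve.\<close>

lemma taylor_mean_step:
  assumes n: "CARD('n) \<ge> 3" and A: "A \<ge> 0"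
  obtains M where "M \<ge> 0"
    and "\<And>U V G (x :: real ^ 'n) z z' r r' i. weak_pair U V G \<Longrightarrow> r > 0 \<Longrightarrow> ball z (4 * r) \<subseteq> U \<Longrightarrow> dist x z \<le> A * r \<Longrightarrow>
      dist z z' \<le> r \<Longrightarrow> r \<le> r' \<Longrightarrow> r' \<le> 2 * r \<Longrightarrow>
      \<bar>taylor_mean (\<lambda>y. V y $ i) z' r' x - taylor_mean (\<lambda>y. V y $ i) z r x\<bar>
        \<le> M * (r * ((1 / r) ^ CARD('n) * L1_trace_free_sym (ball z (4 * r)) G))"
    and "\<And>U V G (x :: real ^ 'n) z z' r r' i j. weak_pair U V G \<Longrightarrow> r > 0 \<Longrightarrow> ball z (4 * r) \<subseteq> U \<Longrightarrow> dist x z \<le> A * r \<Longrightarrow>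
      dist z z' \<le> r \<Longrightarrow> r \<le> r' \<Longrightarrow> r' \<le> 2 * r \<Longrightarrow>
      \<bar>taylor_mean (\<lambda>y. G y $ i $ j) z' r' x - taylor_mean (\<lambda>y. G y $ i $ j) z r x\<bar>
        \<le> M * ((1 / r) ^ CARD('n) * L1_trace_free_sym (ball z (4 * r)) G)"
proof -
  obtain M where M: "M \<ge> 0"
    and MV: "\<And>V G (a :: real ^ 'n) b \<theta> i. weak_pair (ball 0 4) V G \<Longrightarrow> norm a \<le> A \<Longrightarrow> norm b \<le> 1 \<Longrightarrow> 1 \<le> \<theta> \<Longrightarrow> \<theta> \<le> 2 \<Longrightarrow>
      \<bar>\<integral>y. V y $ i * ((1 / \<theta>) ^ CARD('n) * kernel_op ((1 / \<theta>) *\<^sub>R (a - b)) mollifier ((1 / \<theta>) *\<^sub>R (y - b))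
        - kernel_op a mollifier y) \<partial>lborel\<bar> \<le> M * L1_trace_free_sym (ball 0 4) G"
    and MG: "\<And>V G (a :: real ^ 'n) b \<theta> i j. weak_pair (ball 0 4) V G \<Longrightarrow> norm a \<le> A \<Longrightarrow> norm b \<le> 1 \<Longrightarrow> 1 \<le> \<theta> \<Longrightarrow> \<theta> \<le> 2 \<Longrightarrow>
      \<bar>\<integral>y. G y $ i $ j * ((1 / \<theta>) ^ CARD('n) * kernel_op ((1 / \<theta>) *\<^sub>R (a - b)) mollifier ((1 / \<theta>) *\<^sub>R (y - b))
        - kernel_op a mollifier y) \<partial>lborel\<bar> \<le> M * L1_trace_free_sym (ball 0 4) G"
    by (rule kernel_step[OF n A], rule that)
  have *: "taylor_mean f z' r' x - taylor_mean f z r x =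
      (\<integral>y. f (z + r *\<^sub>R y) * ((1 / (r' / r)) ^ CARD('n) *
        kernel_op ((1 / (r' / r)) *\<^sub>R ((1 / r) *\<^sub>R (x - z) - (1 / r) *\<^sub>R (z' - z))) mollifier
          ((1 / (r' / r)) *\<^sub>R (y - (1 / r) *\<^sub>R (z' - z)))
        - kernel_op ((1 / r) *\<^sub>R (x - z)) mollifier y) \<partial>lborel)"
    if f: "integrable lborel f" and r: "r > 0" "r' > 0" for f :: "real^'n \<Rightarrow> real" and z z' r r' x
  proof -
    have f': "integrable lborel (\<lambda>y. f (z + r *\<^sub>R y))" using integrable_lborel_affine[OF f] r by simp
    have 1: "integrable lborel (\<lambda>y. f (z + r *\<^sub>R y) * kernel_op ((1 / r) *\<^sub>R (x - z)) mollifier y)"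
      by (rule integrable_mult_bumps'[OF f' kernel_op_mollifier_bumps compact_cball])
    have "integrable lborel (\<lambda>y. f (z + r *\<^sub>R y) *
        kernel_op ((1 / (r' / r)) *\<^sub>R ((1 / r) *\<^sub>R (x - z) - (1 / r) *\<^sub>R (z' - z))) mollifier
          ((1 / (r' / r)) *\<^sub>R (y - (1 / r) *\<^sub>R (z' - z))))"
      by (rule integrable_mult_bumps[OF f' kernel_op_mollifier_bumps compact_cball])
    then have 2: "integrable lborel (\<lambda>y. f (z + r *\<^sub>R y) * ((1 / (r' / r)) ^ CARD('n) *
        kernel_op ((1 / (r' / r)) *\<^sub>R ((1 / r) *\<^sub>R (x - z) - (1 / r) *\<^sub>R (z' - z))) mollifier
          ((1 / (r' / r)) *\<^sub>R (y - (1 / r) *\<^sub>R (z' - z)))))"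
      by (subst mult.left_commute) (rule integrable_mult_right)
    show ?thesis
      unfolding taylor_mean_rescale[OF r, of f z' x z] right_diff_distrib Bochner_Integration.integral_diff[OF 2 1]
      by (simp add: taylor_mean_def)
  qed
  show thesis
  proof (rule that[OF M])
    fix U V G and x z z' :: "real^'n" and r r' i j
    assume wp: "weak_pair U V G" and r: "r > 0" and sub: "ball z (4 * r) \<subseteq> U"
      and d: "dist x z \<le> A * r" "dist z z' \<le> r" "r \<le> r'" "r' \<le> 2 * r"
    have r': "r' > 0" using r d by simp
    have wp': "weak_pair (ball 0 4) (\<lambda>y. V (z + r *\<^sub>R y)) (\<lambda>y. r *\<^sub>R G (z + r *\<^sub>R y))"
    proof (rule weak_pair_rescale[OF wp r])
      fix y :: "real^'n" assume "y \<in> ball 0 4"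
      then have "z + r *\<^sub>R y \<in> ball z (4 * r)" using r by (simp add: dist_norm)
      then show "z + r *\<^sub>R y \<in> U" using sub by blast
    qed simp
    have a: "norm ((1 / r) *\<^sub>R (x - z)) \<le> A" using d r by (simp add: dist_norm divide_le_eq)
    have b: "norm ((1 / r) *\<^sub>R (z' - z)) \<le> 1" using d r by (simp add: dist_norm norm_minus_commute divide_le_eq)
    have \<theta>: "1 \<le> r' / r" "r' / r \<le> 2" using d r by (simp_all add: divide_le_eq)
    show "\<bar>taylor_mean (\<lambda>y. V y $ i) z' r' x - taylor_mean (\<lambda>y. V y $ i) z r x\<bar>
        \<le> M * (r * ((1 / r) ^ CARD('n) * L1_trace_free_sym (ball z (4 * r)) G))"
      unfolding *[OF weak_pairD(4)[OF wp] r r'] L1_trace_free_sym_rescale[OF r, symmetric]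
      by (rule MV[OF wp' a b \<theta>])
    have "\<bar>\<integral>y. (r *\<^sub>R G (z + r *\<^sub>R y)) $ i $ j * ((1 / (r' / r)) ^ CARD('n) *
        kernel_op ((1 / (r' / r)) *\<^sub>R ((1 / r) *\<^sub>R (x - z) - (1 / r) *\<^sub>R (z' - z))) mollifier
          ((1 / (r' / r)) *\<^sub>R (y - (1 / r) *\<^sub>R (z' - z)))
        - kernel_op ((1 / r) *\<^sub>R (x - z)) mollifier y) \<partial>lborel\<bar>
      \<le> M * (r * ((1 / r) ^ CARD('n) * L1_trace_free_sym (ball z (4 * r)) G))"
      unfolding L1_trace_free_sym_rescale[OF r, symmetric] by (rule MG[OF wp' a b \<theta>])
    then have "r * \<bar>taylor_mean (\<lambda>y. G y $ i $ j) z' r' x - taylor_mean (\<lambda>y. G y $ i $ j) z r x\<bar>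
      \<le> r * (M * ((1 / r) ^ CARD('n) * L1_trace_free_sym (ball z (4 * r)) G))"
      unfolding *[OF weak_pairD(5)[OF wp] r r'] vector_scaleR_component real_scaleR_def mult.assoc[of r]
        integral_mult_right_zero abs_mult
      using r by (simp only: abs_of_pos mult.left_commute[of M])
    then show "\<bar>taylor_mean (\<lambda>y. G y $ i $ j) z' r' x - taylor_mean (\<lambda>y. G y $ i $ j) z r x\<bar>
        \<le> M * ((1 / r) ^ CARD('n) * L1_trace_free_sym (ball z (4 * r)) G)"
      using r by (simp only: mult_le_cancel_left_pos)
  qed
qed

lemma taylor_mean_center:
  fixes f :: "real ^ 'n \<Rightarrow> real"
  assumes r: "r > 0"
  shows "taylor_mean f x r x = (1 / r) ^ CARD('n) * (\<integral>y. f y * kernel_op 0 mollifier ((1 / r) *\<^sub>R (y - x)) \<partial>lborel)"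
proof -
  have "(\<integral>y. f y * kernel_op 0 mollifier ((1 / r) *\<^sub>R (y - x)) \<partial>lborel) =
    r ^ CARD('n) * (\<integral>y. f (x + r *\<^sub>R y) * kernel_op 0 mollifier y \<partial>lborel)"
    using r by (subst integral_lborel_affine[of r _ x]) auto
  then show ?thesis using r by (simp add: taylor_mean_def power_divide)
qed

lemma smooth_taylor_mean_center:
  assumes r: "r > 0" and f: "integrable lborel f"
  shows "smooth (\<lambda>x. taylor_mean f x r x)"
  unfolding taylor_mean_center[OF r]
  by (intro smooth_mult smooth_const smooth_convolution[OF f kernel_op_mollifier_bumps compact_cball])

text \<open>With the evaluation point at the centre the kernel is fixed and the mean is a
  convolution. Its derivative falls on the kernel and is moved to V by the weak identity, since the
  ball lies in \<open>U\<close>.\<close>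

lemma partial_taylor_mean_center:
  assumes wp: "weak_pair U V G" and r: "r > 0" and sub: "cball x r \<subseteq> U"
  shows "partial j (\<lambda>x. taylor_mean (\<lambda>y. V y $ i) x r x) x = taylor_mean (\<lambda>y. G y $ i $ j) x r x"
proof -
  let ?\<psi> = "kernel_op 0 mollifier :: real^'a \<Rightarrow> real"
  note \<psi> = kernel_op_mollifier_bumps[of "0 :: real^'a"]
  define \<phi> where "\<phi> = (\<lambda>y. ?\<psi> ((1 / r) *\<^sub>R (y - x)))"
  have \<phi>: "\<phi> \<in> bumps (cball x r)"
  proof (rule bumpsI)
    show "smooth \<phi>" unfolding \<phi>_def by (intro smooth_affine bumps_smooth[OF \<psi>])
    fix y assume "y \<notin> cball x r"
    then have "(1 / r) *\<^sub>R (y - x) \<notin> cball 0 1" using r by (simp add: dist_norm norm_minus_commute divide_le_eq)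
    then show "\<phi> y = 0" unfolding \<phi>_def by (rule bumps_zero[OF \<psi>])
  qed
  have V: "integrable lborel (\<lambda>y. V y $ i)" by (rule weak_pairD(4)[OF wp])
  have "partial j (\<lambda>x. taylor_mean (\<lambda>y. V y $ i) x r x) x =
    (1 / r) ^ CARD('a) * (- (1 / r) * (\<integral>y. V y $ i * partial j ?\<psi> ((1 / r) *\<^sub>R (y - x)) \<partial>lborel))"
    unfolding taylor_mean_center[OF r]
    by (simp only: partial_cmult[OF smooth_convolution[OF V \<psi> compact_cball]] partial_convolution[OF V \<psi> compact_cball])
  also have "(\<integral>y. V y $ i * partial j \<phi> y \<partial>lborel) = (1 / r) * (\<integral>y. V y $ i * partial j ?\<psi> ((1 / r) *\<^sub>R (y - x)) \<partial>lborel)"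
    unfolding \<phi>_def partial_affine[OF bumps_smooth[OF \<psi>]] by (simp add: mult.left_commute)
  then have "- (1 / r) * (\<integral>y. V y $ i * partial j ?\<psi> ((1 / r) *\<^sub>R (y - x)) \<partial>lborel) = (\<integral>y. G y $ i $ j * \<phi> y \<partial>lborel)"
    using weak_pairD(6)[OF wp compact_cball sub \<phi>, of i j] by simp
  finally show ?thesis unfolding taylor_mean_center[OF r] \<phi>_def .
qed

subsection \<open>Mollification and means in \<open>L\<^sup>2\<close>\<close>

text \<open>Induction over integrable functions. Open sets of finite measure are treated directly,
  measurable sets by outer regularity, and sums and limits by the stability of the property under
  approximation in L^1.\<close>

lemma L1_translation_continuous:
  fixes f :: "'a::euclidean_space \<Rightarrow> real"
  assumes "integrable lborel f" and "e > 0"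
  shows "\<exists>d>0. \<forall>h. norm h < d \<longrightarrow> (\<integral>x. \<bar>f (h + x) - f x\<bar> \<partial>lborel) < e"
proof -
  have trans: "integrable lborel (\<lambda>x. g (h + x))" "(\<integral>x. g (h + x) \<partial>lborel) = (\<integral>x. g x \<partial>lborel)"
    if "integrable lborel g" for g :: "'a \<Rightarrow> real" and h
    using integrable_lborel_affine[OF that, of 1 h] integral_lborel_affine[of 1 g h] by simp_all
  \<comment> \<open>f is compared with g at h + x and at x; by translation invariance both errors
    are the same integral, so three terms of at most e/4 occur.\<close>
  have approx: "\<exists>d>0. \<forall>h. norm h < d \<longrightarrow> (\<integral>x. \<bar>f (h + x) - f x\<bar> \<partial>lborel) < e"
    if f: "integrable lborel f" and g: "integrable lborel g" and e: "e > 0"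
      and fg: "(\<integral>x. \<bar>f x - g x\<bar> \<partial>lborel) \<le> e / 4"
      and gd: "\<exists>d>0. \<forall>h. norm h < d \<longrightarrow> (\<integral>x. \<bar>g (h + x) - g x\<bar> \<partial>lborel) < e / 4"
    for f g :: "'a \<Rightarrow> real" and e :: real
  proof -
    obtain d where d: "d > 0" "\<And>h. norm h < d \<Longrightarrow> (\<integral>x. \<bar>g (h + x) - g x\<bar> \<partial>lborel) < e / 4" using gd by blast
    have "(\<integral>x. \<bar>f (h + x) - f x\<bar> \<partial>lborel) < e" if h: "norm h < d" for h
    proof -
      have i: "integrable lborel (\<lambda>x. \<bar>f x - g x\<bar>)" using f g by simp
      have "(\<integral>x. \<bar>f (h + x) - f x\<bar> \<partial>lborel) \<le>
        (\<integral>x. \<bar>f (h + x) - g (h + x)\<bar> + \<bar>g (h + x) - g x\<bar> + \<bar>f x - g x\<bar> \<partial>lborel)"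
        using f g by (intro integral_mono) (auto intro!: Bochner_Integration.integrable_add integrable_abs Bochner_Integration.integrable_diff trans(1))
      also have "\<dots> = (\<integral>x. \<bar>f x - g x\<bar> \<partial>lborel) + (\<integral>x. \<bar>g (h + x) - g x\<bar> \<partial>lborel) + (\<integral>x. \<bar>f x - g x\<bar> \<partial>lborel)"
        using f g trans[OF i, of h] by (subst Bochner_Integration.integral_add, simp_all add: trans(1))+
      finally show ?thesis using fg d(2)[OF h] e by linarith
    qed
    with d(1) show ?thesis by blast
  qed
  have "\<forall>e>0. \<exists>d>0. \<forall>h. norm h < d \<longrightarrow> (\<integral>x. \<bar>f (h + x) - f x\<bar> \<partial>lborel) < e"
    using assms(1)
  proof (induction rule: integrable_induct)
    case (base A c)
    have iA: "integrable lborel (indicator A :: 'a \<Rightarrow> real)" using base by simp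
    have opn: "\<exists>d>0. \<forall>h. norm h < d \<longrightarrow> (\<integral>x. \<bar>indicat_real U (h + x) - indicator U x\<bar> \<partial>lborel) < e"
      if U: "open U" "emeasure lborel U < \<infinity>" and e: "e > 0" for U :: "'a set" and e :: real
    proof (rule ccontr)
      assume "\<not> ?thesis"
      then have "\<forall>d>0. \<exists>h. norm h < d \<and> e \<le> (\<integral>x. \<bar>indicat_real U (h + x) - indicator U x\<bar> \<partial>lborel)"
        by (metis not_less)
      then have "\<exists>h. norm h < 1 / real (Suc n) \<and> e \<le> (\<integral>x. \<bar>indicat_real U (h + x) - indicator U x\<bar> \<partial>lborel)" for n
        by simp
      then obtain h where h: "\<And>n. norm (h n) < 1 / real (Suc n)"
        "\<And>n. e \<le> (\<integral>x. \<bar>indicat_real U (h n + x) - indicator U x\<bar> \<partial>lborel)" by metis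
      have h0: "h \<longlonglongrightarrow> 0"
        by (rule Lim_null_comparison[OF _ LIMSEQ_inverse_real_of_nat])
          (use h(1) in \<open>auto simp: inverse_eq_divide less_imp_le\<close>)
      have iU: "integrable lborel (indicator U :: 'a \<Rightarrow> real)" using U by simp
      have iUU: "integrable lborel (\<lambda>x. indicat_real U (k + x) * indicator U x)" for k :: 'a
      proof (rule Bochner_Integration.integrable_bound[OF iU])
        have [measurable]: "U \<in> sets borel" using U by simp
        show "(\<lambda>x. indicat_real U (k + x) * indicator U x) \<in> borel_measurable lborel" by measurable
      qed (auto simp: indicator_def)
      \<comment> \<open>The product of the two indicators is dominated by the indicator of U and
        converges to it, because U is open. The difference follows from |p - q| = p + q - 2 p q for
        indicators, where p and q have the same integral.\<close>
      have "(\<lambda>n. \<integral>x. indicat_real U (h n + x) * indicator U x \<partial>lborel) \<longlonglongrightarrow> (\<integral>x. indicator U x \<partial>lborel)"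
      proof (rule integral_dominated_convergence[OF _ _ iU])
        show "AE x in lborel. (\<lambda>n. indicat_real U (h n + x) * indicator U x) \<longlonglongrightarrow> indicator U x"
        proof (rule AE_I2)
          fix x
          show "(\<lambda>n. indicat_real U (h n + x) * indicator U x) \<longlonglongrightarrow> indicator U x"
          proof (cases "x \<in> U")
            case True
            have "(\<lambda>n. h n + x) \<longlonglongrightarrow> x" using tendsto_add[OF h0 tendsto_const, of x] by simp
            then have "eventually (\<lambda>n. h n + x \<in> U) sequentially"
              using topological_tendstoD U(1) True by blast
            then show ?thesis using True by (auto intro!: tendsto_eventually elim!: eventually_mono)
          qed simp
        qed
      next
        show "AE x in lborel. norm (indicat_real U (h n + x) * indicator U x) \<le> indicator U x" for n
          by (auto simp: indicator_def)
      qed (use borel_measurable_integrable[OF iUU] borel_measurable_integrable[OF iU] in auto)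
      then have "(\<lambda>n. 2 * (\<integral>x. indicator U x \<partial>lborel) - 2 * (\<integral>x. indicat_real U (h n + x) * indicator U x \<partial>lborel)) \<longlonglongrightarrow>
        2 * (\<integral>x. indicator U x \<partial>lborel) - 2 * (\<integral>x. indicat_real U x \<partial>lborel)"
        by (intro tendsto_intros)
      moreover have "2 * (\<integral>x. indicator U x \<partial>lborel) - 2 * (\<integral>x. indicat_real U (h n + x) * indicator U x \<partial>lborel)
        = (\<integral>x. \<bar>indicat_real U (h n + x) - indicator U x\<bar> \<partial>lborel)" for n
      proof -
        have "(\<integral>x. \<bar>indicat_real U (h n + x) - indicator U x\<bar> \<partial>lborel) =
          (\<integral>x. indicator U (h n + x) + indicator U x - 2 * (indicator U (h n + x) * indicator U x) \<partial>lborel)"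
          by (intro Bochner_Integration.integral_cong refl) (auto simp: indicator_def)
        also have "\<dots> = (\<integral>x. indicator U (h n + x) \<partial>lborel) + (\<integral>x. indicator U x \<partial>lborel)
            - 2 * (\<integral>x. indicat_real U (h n + x) * indicator U x \<partial>lborel)"
          using iUU[of "h n"] trans(1)[OF iU, of "h n"] iU by (simp only: Bochner_Integration.integral_diff
              Bochner_Integration.integral_add Bochner_Integration.integrable_add integrable_mult_right integral_mult_right_zero)
        finally show ?thesis using trans(2)[OF iU, of "h n"] by simp
      qed
      ultimately have "(\<lambda>n. (\<integral>x. \<bar>indicat_real U (h n + x) - indicator U x\<bar> \<partial>lborel)) \<longlonglongrightarrow> 0"
        by simp
      then have "e \<le> 0" by (rule LIMSEQ_le_const) (use h(2) in auto)
      with e show False by simp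
    qed
    have ind: "\<exists>d>0. \<forall>h. norm h < d \<longrightarrow> (\<integral>x. \<bar>indicat_real A (h + x) - indicator A x\<bar> \<partial>lborel) < e"
      if e: "e > 0" for e :: real
    proof -
      have Ab: "A \<in> sets borel" using base by simp
      obtain U where U: "open U" "A \<subseteq> U" "emeasure lborel (U - A) < ennreal (e / 4)"
        using outer_regular_lborel[OF Ab, of "e / 4"] e by auto
      have "emeasure lborel U \<le> emeasure lborel A + emeasure lborel (U - A)"
        using U Ab emeasure_subadditive[of A lborel "U - A"] by (simp add: Un_absorb1)
      also have "\<dots> < \<infinity>" using base(2) U(3) by (simp add: order_less_trans[OF U(3)])
      finally have fin: "emeasure lborel U < \<infinity>" .
      have iU: "integrable lborel (indicator U :: 'a \<Rightarrow> real)" using U fin by simp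
      have "(\<integral>x. \<bar>indicator A x - indicator U x\<bar> \<partial>lborel) = (\<integral>x. indicat_real (U - A) x \<partial>lborel)"
        using U(2) by (intro Bochner_Integration.integral_cong refl) (auto simp: indicator_def)
      also have "\<dots> = measure lborel (U - A)" by simp
      also have "\<dots> \<le> e / 4"
        unfolding measure_def using U(3) e by (intro enn2real_leI) auto
      finally show ?thesis using approx[OF iA iU e _ opn[OF U(1) fin, of "e/4"]] e by simp
    qed
    show ?case
    proof (intro allI impI)
      fix e :: real assume e: "e > 0"
      have "e / (1 + \<bar>c\<bar>) > 0" using e by simp
      from ind[OF this] obtain d where d: "d > 0" "\<And>h. norm h < d \<Longrightarrow>
        (\<integral>x. \<bar>indicat_real A (h + x) - indicator A x\<bar> \<partial>lborel) < e / (1 + \<bar>c\<bar>)" by blast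
      have "(\<integral>x. \<bar>indicator A (h + x) *\<^sub>R c - indicator A x *\<^sub>R c\<bar> \<partial>lborel) < e" if h: "norm h < d" for h
      proof -
        have "(\<integral>x. \<bar>indicator A (h + x) *\<^sub>R c - indicator A x *\<^sub>R c\<bar> \<partial>lborel) =
          (\<integral>x. \<bar>indicator A (h + x) - indicator A x\<bar> * \<bar>c\<bar> \<partial>lborel)"
          by (intro Bochner_Integration.integral_cong refl) (simp add: abs_mult[symmetric] left_diff_distrib)
        also have "\<dots> \<le> (e / (1 + \<bar>c\<bar>)) * \<bar>c\<bar>"
          using mult_right_mono[OF less_imp_le[OF d(2)[OF h]], of "\<bar>c\<bar>"] by simp
        also have "\<dots> < e" using e by (simp add: field_simps)
        finally show ?thesis .
      qed
      with d(1) show "\<exists>d>0. \<forall>h. norm h < d \<longrightarrow> (\<integral>x. \<bar>indicator A (h + x) *\<^sub>R c - indicator A x *\<^sub>R c\<bar> \<partial>lborel) < e" by blast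
    qed
  next
    case (add f g)
    show ?case
    proof (intro allI impI)
      fix e :: real assume e: "e > 0"
      then have e2: "e / 2 > 0" by simp
      obtain d1 where d1: "d1 > 0" "\<And>h. norm h < d1 \<Longrightarrow> (\<integral>x. \<bar>f (h + x) - f x\<bar> \<partial>lborel) < e / 2"
        using add e2 by blast
      obtain d2 where d2: "d2 > 0" "\<And>h. norm h < d2 \<Longrightarrow> (\<integral>x. \<bar>g (h + x) - g x\<bar> \<partial>lborel) < e / 2"
        using add e2 by blast
      have "(\<integral>x. \<bar>f (h + x) + g (h + x) - (f x + g x)\<bar> \<partial>lborel) < e" if h: "norm h < min d1 d2" for h
      proof -
        have "(\<integral>x. \<bar>f (h + x) + g (h + x) - (f x + g x)\<bar> \<partial>lborel) \<le> (\<integral>x. \<bar>f (h + x) - f x\<bar> + \<bar>g (h + x) - g x\<bar> \<partial>lborel)"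
          using add by (intro integral_mono) (auto intro!: Bochner_Integration.integrable_add integrable_abs Bochner_Integration.integrable_diff trans(1))
        also have "\<dots> = (\<integral>x. \<bar>f (h + x) - f x\<bar> \<partial>lborel) + (\<integral>x. \<bar>g (h + x) - g x\<bar> \<partial>lborel)"
          using add by (intro Bochner_Integration.integral_add) (auto intro!: integrable_abs Bochner_Integration.integrable_diff trans(1))
        finally show ?thesis using d1(2)[of h] d2(2)[of h] h by simp
      qed
      then show "\<exists>d>0. \<forall>h. norm h < d \<longrightarrow> (\<integral>x. \<bar>f (h + x) + g (h + x) - (f x + g x)\<bar> \<partial>lborel) < e"
        using d1(1) d2(1) by (intro exI[of _ "min d1 d2"]) auto
    qed
  next
    case (lim f s)
    show ?case
    proof (intro allI impI)
      fix e :: real assume e: "e > 0"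
      have "(\<lambda>i. \<integral>x. \<bar>f x - s i x\<bar> \<partial>lborel) \<longlonglongrightarrow> (\<integral>x. (0::real) \<partial>(lborel :: 'a measure))"
      proof (rule integral_dominated_convergence[where w = "\<lambda>x. 3 * \<bar>f x\<bar>"])
        show "AE x in lborel. (\<lambda>i. \<bar>f x - s i x\<bar>) \<longlonglongrightarrow> 0"
        proof (rule AE_I2)
          fix x
          have "(\<lambda>i. f x - s i x) \<longlonglongrightarrow> f x - f x" by (intro tendsto_intros lim.hyps(2)) simp
          then show "(\<lambda>i. \<bar>f x - s i x\<bar>) \<longlonglongrightarrow> 0" by (simp add: tendsto_rabs_zero)
        qed
        show "AE x in lborel. norm \<bar>f x - s i x\<bar> \<le> 3 * \<bar>f x\<bar>" for i
        proof (rule AE_I2)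
          fix x show "norm \<bar>f x - s i x\<bar> \<le> 3 * \<bar>f x\<bar>" using lim.hyps(3)[of x i] by simp
        qed
        show "(\<lambda>x. \<bar>f x - s i x\<bar>) \<in> borel_measurable lborel" for i
          using borel_measurable_integrable[OF lim.hyps(1)[of i]] borel_measurable_integrable[OF lim.hyps(4)] by measurable
      qed (use lim.hyps(4) in auto)
      then have "eventually (\<lambda>i. (\<integral>x. \<bar>f x - s i x\<bar> \<partial>lborel) < e / 4) sequentially"
        using order_tendstoD(2)[of _ 0 sequentially "e / 4"] e by simp
      then obtain i where "(\<integral>x. \<bar>f x - s i x\<bar> \<partial>lborel) < e / 4"
        by (meson eventually_happens trivial_limit_sequentially)
      then show "\<exists>d>0. \<forall>h. norm h < d \<longrightarrow> (\<integral>x. \<bar>f (h + x) - f x\<bar> \<partial>lborel) < e"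
        by (intro approx[OF lim.hyps(4) lim.hyps(1)[of i] e] less_imp_le lim.IH[of i, rule_format]) (use e in auto)
    qed
  qed
  with assms(2) show ?thesis by blast
qed

text \<open>After exchanging the integrals, the inner one is the L^1 distance of f from its
  translate by r y with |y| \<le> 1, which is uniformly small. The kernel may change sign, so the
  integral of its absolute value enters the choice of \<open>d\<close>.\<close>

lemma approximate_identity_L1:
  fixes f \<phi> :: "real ^ 'n \<Rightarrow> real"
  assumes f: "integrable lborel f" and \<phi>: "\<phi> \<in> bumps (cball 0 1)" "(\<integral>y. \<phi> y \<partial>lborel) = 1" and e: "e > 0"
  shows "\<exists>d>0. \<forall>r. \<bar>r\<bar> < d \<longrightarrow>
    (\<integral>\<^sup>+x. ennreal \<bar>(\<integral>y. f (x + r *\<^sub>R y) * \<phi> y \<partial>lborel) - f x\<bar> \<partial>lborel) < ennreal e"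
proof -
  have [measurable]: "f \<in> borel_measurable borel" using f by auto
  have [measurable]: "\<phi> \<in> borel_measurable borel" by (rule smooth_borel[OF bumps_smooth[OF \<phi>(1)]])
  have i\<phi>: "integrable lborel \<phi>" by (rule integrable_bumps[OF \<phi>(1) compact_cball])
  define C where "C = (\<integral>y. \<bar>\<phi> y\<bar> \<partial>lborel)"
  have C: "C \<ge> 0" by (simp add: C_def)
  have "e / (1 + C) > 0" using e C by simp
  then obtain d where d: "d > 0" "\<And>h. norm h < d \<Longrightarrow> (\<integral>x. \<bar>f (h + x) - f x\<bar> \<partial>lborel) < e / (1 + C)"
    using L1_translation_continuous[OF f] by blast
  have "(\<integral>\<^sup>+x. ennreal \<bar>(\<integral>y. f (x + r *\<^sub>R y) * \<phi> y \<partial>lborel) - f x\<bar> \<partial>lborel) < ennreal e" if r: "\<bar>r\<bar> < d" for r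
  proof (cases "r = 0")
    case True
    then show ?thesis using \<phi>(2) e by simp
  next
    case r0: False
    have "ennreal \<bar>(\<integral>y. f (x + r *\<^sub>R y) * \<phi> y \<partial>lborel) - f x\<bar> \<le> (\<integral>\<^sup>+y. ennreal (\<bar>f (x + r *\<^sub>R y) - f x\<bar> * \<bar>\<phi> y\<bar>) \<partial>lborel)" for x
    proof -
      have i1: "integrable lborel (\<lambda>y. f (x + r *\<^sub>R y) * \<phi> y)"
        using integrable_mult_bumps[OF integrable_lborel_affine[OF f r0, of x] \<phi>(1) compact_cball, of 1 0] by simp
      have i2: "integrable lborel (\<lambda>y. f x * \<phi> y)" using i\<phi> by simp
      have "(\<integral>y. f (x + r *\<^sub>R y) * \<phi> y \<partial>lborel) - f x = (\<integral>y. f (x + r *\<^sub>R y) * \<phi> y - f x * \<phi> y \<partial>lborel)"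
        using Bochner_Integration.integral_diff[OF i1 i2] \<phi>(2) by simp
      also have "ennreal \<bar>\<dots>\<bar> \<le> (\<integral>\<^sup>+y. ennreal \<bar>f (x + r *\<^sub>R y) * \<phi> y - f x * \<phi> y\<bar> \<partial>lborel)"
        using integral_norm_bound_ennreal[OF Bochner_Integration.integrable_diff[OF i1 i2]] by simp
      finally show ?thesis by (simp add: abs_mult[symmetric] left_diff_distrib)
    qed
    then have "(\<integral>\<^sup>+x. ennreal \<bar>(\<integral>y. f (x + r *\<^sub>R y) * \<phi> y \<partial>lborel) - f x\<bar> \<partial>lborel) \<le>
      (\<integral>\<^sup>+x. (\<integral>\<^sup>+y. ennreal (\<bar>f (x + r *\<^sub>R y) - f x\<bar> * \<bar>\<phi> y\<bar>) \<partial>lborel) \<partial>lborel)"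
      by (intro nn_integral_mono) auto
    also have "\<dots> = (\<integral>\<^sup>+y. (\<integral>\<^sup>+x. ennreal (\<bar>f (x + r *\<^sub>R y) - f x\<bar> * \<bar>\<phi> y\<bar>) \<partial>lborel) \<partial>lborel)"
      by (rule lborel_pair.Fubini') measurable
    also have "\<dots> \<le> (\<integral>\<^sup>+y. ennreal ((e / (1 + C)) * \<bar>\<phi> y\<bar>) \<partial>lborel)"
    proof (rule nn_integral_mono)
      fix y :: "real^'n"
      show "(\<integral>\<^sup>+x. ennreal (\<bar>f (x + r *\<^sub>R y) - f x\<bar> * \<bar>\<phi> y\<bar>) \<partial>lborel) \<le> ennreal ((e / (1 + C)) * \<bar>\<phi> y\<bar>)"
      proof (cases "y \<in> cball 0 1")
        case True
        then have "norm (r *\<^sub>R y) \<le> \<bar>r\<bar> * 1" unfolding norm_scaleR by (intro mult_left_mono) auto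
        then have h: "norm (r *\<^sub>R y) < d" using r by simp
        have i: "integrable lborel (\<lambda>x. \<bar>f (x + r *\<^sub>R y) - f x\<bar>)"
          using integrable_lborel_affine[OF f, of 1 "r *\<^sub>R y"] f by (simp add: add.commute)
        have "(\<integral>\<^sup>+x. ennreal (\<bar>f (x + r *\<^sub>R y) - f x\<bar> * \<bar>\<phi> y\<bar>) \<partial>lborel) = ennreal (\<integral>x. \<bar>f (x + r *\<^sub>R y) - f x\<bar> * \<bar>\<phi> y\<bar> \<partial>lborel)"
          using i by (intro nn_integral_eq_integral) auto
        also have "\<dots> \<le> ennreal ((e / (1 + C)) * \<bar>\<phi> y\<bar>)"
          using mult_right_mono[OF less_imp_le[OF d(2)[OF h]], of "\<bar>\<phi> y\<bar>"] by (intro ennreal_leI) (simp add: add.commute)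
        finally show ?thesis .
      qed (simp add: bumps_zero[OF \<phi>(1)])
    qed
    also have "\<dots> = ennreal ((e / (1 + C)) * C)"
      unfolding C_def using i\<phi> e C by (subst nn_integral_eq_integral) (auto simp: C_def)
    also have "\<dots> < ennreal e"
      using e C by (intro ennreal_lessI) (auto simp: field_simps)
    finally show ?thesis .
  qed
  with d(1) show ?thesis by blast
qed

text \<open>Cauchy-Schwarz on the ball gives one factor of its volume, the exchange of integrals the
  other. The ball is encoded by an indicator of \<open>dist x y\<close>, which is symmetric and
  jointly measurable in both points.\<close>

lemma ball_mean_L2:
  fixes h :: "'a::euclidean_space \<Rightarrow> ennreal"
  assumes [measurable]: "h \<in> borel_measurable borel" "S \<in> sets borel" "T \<in> sets borel"
    and ST: "\<And>x y. x \<in> S \<Longrightarrow> dist x y < t \<Longrightarrow> y \<in> T"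
  shows "(\<integral>\<^sup>+x. indicator S x * (\<integral>\<^sup>+y. indicator {..<t} (dist x y) * h y \<partial>lborel)\<^sup>2 \<partial>lborel)
    \<le> (emeasure lborel (ball (0::'a) t))\<^sup>2 * (\<integral>\<^sup>+y. indicator T y * (h y)\<^sup>2 \<partial>lborel)"
proof -
  let ?m = "emeasure lborel (ball (0::'a) t)"
  have ball: "(\<integral>\<^sup>+y. indicator {..<t} (dist x y) \<partial>lborel) = ?m" for x :: 'a
  proof -
    have "(\<integral>\<^sup>+y. indicator {..<t} (dist x y) \<partial>lborel) = (\<integral>\<^sup>+y. indicator (ball x t) y \<partial>lborel)"
      by (intro nn_integral_cong) (auto simp: indicator_def)
    also have "\<dots> = ?m" by (cases "t \<ge> 0") (auto simp: emeasure_ball not_le ball_empty less_imp_le)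
    finally show ?thesis .
  qed
  have CS: "(\<integral>\<^sup>+y. indicator {..<t} (dist x y) * h y \<partial>lborel)\<^sup>2 \<le> ?m * (\<integral>\<^sup>+y. indicator {..<t} (dist x y) * (h y)\<^sup>2 \<partial>lborel)" for x
  proof -
    have "(\<integral>\<^sup>+y. indicator {..<t} (dist x y) * h y \<partial>lborel)\<^sup>2 =
      (\<integral>\<^sup>+y. indicator {..<t} (dist x y) * (indicator {..<t} (dist x y) * h y) \<partial>lborel)\<^sup>2"
      by (intro arg_cong[where f="\<lambda>x. x\<^sup>2"] nn_integral_cong) (auto simp: indicator_def)
    also have "\<dots> \<le> (\<integral>\<^sup>+y. (indicator {..<t} (dist x y))\<^sup>2 \<partial>lborel) * (\<integral>\<^sup>+y. (indicator {..<t} (dist x y) * h y)\<^sup>2 \<partial>lborel)"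
      by (rule Cauchy_Schwarz_nn_integral) auto
    also have "(\<integral>\<^sup>+y. (indicator {..<t} (dist x y) :: ennreal)\<^sup>2 \<partial>lborel) = (\<integral>\<^sup>+y. indicator {..<t} (dist x y) \<partial>lborel)"
      by (intro nn_integral_cong) (auto simp: indicator_def)
    also have "(\<integral>\<^sup>+y. (indicator {..<t} (dist x y) * h y)\<^sup>2 \<partial>lborel) = (\<integral>\<^sup>+y. indicator {..<t} (dist x y) * (h y)\<^sup>2 \<partial>lborel)"
      by (intro nn_integral_cong) (auto simp: indicator_def)
    finally show ?thesis unfolding ball .
  qed
  have "(\<integral>\<^sup>+x. indicator S x * (\<integral>\<^sup>+y. indicator {..<t} (dist x y) * h y \<partial>lborel)\<^sup>2 \<partial>lborel)
    \<le> (\<integral>\<^sup>+x. indicator S x * (?m * (\<integral>\<^sup>+y. indicator {..<t} (dist x y) * (h y)\<^sup>2 \<partial>lborel)) \<partial>lborel)"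
    by (intro nn_integral_mono mult_left_mono CS) auto
  also have "\<dots> = (\<integral>\<^sup>+x. (\<integral>\<^sup>+y. ?m * (indicator S x * (indicator {..<t} (dist x y) * (h y)\<^sup>2)) \<partial>lborel) \<partial>lborel)"
    by (simp add: nn_integral_cmult mult_ac)
  also have "\<dots> \<le> (\<integral>\<^sup>+x. (\<integral>\<^sup>+y. ?m * (indicator {..<t} (dist y x) * (indicator T y * (h y)\<^sup>2)) \<partial>lborel) \<partial>lborel)"
    by (intro nn_integral_mono mult_left_mono) (auto simp: indicator_def dist_commute ST)
  also have "\<dots> = (\<integral>\<^sup>+y. (\<integral>\<^sup>+x. ?m * (indicator {..<t} (dist y x) * (indicator T y * (h y)\<^sup>2)) \<partial>lborel) \<partial>lborel)"
    by (rule lborel_pair.Fubini') measurable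
  also have "\<dots> = (\<integral>\<^sup>+y. ?m * (?m * (indicator T y * (h y)\<^sup>2)) \<partial>lborel)"
    by (simp add: nn_integral_cmult nn_integral_multc ball)
  also have "\<dots> = ?m\<^sup>2 * (\<integral>\<^sup>+y. indicator T y * (h y)\<^sup>2 \<partial>lborel)"
  proof -
    have "(\<integral>\<^sup>+y. ?m * (?m * (indicator T y * (h y)\<^sup>2)) \<partial>lborel) = ?m * (\<integral>\<^sup>+y. ?m * (indicator T y * (h y)\<^sup>2) \<partial>lborel)"
      by (rule nn_integral_cmult) measurable
    also have "(\<integral>\<^sup>+y. ?m * (indicator T y * (h y)\<^sup>2) \<partial>lborel) = ?m * (\<integral>\<^sup>+y. indicator T y * (h y)\<^sup>2 \<partial>lborel)"
      by (rule nn_integral_cmult) measurable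
    finally show ?thesis by (simp only: power2_eq_square mult.assoc)
  qed
  finally show ?thesis .
qed

lemma norm_matrix_sq: "(norm (A :: real ^ 'n ^ 'm))\<^sup>2 = (\<Sum>i\<in>UNIV. \<Sum>j\<in>UNIV. (A $ i $ j)\<^sup>2)"
  by (simp add: norm_vec_def L2_set_def sum_nonneg)

text \<open>The products A_ij A_ji and A_ii A_jj are kept apart because for the Jacobian of a
  compactly supported field both sums have the same integral.\<close>

lemma norm_trace_free_sym_sq:
  fixes A :: "real ^ 'n ^ 'n"
  shows "2 * (norm (trace_free_sym A))\<^sup>2 = (norm A)\<^sup>2 + (\<Sum>i\<in>UNIV. \<Sum>j\<in>UNIV. A $ i $ j * A $ j $ i)
    - 2 / real CARD('n) * (\<Sum>i\<in>UNIV. \<Sum>j\<in>UNIV. A $ i $ i * A $ j $ j)"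
proof -
  let ?n = "real CARD('n)"
  define t where "t = (\<Sum>m\<in>UNIV. A $ m $ m)"
  define g where "g i = t\<^sup>2 / ?n\<^sup>2 - 2 * t / ?n * (A $ i $ i)" for i
  have 1: "(trace_free_sym A $ i $ j)\<^sup>2 = ((A $ i $ j)\<^sup>2 + (A $ j $ i)\<^sup>2) / 4 + (A $ i $ j * A $ j $ i) / 2
      + (if i = j then g i else 0)" for i j
    unfolding trace_free_sym_component t_def[symmetric] g_def by (simp add: power2_eq_square field_simps)
  have 2: "(\<Sum>i\<in>UNIV. \<Sum>j\<in>UNIV. (A $ j $ i)\<^sup>2) = (norm A)\<^sup>2"
    unfolding norm_matrix_sq by (rule sum.swap)
  have 3: "(\<Sum>i\<in>UNIV. \<Sum>j\<in>UNIV. A $ i $ i * A $ j $ j) = t\<^sup>2"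
    by (simp add: t_def power2_eq_square sum_product)
  have 4: "(\<Sum>i\<in>(UNIV::'n set). g i) = - t\<^sup>2 / ?n"
  proof -
    have "(\<Sum>i\<in>(UNIV::'n set). 2 * t / ?n * (A $ i $ i)) = 2 * t / ?n * t"
      by (subst sum_distrib_left[symmetric]) (simp only: t_def[symmetric])
    moreover have "(\<Sum>i\<in>(UNIV::'n set). t\<^sup>2 / ?n\<^sup>2) = t\<^sup>2 / ?n"
      by (simp add: power2_eq_square)
    moreover have "2 * t / ?n * t = 2 * (t\<^sup>2 / ?n)" by (simp add: power2_eq_square)
    ultimately have "(\<Sum>i\<in>(UNIV::'n set). t\<^sup>2 / ?n\<^sup>2) - (\<Sum>i\<in>(UNIV::'n set). 2 * t / ?n * (A $ i $ i)) = - t\<^sup>2 / ?n"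
      by linarith
    then show ?thesis by (simp only: g_def sum_subtractf[of "\<lambda>i. t\<^sup>2 / ?n\<^sup>2" "\<lambda>i. 2 * t / ?n * (A $ i $ i)"])
  qed
  have "(norm (trace_free_sym A))\<^sup>2 = ((norm A)\<^sup>2 + (norm A)\<^sup>2) / 4 + (\<Sum>i\<in>UNIV. \<Sum>j\<in>UNIV. A $ i $ j * A $ j $ i) / 2 - t\<^sup>2 / ?n"
    unfolding norm_matrix_sq[of "trace_free_sym A"] 1
    by (simp add: sum.distrib add_divide_distrib[symmetric] sum_divide_distrib[symmetric] 2 norm_matrix_sq[symmetric] 4)
  then show ?thesis unfolding 3 by simp
qed

subsection \<open>The local estimate\<close>

lemma integral_by_parts_bumps:
  assumes f: "f \<in> bumps K" "compact K" and g: "smooth g"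
  shows "(\<integral>x. partial j f x * g x \<partial>lborel) = - (\<integral>x. f x * partial j g x \<partial>lborel)"
proof -
  have b: "(\<lambda>x. f x * g x) \<in> bumps K" by (rule bumps_mult_left[OF f(1) g])
  have b1: "(\<lambda>x. partial j f x * g x) \<in> bumps K"
    by (rule bumps_mult_left[OF bumps_partial[OF f(1) compact_imp_closed[OF f(2)]] g])
  have b2: "(\<lambda>x. f x * partial j g x) \<in> bumps K"
    by (rule bumps_mult_left[OF f(1) smooth_partial[OF g]])
  have "0 = (\<integral>x. partial j (\<lambda>x. f x * g x) x \<partial>lborel)"
    by (rule integral_partial_bumps_0[OF b f(2), symmetric])
  also have "\<dots> = (\<integral>x. partial j f x * g x \<partial>lborel) + (\<integral>x. f x * partial j g x \<partial>lborel)"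
    unfolding partial_mult[OF bumps_smooth[OF f(1)] g]
    by (intro Bochner_Integration.integral_add integrable_bumps[OF b1 f(2)] integrable_bumps[OF b2 f(2)])
  finally show ?thesis by simp
qed

section \<open>Korn and Caccioppoli inequalities for smooth fields\<close>

definition jacobian_of :: "('n \<Rightarrow> real ^ 'n \<Rightarrow> real) \<Rightarrow> real ^ 'n \<Rightarrow> real ^ 'n ^ 'n" where
  "jacobian_of w x = (\<chi> i j. partial j (w i) x)"

lemma jacobian_of_component [simp]: "jacobian_of w x $ i $ j = partial j (w i) x"
  by (simp add: jacobian_of_def)

lemma continuous_on_jacobian_of:
  assumes "\<And>i. smooth (w i)" shows "continuous_on S (jacobian_of w)"
  unfolding jacobian_of_def[abs_def] 
  by (intro continuous_on_vec_lambda smooth_continuous_on smooth_partial assms)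

lemma integrable_compact_continuous:
  fixes f :: "'a::euclidean_space \<Rightarrow> real"
  assumes "compact K" "continuous_on K f"
  shows "integrable lborel (\<lambda>x. indicator K x * f x)"
  using borel_integrable_compact[OF assms] by simp

text \<open>Two integrations by parts turn the products D_j w_i D_i w_j into D_i w_i D_j w_j. Twice
  the integral of |L|^2 is therefore that of |Dw|^2 plus (1 - 2/n) times that of (div w)^2, and the
  second term is nonnegative for n \<ge> 2.\<close>

lemma korn_bumps:
  fixes w :: "'n \<Rightarrow> real ^ 'n \<Rightarrow> real"
  assumes n: "CARD('n) \<ge> 2" and w: "\<And>i. w i \<in> bumps K" and K: "compact K"
  shows "integrable lborel (\<lambda>x. (norm (jacobian_of w x))\<^sup>2)"
    and "integrable lborel (\<lambda>x. (norm (trace_free_sym (jacobian_of w x)))\<^sup>2)"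
    and "(\<integral>x. (norm (jacobian_of w x))\<^sup>2 \<partial>lborel) \<le> 2 * (\<integral>x. (norm (trace_free_sym (jacobian_of w x)))\<^sup>2 \<partial>lborel)"
proof -
  note Kc = compact_imp_closed[OF K]
  note sw = bumps_smooth[OF w]
  have bp: "partial j (w i) \<in> bumps K" for i j by (rule bumps_partial[OF w Kc])
  have int: "integrable lborel (\<lambda>x. partial j (w i) x * partial l (w k) x)" for i j k l
    by (intro integrable_bumps[OF bumps_mult_left[OF bp smooth_partial[OF sw]] K])
  have swap: "(\<integral>x. partial j (w i) x * partial i (w j) x \<partial>lborel) = (\<integral>x. partial i (w i) x * partial j (w j) x \<partial>lborel)" for i j
    using integral_by_parts_bumps[OF w K smooth_partial[OF sw], of j i i j]
      integral_by_parts_bumps[OF w K smooth_partial[OF sw], of i i j j] partial_commute[OF sw, of i j j] by simp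
  have z: "jacobian_of w x = 0" if "x \<notin> K" for x
    using bumps_zero[OF bp that] by (simp add: vec_eq_iff)
  have e1: "(\<lambda>x. (norm (jacobian_of w x))\<^sup>2) = (\<lambda>x. indicator K x * (norm (jacobian_of w x))\<^sup>2)"
    using z by (auto simp: indicator_def fun_eq_iff)
  show 1: "integrable lborel (\<lambda>x. (norm (jacobian_of w x))\<^sup>2)"
    by (subst e1) (intro integrable_compact_continuous K continuous_intros continuous_on_jacobian_of sw)
  have e2: "(\<lambda>x. (norm (trace_free_sym (jacobian_of w x)))\<^sup>2) = (\<lambda>x. indicator K x * (norm (trace_free_sym (jacobian_of w x)))\<^sup>2)"
    using z by (auto simp: indicator_def fun_eq_iff linear_0[OF linear_trace_free_sym])
  show 2: "integrable lborel (\<lambda>x. (norm (trace_free_sym (jacobian_of w x)))\<^sup>2)"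
    by (subst e2) (intro integrable_compact_continuous K continuous_intros
      bounded_linear.continuous_on[OF bounded_linear_trace_free_sym] continuous_on_jacobian_of sw)
  define T where "T x = (\<Sum>i\<in>UNIV. \<Sum>j\<in>UNIV. partial i (w i) x * partial j (w j) x)" for x
  have T: "T x = (\<Sum>i\<in>UNIV. partial i (w i) x)\<^sup>2" for x
    by (simp add: T_def power2_eq_square sum_product)
  have iT: "integrable lborel T" unfolding T_def[abs_def] by (simp add: int)
  have "2 * (\<integral>x. (norm (trace_free_sym (jacobian_of w x)))\<^sup>2 \<partial>lborel) = (\<integral>x. 2 * (norm (trace_free_sym (jacobian_of w x)))\<^sup>2 \<partial>lborel)" by simp
  also have "\<dots> = (\<integral>x. (norm (jacobian_of w x))\<^sup>2 + (\<Sum>i\<in>UNIV. \<Sum>j\<in>UNIV. partial j (w i) x * partial i (w j) x)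
    - 2 / real CARD('n) * T x \<partial>lborel)"
    unfolding norm_trace_free_sym_sq T_def by simp
  also have "\<dots> = (\<integral>x. (norm (jacobian_of w x))\<^sup>2 \<partial>lborel) + (\<Sum>i\<in>UNIV. \<Sum>j\<in>UNIV. \<integral>x. partial j (w i) x * partial i (w j) x \<partial>lborel)
    - 2 / real CARD('n) * (\<integral>x. T x \<partial>lborel)"
    using 1 iT by (simp add: int)
  also have "(\<Sum>i\<in>UNIV. \<Sum>j\<in>UNIV. \<integral>x. partial j (w i) x * partial i (w j) x \<partial>lborel) = (\<integral>x. T x \<partial>lborel)"
    unfolding swap T_def by (simp add: int)
  finally have "2 * (\<integral>x. (norm (trace_free_sym (jacobian_of w x)))\<^sup>2 \<partial>lborel) =
    (\<integral>x. (norm (jacobian_of w x))\<^sup>2 \<partial>lborel) + (1 - 2 / real CARD('n)) * (\<integral>x. T x \<partial>lborel)"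
    by (simp add: algebra_simps)
  moreover have "(1 - 2 / real CARD('n)) * (\<integral>x. T x \<partial>lborel) \<ge> 0"
    using n by (intro mult_nonneg_nonneg integral_nonneg_AE) (auto simp: T)
  ultimately show "(\<integral>x. (norm (jacobian_of w x))\<^sup>2 \<partial>lborel) \<le> 2 * (\<integral>x. (norm (trace_free_sym (jacobian_of w x)))\<^sup>2 \<partial>lborel)"
    by linarith
qed

lemma norm_add_sq_le: "(norm (a + b))\<^sup>2 \<le> 2 * (norm a)\<^sup>2 + 2 * (norm b)\<^sup>2"
proof -
  have "(norm (a + b))\<^sup>2 \<le> (norm a + norm b)\<^sup>2" by (intro power_mono norm_triangle_ineq) auto
  also have "\<dots> \<le> 2 * (norm a)\<^sup>2 + 2 * (norm b)\<^sup>2"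
    using sum_squares_bound[of "norm a" "norm b"] by (simp add: power2_sum)
  finally show ?thesis .
qed

text \<open>\<open>korn_bumps\<close> is applied to \<eta> u with a cut-off \<eta>. The Jacobian of
  \<eta> u is \<eta> Du plus a matrix of products of u with derivatives of \<eta>, which is bounded
  by |u|. On the unit ball \<eta> is at least e^(-2); squared and inverted, this is the factor
  \<open>exp 4\<close>.\<close>

lemma caccioppoli_trace_free_sym:
  assumes n: "CARD('n) \<ge> 2"
  obtains C where "C \<ge> 0"
    "\<And>u :: 'n \<Rightarrow> real ^ 'n \<Rightarrow> real. \<forall>i. smooth (u i) \<Longrightarrow>
      (\<integral>x. indicator (ball 0 1) x * (norm (jacobian_of u x))\<^sup>2 \<partial>lborel) \<le>
      C * ((\<integral>x. indicator (cball 0 2) x * (norm (trace_free_sym (jacobian_of u x)))\<^sup>2 \<partial>lborel) +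
        (\<integral>x. indicator (cball 0 2) x * (\<Sum>i\<in>UNIV. (u i x)\<^sup>2) \<partial>lborel))"
proof -
  let ?K = "cball 0 2 :: (real^'n) set"
  define \<eta> where "\<eta> x = std_bump ((1/2) *\<^sub>R (x - 0))" for x :: "real^'n"
  have \<eta>: "\<eta> \<in> bumps ?K"
  proof (rule bumpsI)
    show "smooth \<eta>" unfolding \<eta>_def[abs_def] by (intro smooth_affine bumps_smooth[OF std_bump_bumps])
    show "\<eta> x = 0" if "x \<notin> ?K" for x
      unfolding \<eta>_def by (rule bumps_zero[OF std_bump_bumps]) (use that in auto)
  qed
  have \<eta>1: "exp (-2) \<le> \<eta> x" if "x \<in> ball 0 1" for x
    unfolding \<eta>_def using that by (intro std_bump_lower) auto
  obtain M where M: "M \<ge> 0" "\<And>js x. length js \<le> 1 \<Longrightarrow> \<bar>foldr partial js \<eta> x\<bar> \<le> M"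
    using bumps_derivatives_bounded[OF \<eta> compact_cball] by blast
  have M0: "\<bar>\<eta> x\<bar> \<le> M" and M1: "\<bar>partial j \<eta> x\<bar> \<le> M" for x j
    using M(2)[of "[]" x] M(2)[of "[j]" x] by simp_all
  obtain Ct where Ct: "Ct > 0" "\<And>A. norm (trace_free_sym (A :: real^'n^'n)) \<le> norm A * Ct"
    using bounded_linear.pos_bounded[OF bounded_linear_trace_free_sym] by blast
  let ?n = "real CARD('n)"
  define c1 where "c1 = 8 * M\<^sup>2"
  define c2 where "c2 = 8 * Ct\<^sup>2 * ?n * M\<^sup>2 + 2 * ?n * M\<^sup>2"
  define C where "C = exp 4 * (c1 + c2)"
  have c: "c1 \<ge> 0" "c2 \<ge> 0" by (auto simp: c1_def c2_def)
  show thesis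
  proof (rule that[of C])
    show "C \<ge> 0" using c by (simp add: C_def)
    fix u :: "'n \<Rightarrow> real^'n \<Rightarrow> real" assume "\<forall>i. smooth (u i)"
    then have u: "smooth (u i)" for i by blast
    define w where "w i = (\<lambda>x. \<eta> x * u i x)" for i
    have w: "w i \<in> bumps ?K" for i unfolding w_def by (intro bumps_mult_left \<eta> u)
    define B where "B x = (\<chi> i j. u i x * partial j \<eta> x)" for x
    have A: "jacobian_of w x = \<eta> x *\<^sub>R jacobian_of u x + B x" for x
      unfolding w_def by (simp add: vec_eq_iff partial_mult[OF bumps_smooth[OF \<eta>] u] B_def)
    let ?s = "\<lambda>x. \<Sum>i\<in>UNIV. (u i x)\<^sup>2"
    have B: "(norm (B x))\<^sup>2 \<le> ?n * M\<^sup>2 * ?s x" for x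
    proof -
      have "(norm (B x))\<^sup>2 \<le> (\<Sum>i\<in>UNIV. \<Sum>j\<in>(UNIV::'n set). (u i x)\<^sup>2 * M\<^sup>2)"
        unfolding norm_matrix_sq
      proof (intro sum_mono)
        fix i j
        have "(partial j \<eta> x)\<^sup>2 \<le> M\<^sup>2" using M1[of j x] M(1) by (simp add: abs_le_square_iff[symmetric])
        then show "(B x $ i $ j)\<^sup>2 \<le> (u i x)\<^sup>2 * M\<^sup>2" by (simp add: B_def power_mult_distrib mult_left_mono)
      qed
      then show ?thesis by (simp add: sum_distrib_left sum_distrib_right mult_ac)
    qed
    have \<eta>2: "(\<eta> x)\<^sup>2 \<le> M\<^sup>2" for x using M0[of x] M(1) by (simp add: abs_le_square_iff[symmetric])
    have up: "(norm (trace_free_sym (jacobian_of w x)))\<^sup>2 \<le>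
      2 * M\<^sup>2 * (indicator ?K x * (norm (trace_free_sym (jacobian_of u x)))\<^sup>2) + 2 * Ct\<^sup>2 * ?n * M\<^sup>2 * (indicator ?K x * ?s x)" for x
    proof (cases "x \<in> ?K")
      case True
      have "(norm (trace_free_sym (jacobian_of w x)))\<^sup>2 \<le> 2 * (norm (\<eta> x *\<^sub>R trace_free_sym (jacobian_of u x)))\<^sup>2 + 2 * (norm (trace_free_sym (B x)))\<^sup>2"
        unfolding A linear_add[OF linear_trace_free_sym] trace_free_sym_scaleR by (rule norm_add_sq_le)
      also have "(norm (\<eta> x *\<^sub>R trace_free_sym (jacobian_of u x)))\<^sup>2 \<le> M\<^sup>2 * (norm (trace_free_sym (jacobian_of u x)))\<^sup>2"
        using \<eta>2[of x] by (simp add: power_mult_distrib mult_right_mono)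
      also have "(norm (trace_free_sym (B x)))\<^sup>2 \<le> (norm (B x) * Ct)\<^sup>2" by (intro power_mono Ct) auto
      also have "\<dots> \<le> Ct\<^sup>2 * (?n * M\<^sup>2 * ?s x)"
        using B[of x] by (simp add: power_mult_distrib mult.commute mult_left_mono)
      finally show ?thesis using True by (simp add: mult.assoc)
    next
      case False
      have "jacobian_of w x = 0"
        using bumps_zero[OF bumps_partial[OF w closed_cball] False] by (simp add: vec_eq_iff)
      then show ?thesis using False by (simp add: linear_0[OF linear_trace_free_sym])
    qed
    have lo: "exp (-4) * (indicator (ball 0 1) x * (norm (jacobian_of u x))\<^sup>2) \<le>
      2 * (norm (jacobian_of w x))\<^sup>2 + 2 * ?n * M\<^sup>2 * (indicator ?K x * ?s x)" for x
    proof (cases "x \<in> ball 0 1")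
      case True
      then have xK: "x \<in> ?K" by simp
      have "exp (-2) * exp (-2) \<le> \<eta> x * \<eta> x" by (intro mult_mono \<eta>1 True) (auto intro: order_trans[OF _ \<eta>1[OF True]])
      then have "exp (-4) \<le> (\<eta> x)\<^sup>2" by (simp add: exp_add[symmetric] power2_eq_square)
      then have "exp (-4) * (norm (jacobian_of u x))\<^sup>2 \<le> (norm (\<eta> x *\<^sub>R jacobian_of u x))\<^sup>2"
        by (simp add: power_mult_distrib mult_right_mono)
      also have "\<eta> x *\<^sub>R jacobian_of u x = jacobian_of w x + (- B x)" unfolding A by simp
      also have "(norm (jacobian_of w x + (- B x)))\<^sup>2 \<le> 2 * (norm (jacobian_of w x))\<^sup>2 + 2 * (norm (- B x))\<^sup>2"
        by (rule norm_add_sq_le)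
      also have "(norm (- B x))\<^sup>2 \<le> ?n * M\<^sup>2 * ?s x" using B by simp
      finally show ?thesis using True xK by (simp add: mult.assoc)
    next
      case False
      have "0 \<le> 2 * ?n * M\<^sup>2 * (indicator ?K x * ?s x)"
        by (intro mult_nonneg_nonneg sum_nonneg) auto
      then show ?thesis using False by simp
    qed
    have i1: "integrable lborel (\<lambda>x. indicator ?K x * (norm (trace_free_sym (jacobian_of u x)))\<^sup>2)"
      by (intro integrable_compact_continuous compact_cball continuous_intros
        bounded_linear.continuous_on[OF bounded_linear_trace_free_sym] continuous_on_jacobian_of u)
    have i2: "integrable lborel (\<lambda>x. indicator ?K x * ?s x)"
      by (intro integrable_compact_continuous compact_cball continuous_intros smooth_continuous_on u)
    have i3: "integrable lborel (\<lambda>x. indicator (ball 0 1) x * (norm (jacobian_of u x))\<^sup>2)"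
    proof (rule Bochner_Integration.integrable_bound)
      show "integrable lborel (\<lambda>x. indicator ?K x * (norm (jacobian_of u x))\<^sup>2)"
        by (intro integrable_compact_continuous compact_cball continuous_intros continuous_on_jacobian_of u)
      have "(\<lambda>x. (norm (jacobian_of u x))\<^sup>2) \<in> borel_measurable borel"
        by (intro borel_measurable_continuous_onI continuous_intros continuous_on_jacobian_of u)
      then show "(\<lambda>x. indicator (ball 0 1) x * (norm (jacobian_of u x))\<^sup>2) \<in> borel_measurable lborel"
        by (intro borel_measurable_times borel_measurable_indicator) auto
    qed (auto simp: indicator_def)
    let ?I1 = "\<integral>x. indicator ?K x * (norm (trace_free_sym (jacobian_of u x)))\<^sup>2 \<partial>lborel"
    let ?I2 = "\<integral>x. indicator ?K x * ?s x \<partial>lborel"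
    let ?I3 = "\<integral>x. indicator (ball 0 1) x * (norm (jacobian_of u x))\<^sup>2 \<partial>lborel"
    note kb = korn_bumps[of w ?K, OF n w compact_cball]
    have nn: "?I1 \<ge> 0" "?I2 \<ge> 0" by (auto intro!: integral_nonneg_AE mult_nonneg_nonneg sum_nonneg)
    have "exp (-4) * ?I3 = (\<integral>x. exp (-4) * (indicator (ball 0 1) x * (norm (jacobian_of u x))\<^sup>2) \<partial>lborel)" by simp
    also have "\<dots> \<le> (\<integral>x. 2 * (norm (jacobian_of w x))\<^sup>2 + 2 * ?n * M\<^sup>2 * (indicator ?K x * ?s x) \<partial>lborel)"
      using i2 i3 kb(1) lo by (intro integral_mono) auto
    also have "\<dots> = 2 * (\<integral>x. (norm (jacobian_of w x))\<^sup>2 \<partial>lborel) + 2 * ?n * M\<^sup>2 * ?I2"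
      using i2 kb(1) by simp
    also have "(\<integral>x. (norm (jacobian_of w x))\<^sup>2 \<partial>lborel) \<le> 2 * (\<integral>x. (norm (trace_free_sym (jacobian_of w x)))\<^sup>2 \<partial>lborel)"
      by (rule kb(3))
    also have "(\<integral>x. (norm (trace_free_sym (jacobian_of w x)))\<^sup>2 \<partial>lborel) \<le>
      (\<integral>x. 2 * M\<^sup>2 * (indicator ?K x * (norm (trace_free_sym (jacobian_of u x)))\<^sup>2) + 2 * Ct\<^sup>2 * ?n * M\<^sup>2 * (indicator ?K x * ?s x) \<partial>lborel)"
      using i1 i2 kb(2) up by (intro integral_mono) auto
    also have "\<dots> = 2 * M\<^sup>2 * ?I1 + 2 * Ct\<^sup>2 * ?n * M\<^sup>2 * ?I2"
      using i1 i2 by simp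
    finally have "exp (-4) * ?I3 \<le> c1 * ?I1 + c2 * ?I2"
      by (simp add: c1_def c2_def algebra_simps)
    also have "\<dots> \<le> (c1 + c2) * (?I1 + ?I2)"
      using nn c by (simp add: algebra_simps)
    finally have "exp 4 * (exp (-4) * ?I3) \<le> exp 4 * ((c1 + c2) * (?I1 + ?I2))"
      by (intro mult_left_mono) auto
    then show "?I3 \<le> C * (?I1 + ?I2)"
      by (simp add: C_def mult.assoc[symmetric] exp_add[symmetric])
  qed
qed

section \<open>Means of the trace-free part and mollified matrices\<close>

lemma ennreal_L1_trace_free_sym_ball:
  assumes G: "integrable lborel (G :: real ^ 'n \<Rightarrow> real ^ 'n ^ 'n)"
  shows "ennreal (L1_trace_free_sym (ball x t) G) = (\<integral>\<^sup>+y. indicator {..<t} (dist x y) * ennreal (norm (trace_free_sym (G y))) \<partial>lborel)"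
proof -
  have "ennreal (L1_trace_free_sym (ball x t) G) = (\<integral>\<^sup>+y. ennreal (indicator (ball x t) y * norm (trace_free_sym (G y))) \<partial>lborel)"
    by (rule nn_integral_eq_integral[symmetric, OF integrable_indicator_trace_free_sym[OF G open_ball]]) simp
  also have "\<dots> = (\<integral>\<^sup>+y. indicator {..<t} (dist x y) * ennreal (norm (trace_free_sym (G y))) \<partial>lborel)"
    by (intro nn_integral_cong) (auto simp: indicator_def)
  finally show ?thesis .
qed

text \<open>The factor r^(-n) cancels the volume of the ball of radius s r, so the constant is the
  same at all scales.\<close>

lemma trace_free_sym_mean_L2:
  fixes G :: "real ^ 'n \<Rightarrow> real ^ 'n ^ 'n"
  assumes G: "integrable lborel G" and r: "r > 0" "s > 0" and [measurable]: "S \<in> sets borel" "T \<in> sets borel"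
    and ST: "\<And>x y. x \<in> S \<Longrightarrow> dist x y < s * r \<Longrightarrow> y \<in> T"
  shows "(\<integral>\<^sup>+x. indicator S x * ennreal (((1 / r) ^ CARD('n) * L1_trace_free_sym (ball x (s * r)) G)\<^sup>2) \<partial>lborel)
    \<le> ennreal ((unit_ball_vol (real CARD('n)) * s ^ CARD('n))\<^sup>2) * (\<integral>\<^sup>+y. indicator T y * ennreal ((norm (trace_free_sym (G y)))\<^sup>2) \<partial>lborel)"
proof -
  let ?n = "CARD('n)" and ?h = "\<lambda>y. ennreal (norm (trace_free_sym (G y)))"
  have [measurable]: "G \<in> borel_measurable borel" using G by auto
  have L0: "0 \<le> L1_trace_free_sym U G" for U by simp
  let ?I = "\<lambda>x. \<integral>\<^sup>+y. indicator {..<s * r} (dist x y) * ?h y \<partial>lborel"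
  have eq: "ennreal (((1 / r) ^ ?n * L1_trace_free_sym (ball x (s * r)) G)\<^sup>2) = ennreal (((1 / r) ^ ?n)\<^sup>2) * (?I x)\<^sup>2" for x
    unfolding ennreal_L1_trace_free_sym_ball[OF G, symmetric] power_mult_distrib
    by (subst ennreal_mult) (auto simp: ennreal_power)
  have "(\<integral>\<^sup>+x. indicator S x * ennreal (((1 / r) ^ ?n * L1_trace_free_sym (ball x (s * r)) G)\<^sup>2) \<partial>lborel)
    = (\<integral>\<^sup>+x. ennreal (((1 / r) ^ ?n)\<^sup>2) * (indicator S x * (?I x)\<^sup>2) \<partial>lborel)"
    unfolding eq by (simp add: mult_ac)
  also have "\<dots> = ennreal (((1 / r) ^ ?n)\<^sup>2) * (\<integral>\<^sup>+x. indicator S x * (?I x)\<^sup>2 \<partial>lborel)"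
    by (rule nn_integral_cmult) measurable
  also have "\<dots> \<le> ennreal (((1 / r) ^ ?n)\<^sup>2) * ((emeasure lborel (ball (0::real^'n) (s * r)))\<^sup>2 * (\<integral>\<^sup>+y. indicator T y * (?h y)\<^sup>2 \<partial>lborel))"
    by (intro mult_left_mono ball_mean_L2 ST) auto
  also have "\<dots> = (ennreal (((1 / r) ^ ?n)\<^sup>2) * (emeasure lborel (ball (0::real^'n) (s * r)))\<^sup>2) * (\<integral>\<^sup>+y. indicator T y * (?h y)\<^sup>2 \<partial>lborel)"
    by (simp only: mult.assoc)
  also have "ennreal (((1 / r) ^ ?n)\<^sup>2) * (emeasure lborel (ball (0::real^'n) (s * r)))\<^sup>2 =
    ennreal (((1 / r) ^ ?n)\<^sup>2 * (unit_ball_vol (real ?n) * (s * r) ^ ?n)\<^sup>2)"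
  proof -
    have gg: "ennreal a * (ennreal b)\<^sup>2 = ennreal (a * b\<^sup>2)" if "a \<ge> 0" "b \<ge> 0" for a b :: real
      using that by (simp add: ennreal_mult ennreal_power)
    have "emeasure lborel (ball (0::real^'n) (s * r)) = ennreal (unit_ball_vol (real ?n) * (s * r) ^ ?n)"
      using r by (subst emeasure_ball) auto
    then show ?thesis using r by (simp only: gg zero_le_power2 mult_nonneg_nonneg unit_ball_vol_nonneg
      zero_le_power less_imp_le of_nat_0_le_iff)
  qed
  also have "((1 / r) ^ ?n)\<^sup>2 * (unit_ball_vol (real ?n) * (s * r) ^ ?n)\<^sup>2 = (unit_ball_vol (real ?n) * s ^ ?n)\<^sup>2"
    using r by (simp add: power_mult_distrib power_divide)
  also have "(\<integral>\<^sup>+y. indicator T y * (?h y)\<^sup>2 \<partial>lborel) = (\<integral>\<^sup>+y. indicator T y * ennreal ((norm (trace_free_sym (G y)))\<^sup>2) \<partial>lborel)"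
    by (simp add: ennreal_power)
  finally show ?thesis .
qed

lemma L1_trace_free_sym_ball_measurable:
  assumes G: "integrable lborel (G :: real ^ 'n \<Rightarrow> real ^ 'n ^ 'n)"
  shows "(\<lambda>x. L1_trace_free_sym (ball x t) G) \<in> borel_measurable borel"
proof -
  have [measurable]: "G \<in> borel_measurable borel" using G by auto
  have "(\<lambda>x. ennreal (L1_trace_free_sym (ball x t) G)) \<in> borel_measurable borel"
    unfolding ennreal_L1_trace_free_sym_ball[OF G] by measurable
  then have "(\<lambda>x. enn2real (ennreal (L1_trace_free_sym (ball x t) G))) \<in> borel_measurable borel" by measurable
  then show ?thesis by simp
qed

text \<open>Convolution at scale \<open>r\<close> with the kernel of mass one. It is a matrix-valued
  integral rather than a matrix of Taylor means, so that the linear map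
  \<open>trace_free_sym\<close> can be taken inside.\<close>

definition mollified_matrix :: "(real ^ 'n \<Rightarrow> real ^ 'n ^ 'n) \<Rightarrow> real \<Rightarrow> real ^ 'n \<Rightarrow> real ^ 'n ^ 'n" where
  "mollified_matrix G r x = (\<integral>y. kernel_op 0 mollifier y *\<^sub>R G (x + r *\<^sub>R y) \<partial>lborel)"

lemma integrable_scaleR_bumps:
  fixes G :: "real ^ 'n \<Rightarrow> 'b::{banach, second_countable_topology}"
  assumes G: "integrable lborel G" and \<phi>: "\<phi> \<in> bumps K" "compact K"
  shows "integrable lborel (\<lambda>y. \<phi> y *\<^sub>R G y)"
proof -
  obtain M where M: "M \<ge> 0" "\<And>x. \<bar>\<phi> x\<bar> \<le> M" using bumps_bounded[OF \<phi>] by blast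
  have [measurable]: "\<phi> \<in> borel_measurable borel" by (rule smooth_borel[OF bumps_smooth[OF \<phi>(1)]])
  have [measurable]: "G \<in> borel_measurable borel" using G by auto
  show ?thesis
  proof (rule Bochner_Integration.integrable_bound[of _ "\<lambda>y. M * norm (G y)"])
    show "AE y in lborel. norm (\<phi> y *\<^sub>R G y) \<le> norm (M * norm (G y))"
      using M by (auto intro!: mult_right_mono AE_I2)
  qed (use G in auto)
qed

lemma integrable_mollified_matrix:
  assumes G: "integrable lborel (G :: real ^ 'n \<Rightarrow> real ^ 'n ^ 'n)" and r: "r > 0"
  shows "integrable lborel (\<lambda>y. kernel_op 0 mollifier y *\<^sub>R G (x + r *\<^sub>R y))"
  by (rule integrable_scaleR_bumps[OF integrable_lborel_affine[OF G] kernel_op_mollifier_bumps compact_cball])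
    (use r in simp)

lemma mollified_matrix_component:
  assumes G: "integrable lborel (G :: real ^ 'n \<Rightarrow> real ^ 'n ^ 'n)" and r: "r > 0"
  shows "mollified_matrix G r x $ i $ j = taylor_mean (\<lambda>y. G y $ i $ j) x r x"
proof -
  have "bounded_linear (\<lambda>A :: real^'n^'n. A $ i $ j)"
    by (rule bounded_linear_compose[OF bounded_linear_vec_nth bounded_linear_vec_nth])
  from integral_bounded_linear[OF this integrable_mollified_matrix[OF assms]] show ?thesis
    unfolding mollified_matrix_def taylor_mean_def by (simp add: mult.commute)
qed

lemma mollified_matrix_measurable:
  assumes G: "integrable lborel (G :: real ^ 'n \<Rightarrow> real ^ 'n ^ 'n)" and r: "r > 0"
  shows "mollified_matrix G r \<in> borel_measurable borel"
proof -
  have "integrable lborel (\<lambda>x. G x $ i $ j)" for i j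
    by (intro integrable_bounded_linear[OF bounded_linear_vec_nth] G)
  then have "continuous_on UNIV (\<lambda>x. \<chi> i j. taylor_mean (\<lambda>y. G y $ i $ j) x r x)"
    by (intro continuous_on_vec_lambda smooth_continuous_on smooth_taylor_mean_center r)
  moreover have "mollified_matrix G r = (\<lambda>x. \<chi> i j. taylor_mean (\<lambda>y. G y $ i $ j) x r x)"
    by (auto simp: vec_eq_iff mollified_matrix_component[OF assms])
  ultimately show ?thesis using borel_measurable_continuous_onI by metis
qed

text \<open>\<open>trace_free_sym\<close> commutes with the averaging, and the kernel is bounded.
  The radius is 2 r because the kernel lives on the closed unit ball and the means are taken over
  open balls.\<close>

lemma norm_trace_free_sym_mollified_matrix:
  fixes G :: "real ^ 'n \<Rightarrow> real ^ 'n ^ 'n"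
  assumes G: "integrable lborel G" and r: "r > 0" and M: "\<And>y :: real ^ 'n. \<bar>kernel_op 0 mollifier y\<bar> \<le> M"
  shows "norm (trace_free_sym (mollified_matrix G r (x :: real ^ 'n))) \<le> M * ((1 / r) ^ CARD('n) * L1_trace_free_sym (ball x (2 * r)) G)"
proof -
  let ?\<psi> = "kernel_op 0 mollifier :: real^'n \<Rightarrow> real"
  have M0: "M \<ge> 0" using order_trans[OF abs_ge_zero M] .
  have "trace_free_sym (mollified_matrix G r x) = (\<integral>y. trace_free_sym (?\<psi> y *\<^sub>R G (x + r *\<^sub>R y)) \<partial>lborel)"
    unfolding mollified_matrix_def
    by (rule integral_bounded_linear[OF bounded_linear_trace_free_sym integrable_mollified_matrix[OF G r], symmetric])
  also have "norm \<dots> \<le> (\<integral>y. M * (indicator (ball 0 2) y * norm (trace_free_sym (G (x + r *\<^sub>R y)))) \<partial>lborel)"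
  proof (rule Bochner_Integration.integral_norm_bound_integral)
    show "integrable lborel (\<lambda>y. trace_free_sym (?\<psi> y *\<^sub>R G (x + r *\<^sub>R y)))"
      by (rule integrable_bounded_linear[OF bounded_linear_trace_free_sym integrable_mollified_matrix[OF G r]])
    have "integrable lborel (\<lambda>y. G (x + r *\<^sub>R y))" using integrable_lborel_affine[OF G] r by simp
    then show "integrable lborel (\<lambda>y. M * (indicator (ball 0 2) y * norm (trace_free_sym (G (x + r *\<^sub>R y)))))"
      by (intro integrable_mult_right integrable_indicator_trace_free_sym open_ball)
    fix y
    show "norm (trace_free_sym (?\<psi> y *\<^sub>R G (x + r *\<^sub>R y))) \<le> M * (indicator (ball 0 2) y * norm (trace_free_sym (G (x + r *\<^sub>R y))))"
    proof (cases "y \<in> cball 0 1")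
      case True
      then show ?thesis using M[of y] by (simp add: trace_free_sym_scaleR mult_right_mono)
    next
      case False
      then have "?\<psi> y = 0" using bumps_zero[OF kernel_op_mollifier_bumps] by blast
      then show ?thesis using M0 by (simp add: linear_0[OF linear_trace_free_sym])
    qed
  qed
  also have "\<dots> = M * ((1 / r) ^ CARD('n) * L1_trace_free_sym (ball x (2 * r)) G)"
    using L1_trace_free_sym_rescale[OF r, of 2 G x] r by (simp add: trace_free_sym_scaleR mult.left_commute)
  finally show ?thesis .
qed

section \<open>Summation over dyadic scales\<close>

lemma taylor_mean_dyadic:
  assumes step: "\<And>U V G (x :: real ^ 'n) z z' r r' i. weak_pair U V G \<Longrightarrow> r > 0 \<Longrightarrow> ball z (4 * r) \<subseteq> U \<Longrightarrow> dist x z \<le> 0 * r \<Longrightarrow>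
      dist z z' \<le> r \<Longrightarrow> r \<le> r' \<Longrightarrow> r' \<le> 2 * r \<Longrightarrow>
      \<bar>taylor_mean (\<lambda>y. V y $ i) z' r' x - taylor_mean (\<lambda>y. V y $ i) z r x\<bar>
        \<le> M * (r * ((1 / r) ^ CARD('n) * L1_trace_free_sym (ball z (4 * r)) G))"
    and wp: "weak_pair (U :: (real ^ 'n) set) V G" and U: "ball x 2 \<subseteq> U"
  shows "\<bar>taylor_mean (\<lambda>y. V y $ i) x ((1/2) ^ N) x - taylor_mean (\<lambda>y. V y $ i) x 1 x\<bar> \<le>
    (\<Sum>k<N. M * ((1/2) ^ Suc k * ((1 / (1/2) ^ Suc k) ^ CARD('n) * L1_trace_free_sym (ball x (4 * (1/2) ^ Suc k)) G)))"
proof (induction N)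
  case (Suc N)
  let ?r = "(1/2::real) ^ Suc N"
  have "4 * ?r \<le> 2" using power_le_one[of "1/2::real" N] by simp
  then have sub: "ball x (4 * ?r) \<subseteq> U" by (rule order_trans[OF subset_ball U])
  have "\<bar>taylor_mean (\<lambda>y. V y $ i) x ((1/2) ^ N) x - taylor_mean (\<lambda>y. V y $ i) x ?r x\<bar>
      \<le> M * (?r * ((1 / ?r) ^ CARD('n) * L1_trace_free_sym (ball x (4 * ?r)) G))"
    by (rule step[OF wp _ sub]) simp_all
  moreover have "\<bar>c - a\<bar> \<le> p + q" if "\<bar>b - a\<bar> \<le> p" "\<bar>b - c\<bar> \<le> q" for a b c p q :: real
    using that by linarith
  ultimately show ?case unfolding sum.lessThan_Suc using Suc by blast
qed simp

text \<open>Cauchy-Schwarz with the weights (1/2)^(k+1), whose sum is at most 1. The weights survive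
  on the right, so after integration the sum over the scales stays bounded independently of their
  number.\<close>

lemma sum_geometric_weights_sq:
  fixes b :: "nat \<Rightarrow> real"
  shows "(\<Sum>k<N. (1/2) ^ Suc k * b k)\<^sup>2 \<le> (\<Sum>k<N. (1/2) ^ Suc k * (b k)\<^sup>2)"
proof -
  have s1: "(\<Sum>k<N. (1/2::real) ^ Suc k) \<le> 1"
  proof -
    have "(\<Sum>k<N. (1/2::real) ^ Suc k) = 1 - (1/2) ^ N" by (induction N) auto
    then show ?thesis by simp
  qed
  have "(\<Sum>k<N. (1/2) ^ Suc k * b k)\<^sup>2 = (\<Sum>k<N. sqrt ((1/2) ^ Suc k) * (sqrt ((1/2) ^ Suc k) * b k))\<^sup>2"
    by (simp add: mult.assoc[symmetric])
  also have "\<dots> \<le> (\<Sum>k<N. (sqrt ((1/2) ^ Suc k))\<^sup>2) * (\<Sum>k<N. (sqrt ((1/2) ^ Suc k) * b k)\<^sup>2)"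
    by (rule Cauchy_Schwarz_ineq_sum)
  also have "\<dots> = (\<Sum>k<N. (1/2) ^ Suc k) * (\<Sum>k<N. (1/2) ^ Suc k * (b k)\<^sup>2)"
    by (simp add: power_mult_distrib)
  also have "\<dots> \<le> 1 * (\<Sum>k<N. (1/2) ^ Suc k * (b k)\<^sup>2)"
    by (intro mult_right_mono s1 sum_nonneg) auto
  finally show ?thesis by simp
qed

text \<open>The Caccioppoli inequality is applied to u, the difference of the mollifications of V at
  the scales 2^(-N) and 1, whose Jacobian is the difference of the mollified G. On the ball of
  radius 2, the trace-free part of this Jacobian is bounded by two means of |L|, and u by the
  geometric sum of means over the intermediate scales. The constant must be free of
  \<open>N\<close>, since \<open>N\<close> will tend to infinity.\<close>

lemma mollified_matrix_difference_L2:
  assumes n: "CARD('n) \<ge> 3"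
  obtains C where "C \<ge> 0" "\<And>V (G :: real ^ 'n \<Rightarrow> real ^ 'n ^ 'n) N. weak_pair (ball 0 4) V G \<Longrightarrow>
    (\<integral>\<^sup>+x. indicator (ball 0 1) x * ennreal ((norm (mollified_matrix G ((1/2) ^ N) x - mollified_matrix G 1 x))\<^sup>2) \<partial>lborel)
     \<le> ennreal C * (\<integral>\<^sup>+x. indicator (ball 0 4) x * ennreal ((norm (trace_free_sym (G x)))\<^sup>2) \<partial>lborel)"
proof -
  let ?n = "CARD('n)"
  obtain M where M: "M \<ge> 0"
    and step: "\<And>U V G (x :: real ^ 'n) z z' r r' i. weak_pair U V G \<Longrightarrow> r > 0 \<Longrightarrow> ball z (4 * r) \<subseteq> U \<Longrightarrow> dist x z \<le> 0 * r \<Longrightarrow>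
      dist z z' \<le> r \<Longrightarrow> r \<le> r' \<Longrightarrow> r' \<le> 2 * r \<Longrightarrow>
      \<bar>taylor_mean (\<lambda>y. V y $ i) z' r' x - taylor_mean (\<lambda>y. V y $ i) z r x\<bar>
        \<le> M * (r * ((1 / r) ^ CARD('n) * L1_trace_free_sym (ball z (4 * r)) G))"
    by (rule taylor_mean_step[OF n order_refl], rule that)
  have n2: "?n \<ge> 2" using n by simp
  obtain C0 where C0: "C0 \<ge> 0" and cacc: "\<And>u :: 'n \<Rightarrow> real ^ 'n \<Rightarrow> real. \<forall>i. smooth (u i) \<Longrightarrow>
      (\<integral>x. indicator (ball 0 1) x * (norm (jacobian_of u x))\<^sup>2 \<partial>lborel) \<le>
      C0 * ((\<integral>x. indicator (cball 0 2) x * (norm (trace_free_sym (jacobian_of u x)))\<^sup>2 \<partial>lborel) +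
        (\<integral>x. indicator (cball 0 2) x * (\<Sum>i\<in>UNIV. (u i x)\<^sup>2) \<partial>lborel))"
    by (rule caccioppoli_trace_free_sym[OF n2], rule that)
  obtain P where P: "P \<ge> 0" "\<And>y :: real^'n. \<bar>kernel_op 0 mollifier y\<bar> \<le> P"
    using bumps_bounded[OF kernel_op_mollifier_bumps compact_cball] by blast
  define vol where "vol = unit_ball_vol (real ?n)"
  have vol: "vol > 0" unfolding vol_def by simp
  define c1 where "c1 = 4 * P\<^sup>2 * (vol * 2 ^ ?n)\<^sup>2"
  define c2 where "c2 = real ?n * M\<^sup>2 * (vol * 4 ^ ?n)\<^sup>2"
  have c: "c1 \<ge> 0" "c2 \<ge> 0" by (auto simp: c1_def c2_def)
  show thesis
  proof (rule that[of "C0 * (c1 + c2)"])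
    show "C0 * (c1 + c2) \<ge> 0" using C0 c by simp
    fix V and G :: "real^'n \<Rightarrow> real^'n^'n" and N assume wp: "weak_pair (ball 0 4) V G"
    note G = weak_pairD(3)[OF wp]
    have [measurable]: "G \<in> borel_measurable borel" using G by auto
    let ?H = "\<integral>\<^sup>+x. indicator (ball 0 4) x * ennreal ((norm (trace_free_sym (G x)))\<^sup>2) \<partial>lborel"
    let ?r = "(1/2::real) ^ N"
    have r: "?r > 0" "?r \<le> 1" by (auto simp: power_le_one)
    let ?K = "cball 0 2 :: (real^'n) set"
    define u where "u i x = taylor_mean (\<lambda>y. V y $ i) x ?r x - taylor_mean (\<lambda>y. V y $ i) x 1 x" for i x
    have su: "smooth (u i)" for i unfolding u_def[abs_def]
      by (intro smooth_diff smooth_taylor_mean_center weak_pairD(4)[OF wp] r) simp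
    have Du: "jacobian_of u x = mollified_matrix G ?r x - mollified_matrix G 1 x" if x: "x \<in> ?K" for x
    proof -
      have sub: "cball x s \<subseteq> ball 0 4" if "s \<le> 1" for s
      proof
        fix y assume "y \<in> cball x s"
        then show "y \<in> ball 0 4" using x that norm_triangle_ineq[of "y - x" x] by (simp add: dist_norm norm_minus_commute)
      qed
      have "partial j (u i) x = taylor_mean (\<lambda>y. G y $ i $ j) x ?r x - taylor_mean (\<lambda>y. G y $ i $ j) x 1 x" for i j
        unfolding u_def[abs_def]
        by (subst partial_diff) (simp_all add: smooth_taylor_mean_center weak_pairD(4)[OF wp] r
          partial_taylor_mean_center[OF wp _ sub])
      then show ?thesis by (simp add: vec_eq_iff mollified_matrix_component[OF G] r)
    qed
    have u_nn: "(\<integral>\<^sup>+x. ennreal (indicator ?K x * (\<Sum>i\<in>UNIV. (u i x)\<^sup>2)) \<partial>lborel) \<le> ennreal c2 * ?H"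
    proof -
      define b where "b k x = (1 / (1/2) ^ Suc k) ^ ?n * L1_trace_free_sym (ball x (4 * (1/2) ^ Suc k)) G" for k :: nat and x
      have bm: "b k \<in> borel_measurable borel" for k
        unfolding b_def by (intro borel_measurable_times borel_measurable_const L1_trace_free_sym_ball_measurable G)
      have ub: "indicator ?K x * (\<Sum>i\<in>UNIV. (u i x)\<^sup>2) \<le> (\<Sum>k<N. real ?n * M\<^sup>2 * (1/2) ^ Suc k * (indicator ?K x * (b k x)\<^sup>2))" for x
      proof (cases "x \<in> ?K")
        case True
        have sub: "ball x 2 \<subseteq> ball 0 4"
        proof
          fix y assume "y \<in> ball x 2"
          then show "y \<in> ball 0 4" using True norm_triangle_ineq[of "y - x" x] by (simp add: dist_norm norm_minus_commute)
        qed
        have "(u i x)\<^sup>2 \<le> M\<^sup>2 * (\<Sum>k<N. (1/2) ^ Suc k * (b k x)\<^sup>2)" for i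
        proof -
          have "\<bar>u i x\<bar> \<le> (\<Sum>k<N. M * ((1/2) ^ Suc k * b k x))"
            unfolding u_def b_def by (rule taylor_mean_dyadic[OF step wp sub])
          then have "\<bar>u i x\<bar> \<le> M * (\<Sum>k<N. (1/2) ^ Suc k * b k x)" by (simp only: sum_distrib_left)
          then have "\<bar>u i x\<bar>\<^sup>2 \<le> (M * (\<Sum>k<N. (1/2) ^ Suc k * b k x))\<^sup>2" by (intro power_mono) auto
          also have "\<dots> \<le> M\<^sup>2 * (\<Sum>k<N. (1/2) ^ Suc k * (b k x)\<^sup>2)"
            unfolding power_mult_distrib by (intro mult_left_mono sum_geometric_weights_sq) auto
          finally show ?thesis by simp
        qed
        then have "(\<Sum>i\<in>UNIV. (u i x)\<^sup>2) \<le> (\<Sum>i\<in>(UNIV::'n set). M\<^sup>2 * (\<Sum>k<N. (1/2) ^ Suc k * (b k x)\<^sup>2))"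
          by (intro sum_mono) auto
        then show ?thesis using True by (simp add: sum_distrib_left mult.assoc)
      qed simp
      have "(\<integral>\<^sup>+x. ennreal (indicator ?K x * (\<Sum>i\<in>UNIV. (u i x)\<^sup>2)) \<partial>lborel) \<le>
        (\<integral>\<^sup>+x. (\<Sum>k<N. ennreal (real ?n * M\<^sup>2 * (1/2) ^ Suc k) * (indicator ?K x * ennreal ((b k x)\<^sup>2))) \<partial>lborel)"
      proof (rule nn_integral_mono)
        fix x
        have "(\<Sum>k<N. ennreal (real ?n * M\<^sup>2 * (1/2) ^ Suc k) * (indicator ?K x * ennreal ((b k x)\<^sup>2))) =
          ennreal (\<Sum>k<N. real ?n * M\<^sup>2 * (1/2) ^ Suc k * (indicator ?K x * (b k x)\<^sup>2))"
        proof -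
          have "ennreal (real ?n * M\<^sup>2 * (1/2) ^ Suc k) * (indicator ?K x * ennreal ((b k x)\<^sup>2)) =
            ennreal (real ?n * M\<^sup>2 * (1/2) ^ Suc k * (indicator ?K x * (b k x)\<^sup>2))" for k
            by (simp add: indicator_def ennreal_mult del: power_Suc)
          then show ?thesis by (simp only:) (rule sum_ennreal, auto)
        qed
        then show "ennreal (indicator ?K x * (\<Sum>i\<in>UNIV. (u i x)\<^sup>2)) \<le>
          (\<Sum>k<N. ennreal (real ?n * M\<^sup>2 * (1/2) ^ Suc k) * (indicator ?K x * ennreal ((b k x)\<^sup>2)))"
          using ennreal_leI[OF ub[of x]] by simp
      qed
      also have "\<dots> = (\<Sum>k<N. ennreal (real ?n * M\<^sup>2 * (1/2) ^ Suc k) * (\<integral>\<^sup>+x. indicator ?K x * ennreal ((b k x)\<^sup>2) \<partial>lborel))"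
      proof -
        have mb: "(\<lambda>x. indicator ?K x * ennreal ((b k x)\<^sup>2)) \<in> borel_measurable lborel" for k
          by (intro borel_measurable_times_ennreal borel_measurable_indicator measurable_compose[OF _ measurable_ennreal]
            borel_measurable_power) (simp_all add: bm)
        have "(\<integral>\<^sup>+x. (\<Sum>k<N. ennreal (real ?n * M\<^sup>2 * (1/2) ^ Suc k) * (indicator ?K x * ennreal ((b k x)\<^sup>2))) \<partial>lborel) =
          (\<Sum>k<N. \<integral>\<^sup>+x. ennreal (real ?n * M\<^sup>2 * (1/2) ^ Suc k) * (indicator ?K x * ennreal ((b k x)\<^sup>2)) \<partial>lborel)"
          by (rule nn_integral_sum) (intro borel_measurable_times_ennreal borel_measurable_const mb)
        then show ?thesis by (simp only: nn_integral_cmult[OF mb])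
      qed
      also have "\<dots> \<le> (\<Sum>k<N. ennreal (real ?n * M\<^sup>2 * (1/2) ^ Suc k) * (ennreal ((vol * 4 ^ ?n)\<^sup>2) * ?H))"
      proof (intro sum_mono mult_left_mono)
        fix k
        have s: "4 * (1/2::real) ^ Suc k \<le> 2" using power_le_one[of "1/2::real" k] by simp
        show "(\<integral>\<^sup>+x. indicator ?K x * ennreal ((b k x)\<^sup>2) \<partial>lborel) \<le> ennreal ((vol * 4 ^ ?n)\<^sup>2) * ?H"
          unfolding b_def vol_def
        proof (rule trace_free_sym_mean_L2[OF G])
          fix x y assume "x \<in> ?K" "dist x y < 4 * (1/2) ^ Suc k"
          then have "norm x \<le> 2" "norm (y - x) < 2" using s by (auto simp: dist_norm norm_minus_commute)
          then show "y \<in> ball 0 4" using norm_triangle_ineq[of "y - x" x] by simp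
        qed auto
      qed auto
      also have "\<dots> = (\<Sum>k<N. ennreal (c2 * (1/2) ^ Suc k)) * ?H"
        unfolding sum_distrib_right
      proof (intro sum.cong refl)
        fix k
        have "ennreal (real ?n * M\<^sup>2 * (1/2) ^ Suc k) * ennreal ((vol * 4 ^ ?n)\<^sup>2) =
          ennreal (real ?n * M\<^sup>2 * (1/2) ^ Suc k * (vol * 4 ^ ?n)\<^sup>2)"
          by (rule ennreal_mult[symmetric]) (auto simp del: power_Suc)
        also have "real ?n * M\<^sup>2 * (1/2) ^ Suc k * (vol * 4 ^ ?n)\<^sup>2 = c2 * (1/2) ^ Suc k"
          by (simp only: c2_def mult_ac)
        finally show "ennreal (real ?n * M\<^sup>2 * (1/2) ^ Suc k) * (ennreal ((vol * 4 ^ ?n)\<^sup>2) * ?H) =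
          ennreal (c2 * (1/2) ^ Suc k) * ?H"
          by (simp only: mult.assoc[symmetric])
      qed
      also have "\<dots> \<le> ennreal c2 * ?H"
      proof (rule mult_right_mono)
        have "(\<Sum>k<N. (1/2::real) ^ Suc k) = 1 - (1/2) ^ N" by (induction N) auto
        then have "(\<Sum>k<N. c2 * (1/2) ^ Suc k) \<le> c2"
          unfolding sum_distrib_left[symmetric] using c by (intro mult_left_le) (simp_all only:, simp)
        then show "(\<Sum>k<N. ennreal (c2 * (1/2) ^ Suc k)) \<le> ennreal c2"
          using c by (subst sum_ennreal) (auto intro: ennreal_leI)
      qed simp
      finally show ?thesis .
    qed
    have t_nn: "(\<integral>\<^sup>+x. ennreal (indicator ?K x * (norm (trace_free_sym (jacobian_of u x)))\<^sup>2) \<partial>lborel) \<le> ennreal c1 * ?H"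
    proof -
      define m where "m s x = (1 / s) ^ ?n * L1_trace_free_sym (ball x (2 * s)) G" for s x
      have mm: "m s \<in> borel_measurable borel" for s
        unfolding m_def by (intro borel_measurable_times borel_measurable_const L1_trace_free_sym_ball_measurable G)
      have m: "(\<integral>\<^sup>+x. indicator ?K x * ennreal ((m s x)\<^sup>2) \<partial>lborel) \<le> ennreal ((vol * 2 ^ ?n)\<^sup>2) * ?H"
        if s: "s > 0" "s \<le> 1" for s
        unfolding m_def vol_def
      proof (rule trace_free_sym_mean_L2[OF G s(1)])
        fix x y assume "x \<in> ?K" "dist x y < 2 * s"
        then have "norm x \<le> 2" "norm (y - x) < 2" using s by (auto simp: dist_norm norm_minus_commute)
        then show "y \<in> ball 0 4" using norm_triangle_ineq[of "y - x" x] by simp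
      qed auto
      have tb: "ennreal (indicator ?K x * (norm (trace_free_sym (jacobian_of u x)))\<^sup>2) \<le>
        ennreal (2 * P\<^sup>2) * (indicator ?K x * ennreal ((m ?r x)\<^sup>2)) + ennreal (2 * P\<^sup>2) * (indicator ?K x * ennreal ((m 1 x)\<^sup>2))" for x
      proof (cases "x \<in> ?K")
        case True
        have ms: "(norm (trace_free_sym (mollified_matrix G s x)))\<^sup>2 \<le> P\<^sup>2 * (m s x)\<^sup>2" if "s > 0" for s
          using power_mono[OF norm_trace_free_sym_mollified_matrix[OF G that P(2), of x] norm_ge_zero, of 2]
          by (simp add: m_def power_mult_distrib)
        have "(norm (trace_free_sym (jacobian_of u x)))\<^sup>2 \<le> 2 * (norm (trace_free_sym (mollified_matrix G ?r x)))\<^sup>2 + 2 * (norm (- trace_free_sym (mollified_matrix G 1 x)))\<^sup>2"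
        proof -
          have eq: "trace_free_sym (jacobian_of u x) = trace_free_sym (mollified_matrix G ?r x) + (- trace_free_sym (mollified_matrix G 1 x))"
            by (simp add: Du[OF True] linear_diff[OF linear_trace_free_sym])
          show ?thesis unfolding eq by (rule norm_add_sq_le)
        qed
        also have "\<dots> \<le> 2 * P\<^sup>2 * (m ?r x)\<^sup>2 + 2 * P\<^sup>2 * (m 1 x)\<^sup>2"
          using ms[OF r(1)] ms[of 1] by simp
        finally have "ennreal ((norm (trace_free_sym (jacobian_of u x)))\<^sup>2) \<le> ennreal (2 * P\<^sup>2 * (m ?r x)\<^sup>2 + 2 * P\<^sup>2 * (m 1 x)\<^sup>2)"
          by (rule ennreal_leI)
        then show ?thesis using True by (simp add: ennreal_plus ennreal_mult)
      qed simp
      have "(\<integral>\<^sup>+x. ennreal (indicator ?K x * (norm (trace_free_sym (jacobian_of u x)))\<^sup>2) \<partial>lborel) \<le>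
        (\<integral>\<^sup>+x. ennreal (2 * P\<^sup>2) * (indicator ?K x * ennreal ((m ?r x)\<^sup>2)) + ennreal (2 * P\<^sup>2) * (indicator ?K x * ennreal ((m 1 x)\<^sup>2)) \<partial>lborel)"
        by (intro nn_integral_mono tb)
      also have "\<dots> = ennreal (2 * P\<^sup>2) * (\<integral>\<^sup>+x. indicator ?K x * ennreal ((m ?r x)\<^sup>2) \<partial>lborel) +
        ennreal (2 * P\<^sup>2) * (\<integral>\<^sup>+x. indicator ?K x * ennreal ((m 1 x)\<^sup>2) \<partial>lborel)"
      proof -
        have mb: "(\<lambda>x. indicator ?K x * ennreal ((m s x)\<^sup>2)) \<in> borel_measurable lborel" for s
          by (intro borel_measurable_times_ennreal borel_measurable_indicator measurable_compose[OF _ measurable_ennreal]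
            borel_measurable_power) (simp_all add: mm)
        show ?thesis
          by (subst nn_integral_add) (intro borel_measurable_times_ennreal borel_measurable_const mb | simp only: nn_integral_cmult[OF mb])+
      qed
      also have "\<dots> \<le> ennreal (2 * P\<^sup>2) * (ennreal ((vol * 2 ^ ?n)\<^sup>2) * ?H) + ennreal (2 * P\<^sup>2) * (ennreal ((vol * 2 ^ ?n)\<^sup>2) * ?H)"
        using m[OF r] m[of 1] by (intro add_mono mult_left_mono) auto
      also have "\<dots> = ennreal (2 * P\<^sup>2 * (vol * 2 ^ ?n)\<^sup>2 + 2 * P\<^sup>2 * (vol * 2 ^ ?n)\<^sup>2) * ?H"
        by (subst ennreal_plus) (simp_all add: ennreal_mult mult.assoc distrib_right)
      also have "2 * P\<^sup>2 * (vol * 2 ^ ?n)\<^sup>2 + 2 * P\<^sup>2 * (vol * 2 ^ ?n)\<^sup>2 = c1" by (simp add: c1_def)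
      finally show ?thesis .
    qed
    have nn: "ennreal (\<integral>x. indicator S x * f x \<partial>lborel) = (\<integral>\<^sup>+x. ennreal (indicator S x * f x) \<partial>lborel)"
      if "compact K" "S \<subseteq> K" "S \<in> sets borel" "continuous_on UNIV f" "\<And>x. f x \<ge> 0"
      for K S :: "(real^'n) set" and f :: "real^'n \<Rightarrow> real"
    proof (rule nn_integral_eq_integral[symmetric])
      show "integrable lborel (\<lambda>x. indicator S x * f x)"
      proof (rule Bochner_Integration.integrable_bound)
        show "integrable lborel (\<lambda>x. indicator K x * f x)"
          by (rule integrable_compact_continuous[OF that(1) continuous_on_subset[OF that(4)]]) auto
        show "(\<lambda>x. indicator S x * f x) \<in> borel_measurable lborel"
          using that borel_measurable_continuous_onI[OF that(4)] by (intro borel_measurable_times borel_measurable_indicator) auto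
      qed (use that in \<open>auto simp: indicator_def\<close>)
    qed (use that in auto)
    have "(\<integral>\<^sup>+x. indicator (ball 0 1) x * ennreal ((norm (mollified_matrix G ?r x - mollified_matrix G 1 x))\<^sup>2) \<partial>lborel)
      = (\<integral>\<^sup>+x. ennreal (indicator (ball 0 1) x * (norm (jacobian_of u x))\<^sup>2) \<partial>lborel)"
      by (intro nn_integral_cong) (auto simp: indicator_def Du)
    also have "\<dots> = ennreal (\<integral>x. indicator (ball 0 1) x * (norm (jacobian_of u x))\<^sup>2 \<partial>lborel)"
      by (rule nn[of "cball 0 1", symmetric]) (auto intro!: continuous_intros continuous_on_jacobian_of su)
    also have "\<dots> \<le> ennreal (C0 * ((\<integral>x. indicator ?K x * (norm (trace_free_sym (jacobian_of u x)))\<^sup>2 \<partial>lborel) +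
        (\<integral>x. indicator ?K x * (\<Sum>i\<in>UNIV. (u i x)\<^sup>2) \<partial>lborel)))"
      by (intro ennreal_leI cacc allI su)
    also have "\<dots> = ennreal C0 * (ennreal (\<integral>x. indicator ?K x * (norm (trace_free_sym (jacobian_of u x)))\<^sup>2 \<partial>lborel) +
        ennreal (\<integral>x. indicator ?K x * (\<Sum>i\<in>UNIV. (u i x)\<^sup>2) \<partial>lborel))"
      using C0 by (simp add: ennreal_mult ennreal_plus integral_nonneg_AE sum_nonneg)
    also have "ennreal (\<integral>x. indicator ?K x * (norm (trace_free_sym (jacobian_of u x)))\<^sup>2 \<partial>lborel) =
      (\<integral>\<^sup>+x. ennreal (indicator ?K x * (norm (trace_free_sym (jacobian_of u x)))\<^sup>2) \<partial>lborel)"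
      by (rule nn[of ?K]) (auto intro!: continuous_intros bounded_linear.continuous_on[OF bounded_linear_trace_free_sym] continuous_on_jacobian_of su)
    also have "ennreal (\<integral>x. indicator ?K x * (\<Sum>i\<in>UNIV. (u i x)\<^sup>2) \<partial>lborel) =
      (\<integral>\<^sup>+x. ennreal (indicator ?K x * (\<Sum>i\<in>UNIV. (u i x)\<^sup>2)) \<partial>lborel)"
      by (rule nn[of ?K]) (auto intro!: continuous_on_sum continuous_on_power smooth_continuous_on[OF su] sum_nonneg)
    also have "ennreal C0 * ((\<integral>\<^sup>+x. ennreal (indicator ?K x * (norm (trace_free_sym (jacobian_of u x)))\<^sup>2) \<partial>lborel) +
      (\<integral>\<^sup>+x. ennreal (indicator ?K x * (\<Sum>i\<in>UNIV. (u i x)\<^sup>2)) \<partial>lborel)) \<le> ennreal C0 * (ennreal c1 * ?H + ennreal c2 * ?H)"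
      by (intro mult_left_mono add_mono t_nn u_nn) auto
    also have "\<dots> = ennreal (C0 * (c1 + c2)) * ?H"
      using C0 c by (simp add: ennreal_mult ennreal_plus distrib_right mult.assoc)
    finally show "(\<integral>\<^sup>+x. indicator (ball 0 1) x * ennreal ((norm (mollified_matrix G ?r x - mollified_matrix G 1 x))\<^sup>2) \<partial>lborel)
      \<le> ennreal (C0 * (c1 + c2)) * ?H" .
  qed
qed

text \<open>The mollifications are known to converge to G only in L^1. A subsequence converges
  almost everywhere, and Fatou carries the bound, which is uniform in the scale, to the
  limit.\<close>

lemma local_estimate_unit:
  assumes n: "CARD('n) \<ge> 3"
  obtains C where "C \<ge> 0" "\<And>V (G :: real ^ 'n \<Rightarrow> real ^ 'n ^ 'n). weak_pair (ball 0 4) V G \<Longrightarrow>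
    (\<integral>\<^sup>+x. indicator (ball 0 1) x * ennreal ((norm (G x - mollified_matrix G 1 x))\<^sup>2) \<partial>lborel)
     \<le> ennreal C * (\<integral>\<^sup>+x. indicator (ball 0 4) x * ennreal ((norm (trace_free_sym (G x)))\<^sup>2) \<partial>lborel)"
proof -
  obtain C where C: "C \<ge> 0" and le: "\<And>V (G :: real ^ 'n \<Rightarrow> real ^ 'n ^ 'n) N. weak_pair (ball 0 4) V G \<Longrightarrow>
    (\<integral>\<^sup>+x. indicator (ball 0 1) x * ennreal ((norm (mollified_matrix G ((1/2) ^ N) x - mollified_matrix G 1 x))\<^sup>2) \<partial>lborel)
     \<le> ennreal C * (\<integral>\<^sup>+x. indicator (ball 0 4) x * ennreal ((norm (trace_free_sym (G x)))\<^sup>2) \<partial>lborel)"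
    by (rule mollified_matrix_difference_L2[OF n], rule that)
  show thesis
  proof (rule that[OF C])
    fix V and G :: "real^'n \<Rightarrow> real^'n^'n" assume wp: "weak_pair (ball 0 4) V G"
    note G = weak_pairD(3)[OF wp] and Gij = weak_pairD(5)[OF wp]
    have Gm: "G \<in> borel_measurable borel" using G by auto
    let ?r = "\<lambda>N. (1/2::real) ^ N"
    let ?m = "\<lambda>N. mollified_matrix G (?r N)"
    have r: "?r N > 0" for N by simp
    have mm: "?m N \<in> borel_measurable borel" for N by (rule mollified_matrix_measurable[OF G r])
    define q where "q N x = (\<Sum>i\<in>UNIV. \<Sum>j\<in>UNIV. \<bar>?m N x $ i $ j - G x $ i $ j\<bar>)" for N x
    have mc: "(\<lambda>x. ?m N x $ i $ j - G x $ i $ j) \<in> borel_measurable borel" for N i j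
      using borel_measurable_diff[OF mm Gm, of N]
      by (intro borel_measurable_continuous_on[of "\<lambda>A :: real^'n^'n. A $ i $ j" "\<lambda>x. ?m N x - G x", simplified]
        continuous_intros) auto
    have qij: "(\<lambda>N. \<integral>\<^sup>+x. ennreal \<bar>?m N x $ i $ j - G x $ i $ j\<bar> \<partial>lborel) \<longlonglongrightarrow> 0" for i j
    proof (rule order_tendstoI)
      fix a :: ennreal assume "0 < a"
      then obtain e where e: "e > 0" "ennreal e < a"
        by (metis dense ennreal_cases ennreal_less_zero_iff not_le order_less_imp_le top.not_eq_extremum infinity_ennreal_def)
      obtain d where d: "d > 0" "\<And>r. \<bar>r\<bar> < d \<Longrightarrow>
        (\<integral>\<^sup>+x. ennreal \<bar>(\<integral>y. G (x + r *\<^sub>R y) $ i $ j * kernel_op 0 mollifier y \<partial>lborel) - G x $ i $ j\<bar> \<partial>lborel) < ennreal e"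
        using approximate_identity_L1[OF Gij kernel_op_mollifier_bumps integral_kernel_op_mollifier e(1), of i j 0] by blast
      have "?r \<longlonglongrightarrow> 0" by (rule LIMSEQ_realpow_zero) auto
      then have "eventually (\<lambda>N. \<bar>?r N\<bar> < d) sequentially"
        using d(1) by (auto dest: order_tendstoD(2))
      then show "eventually (\<lambda>N. (\<integral>\<^sup>+x. ennreal \<bar>?m N x $ i $ j - G x $ i $ j\<bar> \<partial>lborel) < a) sequentially"
      proof eventually_elim
        case (elim N)
        have "?m N x $ i $ j = (\<integral>y. G (x + ?r N *\<^sub>R y) $ i $ j * kernel_op 0 mollifier y \<partial>lborel)" for x
          unfolding mollified_matrix_component[OF G r] taylor_mean_def by simp
        then show ?case using d(2)[OF elim] e(2) by simp
      qed
    qed simp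
    have qnn: "(\<lambda>N. \<integral>\<^sup>+x. ennreal (q N x) \<partial>lborel) \<longlonglongrightarrow> 0"
    proof -
      have "(\<integral>\<^sup>+x. ennreal (q N x) \<partial>lborel) = (\<Sum>i\<in>UNIV. \<Sum>j\<in>UNIV. \<integral>\<^sup>+x. ennreal \<bar>?m N x $ i $ j - G x $ i $ j\<bar> \<partial>lborel)" for N
      proof -
        have "ennreal (q N x) = (\<Sum>i\<in>UNIV. \<Sum>j\<in>UNIV. ennreal \<bar>?m N x $ i $ j - G x $ i $ j\<bar>)" for x
          unfolding q_def by (simp add: sum_ennreal sum_nonneg)
        moreover have "(\<lambda>x. ennreal \<bar>?m N x $ i $ j - G x $ i $ j\<bar>) \<in> borel_measurable lborel" for i j
          using mc[of N i j] by simp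
        ultimately show ?thesis by (simp only: nn_integral_sum borel_measurable_sum)
      qed
      moreover have "(\<lambda>N. \<Sum>i\<in>UNIV. \<Sum>j\<in>UNIV. \<integral>\<^sup>+x. ennreal \<bar>?m N x $ i $ j - G x $ i $ j\<bar> \<partial>lborel) \<longlonglongrightarrow>
        (\<Sum>i\<in>(UNIV::'n set). \<Sum>j\<in>(UNIV::'n set). 0)"
        by (intro tendsto_sum qij)
      ultimately show ?thesis by simp
    qed
    have q0: "q N x \<ge> 0" for N x unfolding q_def by (intro sum_nonneg) auto
    have qm: "q N \<in> borel_measurable borel" for N
      unfolding q_def[abs_def] by (intro borel_measurable_sum borel_measurable_abs mc)
    \<comment> \<open>The extraction of an almost everywhere convergent subsequence asks that every
      member be integrable; the convergence in L^1 provides this from \<open>N0\<close> on, hence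
      the shifted sequence \<open>Q\<close>.\<close>
    obtain N0 where N0: "\<And>N. N \<ge> N0 \<Longrightarrow> (\<integral>\<^sup>+x. ennreal (q N x) \<partial>lborel) < 1"
      using order_tendstoD(2)[OF qnn, of 1] unfolding eventually_sequentially by auto
    define Q where "Q N = q (N + N0)" for N
    have iQ: "integrable lborel (Q N)" for N
    proof (rule integrableI_nonneg)
      show "(\<integral>\<^sup>+x. ennreal (Q N x) \<partial>lborel) < \<infinity>"
        using N0[of "N + N0"] unfolding Q_def by (simp add: order_less_trans[OF _ ennreal_one_less_top])
    qed (use qm q0 in \<open>auto simp: Q_def\<close>)
    have "(\<lambda>N. ennreal (\<integral>x. norm (Q N x) \<partial>lborel)) \<longlonglongrightarrow> ennreal 0"
    proof -
      have "ennreal (\<integral>x. norm (Q N x) \<partial>lborel) = (\<integral>\<^sup>+x. ennreal (q (N + N0) x) \<partial>lborel)" for N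
        using nn_integral_eq_integral[OF iQ, of N] q0 by (simp add: Q_def)
      then show ?thesis using LIMSEQ_ignore_initial_segment[OF qnn, of N0] by simp
    qed
    then have "(\<lambda>N. \<integral>x. norm (Q N x) \<partial>lborel) \<longlonglongrightarrow> 0"
      by (subst (asm) tendsto_ennreal_iff) auto
    from tendsto_L1_AE_subseq[OF iQ this] obtain s where s: "strict_mono s" "AE x in lborel. (\<lambda>N. Q (s N) x) \<longlonglongrightarrow> 0"
      by blast
    define t where "t N = s N + N0" for N
    let ?f = "\<lambda>N x. indicator (ball 0 1) x * ennreal ((norm (?m (t N) x - ?m 0 x))\<^sup>2)"
    let ?H = "\<integral>\<^sup>+x. indicator (ball 0 4) x * ennreal ((norm (trace_free_sym (G x)))\<^sup>2) \<partial>lborel"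
    have "AE x in lborel. indicator (ball 0 1) x * ennreal ((norm (G x - ?m 0 x))\<^sup>2) = liminf (\<lambda>N. ?f N x)"
      using s(2)
    proof eventually_elim
      case (elim x)
      have "(\<lambda>N. ?m (t N) x) \<longlonglongrightarrow> G x"
      proof (intro vec_tendstoI)
        fix i j
        have "(\<lambda>N. ?m (t N) x $ i $ j - G x $ i $ j) \<longlonglongrightarrow> 0"
        proof (rule Lim_null_comparison[OF _ elim], rule always_eventually, rule allI)
          fix N
          have "\<bar>?m (t N) x $ i $ j - G x $ i $ j\<bar> \<le> (\<Sum>j\<in>UNIV. \<bar>?m (t N) x $ i $ j - G x $ i $ j\<bar>)"
            by (rule member_le_sum) auto
          also have "\<dots> \<le> q (t N) x" unfolding q_def by (rule member_le_sum) (auto intro: sum_nonneg)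
          finally show "norm (?m (t N) x $ i $ j - G x $ i $ j) \<le> Q (s N) x" by (simp add: Q_def t_def)
        qed
        then show "(\<lambda>N. ?m (t N) x $ i $ j) \<longlonglongrightarrow> G x $ i $ j" by (simp add: LIM_zero_iff)
      qed
      then have "(\<lambda>N. ennreal ((norm (?m (t N) x - ?m 0 x))\<^sup>2)) \<longlonglongrightarrow> ennreal ((norm (G x - ?m 0 x))\<^sup>2)"
        by (intro tendsto_intros)
      then have "(\<lambda>N. ?f N x) \<longlonglongrightarrow> indicator (ball 0 1) x * ennreal ((norm (G x - ?m 0 x))\<^sup>2)"
        by (cases "x \<in> ball 0 1") auto
      then show ?case using lim_imp_Liminf[OF sequentially_bot] by metis
    qed
    then have "(\<integral>\<^sup>+x. indicator (ball 0 1) x * ennreal ((norm (G x - ?m 0 x))\<^sup>2) \<partial>lborel) = (\<integral>\<^sup>+x. liminf (\<lambda>N. ?f N x) \<partial>lborel)"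
      by (rule nn_integral_cong_AE)
    also have "\<dots> \<le> liminf (\<lambda>N. \<integral>\<^sup>+x. ?f N x \<partial>lborel)"
    proof (rule nn_integral_liminf)
      fix N
      have "(\<lambda>x. ennreal ((norm (?m (t N) x - ?m 0 x))\<^sup>2)) \<in> borel_measurable lborel"
        using borel_measurable_diff[OF mm mm, of "t N" 0] by measurable
      then show "?f N \<in> borel_measurable lborel"
        by (intro borel_measurable_times_ennreal borel_measurable_indicator) simp_all
    qed
    also have "\<dots> \<le> ennreal C * ?H"
    proof (rule Liminf_le)
      show "eventually (\<lambda>N. (\<integral>\<^sup>+x. ?f N x \<partial>lborel) \<le> ennreal C * ?H) sequentially"
        using le[OF wp] by (intro always_eventually) simp
    qed simp
    finally show "(\<integral>\<^sup>+x. indicator (ball 0 1) x * ennreal ((norm (G x - mollified_matrix G 1 x))\<^sup>2) \<partial>lborel) \<le> ennreal C * ?H"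
      by simp
  qed
qed

text \<open>Under y \<mapsto> z + R y the differential becomes R D on both sides and the volume
  element scales by R^n on both sides, so the constant of the unit ball is kept.\<close>

lemma local_estimate:
  assumes n: "CARD('n) \<ge> 3"
  obtains C where "C \<ge> 0" "\<And>U V (G :: real ^ 'n \<Rightarrow> real ^ 'n ^ 'n) z R. weak_pair U V G \<Longrightarrow> R > 0 \<Longrightarrow> ball z (4 * R) \<subseteq> U \<Longrightarrow>
    (\<integral>\<^sup>+x. indicator (ball z R) x * ennreal ((norm (G x - mollified_matrix G R x))\<^sup>2) \<partial>lborel)
     \<le> ennreal C * (\<integral>\<^sup>+x. indicator (ball z (4 * R)) x * ennreal ((norm (trace_free_sym (G x)))\<^sup>2) \<partial>lborel)"
proof -
  obtain C where C: "C \<ge> 0" and le: "\<And>V (G :: real ^ 'n \<Rightarrow> real ^ 'n ^ 'n). weak_pair (ball 0 4) V G \<Longrightarrow>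
    (\<integral>\<^sup>+x. indicator (ball 0 1) x * ennreal ((norm (G x - mollified_matrix G 1 x))\<^sup>2) \<partial>lborel)
     \<le> ennreal C * (\<integral>\<^sup>+x. indicator (ball 0 4) x * ennreal ((norm (trace_free_sym (G x)))\<^sup>2) \<partial>lborel)"
    by (rule local_estimate_unit[OF n], rule that)
  show thesis
  proof (rule that[OF C])
    fix U V and G :: "real^'n \<Rightarrow> real^'n^'n" and z R
    assume wp: "weak_pair U V G" and R: "R > 0" and sub: "ball z (4 * R) \<subseteq> U"
    note G = weak_pairD(3)[OF wp]
    have Gm: "G \<in> borel_measurable borel" using G by auto
    have wp': "weak_pair (ball 0 4) (\<lambda>y. V (z + R *\<^sub>R y)) (\<lambda>y. R *\<^sub>R G (z + R *\<^sub>R y))"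
    proof (rule weak_pair_rescale[OF wp R])
      fix y :: "real^'n" assume "y \<in> ball 0 4"
      then have "z + R *\<^sub>R y \<in> ball z (4 * R)" using R by (simp add: dist_norm)
      then show "z + R *\<^sub>R y \<in> U" using sub by blast
    qed simp
    have mol: "mollified_matrix (\<lambda>y. R *\<^sub>R G (z + R *\<^sub>R y)) 1 x = R *\<^sub>R mollified_matrix G R (z + R *\<^sub>R x)" for x
    proof -
      have "mollified_matrix (\<lambda>y. R *\<^sub>R G (z + R *\<^sub>R y)) 1 x =
        (\<integral>y. R *\<^sub>R (kernel_op 0 mollifier y *\<^sub>R G ((z + R *\<^sub>R x) + R *\<^sub>R y)) \<partial>lborel)"
        unfolding mollified_matrix_def
        by (intro Bochner_Integration.integral_cong refl) (simp add: algebra_simps)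
      then show ?thesis unfolding mollified_matrix_def by (simp only: integral_scaleR_right)
    qed
    have mm: "mollified_matrix G R \<in> borel_measurable borel" by (rule mollified_matrix_measurable[OF G R])
    have scale: "(\<integral>\<^sup>+x. indicator (ball z (\<rho> * R)) x * F x \<partial>lborel) =
      ennreal (R ^ CARD('n)) * (\<integral>\<^sup>+y. indicator (ball 0 \<rho>) y * F (z + R *\<^sub>R y) \<partial>lborel)"
      if F: "F \<in> borel_measurable borel" for F :: "real^'n \<Rightarrow> ennreal" and \<rho>
    proof -
      have "(\<integral>\<^sup>+x. indicator (ball z (\<rho> * R)) x * F x \<partial>lborel) =
        ennreal (\<bar>R\<bar> ^ DIM(real^'n)) * (\<integral>\<^sup>+y. indicator (ball z (\<rho> * R)) (z + R *\<^sub>R y) * F (z + R *\<^sub>R y) \<partial>lborel)"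
        using F R by (intro nn_integral_lborel_affine borel_measurable_times_ennreal borel_measurable_indicator) simp_all
      moreover have "indicator (ball z (\<rho> * R)) (z + R *\<^sub>R y) = (indicator (ball 0 \<rho>) y :: ennreal)" for y
        using R by (auto simp: indicator_def dist_norm mult.commute)
      ultimately show ?thesis using R by simp
    qed
    have sq: "ennreal ((norm (R *\<^sub>R A))\<^sup>2) = ennreal (R\<^sup>2) * ennreal ((norm A)\<^sup>2)" for A :: "real^'n^'n"
      by (simp add: power_mult_distrib ennreal_mult)
    let ?F = "\<lambda>x. ennreal ((norm (G x - mollified_matrix G R x))\<^sup>2)"
    let ?E = "\<lambda>x. ennreal ((norm (trace_free_sym (G x)))\<^sup>2)"
    have Fm: "?F \<in> borel_measurable borel" using borel_measurable_diff[OF Gm mm] by measurable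
    have Em: "?E \<in> borel_measurable borel" using measurable_compose[OF Gm trace_free_sym_borel] by measurable
    have Fm': "(\<lambda>y. indicator (ball 0 1) y * ?F (z + R *\<^sub>R y)) \<in> borel_measurable lborel"
      by (intro borel_measurable_times_ennreal borel_measurable_indicator measurable_compose[OF _ Fm]) simp_all
    have Em': "(\<lambda>y. indicator (ball 0 4) y * ?E (z + R *\<^sub>R y)) \<in> borel_measurable lborel"
      by (intro borel_measurable_times_ennreal borel_measurable_indicator measurable_compose[OF _ Em]) simp_all
    have "ennreal (R\<^sup>2) * (\<integral>\<^sup>+y. indicator (ball 0 1) y * ?F (z + R *\<^sub>R y) \<partial>lborel) =
      (\<integral>\<^sup>+x. indicator (ball 0 1) x * ennreal ((norm (R *\<^sub>R G (z + R *\<^sub>R x) - mollified_matrix (\<lambda>y. R *\<^sub>R G (z + R *\<^sub>R y)) 1 x))\<^sup>2) \<partial>lborel)"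
      unfolding mol scaleR_diff_right[symmetric] sq nn_integral_cmult[OF Fm', symmetric] by (simp only: mult.left_commute)
    also have "\<dots> \<le> ennreal C * (\<integral>\<^sup>+x. indicator (ball 0 4) x * ennreal ((norm (trace_free_sym (R *\<^sub>R G (z + R *\<^sub>R x))))\<^sup>2) \<partial>lborel)"
      by (rule le[OF wp'])
    also have "(\<integral>\<^sup>+x. indicator (ball 0 4) x * ennreal ((norm (trace_free_sym (R *\<^sub>R G (z + R *\<^sub>R x))))\<^sup>2) \<partial>lborel) =
      ennreal (R\<^sup>2) * (\<integral>\<^sup>+y. indicator (ball 0 4) y * ?E (z + R *\<^sub>R y) \<partial>lborel)"
      unfolding trace_free_sym_scaleR sq nn_integral_cmult[OF Em', symmetric] by (simp only: mult.left_commute)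
    finally have "ennreal (R\<^sup>2) * (\<integral>\<^sup>+y. indicator (ball 0 1) y * ?F (z + R *\<^sub>R y) \<partial>lborel) \<le>
      ennreal (R\<^sup>2) * (ennreal C * (\<integral>\<^sup>+y. indicator (ball 0 4) y * ?E (z + R *\<^sub>R y) \<partial>lborel))"
      by (simp only: mult.left_commute)
    then have *: "(\<integral>\<^sup>+y. indicator (ball 0 1) y * ?F (z + R *\<^sub>R y) \<partial>lborel) \<le>
      ennreal C * (\<integral>\<^sup>+y. indicator (ball 0 4) y * ?E (z + R *\<^sub>R y) \<partial>lborel)"
      using R by (subst (asm) ennreal_mult_le_mult_iff) auto
    show "(\<integral>\<^sup>+x. indicator (ball z R) x * ?F x \<partial>lborel) \<le> ennreal C * (\<integral>\<^sup>+x. indicator (ball z (4 * R)) x * ?E x \<partial>lborel)"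
      using mult_left_mono[OF *, of "ennreal (R ^ CARD('n))"] scale[OF Fm, of 1] scale[OF Em, of 4]
      by (simp add: mult.left_commute)
  qed
qed

subsection \<open>Averages over shadows\<close>

text \<open>For t_k = j_k / (l m^(k+1) H) the recursion reads t_k^2 \<le> t_(k+1). If t_0 were
  larger than 1, then t_k \<ge> t_0^(k+1) would be unbounded, against t_k \<le> B / (l H). The bound
  \<open>B\<close> may be arbitrarily bad, as it does not enter the conclusion.\<close>

lemma supergeometric_bound:
  fixes j :: "nat \<Rightarrow> real"
  assumes j0: "\<And>k. 0 \<le> j k" and bd: "\<And>k. j k \<le> B" and l: "l > 0" and m: "m \<ge> 1" and H: "H > 0"
    and step: "\<And>k. (j k)\<^sup>2 \<le> l * m ^ k * H * j (Suc k)"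
  shows "j 0 \<le> l * m * H"
proof (rule ccontr)
  define t where "t k = j k / (l * m ^ Suc k * H)" for k
  have t0: "t k \<ge> 0" for k using j0 l m H by (simp add: t_def)
  assume "\<not> j 0 \<le> l * m * H"
  then have t1: "t 0 > 1" using l m H by (simp add: t_def less_divide_eq)
  have tt: "(t k)\<^sup>2 \<le> t (Suc k)" for k
  proof -
    have pos: "l * m ^ Suc k * H > 0" "l * m ^ Suc (Suc k) * H > 0" using l m H by simp_all
    have "(t k)\<^sup>2 = (j k)\<^sup>2 / (l * m ^ Suc k * H)\<^sup>2" by (simp add: t_def power_divide)
    also have "\<dots> \<le> (l * m ^ k * H * j (Suc k)) / (l * m ^ Suc k * H)\<^sup>2"
      by (intro divide_right_mono step) auto
    also have "\<dots> = t (Suc k)" using l m H by (simp add: t_def power2_eq_square field_simps)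
    finally show ?thesis .
  qed
  have tk: "t k \<ge> t 0 ^ Suc k" for k
  proof (induction k)
    case (Suc k)
    have "t 0 ^ Suc (Suc k) \<le> (t 0 ^ Suc k)\<^sup>2"
      unfolding power_mult[symmetric] using t1 by (intro power_increasing) auto
    also have "\<dots> \<le> (t k)\<^sup>2" using Suc t1 by (intro power_mono) auto
    also have "\<dots> \<le> t (Suc k)" by (rule tt)
    finally show ?case .
  qed simp
  have "t k \<le> B / (l * H)" for k
  proof -
    have B0: "B \<ge> 0" using j0[of 0] bd[of 0] by linarith
    have "1 \<le> m ^ Suc k" using m by (rule one_le_power)
    then have "l * H * 1 \<le> l * H * m ^ Suc k" using l H by (intro mult_left_mono) auto
    then have "l * H \<le> l * m ^ Suc k * H" by (simp add: mult_ac)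
    then have "j k / (l * m ^ Suc k * H) \<le> B / (l * H)"
      using bd[of k] l H B0 by (intro frac_le) auto
    then show ?thesis by (simp add: t_def)
  qed
  moreover obtain k where "B / (l * H) < t 0 ^ k" using real_arch_pow[OF t1] by blast
  moreover have "t 0 ^ k \<le> t 0 ^ Suc k" using t1 by (intro power_increasing) auto
  ultimately show False using tk[of k] by (meson not_le order_trans)
qed

text \<open>The shadow of y is the ball around y of radius C d(y). For fixed y the kernel is, up to
  a constant, the uniform density on this ball; for fixed x it selects the points y in whose shadow
  x lies. The condition is an indicator of a real quotient, which makes joint measurability
  immediate.\<close>

definition shadow_kernel :: "'a::euclidean_space set \<Rightarrow> ('a \<Rightarrow> real) \<Rightarrow> real \<Rightarrow> 'a \<Rightarrow> 'a \<Rightarrow> ennreal" where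
  "shadow_kernel \<Omega> d C x y = indicator \<Omega> y * (indicator {..C} (dist x y / d y) * ennreal ((1 / d y) ^ DIM('a)))"

definition shadow_op :: "'a::euclidean_space set \<Rightarrow> ('a \<Rightarrow> real) \<Rightarrow> real \<Rightarrow> ('a \<Rightarrow> ennreal) \<Rightarrow> 'a \<Rightarrow> ennreal" where
  "shadow_op \<Omega> d C h x = (\<integral>\<^sup>+y. shadow_kernel \<Omega> d C x y * h y \<partial>lborel)"

context
  fixes \<Omega> :: "'a::euclidean_space set" and d :: "'a \<Rightarrow> real"
  assumes \<Omega>m[measurable]: "\<Omega> \<in> sets borel" and dm[measurable]: "d \<in> borel_measurable borel"
    and d0: "\<And>y. y \<in> \<Omega> \<Longrightarrow> d y > 0"
begin

lemma shadow_kernel_measurable [measurable (raw)]: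
  "(\<lambda>p. shadow_kernel \<Omega> d C (f p) (g p)) \<in> borel_measurable M"
  if [measurable]: "f \<in> borel_measurable M" "g \<in> borel_measurable M"
  unfolding shadow_kernel_def by measurable

lemma shadow_op_measurable [measurable]:
  assumes [measurable]: "h \<in> borel_measurable borel"
  shows "shadow_op \<Omega> d C h \<in> borel_measurable borel"
  unfolding shadow_op_def[abs_def] by measurable

text \<open>If x lies in both shadows, then |y - z| \<le> C d(y) + C d(z) \<le> 2 C d(z). The
  integral over x in the shadow of y yields a multiple of d(y)^n, which cancels the weight of
  y.\<close>

lemma shadow_kernel_product_integral:
  assumes C: "C \<ge> 0" and yz: "d y \<le> d z"
  shows "(\<integral>\<^sup>+x. shadow_kernel \<Omega> d C x y * shadow_kernel \<Omega> d C x z \<partial>lborel) \<le>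
    ennreal (unit_ball_vol (real DIM('a)) * C ^ DIM('a)) * (indicator \<Omega> y * shadow_kernel \<Omega> d (2 * C) y z)"
proof (cases "y \<in> \<Omega> \<and> z \<in> \<Omega>")
  case True
  let ?n = "DIM('a)"
  have dy: "d y > 0" "d z > 0" using True d0 by auto
  have "(\<integral>\<^sup>+x. shadow_kernel \<Omega> d C x y * shadow_kernel \<Omega> d C x z \<partial>lborel) \<le>
    (\<integral>\<^sup>+x. (ennreal ((1 / d y) ^ ?n) * shadow_kernel \<Omega> d (2 * C) y z) * indicator (cball y (C * d y)) x \<partial>lborel)"
  proof (rule nn_integral_mono)
    fix x
    show "shadow_kernel \<Omega> d C x y * shadow_kernel \<Omega> d C x z \<le> (ennreal ((1 / d y) ^ ?n) * shadow_kernel \<Omega> d (2 * C) y z) * indicator (cball y (C * d y)) x"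
    proof (cases "dist x y / d y \<le> C \<and> dist x z / d z \<le> C")
      case True2: True
      have a: "dist x y \<le> C * d y" "dist x z \<le> C * d z" using True2 dy by (auto simp: divide_le_eq)
      have "dist y z \<le> C * d y + C * d z" using dist_triangle[of y z x] a by (simp add: dist_commute)
      also have "\<dots> \<le> 2 * C * d z" using mult_left_mono[OF yz C] by simp
      finally have "dist y z / d z \<le> 2 * C" using dy by (simp add: divide_le_eq)
      then show ?thesis using True True2 a by (simp add: shadow_kernel_def dist_commute)
    next
      case False
      then have "shadow_kernel \<Omega> d C x y * shadow_kernel \<Omega> d C x z = 0" by (auto simp: shadow_kernel_def)
      then show ?thesis by (simp only: zero_le)
    qed
  qed
  also have "\<dots> = (ennreal ((1 / d y) ^ ?n) * shadow_kernel \<Omega> d (2 * C) y z) * ennreal (unit_ball_vol (real ?n) * (C * d y) ^ ?n)"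
    using C dy by (subst nn_integral_cmult) (auto simp: emeasure_cball intro!: borel_measurable_indicator)
  also have "\<dots> = (ennreal ((1 / d y) ^ ?n) * ennreal (unit_ball_vol (real ?n) * (C * d y) ^ ?n)) * shadow_kernel \<Omega> d (2 * C) y z"
    by (simp only: mult_ac)
  also have "ennreal ((1 / d y) ^ ?n) * ennreal (unit_ball_vol (real ?n) * (C * d y) ^ ?n) =
    ennreal ((1 / d y) ^ ?n * (unit_ball_vol (real ?n) * (C * d y) ^ ?n))"
    using C dy by (intro ennreal_mult[symmetric]) auto
  also have "(1 / d y) ^ ?n * (unit_ball_vol (real ?n) * (C * d y) ^ ?n) = unit_ball_vol (real ?n) * C ^ ?n"
    using dy by (simp add: power_divide power_mult_distrib)
  finally show ?thesis using True by simp
qed (auto simp: shadow_kernel_def)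

text \<open>Expanding the square and integrating over the variable whose distance \<open>d\<close> is the smaller one
  reproduces the operator with \<open>C\<close> doubled.\<close>

lemma shadow_op_square:
  assumes C: "C \<ge> 0" and [measurable]: "h \<in> borel_measurable borel"
  shows "(\<integral>\<^sup>+x. (shadow_op \<Omega> d C h x)\<^sup>2 \<partial>lborel) \<le>
    ennreal (2 * (unit_ball_vol (real DIM('a)) * C ^ DIM('a))) * (\<integral>\<^sup>+y. indicator \<Omega> y * h y * shadow_op \<Omega> d (2 * C) h y \<partial>lborel)"
proof -
  let ?k = "shadow_kernel \<Omega> d C" and ?v = "ennreal (unit_ball_vol (real DIM('a)) * C ^ DIM('a))"
  \<comment> \<open>The pairs with d(y) \<le> d(z); the other pairs arise from these by exchanging y
    and z, whence the factor 2 in front.\<close>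
  define P where "P x y z = (if d y \<le> d z then (?k x y * h y) * (?k x z * h z) else 0)" for x y z
  have Pm[measurable (raw)]: "(\<lambda>p. P (f p) (g p) (e p)) \<in> borel_measurable M"
    if [measurable]: "f \<in> borel_measurable M" "g \<in> borel_measurable M" "e \<in> borel_measurable M" for f g e and M :: "'z measure"
    unfolding P_def by measurable
  have sq: "(shadow_op \<Omega> d C h x)\<^sup>2 \<le> 2 * (\<integral>\<^sup>+y. \<integral>\<^sup>+z. P x y z \<partial>lborel \<partial>lborel)" for x
  proof -
    have "(shadow_op \<Omega> d C h x)\<^sup>2 = (\<integral>\<^sup>+y. \<integral>\<^sup>+z. (?k x y * h y) * (?k x z * h z) \<partial>lborel \<partial>lborel)"
      unfolding shadow_op_def power2_eq_square
      by (subst nn_integral_multc[symmetric], measurable) (subst nn_integral_cmult[symmetric], measurable)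
    also have "\<dots> \<le> (\<integral>\<^sup>+y. \<integral>\<^sup>+z. P x y z + P x z y \<partial>lborel \<partial>lborel)"
      by (intro nn_integral_mono) (auto simp: P_def mult.commute)
    also have "\<dots> = (\<integral>\<^sup>+y. (\<integral>\<^sup>+z. P x y z \<partial>lborel) + (\<integral>\<^sup>+z. P x z y \<partial>lborel) \<partial>lborel)"
      by (subst nn_integral_add, measurable)
    also have "\<dots> = (\<integral>\<^sup>+y. \<integral>\<^sup>+z. P x y z \<partial>lborel \<partial>lborel) + (\<integral>\<^sup>+y. \<integral>\<^sup>+z. P x z y \<partial>lborel \<partial>lborel)"
      by (subst nn_integral_add, measurable)
    also have "(\<integral>\<^sup>+y. \<integral>\<^sup>+z. P x z y \<partial>lborel \<partial>lborel) = (\<integral>\<^sup>+z. \<integral>\<^sup>+y. P x z y \<partial>lborel \<partial>lborel)"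
      by (rule lborel_pair.Fubini') measurable
    finally show ?thesis by (simp add: mult_2)
  qed
  have "(\<integral>\<^sup>+x. (shadow_op \<Omega> d C h x)\<^sup>2 \<partial>lborel) \<le> (\<integral>\<^sup>+x. 2 * (\<integral>\<^sup>+y. \<integral>\<^sup>+z. P x y z \<partial>lborel \<partial>lborel) \<partial>lborel)"
    by (intro nn_integral_mono sq)
  also have "\<dots> = 2 * (\<integral>\<^sup>+x. \<integral>\<^sup>+y. \<integral>\<^sup>+z. P x y z \<partial>lborel \<partial>lborel \<partial>lborel)"
    by (rule nn_integral_cmult) measurable
  also have "(\<integral>\<^sup>+x. \<integral>\<^sup>+y. \<integral>\<^sup>+z. P x y z \<partial>lborel \<partial>lborel \<partial>lborel) = (\<integral>\<^sup>+y. \<integral>\<^sup>+x. \<integral>\<^sup>+z. P x y z \<partial>lborel \<partial>lborel \<partial>lborel)"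
    by (rule lborel_pair.Fubini') measurable
  also have "\<dots> = (\<integral>\<^sup>+y. \<integral>\<^sup>+z. \<integral>\<^sup>+x. P x y z \<partial>lborel \<partial>lborel \<partial>lborel)"
    by (intro nn_integral_cong lborel_pair.Fubini') measurable
  also have "\<dots> \<le> (\<integral>\<^sup>+y. \<integral>\<^sup>+z. ?v * ((indicator \<Omega> y * h y) * (shadow_kernel \<Omega> d (2 * C) y z * h z)) \<partial>lborel \<partial>lborel)"
  proof (intro nn_integral_mono)
    fix y z
    show "(\<integral>\<^sup>+x. P x y z \<partial>lborel) \<le> ?v * ((indicator \<Omega> y * h y) * (shadow_kernel \<Omega> d (2 * C) y z * h z))"
    proof (cases "d y \<le> d z")
      case True
      have "(\<integral>\<^sup>+x. P x y z \<partial>lborel) = (\<integral>\<^sup>+x. (h y * h z) * (?k x y * ?k x z) \<partial>lborel)"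
        using True by (intro nn_integral_cong) (simp add: P_def mult_ac)
      also have "\<dots> = (h y * h z) * (\<integral>\<^sup>+x. ?k x y * ?k x z \<partial>lborel)" by (rule nn_integral_cmult) measurable
      also have "\<dots> \<le> (h y * h z) * (?v * (indicator \<Omega> y * shadow_kernel \<Omega> d (2 * C) y z))"
        by (intro mult_left_mono shadow_kernel_product_integral[OF C True]) auto
      also have "\<dots> = ?v * ((indicator \<Omega> y * h y) * (shadow_kernel \<Omega> d (2 * C) y z * h z))" by (simp only: mult_ac)
      finally show ?thesis .
    qed (simp add: P_def)
  qed
  also have "\<dots> = ?v * (\<integral>\<^sup>+y. indicator \<Omega> y * h y * shadow_op \<Omega> d (2 * C) h y \<partial>lborel)"
  proof -
    have "(\<integral>\<^sup>+z. ?v * ((indicator \<Omega> y * h y) * (shadow_kernel \<Omega> d (2 * C) y z * h z)) \<partial>lborel) =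
      ?v * (indicator \<Omega> y * h y * shadow_op \<Omega> d (2 * C) h y)" for y
    proof -
      have "(\<integral>\<^sup>+z. ?v * ((indicator \<Omega> y * h y) * (shadow_kernel \<Omega> d (2 * C) y z * h z)) \<partial>lborel) =
        ?v * (\<integral>\<^sup>+z. (indicator \<Omega> y * h y) * (shadow_kernel \<Omega> d (2 * C) y z * h z) \<partial>lborel)"
        by (rule nn_integral_cmult) measurable
      also have "(\<integral>\<^sup>+z. (indicator \<Omega> y * h y) * (shadow_kernel \<Omega> d (2 * C) y z * h z) \<partial>lborel) =
        (indicator \<Omega> y * h y) * (\<integral>\<^sup>+z. shadow_kernel \<Omega> d (2 * C) y z * h z \<partial>lborel)"
        by (rule nn_integral_cmult) measurable
      finally show ?thesis unfolding shadow_op_def .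
    qed
    moreover have "(\<integral>\<^sup>+y. ?v * (indicator \<Omega> y * h y * shadow_op \<Omega> d (2 * C) h y) \<partial>lborel) =
      ?v * (\<integral>\<^sup>+y. indicator \<Omega> y * h y * shadow_op \<Omega> d (2 * C) h y \<partial>lborel)"
      by (rule nn_integral_cmult) measurable
    ultimately show ?thesis by simp
  qed
  also have "2 * (?v * (\<integral>\<^sup>+y. indicator \<Omega> y * h y * shadow_op \<Omega> d (2 * C) h y \<partial>lborel)) =
    ennreal (2 * (unit_ball_vol (real DIM('a)) * C ^ DIM('a))) * (\<integral>\<^sup>+y. indicator \<Omega> y * h y * shadow_op \<Omega> d (2 * C) h y \<partial>lborel)"
    using C by (subst ennreal_mult) (simp_all add: mult.assoc)
  finally show ?thesis by (simp add: mult_left_mono)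
qed


text \<open>By the truncation the norms are finite and bounded uniformly in \<open>C\<close>, so that iterating
  the doubling inequality closes up.\<close>

lemma shadow_op_L2_truncated:
  assumes C: "C > 0" and fin: "emeasure lborel \<Omega> < \<infinity>" and hm[measurable]: "h \<in> borel_measurable borel"
    and H: "(\<integral>\<^sup>+y. indicator \<Omega> y * (h y)\<^sup>2 \<partial>lborel) < \<infinity>"
    and \<delta>: "\<delta> > 0" "\<And>y. h y \<noteq> 0 \<Longrightarrow> \<delta> \<le> d y"
  shows "(\<integral>\<^sup>+x. indicator \<Omega> x * (shadow_op \<Omega> d C h x)\<^sup>2 \<partial>lborel) \<le>
    ennreal ((2 * (unit_ball_vol (real DIM('a)) * C ^ DIM('a)))\<^sup>2 * 4 ^ DIM('a)) * (\<integral>\<^sup>+y. indicator \<Omega> y * (h y)\<^sup>2 \<partial>lborel)"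
proof -
  let ?n = "DIM('a)" and ?H = "\<integral>\<^sup>+y. indicator \<Omega> y * (h y)\<^sup>2 \<partial>lborel"
  define v where "v = unit_ball_vol (real ?n)"
  have v: "v > 0" by (simp add: v_def)
  define J where "J k = (\<integral>\<^sup>+x. indicator \<Omega> x * (shadow_op \<Omega> d (2 ^ k * C) h x)\<^sup>2 \<partial>lborel)" for k :: nat
  have ind2: "(indicator \<Omega> y * q)\<^sup>2 = indicator \<Omega> y * q\<^sup>2" for y and q :: ennreal
    by (simp add: indicator_def)
  \<comment> \<open>A crude bound for all \<open>J k\<close> at once: the distance condition of the
    kernel is dropped, so 2^k C disappears, and the weight is at most \<delta>^(-n) wherever h does
    not vanish.\<close>
  define A where "A = emeasure lborel \<Omega> * (ennreal ((1 / \<delta>) ^ ?n) * ennreal ((1 / \<delta>) ^ ?n) * (emeasure lborel \<Omega> * ?H))"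
  have Afin: "A < \<infinity>" unfolding A_def using fin H by (simp add: ennreal_mult_less_top)
  have JA: "J k \<le> A" for k
  proof -
    have T: "shadow_op \<Omega> d (2 ^ k * C) h x \<le> ennreal ((1 / \<delta>) ^ ?n) * (\<integral>\<^sup>+y. indicator \<Omega> y * (indicator \<Omega> y * h y) \<partial>lborel)" for x
    proof -
      have "shadow_op \<Omega> d (2 ^ k * C) h x \<le> (\<integral>\<^sup>+y. ennreal ((1 / \<delta>) ^ ?n) * (indicator \<Omega> y * (indicator \<Omega> y * h y)) \<partial>lborel)"
        unfolding shadow_op_def
      proof (rule nn_integral_mono)
        fix y
        show "shadow_kernel \<Omega> d (2 ^ k * C) x y * h y \<le> ennreal ((1 / \<delta>) ^ ?n) * (indicator \<Omega> y * (indicator \<Omega> y * h y))"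
        proof (cases "h y = 0 \<or> y \<notin> \<Omega>")
          case False
          then have "\<delta> \<le> d y" using \<delta> by auto
          then have "(1 / d y) ^ ?n \<le> (1 / \<delta>) ^ ?n" using \<delta>(1) by (intro power_mono frac_le) auto
          then have "shadow_kernel \<Omega> d (2 ^ k * C) x y \<le> ennreal ((1 / \<delta>) ^ ?n)"
            unfolding shadow_kernel_def by (auto simp: indicator_def intro: ennreal_leI)
          then show ?thesis using False by (auto intro: mult_right_mono)
        qed (auto simp: shadow_kernel_def)
      qed
      also have "\<dots> = ennreal ((1 / \<delta>) ^ ?n) * (\<integral>\<^sup>+y. indicator \<Omega> y * (indicator \<Omega> y * h y) \<partial>lborel)"
        by (rule nn_integral_cmult) measurable
      finally show ?thesis .
    qed
    have "(\<integral>\<^sup>+y. indicator \<Omega> y * (indicator \<Omega> y * h y) \<partial>lborel)\<^sup>2 \<le>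
      (\<integral>\<^sup>+y. (indicator \<Omega> y)\<^sup>2 \<partial>lborel) * (\<integral>\<^sup>+y. (indicator \<Omega> y * h y)\<^sup>2 \<partial>lborel)"
      by (rule Cauchy_Schwarz_nn_integral) measurable
    also have "\<dots> = emeasure lborel \<Omega> * ?H"
      using ind2[of _ 1] by (simp add: ind2)
    finally have CS: "(\<integral>\<^sup>+y. indicator \<Omega> y * (indicator \<Omega> y * h y) \<partial>lborel)\<^sup>2 \<le> emeasure lborel \<Omega> * ?H" .
    have "(shadow_op \<Omega> d (2 ^ k * C) h x)\<^sup>2 \<le> ennreal ((1 / \<delta>) ^ ?n) * ennreal ((1 / \<delta>) ^ ?n) * (emeasure lborel \<Omega> * ?H)" for x
    proof -
      have "(shadow_op \<Omega> d (2 ^ k * C) h x)\<^sup>2 \<le> (ennreal ((1 / \<delta>) ^ ?n) * (\<integral>\<^sup>+y. indicator \<Omega> y * (indicator \<Omega> y * h y) \<partial>lborel))\<^sup>2"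
        by (intro power_mono T) auto
      also have "\<dots> \<le> ennreal ((1 / \<delta>) ^ ?n) * ennreal ((1 / \<delta>) ^ ?n) * (emeasure lborel \<Omega> * ?H)"
        unfolding power_mult_distrib power2_eq_square[of "ennreal ((1 / \<delta>) ^ ?n)"] by (intro mult_left_mono CS) auto
      finally show ?thesis .
    qed
    then have "J k \<le> (\<integral>\<^sup>+x. (ennreal ((1 / \<delta>) ^ ?n) * ennreal ((1 / \<delta>) ^ ?n) * (emeasure lborel \<Omega> * ?H)) * indicator \<Omega> x \<partial>lborel)"
      unfolding J_def by (intro nn_integral_mono) (auto simp: indicator_def)
    also have "\<dots> = A" unfolding A_def by (subst nn_integral_cmult_indicator) (simp_all add: mult.commute)
    finally show ?thesis .
  qed
  \<comment> \<open>\<open>shadow_op_square\<close> followed by Cauchy-Schwarz. With 2^k C in place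
    of C the squared constant gains (2^k)^(2n) = (4^n)^k, the geometric factor of
    \<open>supergeometric_bound\<close>.\<close>
  have step: "(J k)\<^sup>2 \<le> ennreal ((2 * (v * C ^ ?n))\<^sup>2 * (4 ^ ?n) ^ k) * (?H * J (Suc k))" for k
  proof -
    let ?I = "\<integral>\<^sup>+y. (indicator \<Omega> y * h y) * (indicator \<Omega> y * shadow_op \<Omega> d (2 ^ Suc k * C) h y) \<partial>lborel"
    let ?c = "2 * (v * (2 ^ k * C) ^ ?n)"
    have "J k \<le> (\<integral>\<^sup>+x. (shadow_op \<Omega> d (2 ^ k * C) h x)\<^sup>2 \<partial>lborel)"
      unfolding J_def by (intro nn_integral_mono) (auto simp: indicator_def)
    also have "\<dots> \<le> ennreal ?c * (\<integral>\<^sup>+y. indicator \<Omega> y * h y * shadow_op \<Omega> d (2 * (2 ^ k * C)) h y \<partial>lborel)"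
      unfolding v_def using C by (intro shadow_op_square) auto
    also have "(\<integral>\<^sup>+y. indicator \<Omega> y * h y * shadow_op \<Omega> d (2 * (2 ^ k * C)) h y \<partial>lborel) = ?I"
      by (intro nn_integral_cong) (auto simp: indicator_def mult.assoc)
    finally have "(J k)\<^sup>2 \<le> (ennreal ?c * ?I)\<^sup>2" by (intro power_mono) auto
    also have "\<dots> = (ennreal ?c)\<^sup>2 * ?I\<^sup>2" by (simp only: power_mult_distrib)
    also have "\<dots> \<le> (ennreal ?c)\<^sup>2 * ((\<integral>\<^sup>+y. (indicator \<Omega> y * h y)\<^sup>2 \<partial>lborel) * (\<integral>\<^sup>+y. (indicator \<Omega> y * shadow_op \<Omega> d (2 ^ Suc k * C) h y)\<^sup>2 \<partial>lborel))"
      by (intro mult_left_mono Cauchy_Schwarz_nn_integral) measurable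
    also have "\<dots> = (ennreal ?c)\<^sup>2 * (?H * J (Suc k))" by (simp only: ind2 J_def)
    also have "(ennreal ?c)\<^sup>2 = ennreal (?c\<^sup>2)" using C v by (intro ennreal_power) auto
    also have "?c\<^sup>2 = (2 * (v * C ^ ?n))\<^sup>2 * (4 ^ ?n) ^ k"
    proof -
      have "((2::real) ^ k) ^ ?n * (2 ^ k) ^ ?n = (4 ^ ?n) ^ k"
        unfolding power_mult_distrib[symmetric] power_mult[symmetric] by (simp add: mult.commute)
      then show ?thesis by (simp add: power_mult_distrib power2_eq_square mult_ac)
    qed
    finally show ?thesis .
  qed
  have Jfin: "J k < \<infinity>" for k using JA Afin by (rule le_less_trans)
  define j where "j k = enn2real (J k)" for k
  have Jj: "J k = ennreal (j k)" for k using Jfin[of k] by (simp add: j_def)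
  define R where "R = enn2real ?H"
  have HR: "?H = ennreal R" using H by (simp add: R_def)
  have j0: "j k \<ge> 0" for k by (simp add: j_def)
  have R0: "R \<ge> 0" by (simp add: R_def)
  have stepr: "(j k)\<^sup>2 \<le> (2 * (v * C ^ ?n))\<^sup>2 * (4 ^ ?n) ^ k * R * j (Suc k)" for k
  proof -
    have nn: "0 \<le> (2 * (v * C ^ ?n))\<^sup>2 * (4 ^ ?n) ^ k" by simp
    have "ennreal ((j k)\<^sup>2) \<le> ennreal ((2 * (v * C ^ ?n))\<^sup>2 * (4 ^ ?n) ^ k * (R * j (Suc k)))"
      using step[of k] unfolding Jj HR ennreal_power[OF j0] ennreal_mult[OF R0 j0, symmetric]
        ennreal_mult[OF nn mult_nonneg_nonneg[OF R0 j0], symmetric] .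
    then show ?thesis
      using j0 R0 by (subst (asm) ennreal_le_iff) (auto simp: mult.assoc)
  qed
  have "j 0 \<le> (2 * (v * C ^ ?n))\<^sup>2 * 4 ^ ?n * R"
  proof (cases "R = 0")
    case True
    then show ?thesis using stepr[of 0] by simp
  next
    case False
    have "j k \<le> enn2real A" for k
      unfolding j_def using JA[of k] Afin by (intro enn2real_mono) auto
    then show ?thesis using v C False R0 j0 stepr
      by (intro supergeometric_bound[of j "enn2real A"]) auto
  qed
  then have "J 0 \<le> ennreal ((2 * (v * C ^ ?n))\<^sup>2 * 4 ^ ?n * R)" unfolding Jj by (rule ennreal_leI)
  then show ?thesis unfolding J_def HR v_def using R0 by (simp add: ennreal_mult)
qed

text \<open>The truncations of h to the points with d \<ge> 1/(m+1) increase to h on \<Omega>,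
  because d is positive there. The truncated bound does not depend on \<delta>, so monotone
  convergence passes it to h.\<close>

lemma shadow_op_L2:
  assumes C: "C > 0" and fin: "emeasure lborel \<Omega> < \<infinity>" and hm[measurable]: "h \<in> borel_measurable borel"
  shows "(\<integral>\<^sup>+x. indicator \<Omega> x * (shadow_op \<Omega> d C h x)\<^sup>2 \<partial>lborel) \<le>
    ennreal ((2 * (unit_ball_vol (real DIM('a)) * C ^ DIM('a)))\<^sup>2 * 4 ^ DIM('a)) * (\<integral>\<^sup>+y. indicator \<Omega> y * (h y)\<^sup>2 \<partial>lborel)"
    (is "_ \<le> ennreal ?B * ?H")
proof (cases "?H < \<infinity>")
  case False
  have "?B > 0" using C by (intro mult_pos_pos zero_less_power) auto
  then have "ennreal ?B \<noteq> 0" by (simp only: ennreal_eq_0_iff not_le)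
  moreover have "?H = top" using False by (simp add: less_top[symmetric])
  ultimately have "ennreal ?B * ?H = top" by (simp only: ennreal_mult_eq_top_iff) simp
  then show ?thesis by (simp only: top_greatest)
next
  case True
  define g where "g m y = (if 1 / real (Suc m) \<le> d y then h y else 0)" for m y
  have gm[measurable]: "g m \<in> borel_measurable borel" for m unfolding g_def[abs_def] by measurable
  have g_mono: "g m y \<le> g m' y" if "m \<le> m'" for m m' y
  proof -
    have "1 / real (Suc m') \<le> 1 / real (Suc m)" using that by (intro frac_le) auto
    then show ?thesis unfolding g_def by auto
  qed
  have g_le: "g m y \<le> h y" for m y by (simp add: g_def)
  have g_sup: "(SUP m. g m y) = h y" if y: "y \<in> \<Omega>" for y
  proof (rule antisym)
    show "(SUP m. g m y) \<le> h y" by (intro SUP_least g_le)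
    obtain m where "1 / real (Suc m) < d y" using reals_Archimedean[OF d0[OF y]] by (auto simp: inverse_eq_divide)
    then have "h y = g m y" by (simp add: g_def)
    also have "\<dots> \<le> (SUP m. g m y)" by (rule SUP_upper) simp
    finally show "h y \<le> (SUP m. g m y)" .
  qed
  have op: "shadow_op \<Omega> d C h x = (SUP m. shadow_op \<Omega> d C (g m) x)" for x
  proof -
    have "shadow_op \<Omega> d C h x = (\<integral>\<^sup>+y. (SUP m. shadow_kernel \<Omega> d C x y * g m y) \<partial>lborel)"
      unfolding shadow_op_def
    proof (intro nn_integral_cong)
      fix y show "shadow_kernel \<Omega> d C x y * h y = (SUP m. shadow_kernel \<Omega> d C x y * g m y)"
        using g_sup[of y] by (cases "y \<in> \<Omega>") (auto simp: SUP_mult_left_ennreal[symmetric] shadow_kernel_def)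
    qed
    also have "\<dots> = (SUP m. shadow_op \<Omega> d C (g m) x)"
      unfolding shadow_op_def
    proof (rule nn_integral_monotone_convergence_SUP)
      show "incseq (\<lambda>m y. shadow_kernel \<Omega> d C x y * g m y)"
        by (auto simp: incseq_def le_fun_def intro!: mult_left_mono g_mono)
    qed measurable
    finally show ?thesis .
  qed
  have op_mono: "shadow_op \<Omega> d C (g m) x \<le> shadow_op \<Omega> d C (g m') x" if "m \<le> m'" for m m' x
    unfolding shadow_op_def by (intro nn_integral_mono mult_left_mono g_mono that) auto
  have sq: "(SUP m. f m)\<^sup>2 = (SUP m. (f m)\<^sup>2)" if f: "incseq f" for f :: "nat \<Rightarrow> ennreal"
  proof (rule LIMSEQ_unique)
    show "(\<lambda>m. (f m)\<^sup>2) \<longlonglongrightarrow> (SUP m. (f m)\<^sup>2)"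
      using f by (intro LIMSEQ_SUP) (auto simp: incseq_def intro!: power_mono)
    have "(\<lambda>m. f m * f m) \<longlonglongrightarrow> (SUP m. f m) * (SUP m. f m)"
    proof -
      have "(SUP m. f m) * (SUP m. f m) = (SUP m. f m * f m)"
      proof (rule antisym)
        show "(SUP m. f m) * (SUP m. f m) \<le> (SUP m. f m * f m)"
          unfolding SUP_mult_left_ennreal SUP_mult_right_ennreal
        proof (intro SUP_least)
          fix i j
          have "f j * f i \<le> f (max i j) * f (max i j)" using f by (intro mult_mono) (auto simp: incseq_def)
          also have "\<dots> \<le> (SUP m. f m * f m)" by (rule SUP_upper) simp
          finally show "f j * f i \<le> (SUP m. f m * f m)" .
        qed
        show "(SUP m. f m * f m) \<le> (SUP m. f m) * (SUP m. f m)"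
          by (intro SUP_least mult_mono SUP_upper) auto
      qed
      moreover have "(\<lambda>m. f m * f m) \<longlonglongrightarrow> (SUP m. f m * f m)"
        using f by (intro LIMSEQ_SUP) (auto simp: incseq_def intro!: mult_mono)
      ultimately show ?thesis by simp
    qed
    then show "(\<lambda>m. (f m)\<^sup>2) \<longlonglongrightarrow> (SUP m. f m)\<^sup>2" by (simp add: power2_eq_square)
  qed
  have "(\<integral>\<^sup>+x. indicator \<Omega> x * (shadow_op \<Omega> d C h x)\<^sup>2 \<partial>lborel) = (\<integral>\<^sup>+x. (SUP m. indicator \<Omega> x * (shadow_op \<Omega> d C (g m) x)\<^sup>2) \<partial>lborel)"
    unfolding op by (intro nn_integral_cong) (subst sq, auto simp: incseq_def op_mono SUP_mult_left_ennreal)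
  also have "\<dots> = (SUP m. \<integral>\<^sup>+x. indicator \<Omega> x * (shadow_op \<Omega> d C (g m) x)\<^sup>2 \<partial>lborel)"
  proof (rule nn_integral_monotone_convergence_SUP)
    show "incseq (\<lambda>m x. indicator \<Omega> x * (shadow_op \<Omega> d C (g m) x)\<^sup>2)"
      by (auto simp: incseq_def le_fun_def intro!: mult_left_mono power_mono op_mono)
  qed measurable
  also have "\<dots> \<le> ennreal ?B * ?H"
  proof (rule SUP_least)
    fix m
    have le: "(\<integral>\<^sup>+y. indicator \<Omega> y * (g m y)\<^sup>2 \<partial>lborel) \<le> ?H"
      by (intro nn_integral_mono mult_left_mono power_mono g_le) auto
    have "(\<integral>\<^sup>+x. indicator \<Omega> x * (shadow_op \<Omega> d C (g m) x)\<^sup>2 \<partial>lborel) \<le> ennreal ?B * (\<integral>\<^sup>+y. indicator \<Omega> y * (g m y)\<^sup>2 \<partial>lborel)"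
      by (rule shadow_op_L2_truncated[OF C fin gm le_less_trans[OF le True], of "1 / real (Suc m)"])
        (auto simp: g_def split: if_splits)
    also have "\<dots> \<le> ennreal ?B * ?H" by (intro mult_left_mono le) auto
    finally show "(\<integral>\<^sup>+x. indicator \<Omega> x * (shadow_op \<Omega> d C (g m) x)\<^sup>2 \<partial>lborel) \<le> ennreal ?B * ?H" .
  qed
  finally show ?thesis .
qed

end

subsection \<open>Whitney averages and John curves\<close>

lemma infdist_frontier:
  fixes \<Omega> :: "'a::euclidean_space set"
  assumes \<Omega>: "open \<Omega>" "bounded \<Omega>" and x: "x \<in> \<Omega>"
  shows "0 < infdist x (frontier \<Omega>)" and "ball x (infdist x (frontier \<Omega>)) \<subseteq> \<Omega>"
proof -
  \<comment> \<open>\<open>infdist\<close> to the empty set is 0 by convention, so positivity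
    requires a nonempty frontier; this follows since \<Omega> is neither empty nor the whole
    space.\<close>
  have ne: "frontier \<Omega> \<noteq> {}" using assms frontier_eq_empty[of \<Omega>] not_bounded_UNIV[where 'a='a] by auto
  have "x \<notin> frontier \<Omega>" using \<Omega>(1) x by (simp add: frontier_def interior_open)
  then show "0 < infdist x (frontier \<Omega>)"
    using infdist_pos_not_in_closed[OF frontier_closed ne] by blast
  then have xb: "x \<in> ball x (infdist x (frontier \<Omega>))" by simp
  show "ball x (infdist x (frontier \<Omega>)) \<subseteq> \<Omega>"
  proof (rule ccontr)
    assume "\<not> ?thesis"
    then have "ball x (infdist x (frontier \<Omega>)) \<inter> frontier \<Omega> \<noteq> {}"
    proof (intro connected_Int_frontier connected_ball)
      show "ball x (infdist x (frontier \<Omega>)) \<inter> \<Omega> \<noteq> {}" using xb x by blast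
    qed auto
    then obtain w where "dist x w < infdist x (frontier \<Omega>)" "w \<in> frontier \<Omega>" by auto
    then show False using infdist_le[of w "frontier \<Omega>" x] by simp
  qed
qed

lemma infdist_lipschitz: "infdist x A \<le> infdist y A + dist x y"
  by (rule infdist_triangle)

text \<open>A continuous counterpart of a Whitney covering. After exchanging the integrals, x is
  weighted by the integral of d(z)^(-n) over the z with |x - z| < a d(z); there d(z) and d(x) are
  comparable, as d is 1-Lipschitz. Estimates on the balls of radius a d(z) can thus be integrated
  over z to obtain estimates on \<Omega>, without counting overlaps.\<close>

lemma whitney_average:
  fixes \<Omega> :: "'a::euclidean_space set" and F :: "'a \<Rightarrow> ennreal"
  assumes \<Omega>: "open \<Omega>" "bounded \<Omega>" and a: "0 < a" "a \<le> 1/2" and [measurable]: "F \<in> borel_measurable borel"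
  defines "d \<equiv> \<lambda>x. infdist x (frontier \<Omega>)"
  defines "W \<equiv> \<integral>\<^sup>+z. indicator \<Omega> z * (ennreal ((1 / d z) ^ DIM('a)) * (\<integral>\<^sup>+x. indicator (ball z (a * d z)) x * F x \<partial>lborel)) \<partial>lborel"
  shows "W \<le> ennreal (unit_ball_vol (real DIM('a)) * (3 * a) ^ DIM('a)) * (\<integral>\<^sup>+x. indicator \<Omega> x * F x \<partial>lborel)"
    and "ennreal (unit_ball_vol (real DIM('a)) * (a / 4) ^ DIM('a)) * (\<integral>\<^sup>+x. indicator \<Omega> x * F x \<partial>lborel) \<le> W"
proof -
  let ?n = "DIM('a)"
  have [measurable]: "\<Omega> \<in> sets borel" using \<Omega>(1) by simp
  have dm[measurable]: "d \<in> borel_measurable borel"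
    unfolding d_def by (intro borel_measurable_continuous_onI continuous_on_infdist continuous_on_id)
  have dpos: "0 < d x" and dball: "ball x (d x) \<subseteq> \<Omega>" if "x \<in> \<Omega>" for x
    using infdist_frontier[OF \<Omega> that] by (auto simp: d_def)
  have lip: "d x \<le> d y + dist x y" for x y unfolding d_def by (rule infdist_lipschitz)
  \<comment> \<open>Membership in a ball with variable centre and radius is expressed by the sign of
    a d(z) - |z - x|, which is jointly measurable.\<close>
  let ?k = "\<lambda>z x. indicator \<Omega> z * (ennreal ((1 / d z) ^ ?n) * indicator {0<..} (a * d z - dist z x)) :: ennreal"
  have "W = (\<integral>\<^sup>+z. \<integral>\<^sup>+x. ?k z x * F x \<partial>lborel \<partial>lborel)"
    unfolding W_def
  proof (intro nn_integral_cong)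
    fix z
    have "(\<integral>\<^sup>+x. ?k z x * F x \<partial>lborel) = (\<integral>\<^sup>+x. (indicator \<Omega> z * ennreal ((1 / d z) ^ ?n)) * (indicator {0<..} (a * d z - dist z x) * F x) \<partial>lborel)"
      by (simp only: mult.assoc)
    also have "\<dots> = (indicator \<Omega> z * ennreal ((1 / d z) ^ ?n)) * (\<integral>\<^sup>+x. indicator {0<..} (a * d z - dist z x) * F x \<partial>lborel)"
      by (rule nn_integral_cmult) measurable
    also have "(\<integral>\<^sup>+x. indicator {0<..} (a * d z - dist z x) * F x \<partial>lborel) = (\<integral>\<^sup>+x. indicator (ball z (a * d z)) x * F x \<partial>lborel)"
      by (intro nn_integral_cong) (auto simp: indicator_def)
    finally show "indicator \<Omega> z * (ennreal ((1 / d z) ^ ?n) * (\<integral>\<^sup>+x. indicator (ball z (a * d z)) x * F x \<partial>lborel)) =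
      (\<integral>\<^sup>+x. ?k z x * F x \<partial>lborel)" by (simp only: mult.assoc)
  qed
  also have "\<dots> = (\<integral>\<^sup>+x. \<integral>\<^sup>+z. ?k z x * F x \<partial>lborel \<partial>lborel)"
    by (rule lborel_pair.Fubini') measurable
  also have "\<dots> = (\<integral>\<^sup>+x. (\<integral>\<^sup>+z. ?k z x \<partial>lborel) * F x \<partial>lborel)"
    by (intro nn_integral_cong nn_integral_multc) measurable
  finally have W: "W = (\<integral>\<^sup>+x. (\<integral>\<^sup>+z. ?k z x \<partial>lborel) * F x \<partial>lborel)" .
  have ballint: "(\<integral>\<^sup>+z. c * indicator (ball x \<rho>) z \<partial>lborel) = c * ennreal (unit_ball_vol (real ?n) * \<rho> ^ ?n)"
    if "\<rho> \<ge> 0" for c and x :: 'a and \<rho> :: real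
  proof -
    have "(\<integral>\<^sup>+z. c * indicator (ball x \<rho>) z \<partial>lborel) = c * emeasure lborel (ball x \<rho>)"
      by (rule nn_integral_cmult_indicator) simp
    then show ?thesis using that by (simp add: emeasure_ball)
  qed
  have up: "(\<integral>\<^sup>+z. ?k z x \<partial>lborel) \<le> ennreal (unit_ball_vol (real ?n) * (3 * a) ^ ?n) * indicator \<Omega> x" for x
  proof (cases "x \<in> \<Omega>")
    case True
    \<comment> \<open>From a \<le> 1/2 one gets d(x) \<le> (3/2) d(z) and d(z) \<le> 2 d(x): the
      weight is at most (3/(2 d(x)))^n and the points z lie within 2 a d(x) of x.\<close>
    have "(\<integral>\<^sup>+z. ?k z x \<partial>lborel) \<le> (\<integral>\<^sup>+z. ennreal ((3 / (2 * d x)) ^ ?n) * indicator (ball x (2 * a * d x)) z \<partial>lborel)"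
    proof (rule nn_integral_mono)
      fix z
      show "?k z x \<le> ennreal ((3 / (2 * d x)) ^ ?n) * indicator (ball x (2 * a * d x)) z"
      proof (cases "z \<in> \<Omega> \<and> dist z x < a * d z")
        case zx: True
        have dz: "d z > 0" using dpos zx by blast
        have h: "a * d z \<le> (1/2) * d z" using a dz by (intro mult_right_mono) auto
        have "d x \<le> d z + dist z x" using lip[of x z] by (simp add: dist_commute)
        then have 1: "2 * d x \<le> 3 * d z" using zx h by linarith
        have "d z \<le> d x + dist z x" using lip[of z x] by simp
        then have "d z \<le> 2 * d x" using zx h by linarith
        then have "a * d z \<le> 2 * a * d x" using a by (simp add: mult_left_mono mult.assoc mult.left_commute)
        then have 2: "z \<in> ball x (2 * a * d x)" using zx by (simp add: dist_commute)
        have "1 / d z \<le> 3 / (2 * d x)" using 1 dz dpos[OF True] by (simp add: field_simps)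
        then have "(1 / d z) ^ ?n \<le> (3 / (2 * d x)) ^ ?n" using dz by (intro power_mono) auto
        then show ?thesis using 2 zx by (simp add: ennreal_leI)
      qed (auto simp: indicator_def)
    qed
    also have "\<dots> = ennreal ((3 / (2 * d x)) ^ ?n) * ennreal (unit_ball_vol (real ?n) * (2 * a * d x) ^ ?n)"
      using a dpos[OF True] by (intro ballint) auto
    also have "\<dots> = ennreal ((3 / (2 * d x)) ^ ?n * (unit_ball_vol (real ?n) * (2 * a * d x) ^ ?n))"
      using a dpos[OF True] by (intro ennreal_mult[symmetric]) auto
    also have "(3 / (2 * d x)) ^ ?n * (unit_ball_vol (real ?n) * (2 * a * d x) ^ ?n) = unit_ball_vol (real ?n) * ((3 / (2 * d x)) * (2 * a * d x)) ^ ?n"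
      by (simp only: power_mult_distrib mult_ac)
    also have "(3 / (2 * d x)) * (2 * a * d x) = 3 * a" using dpos[OF True] by simp
    finally show ?thesis using True by simp
  next
    case False
    have "?k z x = 0" for z
    proof (cases "z \<in> \<Omega>")
      case True
      have "a * d z \<le> 1 * d z" using a dpos[OF True] by (intro mult_right_mono) auto
      moreover have "\<not> dist z x < d z" using dball[OF True] False by auto
      ultimately show ?thesis by simp
    qed simp
    then show ?thesis by (simp only: nn_integral_const mult_zero_left zero_le)
  qed
  have lo: "ennreal (unit_ball_vol (real ?n) * (a / 4) ^ ?n) * indicator \<Omega> x \<le> (\<integral>\<^sup>+z. ?k z x \<partial>lborel)" for x
  proof (cases "x \<in> \<Omega>")
    case True
    have dx: "d x > 0" using dpos[OF True] .
    have "unit_ball_vol (real ?n) * (a / 4) ^ ?n = unit_ball_vol (real ?n) * ((1 / (2 * d x)) * (a / 2 * d x)) ^ ?n"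
      using dx by simp
    also have "\<dots> = (1 / (2 * d x)) ^ ?n * (unit_ball_vol (real ?n) * (a / 2 * d x) ^ ?n)"
      by (simp only: power_mult_distrib mult_ac)
    finally have "ennreal (unit_ball_vol (real ?n) * (a / 4) ^ ?n) =
      ennreal ((1 / (2 * d x)) ^ ?n) * ennreal (unit_ball_vol (real ?n) * (a / 2 * d x) ^ ?n)"
      using a dx by (simp only: ennreal_mult[symmetric] zero_le_power mult_nonneg_nonneg unit_ball_vol_nonneg of_nat_0_le_iff
        zero_le_divide_iff) (subst ennreal_mult, auto)
    also have "\<dots> = (\<integral>\<^sup>+z. ennreal ((1 / (2 * d x)) ^ ?n) * indicator (ball x (a / 2 * d x)) z \<partial>lborel)"
      using a dx by (intro ballint[symmetric]) auto
    \<comment> \<open>Within a d(x) / 2 of x, d(z) lies between d(x) / 2 and 2 d(x): the first bound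
      puts x into the ball around z, the second one bounds the weight from below.\<close>
    also have "\<dots> \<le> (\<integral>\<^sup>+z. ?k z x \<partial>lborel)"
    proof (rule nn_integral_mono)
      fix z
      show "ennreal ((1 / (2 * d x)) ^ ?n) * indicator (ball x (a / 2 * d x)) z \<le> ?k z x"
      proof (cases "dist z x < a / 2 * d x")
        case zx: True
        have h: "a / 2 * d x \<le> (1/4) * d x" using a dx by (intro mult_right_mono) auto
        have "dist x z < d x" unfolding dist_commute[of x z] using zx h dx by linarith
        then have z: "z \<in> \<Omega>" using dball[OF True] by auto
        have "d x \<le> d z + dist z x" using lip[of x z] by (simp add: dist_commute)
        then have "(1/2) * d x \<le> d z" using zx h dx by linarith
        then have "a * ((1/2) * d x) \<le> a * d z" using a by (intro mult_left_mono) auto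
        moreover have "a * ((1/2) * d x) = a / 2 * d x" by simp
        ultimately have k: "dist z x < a * d z" using zx by linarith
        have "d z \<le> d x + dist z x" using lip[of z x] by simp
        then have "d z \<le> 2 * d x" using zx h dx by linarith
        then have "(1 / (2 * d x)) ^ ?n \<le> (1 / d z) ^ ?n" using dx dpos[OF z] by (intro power_mono frac_le) auto
        then show ?thesis using z k zx by (simp add: ennreal_leI dist_commute)
      next
        case False
        then have "indicator (ball x (a / 2 * d x)) z = (0 :: ennreal)" by (simp add: dist_commute)
        then show ?thesis by (simp only: mult_zero_right zero_le)
      qed
    qed
    finally show ?thesis using True by simp
  qed simp
  have Fm: "(\<lambda>x. indicator \<Omega> x * F x) \<in> borel_measurable lborel" by measurable
  show "W \<le> ennreal (unit_ball_vol (real ?n) * (3 * a) ^ ?n) * (\<integral>\<^sup>+x. indicator \<Omega> x * F x \<partial>lborel)"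
    unfolding W nn_integral_cmult[OF Fm, symmetric]
    by (rule nn_integral_mono) (rule order_trans[OF mult_right_mono[OF up] eq_refl[OF mult.assoc]], simp)
  show "ennreal (unit_ball_vol (real ?n) * (a / 4) ^ ?n) * (\<integral>\<^sup>+x. indicator \<Omega> x * F x \<partial>lborel) \<le> W"
    unfolding W nn_integral_cmult[OF Fm, symmetric]
    by (rule nn_integral_mono) (rule order_trans[OF eq_refl[OF mult.assoc[symmetric]] mult_right_mono[OF lo]], simp)
qed

section \<open>Estimates along John curves\<close>

lemma arc_length_parametrized_dist:
  fixes g :: "real \<Rightarrow> 'a::metric_space"
  assumes g: "arc_length_parametrized g len" and st: "0 \<le> s" "s \<le> t" "t \<le> len"
  shows "dist (g s) (g t) \<le> t - s"
proof -
  let ?S = "\<lambda>ts. \<Sum>i<length ts - 1. ennreal (dist (g (ts ! i)) (g (ts ! Suc i)))"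
  let ?D = "dist (g s) (g t)"
  have cs: "curve_length g 0 s = ennreal s" and ct: "curve_length g 0 t = ennreal t"
    using g st by (auto simp: arc_length_parametrized_def)
  \<comment> \<open>A polygon on [0, s] is prolonged by the vertices s and t, and the edge from its
    last vertex to s is dropped. Its length plus the chord is thus at most t, and the supremum over
    all polygons gives s + chord \<le> t.\<close>
  have key: "?S ts + ennreal ?D \<le> ennreal t" if ts: "sorted ts" "set ts \<subseteq> {0..s}" for ts
  proof -
    let ?ts = "ts @ [s, t]"
    have "sorted ?ts" using ts st by (auto simp: sorted_append)
    moreover have "set ?ts \<subseteq> {0..t}" using ts st by auto
    ultimately have "?S ?ts \<le> ennreal t"
      unfolding ct[symmetric] curve_length_def by (intro SUP_upper) auto
    moreover have "?S ts + ennreal ?D \<le> ?S ?ts"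
    proof -
      have "?S ts + ennreal ?D = (\<Sum>i\<in>{..<length ts - 1} \<union> {length ts}. ennreal (dist (g (?ts ! i)) (g (?ts ! Suc i))))"
      proof (subst sum.union_disjoint)
        show "?S ts + ennreal ?D = (\<Sum>i<length ts - 1. ennreal (dist (g (?ts ! i)) (g (?ts ! Suc i)))) +
          (\<Sum>i\<in>{length ts}. ennreal (dist (g (?ts ! i)) (g (?ts ! Suc i))))"
          by (intro arg_cong2[of _ _ _ _ "(+)"] sum.cong) (auto simp: nth_append)
      qed auto
      also have "\<dots> \<le> ?S ?ts" by (rule sum_mono2) auto
      finally show ?thesis .
    qed
    ultimately show ?thesis by (rule order_trans[rotated])
  qed
  have Dt: "?D \<le> t" using key[of "[]"] st by (auto simp: ennreal_le_iff)
  have "ennreal s \<le> ennreal (t - ?D)"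
    unfolding cs[symmetric] curve_length_def
  proof (rule SUP_least)
    fix ts assume "ts \<in> {ts. sorted ts \<and> set ts \<subseteq> {0..s}}"
    then have k: "?S ts + ennreal ?D \<le> ennreal t" using key by blast
    define r where "r = (\<Sum>i<length ts - 1. dist (g (ts ! i)) (g (ts ! Suc i)))"
    have r: "?S ts = ennreal r" "r \<ge> 0" unfolding r_def by (auto intro: sum_ennreal sum_nonneg)
    have "r + ?D \<le> t" using k r(2) st unfolding r(1) by (simp add: ennreal_plus[symmetric] ennreal_le_iff del: ennreal_plus)
    then show "?S ts \<le> ennreal (t - ?D)" unfolding r(1) by (intro ennreal_leI) linarith
  qed
  then show ?thesis using Dt by (subst (asm) ennreal_le_iff) auto
qed

text \<open>The first term that counts is at most 1 / Q, and the following ones decay by the ratio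
  \<Theta>. The bound depends neither on where the progression starts nor on how many terms it
  has.\<close>

lemma sum_geometric_tail:
  fixes a \<Theta> Q :: real
  assumes a: "a > 0" and \<Theta>: "\<Theta> > 1" and Q: "Q > 0"
  shows "(\<Sum>k<N. if Q \<le> a * \<Theta> ^ k then 1 / (a * \<Theta> ^ k) else 0) \<le> \<Theta> / (\<Theta> - 1) * (1 / Q)"
proof -
  define K where "K = \<Theta> / (\<Theta> - 1)"
  have K: "K > 0" "K * (1 - 1 / \<Theta>) = 1" using \<Theta> by (auto simp: K_def field_simps)
  \<comment> \<open>For the induction the remaining tail is kept in reserve: the full geometric sum
    from index N on is K / (a \<Theta>^N), cut off at K / Q.\<close>
  have "(\<Sum>k<N. if Q \<le> a * \<Theta> ^ k then 1 / (a * \<Theta> ^ k) else 0) \<le> K * (1 / Q - min (1 / Q) (1 / (a * \<Theta> ^ N)))"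
  proof (induction N)
    case 0
    show ?case using K by simp
  next
    case (Suc N)
    define x where "x = 1 / (a * \<Theta> ^ N)"
    have pos: "a * \<Theta> ^ N > 0" using a \<Theta> by simp
    have xS: "1 / (a * \<Theta> ^ Suc N) = x / \<Theta>" by (simp add: x_def mult_ac)
    show ?case
    proof (cases "Q \<le> a * \<Theta> ^ N")
      case True
      have x: "x \<le> 1 / Q" "x > 0" using True Q pos by (auto simp: x_def frac_le)
      then have x2: "x / \<Theta> \<le> 1 / Q"       proof -
        have "x / \<Theta> \<le> x / 1" using \<Theta> x by (intro divide_left_mono) auto
        then show ?thesis using x by simp
      qed
      have "K * (1 / Q - x) + x = K * (1 / Q - x / \<Theta>)"
      proof -
        have "x = K * (1 - 1 / \<Theta>) * x" using K by simp
        then show ?thesis by (simp add: algebra_simps)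
      qed
      then show ?thesis using Suc True x x2 by (simp add: xS x_def[symmetric] min_absorb2 del: power_Suc)
    next
      case False
      then have "1 / Q \<le> x" using Q pos by (auto simp: x_def frac_le)
      then have "(\<Sum>k<N. if Q \<le> a * \<Theta> ^ k then 1 / (a * \<Theta> ^ k) else 0) \<le> 0"
        using Suc by (simp add: x_def[symmetric] min_absorb1)
      moreover have "0 \<le> K * (1 / Q - min (1 / Q) (1 / (a * \<Theta> ^ Suc N)))" using K by simp
      ultimately show ?thesis using False by simp
    qed
  qed
  also have "\<dots> \<le> K * (1 / Q)"
    using K a \<Theta> Q by (intro mult_left_mono) auto
  finally show ?thesis by (simp add: K_def)
qed

lemma partial_kernel_op_bound:
  assumes A: "A \<ge> 0"
  obtains P where "P \<ge> 0" "\<And>(a :: real ^ 'n) j y. norm a \<le> A \<Longrightarrow> \<bar>partial j (kernel_op a mollifier) y\<bar> \<le> P"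
proof -
  let ?\<eta> = "mollifier :: real^'n \<Rightarrow> real" and ?n = "real CARD('n)"
  obtain M0 where M0: "M0 \<ge> 0" "\<And>js x. length js \<le> 3 \<Longrightarrow> \<bar>foldr partial js ?\<eta> x\<bar> \<le> M0"
    using bumps_derivatives_bounded[OF mollifier_bumps compact_cball] by blast
  note sm\<eta> = bumps_smooth[OF mollifier_bumps]
  define B1 where "B1 = 2 ^ 3 * (A + 1) * M0"
  define B2 where "B2 = 2 ^ 3 * (A + 1) * B1"
  have B: "B1 \<ge> 0" "B2 \<ge> 0" using A M0 by (auto simp: B1_def B2_def)
  show thesis
  proof (rule that[of "M0 + ?n * B1 + ?n * (?n * B2) / 2"])
    show "M0 + ?n * B1 + ?n * (?n * B2) / 2 \<ge> 0" using M0 B by simp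
    fix a :: "real^'n" and j y assume a: "norm a \<le> A"
    let ?P1 = "\<lambda>i y. (a $ i - y $ i) * ?\<eta> y" and ?P2 = "\<lambda>i k y. (a $ i - y $ i) * ((a $ k - y $ k) * ?\<eta> y)"
    have s1: "smooth (?P1 i)" and s2: "smooth (?P2 i k)" for i k
      by (intro smooth_mult smooth_dist_coord sm\<eta>)+
    have b: "\<bar>foldr partial js (?P1 i) y\<bar> \<le> B1 \<and> \<bar>foldr partial js (?P2 i k) y\<bar> \<le> B2" if len: "length js \<le> 3" for js i k
    proof (cases "y \<in> cball 0 1")
      case True
      have X: "\<bar>foldr partial ks (\<lambda>y. a $ l - y $ l) y\<bar> \<le> A + 1" for ks l
      proof (rule foldr_partial_affine_bound[OF smooth_dist_coord partial_dist_coord])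
        show "\<bar>a $ l - y $ l\<bar> \<le> A + 1"
          using component_le_norm_cart[of a l] component_le_norm_cart[of y l] a True by auto
      qed (use A in auto)
      have P1: "\<bar>foldr partial ks (?P1 l) y\<bar> \<le> B1" if "length ks \<le> 3" for ks l
        unfolding B1_def by (rule foldr_partial_mult_bound[OF smooth_dist_coord sm\<eta> X M0(2) that])
      have "\<bar>foldr partial js (?P2 i k) y\<bar> \<le> B2"
        unfolding B2_def by (rule foldr_partial_mult_bound[OF smooth_dist_coord s1 X P1 len])
      then show ?thesis using P1[OF len] by blast
    next
      case False
      have "?P1 i \<in> bumps (cball 0 1)" "?P2 i k \<in> bumps (cball 0 1)"
        by (intro bumps_mult_right smooth_dist_coord mollifier_bumps)+
      then show ?thesis
        using bumps_zero[OF bumps_foldr_partial[OF _ closed_cball] False] B by simp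
    qed
    have eq: "partial j (kernel_op a ?\<eta>) y = partial j ?\<eta> y - (\<Sum>i\<in>UNIV. partial j (partial i (?P1 i)) y)
      + (\<Sum>i\<in>UNIV. \<Sum>k\<in>UNIV. partial j (partial i (partial k (?P2 i k))) y) / 2"
    proof -
      define Q1 where "Q1 = (\<lambda>y. \<Sum>i\<in>UNIV. partial i (?P1 i) y)"
      define Q2 where "Q2 = (\<lambda>y. \<Sum>i\<in>UNIV. \<Sum>k\<in>UNIV. partial i (partial k (?P2 i k)) y)"
      have q1: "smooth Q1" and q2: "smooth Q2"
        unfolding Q1_def Q2_def by (intro smooth_sum smooth_partial s1 s2)+
      have "kernel_op a ?\<eta> = (\<lambda>y. (?\<eta> y - Q1 y) + (1/2) * Q2 y)"
        by (simp add: kernel_op_def[abs_def] Q1_def Q2_def)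
      moreover have "partial j (\<lambda>y. (?\<eta> y - Q1 y) + (1/2) * Q2 y) y = partial j ?\<eta> y - partial j Q1 y + (1/2) * partial j Q2 y"
        by (simp only: partial_add[OF smooth_diff[OF sm\<eta> q1] smooth_mult[OF smooth_const q2]]
          partial_diff[OF sm\<eta> q1] partial_cmult[OF q2])
      moreover have "partial j Q1 y = (\<Sum>i\<in>UNIV. partial j (partial i (?P1 i)) y)"
        unfolding Q1_def by (simp add: partial_sum smooth_partial s1)
      moreover have "partial j Q2 y = (\<Sum>i\<in>UNIV. \<Sum>k\<in>UNIV. partial j (partial i (partial k (?P2 i k))) y)"
        unfolding Q2_def by (simp add: partial_sum smooth_sum smooth_partial s2)
      ultimately show ?thesis by simp
    qed
    have tri: "\<bar>p - q + w / 2\<bar> \<le> \<bar>p\<bar> + \<bar>q\<bar> + \<bar>w\<bar> / 2" for p q w :: real by linarith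
    have "\<bar>partial j (kernel_op a ?\<eta>) y\<bar> \<le> \<bar>partial j ?\<eta> y\<bar> + \<bar>\<Sum>i\<in>UNIV. partial j (partial i (?P1 i)) y\<bar>
      + \<bar>\<Sum>i\<in>UNIV. \<Sum>k\<in>UNIV. partial j (partial i (partial k (?P2 i k))) y\<bar> / 2"
      unfolding eq by (rule tri)
    also have "\<dots> \<le> M0 + (\<Sum>i\<in>(UNIV::'n set). B1) + (\<Sum>i\<in>(UNIV::'n set). \<Sum>k\<in>(UNIV::'n set). B2) / 2"
    proof (intro add_mono divide_right_mono order_trans[OF sum_abs] sum_mono)
      show "\<bar>partial j ?\<eta> y\<bar> \<le> M0" using M0(2)[of "[j]" y] by simp
      show "\<bar>partial j (partial i (?P1 i)) y\<bar> \<le> B1" for i using b[of "[j, i]" i i] by simp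
      show "\<bar>partial j (partial i (partial k (?P2 i k))) y\<bar> \<le> B2" for i k using b[of "[j, i, k]" i k] by simp
    qed auto
    finally show "\<bar>partial j (kernel_op a ?\<eta>) y\<bar> \<le> M0 + ?n * B1 + ?n * (?n * B2) / 2" by simp
  qed
qed

text \<open>For the last ball of the chain, where nothing is left to compare with: the derivative is
  moved from D to the kernel, which leaves the L^1 norm of v at the price of r^(-n-1).\<close>

lemma taylor_mean_bound:
  assumes A: "A \<ge> 0"
  obtains P where "P \<ge> 0"
    "\<And>U V G (x :: real ^ 'n) z r i j. weak_pair U V G \<Longrightarrow> r > 0 \<Longrightarrow> ball z (4 * r) \<subseteq> U \<Longrightarrow> dist x z \<le> A * r \<Longrightarrow>
      \<bar>taylor_mean (\<lambda>y. G y $ i $ j) z r x\<bar> \<le> P * (1 / r) ^ Suc CARD('n) * (\<integral>y. norm (V y) \<partial>lborel)"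
proof -
  obtain P where P: "P \<ge> 0" "\<And>(a :: real ^ 'n) j y. norm a \<le> A \<Longrightarrow> \<bar>partial j (kernel_op a mollifier) y\<bar> \<le> P"
    by (rule partial_kernel_op_bound[OF A, where 'n = 'n], rule that)
  show thesis
  proof (rule that[OF P(1)])
    fix U V G and x z :: "real^'n" and r i j
    assume wp: "weak_pair U V G" and r: "r > 0" and sub: "ball z (4 * r) \<subseteq> U" and d: "dist x z \<le> A * r"
    have wp': "weak_pair (ball 0 4) (\<lambda>y. V (z + r *\<^sub>R y)) (\<lambda>y. r *\<^sub>R G (z + r *\<^sub>R y))"
    proof (rule weak_pair_rescale[OF wp r])
      fix y :: "real^'n" assume "y \<in> ball 0 4"
      then have "z + r *\<^sub>R y \<in> ball z (4 * r)" using r by (simp add: dist_norm)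
      then show "z + r *\<^sub>R y \<in> U" using sub by blast
    qed simp
    define a where "a = (1 / r) *\<^sub>R (x - z)"
    have a: "norm a \<le> A" using d r by (simp add: a_def dist_norm divide_le_eq)
    have sub1: "cball 0 1 \<subseteq> ball (0::real^'n) 4" by auto
    let ?k = "kernel_op a mollifier :: real^'n \<Rightarrow> real"
    have bp: "partial j ?k \<in> bumps (cball 0 1)" by (intro bumps_partial kernel_op_mollifier_bumps closed_cball)
    have "r * taylor_mean (\<lambda>y. G y $ i $ j) z r x = (\<integral>y. (r *\<^sub>R G (z + r *\<^sub>R y)) $ i $ j * ?k y \<partial>lborel)"
      unfolding taylor_mean_def a_def by (simp add: mult.assoc)
    also have "\<dots> = - (\<integral>y. V (z + r *\<^sub>R y) $ i * partial j ?k y \<partial>lborel)"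
      using weak_pairD(6)[OF wp' compact_cball sub1 kernel_op_mollifier_bumps[of a], of i j] by simp
    finally have "\<bar>r * taylor_mean (\<lambda>y. G y $ i $ j) z r x\<bar> = \<bar>\<integral>y. V (z + r *\<^sub>R y) $ i * partial j ?k y \<partial>lborel\<bar>" by simp
    also have "\<dots> \<le> (\<integral>y. P * norm (V (z + r *\<^sub>R y)) \<partial>lborel)"
    proof (rule order_trans[OF integral_abs_bound], rule integral_mono')
      show "integrable lborel (\<lambda>y. P * norm (V (z + r *\<^sub>R y)))"
        using weak_pairD(2)[OF wp'] by simp
      show "\<bar>V (z + r *\<^sub>R y) $ i * partial j ?k y\<bar> \<le> P * norm (V (z + r *\<^sub>R y))" for y
        using mult_mono[OF P(2)[OF a, of j y] component_le_norm_cart[of "V (z + r *\<^sub>R y)" i]] P(1)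
        by (simp add: abs_mult mult.commute)
    qed (use P(1) in simp)
    also have "\<dots> = P * (1 / r) ^ CARD('n) * (\<integral>y. norm (V y) \<partial>lborel)"
    proof -
      have "(\<integral>y. norm (V y) \<partial>lborel) = r ^ CARD('n) * (\<integral>y. norm (V (z + r *\<^sub>R y)) \<partial>lborel)"
        using r by (subst integral_lborel_affine[of r _ z]) auto
      then show ?thesis using r by (simp add: power_divide)
    qed
    finally have "(1 / r) * \<bar>r * taylor_mean (\<lambda>y. G y $ i $ j) z r x\<bar> \<le> (1 / r) * (P * (1 / r) ^ CARD('n) * (\<integral>y. norm (V y) \<partial>lborel))"
      using r by (intro mult_left_mono) auto
    then show "\<bar>taylor_mean (\<lambda>y. G y $ i $ j) z r x\<bar> \<le> P * (1 / r) ^ Suc CARD('n) * (\<integral>y. norm (V y) \<partial>lborel)"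
      using r by (simp add: abs_mult mult_ac)
  qed
qed

text \<open>The Taylor means of D, always evaluated at the same x, are compared along balls on the
  John curve whose radius is proportional to s plus the length travelled. The initial radius may be
  chosen with s anywhere in [d(x)/2, d(x)]: the caller needs one radius for all x in a ball, hence
  one that does not depend exactly on d(x).\<close>

lemma john_pointwise_bound:
  fixes \<Omega> :: "(real ^ 'n) set"
  assumes n: "CARD('n) \<ge> 3" and J: "john_domain_with Cj \<Omega>"
  defines "d \<equiv> \<lambda>x. infdist x (frontier \<Omega>)"
  obtains c C2 P B where "0 < c" "c \<le> 1 / 24" "C2 > 0" "P \<ge> 0" "B \<ge> 0"
    "\<And>V G x s i j. weak_pair \<Omega> V G \<Longrightarrow> x \<in> \<Omega> \<Longrightarrow> d x / 2 \<le> s \<Longrightarrow> s \<le> d x \<Longrightarrow>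
      ennreal \<bar>taylor_mean (\<lambda>y. G y $ i $ j) x (c * s) x\<bar> \<le>
        ennreal (P * (\<integral>y. norm (V y) \<partial>lborel)) + ennreal B * shadow_op \<Omega> d C2 (\<lambda>y. ennreal (norm (trace_free_sym (G y)))) x"
proof -
  let ?n = "CARD('n)"
  have Cj: "Cj > 1" and \<Omega>: "open \<Omega>" "bounded \<Omega>" using J by (auto simp: john_domain_with_def)
  obtain x0 where x0: "x0 \<in> \<Omega>" and curve: "\<And>y. y \<in> \<Omega> \<Longrightarrow> \<exists>g len. arc_length_parametrized g len \<and> g ` {0..len} \<subseteq> \<Omega> \<and>
      g 0 = y \<and> g len = x0 \<and> (\<forall>t\<in>{0..len}. t / Cj \<le> infdist (g t) (frontier \<Omega>))"
    using J unfolding john_domain_with_def by blast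
  have dpos: "0 < d x" and dball: "ball x (d x) \<subseteq> \<Omega>" if "x \<in> \<Omega>" for x
    using infdist_frontier[OF \<Omega> that] by (auto simp: d_def)
  have lip: "d x \<le> d y + dist x y" for x y unfolding d_def by (rule infdist_lipschitz)
  have \<Omega>m[measurable]: "\<Omega> \<in> sets borel" using \<Omega>(1) by simp
  have dm[measurable]: "d \<in> borel_measurable borel"
    unfolding d_def by (intro borel_measurable_continuous_onI continuous_on_infdist continuous_on_id)
  \<comment> \<open>24 = 3 * 8. The 3 absorbs the comparison of s k with the length travelled or
    with d(x); the 8 keeps the ball of radius 4 r k at distance at least 4 r k from the
    frontier.\<close>
  define c where "c = 1 / (24 * Cj)"
  have c: "0 < c" "c \<le> 1 / 24" using Cj by (auto simp: c_def divide_le_eq field_simps)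
  \<comment> \<open>The distance from x to the k-th centre is at most s k, and s k = A * r
    k.\<close>
  define A where "A = 1 / c"
  have A: "A > 0" "A * c = 1" using c by (auto simp: A_def)
  \<comment> \<open>A step from s k to at most \<theta> * s k moves the centre by at most c * s k =
    r k, as \<open>taylor_mean_step\<close> demands.\<close>
  define \<theta> where "\<theta> = 1 + c"
  have \<theta>: "1 < \<theta>" "\<theta> \<le> 2" using c by (auto simp: \<theta>_def)
  have A0: "A \<ge> 0" using A by simp
  obtain M where M: "M \<ge> 0"
    and step: "\<And>U V G (x :: real ^ 'n) z z' r r' i j. weak_pair U V G \<Longrightarrow> r > 0 \<Longrightarrow> ball z (4 * r) \<subseteq> U \<Longrightarrow> dist x z \<le> A * r \<Longrightarrow>
      dist z z' \<le> r \<Longrightarrow> r \<le> r' \<Longrightarrow> r' \<le> 2 * r \<Longrightarrow>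
      \<bar>taylor_mean (\<lambda>y. G y $ i $ j) z' r' x - taylor_mean (\<lambda>y. G y $ i $ j) z r x\<bar>
        \<le> M * ((1 / r) ^ CARD('n) * L1_trace_free_sym (ball z (4 * r)) G)"
    by (rule taylor_mean_step[OF n A0], rule that)
  obtain P where P: "P \<ge> 0"
    and last: "\<And>U V G (x :: real ^ 'n) z r i j. weak_pair U V G \<Longrightarrow> r > 0 \<Longrightarrow> ball z (4 * r) \<subseteq> U \<Longrightarrow> dist x z \<le> A * r \<Longrightarrow>
      \<bar>taylor_mean (\<lambda>y. G y $ i $ j) z r x\<bar> \<le> P * (1 / r) ^ Suc CARD('n) * (\<integral>y. norm (V y) \<partial>lborel)"
    by (rule taylor_mean_bound[OF A0, where 'n = 'n], rule that)
  define P' where "P' = P * (2 / (c * d x0)) ^ Suc ?n"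
  define \<Theta> where "\<Theta> = \<theta> ^ ?n"
  have \<Theta>: "\<Theta> > 1" unfolding \<Theta>_def using \<theta> by (intro one_less_power) auto
  define C2 where "C2 = A + 4"
  define C3 where "C3 = 3 * A + 4"
  have C23: "C2 > 0" "C3 > 0" using A by (auto simp: C2_def C3_def)
  define B where "B = M * (\<Theta> / (\<Theta> - 1) * C3 ^ ?n)"
  show thesis
  proof (rule that[OF c, of C2 P' B])
    show "C2 > 0" "P' \<ge> 0" "B \<ge> 0"
      using C23 P M \<Theta> c dpos[OF x0] by (auto simp: P'_def B_def)
    fix V and G :: "real^'n \<Rightarrow> real^'n^'n" and x s0 i j
    assume wp: "weak_pair \<Omega> V G" and x: "x \<in> \<Omega>" and s0: "d x / 2 \<le> s0" "s0 \<le> d x"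
    note G = weak_pairD(3)[OF wp]
    have [measurable]: "G \<in> borel_measurable borel" using G by auto
    have s0p: "s0 > 0" using s0 dpos[OF x] by simp
    obtain g len where g: "arc_length_parametrized g len" "g ` {0..len} \<subseteq> \<Omega>" "g 0 = x" "g len = x0"
      "\<And>t. t \<in> {0..len} \<Longrightarrow> t / Cj \<le> d (g t)"
      using curve[OF x] unfolding d_def by blast
    have len: "len \<ge> 0" using g(1) by (simp add: arc_length_parametrized_def)
    \<comment> \<open>Geometric growth, capped so that the chain stops at the endpoint x0 of the
      curve.\<close>
    define s where "s k = min (s0 * \<theta> ^ k) (s0 + len)" for k
    define z where "z k = g (s k - s0)" for k
    define r where "r k = c * s k" for k
    have s_ge: "s0 \<le> s k" for k
    proof -
      have "s0 * 1 \<le> s0 * \<theta> ^ k" using s0p \<theta> by (intro mult_left_mono one_le_power) auto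
      then show ?thesis using len by (simp add: s_def)
    qed
    have sI: "s k - s0 \<in> {0..len}" for k using s_ge[of k] by (simp add: s_def)
    have s_pos: "s k > 0" and r_pos: "r k > 0" for k using s_ge[of k] s0p c by (auto simp: r_def)
    have s_mono: "s k \<le> s (Suc k)" for k
    proof -
      have "s0 * \<theta> ^ k * 1 \<le> s0 * \<theta> ^ k * \<theta>" using s0p \<theta> by (intro mult_left_mono) auto
      then show ?thesis by (auto simp: s_def mult_ac)
    qed
    have s_step: "s (Suc k) \<le> \<theta> * s k" for k
    proof -
      have "s0 + len \<le> \<theta> * (s0 + len)" using \<theta> s0p len by simp
      moreover have "s (Suc k) \<le> s0 + len" "s (Suc k) \<le> \<theta> * (s0 * \<theta> ^ k)" by (auto simp: s_def mult_ac)
      moreover have "s k = s0 * \<theta> ^ k \<or> s k = s0 + len" by (auto simp: s_def min_def)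
      ultimately show ?thesis by (elim disjE) simp_all
    qed
    have zO: "z k \<in> \<Omega>" for k using g(2) sI[of k] by (auto simp: z_def)
    have dz: "8 * r k \<le> d (z k)" for k
    proof -
      define t where "t = s k - s0"
      have t: "0 \<le> t" "t \<le> len" using sI[of k] by (auto simp: t_def)
      have "dist x (z k) \<le> t" using arc_length_parametrized_dist[OF g(1), of 0 t] t g(3) by (simp add: z_def t_def)
      then have d1: "d x - t \<le> d (z k)" using lip[of x "z k"] by linarith
      have d2: "t / Cj \<le> d (z k)" using g(5)[OF sI[of k]] by (simp add: z_def t_def)
      have sk: "s k \<le> d x + t" using s0 by (simp add: t_def)
      have r3: "8 * r k = s k / (3 * Cj)" using Cj by (simp add: r_def c_def)
      show ?thesis
      \<comment> \<open>On the first part of the curve, closeness to x bounds the distance to the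
        frontier from below; beyond it the John condition takes over.\<close>
      proof (cases "t \<le> d x / 2")
        case True
        have "8 * r k \<le> s k / 3" unfolding r3 using Cj s_pos[of k] by (intro divide_left_mono) auto
        also have "\<dots> \<le> d (z k)" using sk True d1 by linarith
        finally show ?thesis .
      next
        case False
        have "s k \<le> 3 * t" using sk False by linarith
        then have "s k / (3 * Cj) \<le> (3 * t) / (3 * Cj)" using Cj by (intro divide_right_mono) auto
        then show ?thesis unfolding r3 using d2 by simp
      qed
    qed
    have sub: "ball (z k) (4 * r k) \<subseteq> \<Omega>" for k
      by (rule order_trans[OF subset_ball dball[OF zO[of k]]]) (use dz[of k] r_pos[of k] in linarith)
    have xz: "dist x (z k) \<le> A * r k" for k
    proof -
      have "dist x (z k) \<le> s k - s0"
        using arc_length_parametrized_dist[OF g(1), of 0 "s k - s0"] sI[of k] g(3) by (simp add: z_def)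
      also have "\<dots> \<le> (A * c) * s k" using s0p A by simp
      finally show ?thesis by (simp add: r_def mult.assoc)
    qed
    have zz: "dist (z k) (z (Suc k)) \<le> r k" for k
    proof -
      have "dist (z k) (z (Suc k)) \<le> (s (Suc k) - s0) - (s k - s0)"
        unfolding z_def using sI[of k] sI[of "Suc k"] s_mono[of k] by (intro arc_length_parametrized_dist[OF g(1)]) auto
      also have "\<dots> \<le> \<theta> * s k - s k" using s_step[of k] by simp
      finally show ?thesis by (simp add: \<theta>_def r_def algebra_simps)
    qed
    have rr: "r k \<le> r (Suc k)" "r (Suc k) \<le> 2 * r k" for k
    proof -
      show "r k \<le> r (Suc k)" unfolding r_def using c s_mono by (intro mult_left_mono) auto
      have "s (Suc k) \<le> 2 * s k" using s_step[of k] mult_right_mono[OF \<theta>(2), of "s k"] s_pos[of k] by linarith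
      then show "r (Suc k) \<le> 2 * r k" unfolding r_def using c by simp
    qed
    let ?T = "\<lambda>k. taylor_mean (\<lambda>y. G y $ i $ j) (z k) (r k) x"
    let ?b = "\<lambda>k. (1 / r k) ^ ?n * L1_trace_free_sym (ball (z k) (4 * r k)) G"
    have tele: "\<bar>?T 0\<bar> \<le> \<bar>?T N\<bar> + M * (\<Sum>k<N. ?b k)" for N
    proof (induction N)
      case (Suc N)
      have "\<bar>?T (Suc N) - ?T N\<bar> \<le> M * ?b N"
        by (rule step[OF wp r_pos sub xz zz rr])
      moreover have "M * (\<Sum>k<Suc N. ?b k) = M * (\<Sum>k<N. ?b k) + M * ?b N" by (simp add: distrib_left)
      moreover have "\<bar>p\<bar> \<le> \<bar>q'\<bar> + (S + e)" if "\<bar>p\<bar> \<le> \<bar>q\<bar> + S" "\<bar>q' - q\<bar> \<le> e" for p q q' S e :: real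
        using that by linarith
      ultimately show ?case using Suc by (metis (no_types, lifting))
    qed simp
    obtain N0 where N0: "(s0 + len) / s0 < \<theta> ^ N0" using real_arch_pow[OF \<theta>(1)] by blast
    \<comment> \<open>Below the least such index the cap is inactive, so the radii form an exact
      geometric progression; at this index the ball is centred at x0.\<close>
    define N where "N = (LEAST N. s0 + len \<le> s0 * \<theta> ^ N)"
    have "s0 + len \<le> s0 * \<theta> ^ N0" using N0 s0p by (simp add: divide_less_eq mult.commute)
    then have N: "s0 + len \<le> s0 * \<theta> ^ N" unfolding N_def by (rule LeastI)
    have Nk: "s k = s0 * \<theta> ^ k" if "k < N" for k
      using not_less_Least[OF that[unfolded N_def]] by (simp add: s_def)
    have sN: "s N = s0 + len" using N by (simp add: s_def)
    \<comment> \<open>s N = s0 + len is at least d(x)/2 + |x - x0|, hence at least d(x0)/2: the last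
      radius is bounded below uniformly in x.\<close>
    have endpt: "\<bar>?T N\<bar> \<le> P' * (\<integral>y. norm (V y) \<partial>lborel)"
    proof -
      have "d x0 \<le> d x + dist x0 x" by (rule lip)
      moreover have "dist x0 x \<le> len"
        using arc_length_parametrized_dist[OF g(1), of 0 len] len g(3,4) by (simp add: dist_commute)
      ultimately have "d x0 / 2 \<le> s N" using s0 len dpos[OF x] unfolding sN by linarith
      then have "c * d x0 / 2 \<le> r N" unfolding r_def using c by (simp add: mult_left_mono)
      then have "1 / r N \<le> 2 / (c * d x0)" using c dpos[OF x0] r_pos[of N] by (simp add: field_simps)
      then have "(1 / r N) ^ Suc ?n \<le> (2 / (c * d x0)) ^ Suc ?n" using r_pos[of N] by (intro power_mono) auto
      then have "P * (1 / r N) ^ Suc ?n * (\<integral>y. norm (V y) \<partial>lborel) \<le> P' * (\<integral>y. norm (V y) \<partial>lborel)"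
        unfolding P'_def using P by (intro mult_right_mono mult_left_mono) auto
      then show ?thesis using last[OF wp r_pos sub xz, of i j N] by linarith
    qed
    let ?h = "\<lambda>y. ennreal (norm (trace_free_sym (G y)))"
    let ?K = "\<Theta> / (\<Theta> - 1) * C3 ^ ?n"
    have K: "?K \<ge> 0" using \<Theta> C23 by simp
    \<comment> \<open>For fixed y, the balls that contain y have radii at least d(y) / C3, so their
      weights form a tail of a geometric series, of size d(y)^(-n). The choice of the curve thereby
      disappears from the bound, which depends on x and y alone.\<close>
    have ptw: "(\<Sum>k<N. ennreal ((1 / r k) ^ ?n) * indicator {..<4 * r k} (dist (z k) y)) \<le> ennreal ?K * shadow_kernel \<Omega> d C2 x y" for y
    proof (cases "\<exists>k<N. dist (z k) y < 4 * r k")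
      case False
      then have "(\<Sum>k<N. ennreal ((1 / r k) ^ ?n) * indicator {..<4 * r k} (dist (z k) y)) = 0"
        by (intro sum.neutral) auto
      then show ?thesis by (simp only: zero_le)
    next
      case True
      \<comment> \<open>C2 comes from |x - y| \<le> A r k + 4 r k, and C3 from d(y) \<le> d(x) + |x
        - y| together with d(x) \<le> 2 s k = 2 A r k.\<close>
      have near: "y \<in> \<Omega> \<and> dist x y \<le> C2 * d y \<and> d y / C3 \<le> r k" if k: "dist (z k) y < 4 * r k" for k
      proof -
        have yO: "y \<in> \<Omega>" using sub[of k] k by auto
        have "4 * r k \<le> d y" using lip[of "z k" y] dz[of k] k by linarith
        then have 1: "r k \<le> d y" using r_pos[of k] by linarith
        have "dist x y \<le> dist x (z k) + dist (z k) y" by (rule dist_triangle)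
        then have 2: "dist x y \<le> C2 * r k" using xz[of k] k by (simp add: C2_def distrib_right)
        also have "\<dots> \<le> C2 * d y" using 1 C23 by (intro mult_left_mono) auto
        finally have 3: "dist x y \<le> C2 * d y" .
        have "d x \<le> 2 * s k" using s0 s_ge[of k] by linarith
        also have "s k = A * r k" using A by (simp add: r_def mult.assoc[symmetric])
        finally have "d y \<le> 2 * (A * r k) + C2 * r k" using lip[of y x] 2 by (simp add: dist_commute)
        then have "d y \<le> C3 * r k" by (simp add: C2_def C3_def algebra_simps)
        then have "d y / C3 \<le> r k" using C23 by (simp add: divide_le_eq mult.commute)
        with yO 3 show ?thesis by blast
      qed
      then have yO: "y \<in> \<Omega>" and xy: "dist x y \<le> C2 * d y" using True by blast+
      have dy: "d y > 0" by (rule dpos[OF yO])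
      define Q where "Q = (d y / C3) ^ ?n"
      have Q: "Q > 0" using dy C23 by (simp add: Q_def)
      define a where "a = (c * s0) ^ ?n"
      have a: "a > 0" using c s0p by (simp add: a_def)
      have ra: "(r k) ^ ?n = a * \<Theta> ^ k" if "k < N" for k
        unfolding r_def Nk[OF that] a_def \<Theta>_def power_mult_distrib power_mult[symmetric] by (simp add: mult_ac)
      have "(\<Sum>k<N. ennreal ((1 / r k) ^ ?n) * indicator {..<4 * r k} (dist (z k) y)) \<le>
        (\<Sum>k<N. ennreal (if Q \<le> a * \<Theta> ^ k then 1 / (a * \<Theta> ^ k) else 0))"
      proof (rule sum_mono)
        fix k assume "k \<in> {..<N}"
        then have k: "k < N" by simp
        show "ennreal ((1 / r k) ^ ?n) * indicator {..<4 * r k} (dist (z k) y) \<le> ennreal (if Q \<le> a * \<Theta> ^ k then 1 / (a * \<Theta> ^ k) else 0)"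
        proof (cases "dist (z k) y < 4 * r k")
          case True
          then have "d y / C3 \<le> r k" using near by blast
          then have "Q \<le> (r k) ^ ?n" unfolding Q_def using dy C23 by (intro power_mono) auto
          then show ?thesis using True by (simp add: ra[OF k] power_one_over)
        qed simp
      qed
      also have "\<dots> = ennreal (\<Sum>k<N. if Q \<le> a * \<Theta> ^ k then 1 / (a * \<Theta> ^ k) else 0)"
        using a \<Theta> by (intro sum_ennreal) auto
      also have "\<dots> \<le> ennreal (\<Theta> / (\<Theta> - 1) * (1 / Q))"
        by (intro ennreal_leI sum_geometric_tail a \<Theta> Q)
      also have "\<Theta> / (\<Theta> - 1) * (1 / Q) = ?K * (1 / d y) ^ ?n"
        using C23 dy by (simp add: Q_def power_divide)
      also have "ennreal (?K * (1 / d y) ^ ?n) = ennreal ?K * ennreal ((1 / d y) ^ ?n)"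
        using K dy by (intro ennreal_mult) auto
      also have "\<dots> = ennreal ?K * shadow_kernel \<Omega> d C2 x y"
        using yO xy dy by (simp add: shadow_kernel_def divide_le_eq)
      finally show ?thesis .
    qed
    have L0: "L1_trace_free_sym U G \<ge> 0" for U by simp
    have "ennreal (\<Sum>k<N. ?b k) = (\<Sum>k<N. ennreal ((1 / r k) ^ ?n) * ennreal (L1_trace_free_sym (ball (z k) (4 * r k)) G))"
    proof -
      have "ennreal (?b k) = ennreal ((1 / r k) ^ ?n) * ennreal (L1_trace_free_sym (ball (z k) (4 * r k)) G)" for k
        using r_pos[of k] L0 by (intro ennreal_mult) auto
      moreover have "ennreal (\<Sum>k<N. ?b k) = (\<Sum>k<N. ennreal (?b k))"
        using r_pos L0 by (intro sum_ennreal[symmetric] mult_nonneg_nonneg) (auto simp: less_imp_le)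
      ultimately show ?thesis by simp
    qed
    also have "\<dots> = (\<Sum>k<N. \<integral>\<^sup>+y. ennreal ((1 / r k) ^ ?n) * (indicator {..<4 * r k} (dist (z k) y) * ?h y) \<partial>lborel)"
      unfolding ennreal_L1_trace_free_sym_ball[OF G] by (intro sum.cong refl nn_integral_cmult[symmetric]) measurable
    also have "\<dots> = (\<integral>\<^sup>+y. (\<Sum>k<N. ennreal ((1 / r k) ^ ?n) * (indicator {..<4 * r k} (dist (z k) y) * ?h y)) \<partial>lborel)"
      by (rule nn_integral_sum[symmetric]) measurable
    also have "\<dots> \<le> (\<integral>\<^sup>+y. ennreal ?K * (shadow_kernel \<Omega> d C2 x y * ?h y) \<partial>lborel)"
    proof (rule nn_integral_mono)
      fix y
      have "(\<Sum>k<N. ennreal ((1 / r k) ^ ?n) * (indicator {..<4 * r k} (dist (z k) y) * ?h y)) =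
        (\<Sum>k<N. ennreal ((1 / r k) ^ ?n) * indicator {..<4 * r k} (dist (z k) y)) * ?h y"
        by (simp only: sum_distrib_right mult.assoc)
      also have "\<dots> \<le> (ennreal ?K * shadow_kernel \<Omega> d C2 x y) * ?h y" by (intro mult_right_mono ptw) simp
      finally show "(\<Sum>k<N. ennreal ((1 / r k) ^ ?n) * (indicator {..<4 * r k} (dist (z k) y) * ?h y)) \<le>
        ennreal ?K * (shadow_kernel \<Omega> d C2 x y * ?h y)" by (simp only: mult.assoc)
    qed
    also have "\<dots> = ennreal ?K * shadow_op \<Omega> d C2 ?h x"
    proof -
      show ?thesis unfolding shadow_op_def
        by (rule nn_integral_cmult) (unfold shadow_kernel_def, measurable)
    qed
    finally have sum_le: "ennreal (\<Sum>k<N. ?b k) \<le> ennreal ?K * shadow_op \<Omega> d C2 ?h x" .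
    have S0: "(\<Sum>k<N. ?b k) \<ge> 0" using r_pos L0 by (intro sum_nonneg mult_nonneg_nonneg) (auto simp: less_imp_le)
    have "s 0 = s0" using len by (simp add: s_def)
    then have T0: "taylor_mean (\<lambda>y. G y $ i $ j) x (c * s0) x = ?T 0" using g(3) by (simp add: z_def r_def)
    have "\<bar>?T 0\<bar> \<le> P' * (\<integral>y. norm (V y) \<partial>lborel) + M * (\<Sum>k<N. ?b k)"
      using tele[of N] endpt by linarith
    then have "ennreal \<bar>?T 0\<bar> \<le> ennreal (P' * (\<integral>y. norm (V y) \<partial>lborel) + M * (\<Sum>k<N. ?b k))" by (rule ennreal_leI)
    also have "\<dots> = ennreal (P' * (\<integral>y. norm (V y) \<partial>lborel)) + ennreal M * ennreal (\<Sum>k<N. ?b k)"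
    proof -
      have "0 \<le> P' * (\<integral>y. norm (V y) \<partial>lborel)" using P c dpos[OF x0] by (simp add: P'_def)
      then show ?thesis using M S0 by (simp only: ennreal_plus mult_nonneg_nonneg ennreal_mult)
    qed
    also have "\<dots> \<le> ennreal (P' * (\<integral>y. norm (V y) \<partial>lborel)) + ennreal M * (ennreal ?K * shadow_op \<Omega> d C2 ?h x)"
      by (intro add_left_mono mult_left_mono sum_le) auto
    also have "ennreal M * (ennreal ?K * shadow_op \<Omega> d C2 ?h x) = ennreal B * shadow_op \<Omega> d C2 ?h x"
      unfolding B_def mult.assoc[symmetric] using M K by (subst ennreal_mult[symmetric]) (auto simp: mult.assoc)
    finally show "ennreal \<bar>taylor_mean (\<lambda>y. G y $ i $ j) x (c * s0) x\<bar> \<le>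
        ennreal (P' * (\<integral>y. norm (V y) \<partial>lborel)) + ennreal B * shadow_op \<Omega> d C2 ?h x"
      unfolding T0 .
  qed
qed

subsection \<open>The global estimate\<close>

lemma ennreal_add_sq_le: "((a :: ennreal) + b)\<^sup>2 \<le> 2 * a\<^sup>2 + 2 * b\<^sup>2"
proof (cases a; cases b)
  fix r s assume rs: "0 \<le> r" "a = ennreal r" "0 \<le> s" "b = ennreal s"
  have "(r + s)\<^sup>2 \<le> 2 * r\<^sup>2 + 2 * s\<^sup>2"
    using sum_squares_bound[of r s] by (simp add: power2_sum)
  then have "ennreal ((r + s)\<^sup>2) \<le> ennreal (2 * r\<^sup>2 + 2 * s\<^sup>2)" by (rule ennreal_leI)
  moreover have "ennreal ((r + s)\<^sup>2) = (a + b)\<^sup>2"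
    using rs by (simp add: ennreal_power[symmetric] ennreal_plus[symmetric] del: ennreal_plus)
  moreover have "ennreal (2 * r\<^sup>2 + 2 * s\<^sup>2) = 2 * a\<^sup>2 + 2 * b\<^sup>2"
    using rs by (simp add: ennreal_mult ennreal_power)
  ultimately show ?thesis by simp
qed (simp_all add: power2_eq_square ennreal_mult_top)

text \<open>On the ball of radius a d(z) around z, the mollification of D at this scale links
  \<open>local_estimate\<close>, which needs one scale for the whole ball, with
  \<open>john_pointwise_bound\<close>, which needs a scale comparable to d(x).
  \<open>whitney_average\<close> turns the sum of both bounds into integrals over \<Omega>, and
  \<open>shadow_op_L2\<close> removes the operator.\<close>

lemma korn_john_domain:
  fixes \<Omega> :: "(real ^ 'n) set"
  assumes n: "CARD('n) \<ge> 3" and J: "john_domain_with Cj \<Omega>"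
  obtains C where "C \<ge> 0" "\<And>V G. weak_pair \<Omega> V G \<Longrightarrow>
    (\<integral>\<^sup>+x. indicator \<Omega> x * ennreal ((norm (G x))\<^sup>2) \<partial>lborel) \<le>
    ennreal C * ((\<integral>\<^sup>+x. indicator \<Omega> x * ennreal ((norm (trace_free_sym (G x)))\<^sup>2) \<partial>lborel) + ennreal ((\<integral>y. norm (V y) \<partial>lborel)\<^sup>2))"
proof -
  let ?n = "CARD('n)"
  define d where "d x = infdist x (frontier \<Omega>)" for x
  have \<Omega>: "open \<Omega>" "bounded \<Omega>" using J by (auto simp: john_domain_with_def)
  have \<Omega>m[measurable]: "\<Omega> \<in> sets borel" using \<Omega>(1) by simp
  have dm[measurable]: "d \<in> borel_measurable borel"
    unfolding d_def by (intro borel_measurable_continuous_onI continuous_on_infdist continuous_on_id)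
  have fin: "emeasure lborel \<Omega> < \<infinity>" using emeasure_bounded_finite[OF \<Omega>(2)] by (simp add: less_top)
  have dpos: "0 < d x" and dball: "ball x (d x) \<subseteq> \<Omega>" if "x \<in> \<Omega>" for x
    using infdist_frontier[OF \<Omega> that] by (auto simp: d_def)
  have lip: "d x \<le> d y + dist x y" for x y unfolding d_def by (rule infdist_lipschitz)
  obtain c C2 P B where c: "0 < c" "c \<le> 1 / 24" and C2: "C2 > 0" and P: "P \<ge> 0" and B: "B \<ge> 0"
    and ptw: "\<And>V G x s i j. weak_pair \<Omega> V G \<Longrightarrow> x \<in> \<Omega> \<Longrightarrow> infdist x (frontier \<Omega>) / 2 \<le> s \<Longrightarrow> s \<le> infdist x (frontier \<Omega>) \<Longrightarrow>
      ennreal \<bar>taylor_mean (\<lambda>y. G y $ i $ j) x (c * s) x\<bar> \<le>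
        ennreal (P * (\<integral>y. norm (V y) \<partial>lborel)) +
        ennreal B * shadow_op \<Omega> (\<lambda>x. infdist x (frontier \<Omega>)) C2 (\<lambda>y. ennreal (norm (trace_free_sym (G y)))) x"
    by (rule john_pointwise_bound[OF n J], rule that)
  have d_eq: "(\<lambda>x. infdist x (frontier \<Omega>)) = d" by (simp add: d_def fun_eq_iff)
  note ptw = ptw[unfolded d_eq, folded d_def]
  obtain Cl where Cl: "Cl \<ge> 0" and loc: "\<And>U V (G :: real ^ 'n \<Rightarrow> real ^ 'n ^ 'n) z R. weak_pair U V G \<Longrightarrow> R > 0 \<Longrightarrow> ball z (4 * R) \<subseteq> U \<Longrightarrow>
    (\<integral>\<^sup>+x. indicator (ball z R) x * ennreal ((norm (G x - mollified_matrix G R x))\<^sup>2) \<partial>lborel)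
     \<le> ennreal Cl * (\<integral>\<^sup>+x. indicator (ball z (4 * R)) x * ennreal ((norm (trace_free_sym (G x)))\<^sup>2) \<partial>lborel)"
    by (rule local_estimate[OF n], rule that)
  \<comment> \<open>The common scale is c s with s = (3/4) d(z). For |x - z| < d(z)/32 this s lies
    between d(x)/2 and d(x).\<close>
  define a where "a = c * (3 / 4)"
  have a: "0 < a" "a \<le> 1 / 32" using c by (auto simp: a_def)
  define vol where "vol = unit_ball_vol (real ?n)"
  have vol: "vol > 0" by (simp add: vol_def)
  define \<kappa> where "\<kappa> = vol * (a / 4) ^ ?n"
  have \<kappa>: "\<kappa> > 0" using vol a by (simp add: \<kappa>_def)
  define C1 where "C1 = 2 * Cl"
  \<comment> \<open>The norm of a matrix is at most the sum of its n^2 entries, which gives n^4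
    after squaring; the 4 comes from using (p + q)^2 \<le> 2 p^2 + 2 q^2 twice.\<close>
  define C3 where "C3 = 4 * (real ?n * real ?n)\<^sup>2"
  define W1 where "W1 = vol * (3 * (4 * a)) ^ ?n"
  define W2 where "W2 = vol * (3 * a) ^ ?n"
  define Sb where "Sb = (2 * (vol * C2 ^ ?n))\<^sup>2 * 4 ^ ?n"
  define mu where "mu = enn2real (emeasure lborel \<Omega>)"
  have mu: "emeasure lborel \<Omega> = ennreal mu" "mu \<ge> 0" using fin by (auto simp: mu_def)
  have pos: "C1 \<ge> 0" "C3 \<ge> 0" "W1 \<ge> 0" "W2 \<ge> 0" "Sb \<ge> 0"
    using Cl vol a by (auto simp: C1_def C3_def W1_def W2_def Sb_def)
  define K1 where "K1 = C1 * W1 + C3 * W2 * (B\<^sup>2 * Sb)"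
  define K2 where "K2 = C3 * W2 * (P\<^sup>2 * mu)"
  have K: "K1 \<ge> 0" "K2 \<ge> 0" using pos mu by (auto simp: K1_def K2_def)
  show thesis
  proof (rule that[of "(1 / \<kappa>) * (K1 + K2)"])
    show "(1 / \<kappa>) * (K1 + K2) \<ge> 0" using K \<kappa> by simp
    fix V and G :: "real^'n \<Rightarrow> real^'n^'n" assume wp: "weak_pair \<Omega> V G"
    note Gi = weak_pairD(3)[OF wp]
    have Gm[measurable]: "G \<in> borel_measurable borel" using Gi by auto
    define N where "N = (\<integral>y. norm (V y) \<partial>lborel)"
    have N: "N \<ge> 0" by (simp add: N_def)
    let ?h = "\<lambda>y. ennreal (norm (trace_free_sym (G y)))"
    have hm[measurable]: "?h \<in> borel_measurable borel" using measurable_compose[OF Gm trace_free_sym_borel] by measurable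
    let ?E = "\<lambda>x. ennreal ((norm (trace_free_sym (G x)))\<^sup>2)"
    have Em[measurable]: "?E \<in> borel_measurable borel" using measurable_compose[OF Gm trace_free_sym_borel] by measurable
    let ?F = "\<lambda>x. ennreal ((norm (G x))\<^sup>2)"
    have Fm[measurable]: "?F \<in> borel_measurable borel" by measurable
    define S where "S = shadow_op \<Omega> d C2 ?h"
    have Sm[measurable]: "S \<in> borel_measurable borel" unfolding S_def by (rule shadow_op_measurable[OF \<Omega>m dm dpos hm])
    define H where "H x = ennreal (P\<^sup>2 * N\<^sup>2) + ennreal (B\<^sup>2) * (S x)\<^sup>2" for x
    have Hm[measurable]: "H \<in> borel_measurable borel" unfolding H_def[abs_def] by measurable
    have ball_le: "(\<integral>\<^sup>+x. indicator (ball z (a * d z)) x * ?F x \<partial>lborel) \<le>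
      ennreal C1 * (\<integral>\<^sup>+x. indicator (ball z (4 * a * d z)) x * ?E x \<partial>lborel) +
      ennreal C3 * (\<integral>\<^sup>+x. indicator (ball z (a * d z)) x * H x \<partial>lborel)" if z: "z \<in> \<Omega>" for z
    proof -
      define R where "R = a * d z"
      have dz: "d z > 0" by (rule dpos[OF z])
      have R: "R > 0" using a dz by (simp add: R_def)
      have aR: "R \<le> (1 / 32) * d z" unfolding R_def using a dz by (intro mult_right_mono) auto
      have sub: "ball z (4 * R) \<subseteq> \<Omega>"
        by (rule order_trans[OF subset_ball dball[OF z]]) (use aR dz in linarith)
      let ?m = "mollified_matrix G R"
      have mm: "?m \<in> borel_measurable borel" by (rule mollified_matrix_measurable[OF Gi R])
      have mH: "2 * ennreal ((norm (?m x))\<^sup>2) \<le> ennreal C3 * H x" if x: "x \<in> ball z R" for x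
      proof -
        have xz: "dist z x < R" using x by simp
        have xO: "x \<in> \<Omega>" using sub x R by auto
        define s where "s = (3 / 4) * d z"
        have "d x \<le> d z + dist z x" "d z \<le> d x + dist z x" using lip[of x z] lip[of z x] by (simp_all add: dist_commute)
        then have s: "d x / 2 \<le> s" "s \<le> d x" using xz aR dz by (auto simp: s_def)
        have cs: "c * s = R" by (simp add: s_def R_def a_def)
        have T: "ennreal \<bar>?m x $ i $ j\<bar> \<le> ennreal (P * N) + ennreal B * S x" for i j
          using ptw[OF wp xO s, of i j] unfolding cs mollified_matrix_component[OF Gi R] N_def S_def .
        have "norm (?m x) \<le> (\<Sum>i\<in>UNIV. norm (?m x $ i))" unfolding norm_vec_def[of "?m x"] by (rule L2_set_le_sum) simp
        also have "\<dots> \<le> (\<Sum>i\<in>UNIV. \<Sum>j\<in>UNIV. \<bar>?m x $ i $ j\<bar>)" by (intro sum_mono norm_le_l1_cart)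
        finally have "ennreal (norm (?m x)) \<le> ennreal (\<Sum>i\<in>UNIV. \<Sum>j\<in>UNIV. \<bar>?m x $ i $ j\<bar>)" by (rule ennreal_leI)
        also have "\<dots> = (\<Sum>i\<in>UNIV. \<Sum>j\<in>UNIV. ennreal \<bar>?m x $ i $ j\<bar>)" by (simp add: sum_ennreal sum_nonneg)
        also have "\<dots> \<le> (\<Sum>i\<in>(UNIV::'n set). \<Sum>j\<in>(UNIV::'n set). ennreal (P * N) + ennreal B * S x)" by (intro sum_mono T)
        also have "\<dots> = ennreal (real ?n * real ?n) * (ennreal (P * N) + ennreal B * S x)"
          by (simp add: ennreal_of_nat_eq_real_of_nat ennreal_mult mult.assoc)
        finally have "(ennreal (norm (?m x)))\<^sup>2 \<le> (ennreal (real ?n * real ?n) * (ennreal (P * N) + ennreal B * S x))\<^sup>2"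
          by (intro power_mono) auto
        also have "\<dots> \<le> (ennreal (real ?n * real ?n))\<^sup>2 * (2 * (ennreal (P * N))\<^sup>2 + 2 * (ennreal B * S x)\<^sup>2)"
          unfolding power_mult_distrib[of "ennreal (real ?n * real ?n)"] by (intro mult_left_mono ennreal_add_sq_le) auto
        also have "2 * (ennreal (P * N))\<^sup>2 + 2 * (ennreal B * S x)\<^sup>2 = 2 * H x"
          using P N B unfolding H_def by (simp add: power_mult_distrib ennreal_power distrib_left)
        finally have "2 * (ennreal (norm (?m x)))\<^sup>2 \<le> 2 * ((ennreal (real ?n * real ?n))\<^sup>2 * (2 * H x))"
          by (intro mult_left_mono) auto
        also have "\<dots> = ennreal C3 * H x"
        proof -
          have "ennreal C3 = 4 * (ennreal (real ?n * real ?n))\<^sup>2" unfolding C3_def by (subst ennreal_mult) (auto simp: ennreal_power)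
          moreover have "2 * (q * (2 * H x)) = 4 * q * H x" for q
          proof -
            have "(2::ennreal) * 2 = 4" by simp
            moreover have "2 * (q * (2 * H x)) = (2 * 2) * q * H x" by (simp only: mult_ac)
            ultimately show ?thesis by (simp only:)
          qed
          ultimately show ?thesis by (simp only:)
        qed
        finally show ?thesis by (simp add: ennreal_power)
      qed
      have "(\<integral>\<^sup>+x. indicator (ball z R) x * ?F x \<partial>lborel) \<le>
        (\<integral>\<^sup>+x. 2 * (indicator (ball z R) x * ennreal ((norm (G x - ?m x))\<^sup>2)) + ennreal C3 * (indicator (ball z R) x * H x) \<partial>lborel)"
      proof (rule nn_integral_mono)
        fix x
        show "indicator (ball z R) x * ?F x \<le>
          2 * (indicator (ball z R) x * ennreal ((norm (G x - ?m x))\<^sup>2)) + ennreal C3 * (indicator (ball z R) x * H x)"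
        proof (cases "x \<in> ball z R")
          case True
          have "(norm (G x))\<^sup>2 \<le> 2 * (norm (G x - ?m x))\<^sup>2 + 2 * (norm (?m x))\<^sup>2"
            using norm_add_sq_le[of "G x - ?m x" "?m x"] by simp
          then have "?F x \<le> ennreal (2 * (norm (G x - ?m x))\<^sup>2 + 2 * (norm (?m x))\<^sup>2)" by (rule ennreal_leI)
          also have "\<dots> = 2 * ennreal ((norm (G x - ?m x))\<^sup>2) + 2 * ennreal ((norm (?m x))\<^sup>2)"
            by (simp add: ennreal_mult)
          also have "\<dots> \<le> 2 * ennreal ((norm (G x - ?m x))\<^sup>2) + ennreal C3 * H x" by (intro add_left_mono mH True)
          finally show ?thesis using True by simp
        qed simp
      qed
      also have "\<dots> = 2 * (\<integral>\<^sup>+x. indicator (ball z R) x * ennreal ((norm (G x - ?m x))\<^sup>2) \<partial>lborel) +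
        ennreal C3 * (\<integral>\<^sup>+x. indicator (ball z R) x * H x \<partial>lborel)"
      proof -
        have "(\<lambda>x. ennreal ((norm (G x - ?m x))\<^sup>2)) \<in> borel_measurable lborel"
          using borel_measurable_diff[OF Gm mm] by measurable
        then have m1: "(\<lambda>x. indicator (ball z R) x * ennreal ((norm (G x - ?m x))\<^sup>2)) \<in> borel_measurable lborel"
          by (intro borel_measurable_times_ennreal borel_measurable_indicator) simp_all
        have m2: "(\<lambda>x. indicator (ball z R) x * H x) \<in> borel_measurable lborel"
          using Hm by (intro borel_measurable_times_ennreal borel_measurable_indicator) simp_all
        show ?thesis
          by (subst nn_integral_add) (intro borel_measurable_times_ennreal borel_measurable_const m1 m2 |
            simp only: nn_integral_cmult[OF m1] nn_integral_cmult[OF m2])+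
      qed
      also have "\<dots> \<le> 2 * (ennreal Cl * (\<integral>\<^sup>+x. indicator (ball z (4 * R)) x * ?E x \<partial>lborel)) +
        ennreal C3 * (\<integral>\<^sup>+x. indicator (ball z R) x * H x \<partial>lborel)"
        by (intro add_right_mono mult_left_mono loc[OF wp R sub]) auto
      also have "2 * (ennreal Cl * (\<integral>\<^sup>+x. indicator (ball z (4 * R)) x * ?E x \<partial>lborel)) =
        ennreal C1 * (\<integral>\<^sup>+x. indicator (ball z (4 * R)) x * ?E x \<partial>lborel)"
        unfolding C1_def using Cl by (simp add: ennreal_mult mult.assoc)
      finally show ?thesis unfolding R_def by (simp only: mult.assoc)
    qed
    let ?w = "\<lambda>b F. \<integral>\<^sup>+z. indicator \<Omega> z * (ennreal ((1 / d z) ^ ?n) * (\<integral>\<^sup>+x. indicator (ball z (b * d z)) x * F x \<partial>lborel)) \<partial>lborel"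
    have up: "?w b F \<le> ennreal (vol * (3 * b) ^ ?n) * (\<integral>\<^sup>+x. indicator \<Omega> x * F x \<partial>lborel)"
      if "0 < b" "b \<le> 1 / 2" "F \<in> borel_measurable borel" for b and F :: "real^'n \<Rightarrow> ennreal"
      using whitney_average(1)[OF \<Omega> that] unfolding vol_def d_def by simp
    have wm: "(\<lambda>z. indicator \<Omega> z * (ennreal ((1 / d z) ^ ?n) * (\<integral>\<^sup>+x. indicator (ball z (b * d z)) x * F x \<partial>lborel))) \<in> borel_measurable lborel"
      if [measurable]: "F \<in> borel_measurable borel" for b and F :: "real^'n \<Rightarrow> ennreal"
    proof -
      have "(\<integral>\<^sup>+x. indicator (ball z (b * d z)) x * F x \<partial>lborel) = (\<integral>\<^sup>+x. indicator {0<..} (b * d z - dist z x) * F x \<partial>lborel)" for z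
        by (intro nn_integral_cong) (auto simp: indicator_def)
      then show ?thesis by simp
    qed
    define E where "E = (\<integral>\<^sup>+x. indicator \<Omega> x * ?E x \<partial>lborel)"
    define X where "X = (\<integral>\<^sup>+x. indicator \<Omega> x * ?F x \<partial>lborel)"
    have "ennreal \<kappa> * X \<le> ?w a ?F"
      using whitney_average(2)[OF \<Omega> a(1) _ Fm] a unfolding \<kappa>_def vol_def X_def d_def by simp
    also have "\<dots> \<le> (\<integral>\<^sup>+z. ennreal C1 * (indicator \<Omega> z * (ennreal ((1 / d z) ^ ?n) * (\<integral>\<^sup>+x. indicator (ball z (4 * a * d z)) x * ?E x \<partial>lborel))) +
        ennreal C3 * (indicator \<Omega> z * (ennreal ((1 / d z) ^ ?n) * (\<integral>\<^sup>+x. indicator (ball z (a * d z)) x * H x \<partial>lborel))) \<partial>lborel)"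
    proof (rule nn_integral_mono)
      fix z
      let ?e = "\<integral>\<^sup>+x. indicator (ball z (4 * a * d z)) x * ?E x \<partial>lborel" and ?k = "\<integral>\<^sup>+x. indicator (ball z (a * d z)) x * H x \<partial>lborel"
      show "indicator \<Omega> z * (ennreal ((1 / d z) ^ ?n) * (\<integral>\<^sup>+x. indicator (ball z (a * d z)) x * ?F x \<partial>lborel)) \<le>
        ennreal C1 * (indicator \<Omega> z * (ennreal ((1 / d z) ^ ?n) * ?e)) + ennreal C3 * (indicator \<Omega> z * (ennreal ((1 / d z) ^ ?n) * ?k))"
      proof (cases "z \<in> \<Omega>")
        case True
        have "ennreal ((1 / d z) ^ ?n) * (\<integral>\<^sup>+x. indicator (ball z (a * d z)) x * ?F x \<partial>lborel) \<le>
          ennreal ((1 / d z) ^ ?n) * (ennreal C1 * ?e + ennreal C3 * ?k)"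
          by (intro mult_left_mono ball_le True) simp
        also have "\<dots> = ennreal C1 * (ennreal ((1 / d z) ^ ?n) * ?e) + ennreal C3 * (ennreal ((1 / d z) ^ ?n) * ?k)"
          by (simp only: distrib_left mult.left_commute)
        finally show ?thesis using True by simp
      qed simp
    qed
    also have "\<dots> = ennreal C1 * ?w (4 * a) ?E + ennreal C3 * ?w a H"
      by (subst nn_integral_add) (intro borel_measurable_times_ennreal[OF borel_measurable_const] wm Em Hm |
            simp only: nn_integral_cmult[OF wm[OF Em]] nn_integral_cmult[OF wm[OF Hm]])+
    also have "\<dots> \<le> ennreal C1 * (ennreal W1 * E) + ennreal C3 * (ennreal W2 * (\<integral>\<^sup>+x. indicator \<Omega> x * H x \<partial>lborel))"
      unfolding W1_def W2_def E_def using a by (intro add_mono mult_left_mono up Em Hm) auto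
    also have "(\<integral>\<^sup>+x. indicator \<Omega> x * H x \<partial>lborel) \<le> ennreal (P\<^sup>2 * mu) * ennreal (N\<^sup>2) + ennreal (B\<^sup>2 * Sb) * E"
    proof -
      have m1: "(\<lambda>x. indicator \<Omega> x * (S x)\<^sup>2) \<in> borel_measurable lborel" by measurable
      have "(\<integral>\<^sup>+x. indicator \<Omega> x * H x \<partial>lborel) = (\<integral>\<^sup>+x. ennreal (P\<^sup>2 * N\<^sup>2) * indicator \<Omega> x + ennreal (B\<^sup>2) * (indicator \<Omega> x * (S x)\<^sup>2) \<partial>lborel)"
        unfolding H_def by (intro nn_integral_cong) (simp only: distrib_left mult.left_commute mult.commute)
      also have "\<dots> = ennreal (P\<^sup>2 * N\<^sup>2) * emeasure lborel \<Omega> + ennreal (B\<^sup>2) * (\<integral>\<^sup>+x. indicator \<Omega> x * (S x)\<^sup>2 \<partial>lborel)"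
      proof (subst nn_integral_add)
        show "(\<lambda>x. ennreal (P\<^sup>2 * N\<^sup>2) * indicator \<Omega> x) \<in> borel_measurable lborel" by measurable
        show "(\<lambda>x. ennreal (B\<^sup>2) * (indicator \<Omega> x * (S x)\<^sup>2)) \<in> borel_measurable lborel" by measurable
      qed (simp add: nn_integral_cmult_indicator nn_integral_cmult[OF m1])
      also have "(\<integral>\<^sup>+x. indicator \<Omega> x * (S x)\<^sup>2 \<partial>lborel) \<le> ennreal Sb * E"
        using shadow_op_L2[OF \<Omega>m dm dpos C2 fin hm] unfolding S_def Sb_def vol_def E_def by (simp add: ennreal_power)
      finally have "(\<integral>\<^sup>+x. indicator \<Omega> x * H x \<partial>lborel) \<le> ennreal (P\<^sup>2 * N\<^sup>2) * emeasure lborel \<Omega> + ennreal (B\<^sup>2) * (ennreal Sb * E)"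
        by (simp add: mult_left_mono)
      also have "ennreal (P\<^sup>2 * N\<^sup>2) * emeasure lborel \<Omega> = ennreal (P\<^sup>2 * mu) * ennreal (N\<^sup>2)"
        unfolding mu(1) using mu(2) by (simp add: ennreal_mult mult_ac)
      also have "ennreal (B\<^sup>2) * (ennreal Sb * E) = ennreal (B\<^sup>2 * Sb) * E"
        using pos by (simp add: ennreal_mult mult.assoc)
      finally show ?thesis .
    qed
    finally have "ennreal \<kappa> * X \<le> ennreal C1 * (ennreal W1 * E) +
      ennreal C3 * (ennreal W2 * (ennreal (P\<^sup>2 * mu) * ennreal (N\<^sup>2) + ennreal (B\<^sup>2 * Sb) * E))"
      by (simp add: mult_left_mono add_left_mono)
    also have "\<dots> = ennreal K1 * E + ennreal K2 * ennreal (N\<^sup>2)"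
    proof -
      have "ennreal K1 = ennreal C1 * ennreal W1 + ennreal C3 * ennreal W2 * ennreal (B\<^sup>2 * Sb)"
        unfolding K1_def using pos by (subst ennreal_plus) (simp_all add: ennreal_mult mult.assoc)
      moreover have "ennreal K2 = ennreal C3 * ennreal W2 * ennreal (P\<^sup>2 * mu)"
        unfolding K2_def using pos mu by (simp add: ennreal_mult mult.assoc)
      ultimately show ?thesis by (simp only: distrib_left distrib_right mult.assoc add_ac)
    qed
    also have "\<dots> \<le> ennreal (K1 + K2) * (E + ennreal (N\<^sup>2))"
    proof -
      have "ennreal K1 * E + ennreal K2 * ennreal (N\<^sup>2) \<le> ennreal (K1 + K2) * E + ennreal (K1 + K2) * ennreal (N\<^sup>2)"
        using K by (intro add_mono mult_right_mono ennreal_leI) auto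
      then show ?thesis by (simp only: distrib_left)
    qed
    finally have "ennreal (1 / \<kappa>) * (ennreal \<kappa> * X) \<le> ennreal (1 / \<kappa>) * (ennreal (K1 + K2) * (E + ennreal (N\<^sup>2)))"
      by (intro mult_left_mono) auto
    moreover have "ennreal (1 / \<kappa>) * (ennreal \<kappa> * X) = X"
    proof -
      have "ennreal (1 / \<kappa>) * ennreal \<kappa> = 1" using \<kappa> by (subst ennreal_mult[symmetric]) auto
      then show ?thesis by (simp add: mult.assoc[symmetric])
    qed
    moreover have "ennreal (1 / \<kappa>) * (ennreal (K1 + K2) * (E + ennreal (N\<^sup>2))) = ennreal ((1 / \<kappa>) * (K1 + K2)) * (E + ennreal (N\<^sup>2))"
    proof -
      have "ennreal ((1 / \<kappa>) * (K1 + K2)) = ennreal (1 / \<kappa>) * ennreal (K1 + K2)" using K \<kappa> by (intro ennreal_mult) auto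
      then show ?thesis by (simp only: mult.assoc)
    qed
    ultimately show "(\<integral>\<^sup>+x. indicator \<Omega> x * ?F x \<partial>lborel) \<le> ennreal ((1 / \<kappa>) * (K1 + K2)) *
      ((\<integral>\<^sup>+x. indicator \<Omega> x * ?E x \<partial>lborel) + ennreal ((\<integral>y. norm (V y) \<partial>lborel)\<^sup>2))"
      unfolding N_def[symmetric] X_def[symmetric] E_def[symmetric] by (simp only:)
  qed
qed

section \<open>From Lebesgue measurable functions on \<Omega> to Borel representatives on the whole
  space\<close>

lemma borel_representative:
  fixes f :: "'a::euclidean_space \<Rightarrow> 'b::euclidean_space"
  assumes f: "f \<in> borel_measurable lebesgue"
  obtains g where "g \<in> borel_measurable borel" "AE x in lborel. f x = g x"
proof -
  have "\<exists>h\<in>borel_measurable lborel. AE x in lborel. f x \<bullet> b = h x" for b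
    by (rule completion_ex_borel_measurable_real) (intro borel_measurable_inner f borel_measurable_const)
  then obtain h where h: "\<And>b. h b \<in> borel_measurable lborel" "\<And>b. AE x in lborel. f x \<bullet> b = h b x" by metis
  show thesis
  proof (rule that)
    show "(\<lambda>x. \<Sum>b\<in>Basis. h b x *\<^sub>R b) \<in> borel_measurable borel"
      using h(1) by (intro borel_measurable_sum borel_measurable_scaleR) simp_all
    have "AE x in lborel. \<forall>b\<in>Basis. f x \<bullet> b = h b x" using h(2) by (intro AE_finite_allI) auto
    then show "AE x in lborel. f x = (\<Sum>b\<in>Basis. h b x *\<^sub>R b)"
    proof eventually_elim
      case (elim x)
      then have "(\<Sum>b\<in>Basis. h b x *\<^sub>R b) = (\<Sum>b\<in>Basis. (f x \<bullet> b) *\<^sub>R b)" by (intro sum.cong) auto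
      then show ?case by (simp add: euclidean_representation)
    qed
  qed
qed

lemma lebesgue_integral_borel_representative:
  fixes F :: "'a::euclidean_space \<Rightarrow> real"
  assumes f: "f \<in> borel_measurable lebesgue" and F: "F \<in> borel_measurable borel" and eq: "AE x in lborel. f x = F x"
  shows "integrable lebesgue f \<longleftrightarrow> integrable lborel F" and "(\<integral>x. f x \<partial>lebesgue) = (\<integral>x. F x \<partial>lborel)"
proof -
  have eq': "AE x in lebesgue. f x = F x" by (rule AE_completion[OF eq])
  have Fl: "F \<in> borel_measurable lborel" using F by simp
  show "integrable lebesgue f \<longleftrightarrow> integrable lborel F"
    using integrable_cong_AE[OF f measurable_completion[OF Fl] eq'] integrable_completion[OF Fl] by simp
  show "(\<integral>x. f x \<partial>lebesgue) = (\<integral>x. F x \<partial>lborel)"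
    using integral_cong_AE[OF f measurable_completion[OF Fl] eq'] integral_completion[OF Fl] by simp
qed

lemma L2_norm_borel_representative:
  fixes f :: "real ^ 'n \<Rightarrow> 'b::euclidean_space"
  assumes f: "(\<lambda>x. indicator \<Omega> x *\<^sub>R f x) \<in> borel_measurable lebesgue"
    and F: "F \<in> borel_measurable borel" and eq: "AE x in lborel. indicator \<Omega> x *\<^sub>R f x = F x"
  shows "set_integrable lebesgue \<Omega> (\<lambda>x. (norm (f x))\<^sup>2) \<longleftrightarrow> integrable lborel (\<lambda>x. (norm (F x))\<^sup>2)"
    and "L2_norm \<Omega> f = sqrt (\<integral>x. (norm (F x))\<^sup>2 \<partial>lborel)"
proof -
  have n: "indicator \<Omega> x *\<^sub>R (norm (f x))\<^sup>2 = (norm (indicator \<Omega> x *\<^sub>R f x))\<^sup>2" for x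
    by (simp add: indicator_def)
  have 1: "(\<lambda>x. (norm (indicator \<Omega> x *\<^sub>R f x))\<^sup>2) \<in> borel_measurable lebesgue"
    by (intro borel_measurable_power measurable_compose[OF f borel_measurable_norm])
  have 2: "(\<lambda>x. (norm (F x))\<^sup>2) \<in> borel_measurable borel"
    by (intro borel_measurable_power measurable_compose[OF F borel_measurable_norm])
  have 3: "AE x in lborel. (norm (indicator \<Omega> x *\<^sub>R f x))\<^sup>2 = (norm (F x))\<^sup>2"
    using eq by eventually_elim simp
  show "set_integrable lebesgue \<Omega> (\<lambda>x. (norm (f x))\<^sup>2) \<longleftrightarrow> integrable lborel (\<lambda>x. (norm (F x))\<^sup>2)"
    unfolding set_integrable_def n by (rule lebesgue_integral_borel_representative(1)[OF 1 2 3])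
  show "L2_norm \<Omega> f = sqrt (\<integral>x. (norm (F x))\<^sup>2 \<partial>lborel)"
    unfolding L2_norm_def set_lebesgue_integral_def n
    by (simp only: lebesgue_integral_borel_representative(2)[OF 1 2 3])
qed

text \<open>The representative is cut off by the indicator of \<Omega>, so it vanishes at every
  point outside and not just at almost every one. It is integrable because \<Omega> has finite
  measure and t \<le> 1 + t^2.\<close>

lemma L2_representative:
  fixes f :: "real ^ 'n \<Rightarrow> 'b::euclidean_space"
  assumes f: "f \<in> L2_space \<Omega>" and \<Omega>: "\<Omega> \<in> sets borel" "emeasure lborel \<Omega> < \<infinity>"
  obtains F where "F \<in> borel_measurable borel" "AE x in lborel. indicator \<Omega> x *\<^sub>R f x = F x"
    "\<And>x. x \<notin> \<Omega> \<Longrightarrow> F x = 0" "integrable lborel F" "integrable lborel (\<lambda>x. (norm (F x))\<^sup>2)"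
proof -
  have fm: "(\<lambda>x. indicator \<Omega> x *\<^sub>R f x) \<in> borel_measurable lebesgue"
    using f by (simp add: L2_space_def set_borel_measurable_def)
  obtain g where g: "g \<in> borel_measurable borel" "AE x in lborel. indicator \<Omega> x *\<^sub>R f x = g x"
    by (rule borel_representative[OF fm])
  define F where "F x = indicator \<Omega> x *\<^sub>R g x" for x
  have Fm: "F \<in> borel_measurable borel"
    unfolding F_def[abs_def] using \<Omega>(1) g(1) by (intro borel_measurable_scaleR borel_measurable_indicator)
  have eq: "AE x in lborel. indicator \<Omega> x *\<^sub>R f x = F x"
    using g(2)
  proof eventually_elim
    case (elim x)
    then show ?case by (cases "x \<in> \<Omega>") (simp_all add: F_def)
  qed
  have sq: "integrable lborel (\<lambda>x. (norm (F x))\<^sup>2)"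
    using L2_norm_borel_representative(1)[OF fm Fm eq] f by (simp add: L2_space_def)
  have "integrable lborel F"
  proof (rule Bochner_Integration.integrable_bound)
    show "integrable lborel (\<lambda>x. indicator \<Omega> x + (norm (F x))\<^sup>2 :: real)"
      using \<Omega> sq by simp
    have "t \<le> 1 + t\<^sup>2" if "t \<ge> 0" for t :: real
      using sum_squares_bound[of t 1] that zero_le_power2[of t] by (simp add: power2_eq_square)
    then show "AE x in lborel. norm (F x) \<le> norm (indicator \<Omega> x + (norm (F x))\<^sup>2 :: real)"
      by (intro AE_I2) (auto simp: F_def indicator_def)
  qed (use Fm in simp)
  with Fm eq sq show thesis by (intro that[of F]) (simp_all add: F_def)
qed

lemma has_weak_differential_imp_weak_pair:
  fixes \<Omega> :: "(real ^ 'n) set"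
  assumes \<Omega>: "open \<Omega>" and wd: "has_weak_differential \<Omega> v D"
    and v: "(\<lambda>x. indicator \<Omega> x *\<^sub>R v x) \<in> borel_measurable lebesgue"
    and D: "(\<lambda>x. indicator \<Omega> x *\<^sub>R D x) \<in> borel_measurable lebesgue"
    and V: "integrable lborel V" "AE x in lborel. indicator \<Omega> x *\<^sub>R v x = V x"
    and G: "integrable lborel G" "AE x in lborel. indicator \<Omega> x *\<^sub>R D x = G x"
  shows "weak_pair \<Omega> V G"
  unfolding weak_pair_def
proof (intro conjI allI impI \<Omega> V(1) G(1))
  fix K \<phi> i j assume K: "compact K" "K \<subseteq> \<Omega>" and \<phi>: "\<phi> \<in> bumps K"
  have mv: "(\<lambda>y :: real ^ 'n. y $ i) \<in> borel_measurable borel"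
    and mD: "(\<lambda>A :: real ^ 'n ^ 'n. A $ i $ j) \<in> borel_measurable borel"
    by (intro borel_measurable_continuous_onI continuous_intros)+
  have leb: "g \<in> borel_measurable lebesgue" if "g \<in> borel_measurable borel" for g :: "real ^ 'n \<Rightarrow> real"
    using that by (intro measurable_completion) simp
  have m1: "\<phi> \<in> borel_measurable borel" by (rule smooth_borel[OF bumps_smooth[OF \<phi>]])
  have m2: "partial j \<phi> \<in> borel_measurable borel" by (rule smooth_borel[OF smooth_partial[OF bumps_smooth[OF \<phi>]]])
  have "\<phi> \<in> test_functions \<Omega>" by (rule bumps_test_functions[OF \<phi> K])
  then have "set_lebesgue_integral lebesgue \<Omega> (\<lambda>x. v x $ i * partial j \<phi> x) =
        - set_lebesgue_integral lebesgue \<Omega> (\<lambda>x. D x $ i $ j * \<phi> x)"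
    using wd unfolding has_weak_differential_def by blast
  moreover have "set_lebesgue_integral lebesgue \<Omega> (\<lambda>x. v x $ i * partial j \<phi> x) = (\<integral>x. V x $ i * partial j \<phi> x \<partial>lborel)"
  proof -
    have "set_lebesgue_integral lebesgue \<Omega> (\<lambda>x. v x $ i * partial j \<phi> x) =
      (\<integral>x. (indicator \<Omega> x *\<^sub>R v x) $ i * partial j \<phi> x \<partial>lebesgue)"
      unfolding set_lebesgue_integral_def by (simp add: mult.assoc)
    also have "\<dots> = (\<integral>x. V x $ i * partial j \<phi> x \<partial>lborel)"
    proof (rule lebesgue_integral_borel_representative(2))
      show "(\<lambda>x. (indicator \<Omega> x *\<^sub>R v x) $ i * partial j \<phi> x) \<in> borel_measurable lebesgue"
        by (intro borel_measurable_times measurable_compose[OF v mv] leb m2)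
      show "(\<lambda>x. V x $ i * partial j \<phi> x) \<in> borel_measurable borel"
        using V(1) by (intro borel_measurable_times measurable_compose[OF _ mv] m2) auto
      show "AE x in lborel. (indicator \<Omega> x *\<^sub>R v x) $ i * partial j \<phi> x = V x $ i * partial j \<phi> x"
        using V(2) by eventually_elim simp
    qed
    finally show ?thesis .
  qed
  moreover have "set_lebesgue_integral lebesgue \<Omega> (\<lambda>x. D x $ i $ j * \<phi> x) = (\<integral>x. G x $ i $ j * \<phi> x \<partial>lborel)"
  proof -
    have "set_lebesgue_integral lebesgue \<Omega> (\<lambda>x. D x $ i $ j * \<phi> x) =
      (\<integral>x. (indicator \<Omega> x *\<^sub>R D x) $ i $ j * \<phi> x \<partial>lebesgue)"
      unfolding set_lebesgue_integral_def by (simp add: mult.assoc)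
    also have "\<dots> = (\<integral>x. G x $ i $ j * \<phi> x \<partial>lborel)"
    proof (rule lebesgue_integral_borel_representative(2))
      show "(\<lambda>x. (indicator \<Omega> x *\<^sub>R D x) $ i $ j * \<phi> x) \<in> borel_measurable lebesgue"
        by (intro borel_measurable_times measurable_compose[OF D mD] leb m1)
      show "(\<lambda>x. G x $ i $ j * \<phi> x) \<in> borel_measurable borel"
        using G(1) by (intro borel_measurable_times measurable_compose[OF _ mD] m1) auto
      show "AE x in lborel. (indicator \<Omega> x *\<^sub>R D x) $ i $ j * \<phi> x = G x $ i $ j * \<phi> x"
        using G(2) by eventually_elim simp
    qed
    finally show ?thesis .
  qed
  ultimately show "(\<integral>x. V x $ i * partial j \<phi> x \<partial>lborel) = - (\<integral>x. G x $ i $ j * \<phi> x \<partial>lborel)" by simp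
qed

text \<open>Cauchy-Schwarz on a set of finite measure; it replaces the L^1 norm of v, which remains
  at the end of the John curves, by the L^2 norm.\<close>

lemma integral_norm_sq_le:
  fixes V :: "'a::euclidean_space \<Rightarrow> 'b::euclidean_space"
  assumes V: "integrable lborel V" "integrable lborel (\<lambda>x. (norm (V x))\<^sup>2)" and z: "\<And>x. x \<notin> \<Omega> \<Longrightarrow> V x = 0"
    and \<Omega>: "\<Omega> \<in> sets borel" "emeasure lborel \<Omega> < \<infinity>"
  shows "(\<integral>x. norm (V x) \<partial>lborel)\<^sup>2 \<le> measure lborel \<Omega> * (\<integral>x. (norm (V x))\<^sup>2 \<partial>lborel)"
proof -
  have [measurable]: "V \<in> borel_measurable borel" "\<Omega> \<in> sets borel" using V \<Omega> by auto
  have "(ennreal (\<integral>x. norm (V x) \<partial>lborel))\<^sup>2 = (\<integral>\<^sup>+x. indicator \<Omega> x * ennreal (norm (V x)) \<partial>lborel)\<^sup>2"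
  proof -
    have "ennreal (\<integral>x. norm (V x) \<partial>lborel) = (\<integral>\<^sup>+x. ennreal (norm (V x)) \<partial>lborel)"
      using V by (intro nn_integral_eq_integral[symmetric]) auto
    also have "\<dots> = (\<integral>\<^sup>+x. indicator \<Omega> x * ennreal (norm (V x)) \<partial>lborel)"
      using z by (intro nn_integral_cong) (auto simp: indicator_def)
    finally show ?thesis by simp
  qed
  also have "\<dots> \<le> (\<integral>\<^sup>+x. (indicator \<Omega> x)\<^sup>2 \<partial>lborel) * (\<integral>\<^sup>+x. (ennreal (norm (V x)))\<^sup>2 \<partial>lborel)"
    by (rule Cauchy_Schwarz_nn_integral) measurable
  also have "(\<integral>\<^sup>+x. (indicator \<Omega> x)\<^sup>2 \<partial>lborel) = (\<integral>\<^sup>+x. indicator \<Omega> x \<partial>lborel)"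
    by (intro nn_integral_cong) (simp add: indicator_def)
  also have "\<dots> = ennreal (measure lborel \<Omega>)"
    using \<Omega> by (simp add: emeasure_eq_ennreal_measure less_top)
  also have "(\<integral>\<^sup>+x. (ennreal (norm (V x)))\<^sup>2 \<partial>lborel) = ennreal (\<integral>x. (norm (V x))\<^sup>2 \<partial>lborel)"
    using nn_integral_eq_integral[OF V(2)] by (simp add: ennreal_power)
  finally have "ennreal ((\<integral>x. norm (V x) \<partial>lborel)\<^sup>2) \<le> ennreal (measure lborel \<Omega> * (\<integral>x. (norm (V x))\<^sup>2 \<partial>lborel))"
    by (simp add: ennreal_power ennreal_mult)
  then show ?thesis by (subst (asm) ennreal_le_iff) auto
qed

theorem corollary3p6:
  fixes \<Omega> :: "(real ^ 'n) set"
  assumes "CARD('n) \<ge> 3"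
    and "john_domain \<Omega>"
  shows "\<exists>C::real. \<forall>v \<in> W12_space \<Omega>.
           W12_norm \<Omega> v \<le> C * (L2_norm \<Omega> v + L2_norm \<Omega> (trace_free_sym_gradient \<Omega> v))"
proof -
  obtain Cj where J: "john_domain_with Cj \<Omega>" using assms(2) by (auto simp: john_domain_def)
  obtain C where C: "C \<ge> 0" and korn: "\<And>V G. weak_pair \<Omega> V G \<Longrightarrow>
    (\<integral>\<^sup>+x. indicator \<Omega> x * ennreal ((norm (G x))\<^sup>2) \<partial>lborel) \<le>
    ennreal C * ((\<integral>\<^sup>+x. indicator \<Omega> x * ennreal ((norm (trace_free_sym (G x)))\<^sup>2) \<partial>lborel) + ennreal ((\<integral>y. norm (V y) \<partial>lborel)\<^sup>2))"
    by (rule korn_john_domain[OF assms(1) J], rule that)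
  have \<Omega>: "open \<Omega>" "bounded \<Omega>" using J by (auto simp: john_domain_with_def)
  have \<Omega>m: "\<Omega> \<in> sets borel" using \<Omega>(1) by simp
  have fin: "emeasure lborel \<Omega> < \<infinity>" using emeasure_bounded_finite[OF \<Omega>(2)] by (simp add: less_top)
  define m where "m = measure lborel \<Omega>"
  have m: "m \<ge> 0" by (simp add: m_def)
  have main: "W12_norm \<Omega> v \<le> (1 + sqrt C * (1 + sqrt m)) * (L2_norm \<Omega> v + L2_norm \<Omega> (trace_free_sym_gradient \<Omega> v))"
    if v: "v \<in> W12_space \<Omega>" for v
  proof -
    let ?D = "weak_differential \<Omega> v"
    have vL: "v \<in> L2_space \<Omega>" and DL: "?D \<in> L2_space \<Omega>" and "weakly_differentiable \<Omega> v"
      using v by (auto simp: W12_space_def)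
    then have wd: "has_weak_differential \<Omega> v ?D"
      unfolding weakly_differentiable_def weak_differential_def by (simp add: someI_ex)
    have vm: "(\<lambda>x. indicator \<Omega> x *\<^sub>R v x) \<in> borel_measurable lebesgue"
      and Dm: "(\<lambda>x. indicator \<Omega> x *\<^sub>R ?D x) \<in> borel_measurable lebesgue"
      using vL DL by (simp_all add: L2_space_def set_borel_measurable_def)
    obtain V where V: "V \<in> borel_measurable borel" "AE x in lborel. indicator \<Omega> x *\<^sub>R v x = V x"
      "\<And>x. x \<notin> \<Omega> \<Longrightarrow> V x = 0" "integrable lborel V" "integrable lborel (\<lambda>x. (norm (V x))\<^sup>2)"
      by (rule L2_representative[OF vL \<Omega>m fin], rule that)
    obtain G where G: "G \<in> borel_measurable borel" "AE x in lborel. indicator \<Omega> x *\<^sub>R ?D x = G x"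
      "\<And>x. x \<notin> \<Omega> \<Longrightarrow> G x = 0" "integrable lborel G" "integrable lborel (\<lambda>x. (norm (G x))\<^sup>2)"
      by (rule L2_representative[OF DL \<Omega>m fin], rule that)
    have wp: "weak_pair \<Omega> V G"
      by (rule has_weak_differential_imp_weak_pair[OF \<Omega>(1) wd vm Dm V(4) V(2) G(4) G(2)])
    have tf: "indicator \<Omega> x *\<^sub>R trace_free_sym_gradient \<Omega> v x = trace_free_sym (indicator \<Omega> x *\<^sub>R ?D x)" for x
      unfolding trace_free_sym_scaleR by (simp add: trace_free_sym_gradient_def sym_gradient_def divergence_def trace_free_sym_def)
    have Tm: "(\<lambda>x. trace_free_sym (G x)) \<in> borel_measurable borel" by (rule measurable_compose[OF G(1) trace_free_sym_borel])
    have Tf: "(\<lambda>x. indicator \<Omega> x *\<^sub>R trace_free_sym_gradient \<Omega> v x) \<in> borel_measurable lebesgue"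
      unfolding tf by (rule measurable_compose[OF Dm trace_free_sym_borel])
    have Teq: "AE x in lborel. indicator \<Omega> x *\<^sub>R trace_free_sym_gradient \<Omega> v x = trace_free_sym (G x)"
      unfolding tf using G(2) by eventually_elim simp
    obtain Ct where Ct: "Ct > 0" "\<And>A. norm (trace_free_sym (A :: real^'n^'n)) \<le> norm A * Ct"
      using bounded_linear.pos_bounded[OF bounded_linear_trace_free_sym] by blast
    \<comment> \<open>Square integrability has to be secured: the Bochner integral of a
      non-integrable function is 0, and an infinite norm on the right-hand side would then be
      recorded as 0.\<close>
    have Tint: "integrable lborel (\<lambda>x. (norm (trace_free_sym (G x)))\<^sup>2)"
    proof (rule Bochner_Integration.integrable_bound)
      show "integrable lborel (\<lambda>x. Ct\<^sup>2 * (norm (G x))\<^sup>2)" using G(5) by simp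
      show "(\<lambda>x. (norm (trace_free_sym (G x)))\<^sup>2) \<in> borel_measurable lborel"
        using measurable_compose[OF Tm borel_measurable_norm] by (intro borel_measurable_power) simp
      show "AE x in lborel. norm ((norm (trace_free_sym (G x)))\<^sup>2) \<le> norm (Ct\<^sup>2 * (norm (G x))\<^sup>2)"
        using power_mono[OF Ct(2) norm_ge_zero, of _ 2] by (simp add: power_mult_distrib mult.commute)
    qed
    define a where "a = L2_norm \<Omega> v"
    define g where "g = L2_norm \<Omega> ?D"
    define l where "l = L2_norm \<Omega> (trace_free_sym_gradient \<Omega> v)"
    have a: "a\<^sup>2 = (\<integral>x. (norm (V x))\<^sup>2 \<partial>lborel)" "a \<ge> 0"
      unfolding a_def L2_norm_borel_representative(2)[OF vm V(1,2)] by simp_all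
    have g: "g\<^sup>2 = (\<integral>x. (norm (G x))\<^sup>2 \<partial>lborel)" "g \<ge> 0"
      unfolding g_def L2_norm_borel_representative(2)[OF Dm G(1,2)] by simp_all
    have l: "l\<^sup>2 = (\<integral>x. (norm (trace_free_sym (G x)))\<^sup>2 \<partial>lborel)" "l \<ge> 0"
      unfolding l_def L2_norm_borel_representative(2)[OF Tf Tm Teq] by simp_all
    have "ennreal (g\<^sup>2) = (\<integral>\<^sup>+x. indicator \<Omega> x * ennreal ((norm (G x))\<^sup>2) \<partial>lborel)"
    proof -
      have "ennreal (g\<^sup>2) = (\<integral>\<^sup>+x. ennreal ((norm (G x))\<^sup>2) \<partial>lborel)"
        unfolding g(1) by (rule nn_integral_eq_integral[symmetric, OF G(5)]) simp
      also have "\<dots> = (\<integral>\<^sup>+x. indicator \<Omega> x * ennreal ((norm (G x))\<^sup>2) \<partial>lborel)"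
        using G(3) by (intro nn_integral_cong) (auto simp: indicator_def)
      finally show ?thesis .
    qed
    also have "\<dots> \<le> ennreal C * ((\<integral>\<^sup>+x. indicator \<Omega> x * ennreal ((norm (trace_free_sym (G x)))\<^sup>2) \<partial>lborel) + ennreal ((\<integral>y. norm (V y) \<partial>lborel)\<^sup>2))"
      by (rule korn[OF wp])
    also have "\<dots> \<le> ennreal C * (ennreal (l\<^sup>2) + ennreal (m * a\<^sup>2))"
    proof (intro mult_left_mono add_mono ennreal_leI)
      have "(\<integral>\<^sup>+x. indicator \<Omega> x * ennreal ((norm (trace_free_sym (G x)))\<^sup>2) \<partial>lborel) \<le> (\<integral>\<^sup>+x. ennreal ((norm (trace_free_sym (G x)))\<^sup>2) \<partial>lborel)"
        by (intro nn_integral_mono) (auto simp: indicator_def)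
      also have "\<dots> = ennreal (l\<^sup>2)" unfolding l(1) by (rule nn_integral_eq_integral[OF Tint]) simp
      finally show "(\<integral>\<^sup>+x. indicator \<Omega> x * ennreal ((norm (trace_free_sym (G x)))\<^sup>2) \<partial>lborel) \<le> ennreal (l\<^sup>2)" .
      show "(\<integral>y. norm (V y) \<partial>lborel)\<^sup>2 \<le> m * a\<^sup>2"
        unfolding m_def a(1) by (rule integral_norm_sq_le[OF V(4,5,3) \<Omega>m fin])
    qed simp
    also have "\<dots> = ennreal (C * (l\<^sup>2 + m * a\<^sup>2))" using C m by (simp add: ennreal_mult ennreal_plus)
    finally have "g\<^sup>2 \<le> C * (l\<^sup>2 + m * a\<^sup>2)" using C m by (subst (asm) ennreal_le_iff) auto
    \<comment> \<open>From squares to norms by subadditivity of the square root; the measure of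
      \<Omega> enters the constant through the comparison of the L^1 and L^2 norms of v.\<close>
    then have "g \<le> sqrt (C * (l\<^sup>2 + m * a\<^sup>2))" by (rule real_le_rsqrt)
    also have "\<dots> = sqrt C * sqrt (l\<^sup>2 + m * a\<^sup>2)" by (rule real_sqrt_mult)
    also have "\<dots> \<le> sqrt C * (sqrt (l\<^sup>2) + sqrt (m * a\<^sup>2))"
      using m C by (intro mult_left_mono sqrt_add_le_add_sqrt) auto
    also have "\<dots> = sqrt C * (l + sqrt m * a)" using a(2) l(2) by (simp add: real_sqrt_mult)
    also have "\<dots> \<le> sqrt C * ((1 + sqrt m) * (a + l))"
      using C m a(2) l(2) by (intro mult_left_mono) (auto simp: algebra_simps)
    finally have gle: "g \<le> sqrt C * (1 + sqrt m) * (a + l)" by (simp only: mult.assoc)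
    have "W12_norm \<Omega> v = sqrt (a\<^sup>2 + g\<^sup>2)" by (simp add: W12_norm_def a_def g_def)
    also have "\<dots> \<le> sqrt (a\<^sup>2) + sqrt (g\<^sup>2)" by (rule sqrt_add_le_add_sqrt) auto
    also have "\<dots> = a + g" using a(2) g(2) by simp
    also have "\<dots> \<le> (1 + sqrt C * (1 + sqrt m)) * (a + l)" using gle l(2) by (simp add: distrib_right)
    finally show ?thesis by (simp add: a_def l_def)
  qed
  then show ?thesis by blast
qed

end
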